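(* Let $N_a\sim P_a$ and $N_b\sim P_b$ be two independent $B_4$-mixing point processes on $\mathbb{R}^d$, both observed in $W_n$, where $(W_n)$ is a convex averaging sequence. Let $R>0$ and $0<\alpha\le1/2$ with $c_n^\alpha/\varrho(W_n)\to0$. Assume that each of the two processes, denoted generically $N$ with intensity $\lambda>0$ and (reduced) moment and cumulant measures $\alpha^{(2)}_{red},\gamma^{(k)}_{red}$, satisfies: (a) $(N(W_n)-\lambda|W_n|)/\sqrt{|W_n|}\xrightarrow{d}\mathcal N(0,\sigma^2)$ as $n\to\infty$, where $\sigma^2=\lambda(1+\gamma^{(2)}_{red}(\mathbb{R}^d))$; (b) there is $a_0>0$ with $\alpha^{(2)}_{red}(A)\le a_0|A|$ for all bounded Borel $A\subset\mathbb{R}^d$; (c) either $\alpha>1/4$, or $\gamma^{(3)}_{red},\gamma^{(4)}_{red}$ have Lebesgue densities $\kappa^{(3)},\kappa^{(4)}$ with $|\kappa^{(3)}(x,y)|\le a_{01}$ for all $x,y\in\mathbb{R}^d$ and $\int_{\mathbb{R}^d}\int_{\mathbb{R}^d}\bigl(\int_{\mathbb{R}^d}|\kappa^{(4)}(x,y+z,z)|dz\bigr)^2dy\,dx\le a_{02}$ for some constants $a_{01},a_{02}$. Let the bandwidths $b_n>0$ satisfy $b_n\to0$, $c_nb_n\to\infty$, $c_nb_n^2\to0$ and $c_nb_n/\varrho(W_n)\to0$, and let $V:[0,R]\to[0,\infty)$ be non-decreasing and right-continuous with $V(R)<\infty$. Then, under the null hypothesis $H_0^{a,b}:P_a=P_b$,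 as $n\to\infty$, $$\frac{|W_n|\int_0^R\bigl((\widehat{\lambda_a^2K_a})_n(c_n^\alpha r)-(\widehat{\lambda_b^2K_b})_n(c_n^\alpha r)\bigr)^2dV(r)}{|W_n|^{2\alpha}\bigl((\widehat{\lambda_a^2})_n(\widehat{\sigma_a^2})_n+(\widehat{\lambda_b^2})_n(\widehat{\sigma_b^2})_n\bigr)}+\frac{|W_n|\bigl((\widehat{\lambda_a})_n-(\widehat{\lambda_b})_n\bigr)^2}{(\widehat{\sigma_a^2})_n+(\widehat{\sigma_b^2})_n}\ \xrightarrow{d}\ \Bigl(4|B|^2\int_0^Rr^{2d}\,dV(r)+1\Bigr)\mathcal N(0,1)^2.$$
   Context: $|\cdot|$ is Lebesgue measure on $\mathbb{R}^d$ (or absolute value), $\mathcal N(0,\tau^2)$ a centered Gaussian random variable with variance $\tau^2$, $\xrightarrow{d}$ convergence in distribution, $\sum^{\ne}$ a sum over tuples of pairwise distinct indices. Point processes. $N=\sum_{i\ge1}\delta_{X_i}$ is a simple point process on $\mathbb{R}^d$ with intensity $\lambda=\mathbf E N([0,1)^d)>0$. Its $k$-th factorial moment measure is $\alpha^{(k)}(A_1\times\dots\times A_k)=\mathbf E\sum^{\ne}_{i_1,\dots,i_k\ge1}\mathbf 1_{A_1}(X_{i_1})\cdots\mathbf 1_{A_k}(X_{i_k})$. $N$ is $k$-th order stationary if $\mathbf E N^k([0,1)^d)<\infty$ and, for $j=1,\dots,k$, $\alpha^{(j)}$ is invariant under diagonal shifts $A_1\times\dots\times A_j\mapsto(A_1+x)\times\dots\times(A_j+x)$.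 The $k$-th factorial cumulant measure is the (locally finite) signed measure $\gamma^{(k)}(A_1\times\dots\times A_k)=\sum_{j=1}^k(-1)^{j-1}(j-1)!\sum_{K_1\cup\dots\cup K_j=\{1,\dots,k\}}\prod_{i=1}^j\alpha^{(\#K_i)}(\times_{l\in K_i}A_l)$, the inner sum being over partitions into $j$ disjoint non-empty subsets. The reduced measures $\alpha^{(k)}_{red},\gamma^{(k)}_{red}$ on $\mathbb{R}^{d(k-1)}$ are defined by $\alpha^{(k)}(A_1\times\dots\times A_k)=\lambda\int_{A_k}\alpha^{(k)}_{red}((A_1-x)\times\dots\times(A_{k-1}-x))\,dx$ and likewise for $\gamma^{(k)}$; in particular $\gamma^{(2)}_{red}(\cdot)=\alpha^{(2)}_{red}(\cdot)-\lambda|\cdot|$. $\|\gamma^{(k)}_{red}\|_{var}$ is the total variation on $\mathbb{R}^{d(k-1)}$. $N$ is $B_4$-mixing if it is fourth-order stationary and $\|\gamma^{(j)}_{red}\|_{var}<\infty$ for $j=2,3,4$. Windows and $B$. A convex averaging sequence $(W_n)$ is an increasing sequence of convex compact sets $W_n\subset\mathbb{R}^d$ with $\varrho(W_n):=\sup\{r>0: x+rB_e\subseteq W_n\text{ for some }x\in W_n\}\to\infty$, where $B_e$ is the closed Euclidean unit ball. Put $c_n:=|W_n|^{1/d}$. $B\subset\mathbb{R}^d$ is a fixed compact convex set, symmetric about the origin, with the origin as an interior point. Estimators. For a point process $N=\sum_{i\ge1}\delta_{X_i}$ put $$(\widehat{\lambda^2K_B})_n(r):=\sum^{\ne}_{i,j\ge1}\frac{\mathbf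 1_{W_n}(X_i)\mathbf 1_{W_n}(X_j)\mathbf 1_{rB}(X_j-X_i)}{|(W_n-X_i)\cap(W_n-X_j)|},\quad \widehat\lambda_n:=\frac{N(W_n)}{|W_n|},\quad(\widehat{\lambda^2})_n:=\frac{(N(W_n)-1)N(W_n)}{|W_n|^2},$$ $$(\widehat{\sigma^2})_n:=\widehat\lambda_n+\sum^{\ne}_{i,j\ge1}\frac{\mathbf 1_{W_n}(X_i)\mathbf 1_{W_n}(X_j)}{|(W_n-X_i)\cap(W_n-X_j)|}\,w\Bigl(\frac{X_j-X_i}{b_nc_n}\Bigr)-(\widehat{\lambda^2})_n(b_nc_n)^d\int_{\mathbb{R}^d}w(x)\,dx,$$ where $w:\mathbb{R}^d\to[0,\infty)$ is a fixed Borel-measurable, bounded, symmetric function with bounded support and $\lim_{x\to0}w(x)=w(0)=1$. The quantities $(\widehat{\lambda_a^2K_a})_n$, $(\widehat{\lambda_a})_n$, $(\widehat{\lambda_a^2})_n$, $(\widehat{\sigma_a^2})_n$ are the estimators $(\widehat{\lambda^2K_B})_n$, $\widehat\lambda_n$, $(\widehat{\lambda^2})_n$, $(\widehat{\sigma^2})_n$ computed from $N_a$, and those with subscript $b$ are computed from $N_b$.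
   Formalization: In (a) the asymptotic variance σ² is assumed strictly positive for both processes; for σ² = 0 (e.g. Ginibre processes with constant V) the stated limit fails. *)

theory Defs
  imports "HOL-Probability.Probability"
begin

section \<open>Simple point processes\<close>

text \<open>A locally finite simple counting measure is identified with its support, a locally finite
  set of points; \<open>N(A)\<close> is then the cardinality of \<open>N \<inter> A\<close>. The \<open>\<sigma>\<close>-algebra on configurations is
  the one generated by the counts in bounded Borel sets, so the law of a point process \<open>N\<close> on
  \<open>M\<close> is \<open>distr M config_algebra N\<close>. The space is \<open>'a::euclidean_space\<close>, with \<open>d = DIM('a)\<close>.\<close>

definition configs :: "'a::euclidean_space set set" where
  "configs = {S. \<forall>r. finite (S \<inter> cball 0 r)}"

definition config_algebra :: "'a::euclidean_space set measure" where
  "config_algebra = sigma configs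
     {{S \<in> configs. card (S \<inter> A) = m} | A m. A \<in> sets borel \<and> bounded A}"

definition unit_cube :: "'a::euclidean_space set" where
  "unit_cube = {x. \<forall>e\<in>Basis. 0 \<le> x \<bullet> e \<and> x \<bullet> e < 1}"

definition intensity :: "'w measure \<Rightarrow> ('w \<Rightarrow> 'a::euclidean_space set) \<Rightarrow> real" where
  "intensity M N = (LINT \<omega>|M. real (card (N \<omega> \<inter> unit_cube)))"

definition point_process :: "'w measure \<Rightarrow> ('w \<Rightarrow> 'a::euclidean_space set) \<Rightarrow> bool" where
  "point_process M N \<longleftrightarrow> prob_space M \<and> N \<in> measurable M config_algebra \<and> 0 < intensity M N"

section \<open>Factorial moment and cumulant measures\<close>

text \<open>Tuples are indexed by a finite set \<open>I\<close> of naturals, so that \<open>fact_moment M N {1..k} A\<close> is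
  \<open>\<alpha>\<^sup>(\<^sup>k\<^sup>)(A\<^sub>1 \<times> \<dots> \<times> A\<^sub>k)\<close>, and for \<open>K \<subseteq> {1..k}\<close> the value \<open>fact_moment M N K A\<close> is the moment
  measure of order \<open>card K\<close> evaluated at the product of the \<open>A\<^sub>l\<close> with \<open>l \<in> K\<close>. As the processes
  are simple, pairwise distinct indices amount to pairwise distinct points.\<close>

definition fact_moment ::
    "'w measure \<Rightarrow> ('w \<Rightarrow> 'a::euclidean_space set) \<Rightarrow> nat set \<Rightarrow> (nat \<Rightarrow> 'a set) \<Rightarrow> ennreal" where
  "fact_moment M N I A =
     (\<integral>\<^sup>+\<omega>. emeasure (count_space UNIV) {x \<in> Pi\<^sub>E I (\<lambda>i. N \<omega> \<inter> A i). inj_on x I} \<partial>M)"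

definition fact_cumulant ::
    "'w measure \<Rightarrow> ('w \<Rightarrow> 'a::euclidean_space set) \<Rightarrow> nat \<Rightarrow> (nat \<Rightarrow> 'a set) \<Rightarrow> real" where
  "fact_cumulant M N k A =
     (\<Sum>j=1..k. (-1) ^ (j - 1) * fact (j - 1) *
        (\<Sum>P | partition_on {1..k} P \<and> card P = j. \<Prod>K\<in>P. enn2real (fact_moment M N K A)))"

definition stationary_of_order ::
    "nat \<Rightarrow> 'w measure \<Rightarrow> ('w \<Rightarrow> 'a::euclidean_space set) \<Rightarrow> bool" where
  "stationary_of_order k M N \<longleftrightarrow>
     (\<integral>\<^sup>+\<omega>. of_nat (card (N \<omega> \<inter> unit_cube)) ^ k \<partial>M) < \<infinity> \<and>
     (\<forall>j\<in>{1..k}. \<forall>A x. (\<forall>i\<in>{1..j}. A i \<in> sets borel) \<longrightarrow>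
        fact_moment M N {1..j} (\<lambda>i. (\<lambda>y. y + x) ` A i) = fact_moment M N {1..j} A)"

section \<open>Locally finite signed measures and reduced measures\<close>

text \<open>A locally finite signed measure on \<open>(\<real>\<^sup>d)\<^sup>J\<close> is a real-valued set function on the bounded Borel
  sets, \<open>\<sigma>\<close>-additive as long as the union stays bounded. It need not extend to unbounded sets; its
  values outside \<open>bounded_borel J\<close> are irrelevant.\<close>

definition bounded_borel :: "nat set \<Rightarrow> (nat \<Rightarrow> 'a::euclidean_space) set set" where
  "bounded_borel J = {C \<in> sets (Pi\<^sub>M J (\<lambda>_. borel)). \<exists>r. C \<subseteq> Pi\<^sub>E J (\<lambda>_. cball 0 r)}"

definition signed_measure_on ::
    "nat set \<Rightarrow> ((nat \<Rightarrow> 'a::euclidean_space) set \<Rightarrow> real) \<Rightarrow> bool" where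
  "signed_measure_on J \<rho> \<longleftrightarrow>
     (\<forall>C :: nat \<Rightarrow> (nat \<Rightarrow> 'a) set.
        range C \<subseteq> bounded_borel J \<and> disjoint_family C \<and> (\<Union>n. C n) \<in> bounded_borel J
        \<longrightarrow> (\<lambda>n. \<rho> (C n)) sums \<rho> (\<Union>n. C n))"

definition variation_norm ::
    "nat set \<Rightarrow> ((nat \<Rightarrow> 'a::euclidean_space) set \<Rightarrow> real) \<Rightarrow> ennreal" where
  "variation_norm J \<rho> =
     (SUP F \<in> {F. finite F \<and> F \<subseteq> bounded_borel J \<and> disjoint F}. \<Sum>C\<in>F. ennreal \<bar>\<rho> C\<bar>)"

text \<open>The value of \<open>\<rho>\<close> on the whole space, meaningful when \<open>variation_norm J \<rho>\<close> is finite.\<close>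

definition total_mass ::
    "nat set \<Rightarrow> ((nat \<Rightarrow> 'a::euclidean_space) set \<Rightarrow> real) \<Rightarrow> real" where
  "total_mass J \<rho> = lim (\<lambda>m. \<rho> (Pi\<^sub>E J (\<lambda>_. cball 0 (real m))))"

definition has_lebesgue_density ::
    "nat set \<Rightarrow> ((nat \<Rightarrow> 'a::euclidean_space) set \<Rightarrow> real) \<Rightarrow> ((nat \<Rightarrow> 'a) \<Rightarrow> real) \<Rightarrow> bool" where
  "has_lebesgue_density J \<rho> f \<longleftrightarrow>
     f \<in> borel_measurable (Pi\<^sub>M J (\<lambda>_. borel)) \<and>
     (\<forall>C\<in>bounded_borel J. set_integrable (Pi\<^sub>M J (\<lambda>_. lborel)) C f \<and>
        \<rho> C = (LINT x:C|Pi\<^sub>M J (\<lambda>_. lborel). f x))"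

text \<open>\<open>\<rho>\<close> is a reduced measure of \<open>\<mu>\<close>, where \<open>\<mu> A\<close> stands for \<open>\<mu>(A\<^sub>1 \<times> \<dots> \<times> A\<^sub>k)\<close>. The coordinates
  of the reduced measure are indexed by \<open>{1..<k}\<close>. The defining equation determines \<open>\<rho>\<close> uniquely
  on the bounded Borel sets.\<close>

definition is_reduced ::
    "real \<Rightarrow> nat \<Rightarrow> ((nat \<Rightarrow> 'a::euclidean_space set) \<Rightarrow> real) \<Rightarrow> ((nat \<Rightarrow> 'a) set \<Rightarrow> real) \<Rightarrow> bool" where
  "is_reduced lam k \<mu> \<rho> \<longleftrightarrow> signed_measure_on {1..<k} \<rho> \<and>
     (\<forall>A. (\<forall>i\<in>{1..k}. A i \<in> sets borel \<and> bounded (A i)) \<longrightarrow>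
        set_integrable lborel (A k) (\<lambda>x. \<rho> (Pi\<^sub>E {1..<k} (\<lambda>i. (\<lambda>y. y - x) ` A i))) \<and>
        \<mu> A = lam * (LINT x:A k|lborel. \<rho> (Pi\<^sub>E {1..<k} (\<lambda>i. (\<lambda>y. y - x) ` A i))))"

definition moment_red ::
    "'w measure \<Rightarrow> ('w \<Rightarrow> 'a::euclidean_space set) \<Rightarrow> nat \<Rightarrow> (nat \<Rightarrow> 'a) set \<Rightarrow> real" where
  "moment_red M N k =
     (SOME \<rho>. is_reduced (intensity M N) k (\<lambda>A. enn2real (fact_moment M N {1..k} A)) \<rho>)"

definition cumulant_red ::
    "'w measure \<Rightarrow> ('w \<Rightarrow> 'a::euclidean_space set) \<Rightarrow> nat \<Rightarrow> (nat \<Rightarrow> 'a) set \<Rightarrow> real" where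
  "cumulant_red M N k = (SOME \<rho>. is_reduced (intensity M N) k (fact_cumulant M N k) \<rho>)"

text \<open>The conjunct \<open>is_reduced\<close> only records that the choice in \<open>cumulant_red\<close> is a proper one: for a
  fourth-order stationary process the reduced cumulant measures exist.\<close>

definition B4_mixing :: "'w measure \<Rightarrow> ('w \<Rightarrow> 'a::euclidean_space set) \<Rightarrow> bool" where
  "B4_mixing M N \<longleftrightarrow> stationary_of_order 4 M N \<and>
     (\<forall>j\<in>{2,3,4}.
        is_reduced (intensity M N) j (fact_cumulant M N j) (cumulant_red M N j) \<and>
        variation_norm {1..<j} (cumulant_red M N j) < \<infinity>)"

definition asymp_var :: "'w measure \<Rightarrow> ('w \<Rightarrow> 'a::euclidean_space set) \<Rightarrow> real" where
  "asymp_var M N = intensity M N * (1 + total_mass {1..<2} (cumulant_red M N 2))"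

section \<open>Observation windows\<close>

definition inball_radius :: "'a::euclidean_space set \<Rightarrow> real" where
  "inball_radius W = Sup {r. 0 < r \<and> (\<exists>x\<in>W. cball x r \<subseteq> W)}"

definition convex_averaging :: "(nat \<Rightarrow> 'a::euclidean_space set) \<Rightarrow> bool" where
  "convex_averaging W \<longleftrightarrow> (\<forall>n. convex (W n) \<and> compact (W n)) \<and> (\<forall>n. W n \<subseteq> W (Suc n)) \<and>
     filterlim (\<lambda>n. inball_radius (W n)) at_top sequentially"

definition window_scale :: "'a::euclidean_space set \<Rightarrow> real" where
  "window_scale W = measure lborel W powr (1 / DIM('a))"

section \<open>Estimators\<close>

text \<open>The estimators are functions of an observed configuration \<open>S\<close>, which stands for \<open>N \<omega>\<close>.
  For locally finite \<open>S\<close> and bounded \<open>W\<close> all sums are finite.\<close>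

definition distinct_pairs :: "'a set \<Rightarrow> ('a \<times> 'a) set" where
  "distinct_pairs S = {(x, y). x \<in> S \<and> y \<in> S \<and> x \<noteq> y}"

definition edge_volume :: "'a::euclidean_space set \<Rightarrow> 'a \<Rightarrow> 'a \<Rightarrow> real" where
  "edge_volume W x y = measure lborel (((\<lambda>z. z - x) ` W) \<inter> ((\<lambda>z. z - y) ` W))"

definition lambda2K_est ::
    "'a::euclidean_space set \<Rightarrow> 'a set \<Rightarrow> 'a set \<Rightarrow> real \<Rightarrow> real" where
  "lambda2K_est B W S r =
     (\<Sum>(x, y)\<in>distinct_pairs (S \<inter> W). indicat_real ((\<lambda>z. r *\<^sub>R z) ` B) (y - x) / edge_volume W x y)"

definition lambda_est :: "'a::euclidean_space set \<Rightarrow> 'a set \<Rightarrow> real" where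
  "lambda_est W S = real (card (S \<inter> W)) / measure lborel W"

definition lambda2_est :: "'a::euclidean_space set \<Rightarrow> 'a set \<Rightarrow> real" where
  "lambda2_est W S =
     (real (card (S \<inter> W)) - 1) * real (card (S \<inter> W)) / (measure lborel W)\<^sup>2"

text \<open>The argument \<open>h\<close> is the product of the bandwidth and the scale of the window.\<close>

definition sigma2_est ::
    "('a::euclidean_space \<Rightarrow> real) \<Rightarrow> real \<Rightarrow> 'a set \<Rightarrow> 'a set \<Rightarrow> real" where
  "sigma2_est w h W S = lambda_est W S
     + (\<Sum>(x, y)\<in>distinct_pairs (S \<inter> W). w ((y - x) /\<^sub>R h) / edge_volume W x y)
     - lambda2_est W S * h ^ DIM('a) * (LINT x|lborel. w x)"

section \<open>Stieltjes measure\<close>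

text \<open>The measure \<open>dV\<close> of a non-decreasing right-continuous function on \<open>[0,R]\<close>, extended to the real
  line by its end values. It has no atom at \<open>0\<close>; the integrands of interest vanish there anyway.\<close>

definition stieltjes :: "real \<Rightarrow> (real \<Rightarrow> real) \<Rightarrow> real measure" where
  "stieltjes R V = interval_measure (\<lambda>r. V (max 0 (min R r)))"

end

(*
  Write U for the sum of a symmetric kernel psi(x, y) over the pairs of distinct points in a window
  W, and G for the sum of g(x) = int psi(x, y) lambda dy over the points in W. Expressing moment
  measures by cumulant measures, all terms of Var(U - 2G) with the two pairs linked only through
  their projections cancel; what is left is bounded by const * sup|psi|^2 * |W| * (1 + |D|), where D
  is the support of psi in the variable y - x. Applied to the kernel of the K-function estimator this
  shows that |W|^(1/2 - alpha) times its deviation from its mean at c^alpha r agrees up to o(1) in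
  L^2, uniformly in r <= R, with 2 lambda |B| r^d times |W|^(1/2) (lambda_est - lambda); the edge
  correction only matters in a boundary layer of small relative volume. The means are not under
  control, but they cancel under the null hypothesis. The same bound gives the consistency of the
  variance estimator, so the statistic equals a constant times the squared difference of the two
  intensity estimators up to a term that tends to 0 in probability.
*)
theory Submission
  imports Defs
begin

section \<open>Random finite sets\<close>

text \<open>The reduced cumulant measures are given only as real set functions on bounded Borel sets
  with finite total variation, and no Jordan decomposition is built. Integrals against cumulants are
  therefore formed inside a window, as alternating sums of integrals against products of moment
  measures (\<open>cum2\<close>, \<open>cum3\<close>, \<open>cum4\<close>). On rectangles these
  agree with \<open>lam\<close> times an integral of reduced measures of sections; a Dynkin argument
  carries this to all Borel sets, and simple functions then give bounds by the total variation at
  the price of a factor 4. Rates: the kernel of the K-function estimator is of order 1/|W| and |D|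
  of order |W|^\<alpha>, so the variance bound times |W|^(1 - 2\<alpha>) is of order
  |W|^(-\<alpha>). For the variance estimator, with h = b_n c_n, the linear part 2G is itself small:
  its variance is of order h^(2d)/|W| = (c_n b_n^2)^d. The mean of that estimator is accessible
  because dividing by the overlap volume leaves no edge effect in the first order part. The integral
  over r needs only that dV is finite and that the bounds are uniform in r.\<close>

definition finite_process :: "'w measure \<Rightarrow> ('w \<Rightarrow> 'e::topological_space set) \<Rightarrow> bool" where
  "finite_process M T \<longleftrightarrow> (\<forall>\<omega>\<in>space M. finite (T \<omega>)) \<and>
     (\<forall>A\<in>sets borel. (\<lambda>\<omega>. real (card (T \<omega> \<inter> A))) \<in> borel_measurable M)"

text \<open>The intensity measure of the random set. For the set of k-tuples of distinct points of a
  window it is the k-th factorial moment measure restricted to the window, as a genuine measure on a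
  power of the space; this is why the carrier is an arbitrary topological space and why
  \<open>finite_process\<close> speaks only of finiteness and measurable counts.\<close>

definition mean_measure :: "'w measure \<Rightarrow> ('w \<Rightarrow> 'e::topological_space set) \<Rightarrow> 'e measure" where
  "mean_measure M T = measure_of UNIV (sets borel) (\<lambda>A. \<integral>\<^sup>+\<omega>. ennreal (real (card (T \<omega> \<inter> A))) \<partial>M)"

lemma finite_processD:
  assumes "finite_process M T"
  shows "\<And>\<omega>. \<omega> \<in> space M \<Longrightarrow> finite (T \<omega>)"
    and "\<And>A. A \<in> sets borel \<Longrightarrow> (\<lambda>\<omega>. real (card (T \<omega> \<inter> A))) \<in> borel_measurable M"
  using assms by (auto simp: finite_process_def)

lemma card_inter_sums:
  assumes "finite T" "disjoint_family A"
  shows "(\<lambda>i::nat. real (card (T \<inter> A i))) sums real (card (T \<inter> (\<Union>i. A i)))"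
proof -
  interpret finite_measure "count_space T" by (rule finite_measure_count_space) fact
  have "(\<lambda>i. measure (count_space T) (T \<inter> A i)) sums measure (count_space T) (\<Union>i. T \<inter> A i)"
    using assms(2) by (intro finite_measure_UNION) (auto simp: disjoint_family_on_def)
  moreover have "measure (count_space T) (T \<inter> X) = real (card (T \<inter> X))" for X
    using assms(1) by (subst measure_count_space) auto
  ultimately show ?thesis by simp
qed

lemma sets_mean_measure [simp, measurable_cong]: "sets (mean_measure M T) = sets borel"
  unfolding mean_measure_def using sets.sigma_sets_eq[of borel] by simp

lemma space_mean_measure [simp]: "space (mean_measure M T) = UNIV"
  unfolding mean_measure_def by simp

lemma emeasure_mean_measure:
  assumes T: "finite_process M T" and A: "A \<in> sets borel"
  shows "emeasure (mean_measure M T) A = (\<integral>\<^sup>+\<omega>. ennreal (real (card (T \<omega> \<inter> A))) \<partial>M)"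
proof (rule emeasure_measure_of[OF mean_measure_def[of M T]])
  show "countably_additive (sets (mean_measure M T)) (\<lambda>A. \<integral>\<^sup>+\<omega>. ennreal (real (card (T \<omega> \<inter> A))) \<partial>M)"
  proof (rule countably_additiveI)
    fix A :: "nat \<Rightarrow> 'b set"
    assume A: "range A \<subseteq> sets (mean_measure M T)" "disjoint_family A"
    note [measurable] = finite_processD(2)[OF T]
    have [measurable]: "A i \<in> sets borel" for i using A(1) by auto
    have "(\<Sum>i. \<integral>\<^sup>+\<omega>. ennreal (real (card (T \<omega> \<inter> A i))) \<partial>M)
        = (\<integral>\<^sup>+\<omega>. (\<Sum>i. ennreal (real (card (T \<omega> \<inter> A i)))) \<partial>M)"
      by (subst nn_integral_suminf) auto
    also have "\<dots> = (\<integral>\<^sup>+\<omega>. ennreal (real (card (T \<omega> \<inter> (\<Union>i. A i)))) \<partial>M)"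
    proof (rule nn_integral_cong)
      fix \<omega> assume "\<omega> \<in> space M"
      then have "(\<lambda>i. real (card (T \<omega> \<inter> A i))) sums real (card (T \<omega> \<inter> (\<Union>i. A i)))"
        using A(2) finite_processD(1)[OF T] by (intro card_inter_sums) auto
      then show "(\<Sum>i. ennreal (real (card (T \<omega> \<inter> A i)))) = ennreal (real (card (T \<omega> \<inter> (\<Union>i. A i))))"
        by (intro suminf_ennreal_eq) auto
    qed
    finally show "(\<Sum>i. \<integral>\<^sup>+\<omega>. ennreal (real (card (T \<omega> \<inter> A i))) \<partial>M)
        = (\<integral>\<^sup>+\<omega>. ennreal (real (card (T \<omega> \<inter> (\<Union>i. A i)))) \<partial>M)" .
  qed
  show "sets borel \<subseteq> Pow UNIV" "A \<in> sets (mean_measure M T)" using A by auto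
  show "positive (sets (mean_measure M T)) (\<lambda>A. \<integral>\<^sup>+\<omega>. ennreal (real (card (T \<omega> \<inter> A))) \<partial>M)"
    by (simp add: positive_def)
qed

text \<open>Campbell's formula by induction over nonnegative Borel functions. Measurability of the
  sum is part of the conclusion because the steps for sums, multiples and suprema use it as an
  induction hypothesis.\<close>

lemma campbell_nn:
  assumes T: "finite_process M T" and F: "F \<in> borel_measurable borel"
  shows "(\<lambda>\<omega>. \<Sum>x\<in>T \<omega>. F x :: ennreal) \<in> borel_measurable M \<and>
    (\<integral>\<^sup>+x. F x \<partial>mean_measure M T) = (\<integral>\<^sup>+\<omega>. (\<Sum>x\<in>T \<omega>. F x) \<partial>M)"
  using F
proof (induction F rule: borel_measurable_induct)
  case (cong f g)
  then show ?case by simp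
next
  case (set A)
  have *: "(\<Sum>x\<in>T \<omega>. indicator A x) = ennreal (real (card (T \<omega> \<inter> A)))" if "\<omega> \<in> space M" for \<omega>
    using finite_processD(1)[OF T that]
    by (simp add: indicator_def sum.If_cases ennreal_of_nat_eq_real_of_nat)
  have "(\<lambda>\<omega>. \<Sum>x\<in>T \<omega>. indicator A x :: ennreal) \<in> borel_measurable M"
    using finite_processD(2)[OF T set] by (subst measurable_cong[OF *]) auto
  moreover have "(\<integral>\<^sup>+x. indicator A x \<partial>mean_measure M T) = emeasure (mean_measure M T) A"
    using set by (subst nn_integral_indicator) auto
  moreover have "(\<integral>\<^sup>+\<omega>. (\<Sum>x\<in>T \<omega>. indicator A x) \<partial>M) = (\<integral>\<^sup>+\<omega>. ennreal (real (card (T \<omega> \<inter> A))) \<partial>M)"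
    by (rule nn_integral_cong) (rule *)
  ultimately show ?case using emeasure_mean_measure[OF T set] by simp
next
  case (mult u c)
  have [measurable]: "u \<in> borel_measurable borel" "(\<lambda>\<omega>. \<Sum>x\<in>T \<omega>. u x) \<in> borel_measurable M"
    using mult by auto
  have "(\<integral>\<^sup>+x. c * u x \<partial>mean_measure M T) = c * (\<integral>\<^sup>+x. u x \<partial>mean_measure M T)"
    by (rule nn_integral_cmult) simp
  also have "\<dots> = (\<integral>\<^sup>+\<omega>. c * (\<Sum>x\<in>T \<omega>. u x) \<partial>M)"
    using mult by (subst nn_integral_cmult) auto
  finally show ?case by (simp add: sum_distrib_left[symmetric])
next
  case (add u v)
  have [measurable]: "u \<in> borel_measurable borel" "(\<lambda>\<omega>. \<Sum>x\<in>T \<omega>. u x) \<in> borel_measurable M"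
    "v \<in> borel_measurable borel" "(\<lambda>\<omega>. \<Sum>x\<in>T \<omega>. v x) \<in> borel_measurable M"
    using add by auto
  have "(\<integral>\<^sup>+x. v x + u x \<partial>mean_measure M T) = (\<integral>\<^sup>+\<omega>. (\<Sum>x\<in>T \<omega>. v x) + (\<Sum>x\<in>T \<omega>. u x) \<partial>M)"
    using add by (simp add: nn_integral_add)
  then show ?case by (simp add: sum.distrib)
next
  case (seq U)
  have [measurable]: "U i \<in> borel_measurable borel" "(\<lambda>\<omega>. \<Sum>x\<in>T \<omega>. U i x) \<in> borel_measurable M" for i
    using seq by auto
  have inc: "incseq (\<lambda>i. U i x)" for x
    using seq(3) by (auto simp: incseq_def le_fun_def)
  have *: "(\<Sum>x\<in>T \<omega>. (SUP i. U i) x) = (SUP i. \<Sum>x\<in>T \<omega>. U i x)" for \<omega>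
    unfolding SUP_apply by (rule ennreal_SUP_sum[symmetric]) (rule inc)
  have "(\<integral>\<^sup>+x. (SUP i. U i) x \<partial>mean_measure M T) = (SUP i. \<integral>\<^sup>+x. U i x \<partial>mean_measure M T)"
    unfolding SUP_apply by (rule nn_integral_monotone_convergence_SUP) (use seq(3) in auto)
  also have "\<dots> = (SUP i. \<integral>\<^sup>+\<omega>. (\<Sum>x\<in>T \<omega>. U i x) \<partial>M)" using seq by simp
  also have "\<dots> = (\<integral>\<^sup>+\<omega>. (SUP i. \<Sum>x\<in>T \<omega>. U i x) \<partial>M)"
    using seq(3) by (intro nn_integral_monotone_convergence_SUP[symmetric])
      (auto simp: incseq_def le_fun_def intro!: sum_mono)
  finally show ?case unfolding * by simp
qed

lemma finite_process_sum_nn_measurable [measurable (raw)]: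
  assumes "finite_process M T" "F \<in> borel_measurable borel"
  shows "(\<lambda>\<omega>. \<Sum>x\<in>T \<omega>. F x :: ennreal) \<in> borel_measurable M"
  using campbell_nn[OF assms] by simp

lemma finite_process_sum_measurable:
  assumes T: "finite_process M T" and F: "F \<in> borel_measurable borel"
  shows "(\<lambda>\<omega>. \<Sum>x\<in>T \<omega>. F x :: real) \<in> borel_measurable M"
proof -
  have "(\<Sum>x\<in>T \<omega>. F x) = enn2real (\<Sum>x\<in>T \<omega>. ennreal (F x)) - enn2real (\<Sum>x\<in>T \<omega>. ennreal (- F x))" for \<omega>
  proof -
    have "(\<Sum>x\<in>T \<omega>. ennreal (G x)) = ennreal (\<Sum>x\<in>T \<omega>. max 0 (G x))" for G
      by (subst sum_ennreal[symmetric]) (auto intro!: sum.cong simp: max_def ennreal_neg simp del: sum_ennreal)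
    moreover have "F x = max 0 (F x) - max 0 (- F x)" for x by auto
    then have "(\<Sum>x\<in>T \<omega>. F x) = (\<Sum>x\<in>T \<omega>. max 0 (F x)) - (\<Sum>x\<in>T \<omega>. max 0 (- F x))"
      by (subst sum_subtractf[symmetric]) simp
    ultimately show ?thesis by (simp add: sum_nonneg)
  qed
  moreover have "(\<lambda>\<omega>. \<Sum>x\<in>T \<omega>. ennreal (F x)) \<in> borel_measurable M"
    "(\<lambda>\<omega>. \<Sum>x\<in>T \<omega>. ennreal (- F x)) \<in> borel_measurable M"
    using F by (auto intro!: finite_process_sum_nn_measurable[OF T])
  ultimately show ?thesis by simp
qed

text \<open>Counts in rectangles are products of counts, and the sets with measurable count form a
  Dynkin class; finiteness of the random sets is what turns complements into a subtraction of real
  numbers.\<close>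

lemma finite_process_times:
  fixes T :: "'w \<Rightarrow> 'e::second_countable_topology set" and T' :: "'w \<Rightarrow> 'f::second_countable_topology set"
  assumes T: "finite_process M T" and T': "finite_process M T'"
  shows "finite_process M (\<lambda>\<omega>. T \<omega> \<times> T' \<omega>)"
proof -
  have "(\<lambda>\<omega>. real (card (T \<omega> \<times> T' \<omega> \<inter> Q))) \<in> borel_measurable M" if "Q \<in> sets borel" for Q
  proof -
    define G where "G = {a \<times> b | a b. a \<in> sets (borel :: 'e measure) \<and> b \<in> sets (borel :: 'f measure)}"
    have Q: "Q \<in> sigma_sets UNIV G"
      using that unfolding borel_prod[symmetric] sets_pair_measure G_def by simp
    show ?thesis
    proof (rule sigma_sets_induct_disjoint[OF _ _ Q])
      show "Int_stable G"
        unfolding G_def using Int_stable_pair_measure_generator[of borel borel] by simp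
    next
      fix A assume "A \<in> G"
      then obtain a b where ab: "A = a \<times> b" "a \<in> sets borel" "b \<in> sets borel" by (auto simp: G_def)
      have "T \<omega> \<times> T' \<omega> \<inter> A = (T \<omega> \<inter> a) \<times> (T' \<omega> \<inter> b)" for \<omega>
        using ab by auto
      then show "(\<lambda>\<omega>. real (card (T \<omega> \<times> T' \<omega> \<inter> A))) \<in> borel_measurable M"
        using finite_processD(2)[OF T ab(2)] finite_processD(2)[OF T' ab(3)]
        by (simp add: card_cartesian_product)
    next
      fix A assume A: "(\<lambda>\<omega>. real (card (T \<omega> \<times> T' \<omega> \<inter> A))) \<in> borel_measurable M"
      have "real (card (T \<omega> \<times> T' \<omega> \<inter> (UNIV - A)))
          = real (card (T \<omega> \<inter> UNIV)) * real (card (T' \<omega> \<inter> UNIV)) - real (card (T \<omega> \<times> T' \<omega> \<inter> A))"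
        if "\<omega> \<in> space M" for \<omega>
      proof -
        have "finite (T \<omega> \<times> T' \<omega>)"
          by (intro finite_cartesian_product finite_processD(1)[OF T] finite_processD(1)[OF T'] that)
        then have "card (T \<omega> \<times> T' \<omega> \<inter> A) + card (T \<omega> \<times> T' \<omega> \<inter> (UNIV - A)) = card (T \<omega> \<times> T' \<omega>)"
          by (subst card_Un_disjoint[symmetric]) (auto intro!: arg_cong[of _ _ card])
        then have "real (card (T \<omega> \<times> T' \<omega> \<inter> A)) + real (card (T \<omega> \<times> T' \<omega> \<inter> (UNIV - A))) = real (card (T \<omega> \<times> T' \<omega>))"
          by (metis of_nat_add)
        then show ?thesis by (simp add: card_cartesian_product)
      qed
      then show "(\<lambda>\<omega>. real (card (T \<omega> \<times> T' \<omega> \<inter> (UNIV - A)))) \<in> borel_measurable M"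
        using A finite_processD(2)[OF T space_in_borel]
          finite_processD(2)[OF T' space_in_borel]
        by (subst measurable_cong[where g = "\<lambda>\<omega>. real (card (T \<omega> \<inter> UNIV)) * real (card (T' \<omega> \<inter> UNIV))
          - real (card (T \<omega> \<times> T' \<omega> \<inter> A))"]) auto
    next
      fix A :: "nat \<Rightarrow> ('e \<times> 'f) set"
      assume A: "disjoint_family A" "\<And>i. (\<lambda>\<omega>. real (card (T \<omega> \<times> T' \<omega> \<inter> A i))) \<in> borel_measurable M"
      have "(\<lambda>i. real (card (T \<omega> \<times> T' \<omega> \<inter> A i))) sums real (card (T \<omega> \<times> T' \<omega> \<inter> (\<Union>i. A i)))"
        if "\<omega> \<in> space M" for \<omega>
        by (intro card_inter_sums A finite_cartesian_product finite_processD(1)[OF T] finite_processD(1)[OF T'] that)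
      then have *: "real (card (T \<omega> \<times> T' \<omega> \<inter> (\<Union>i. A i))) = (\<Sum>i. real (card (T \<omega> \<times> T' \<omega> \<inter> A i)))"
        if "\<omega> \<in> space M" for \<omega> using that sums_unique by blast
      show "(\<lambda>\<omega>. real (card (T \<omega> \<times> T' \<omega> \<inter> (\<Union>i. A i)))) \<in> borel_measurable M"
        using A(2) by (subst measurable_cong[OF *]) auto
    qed auto
  qed
  then show ?thesis
    using T T' unfolding finite_process_def by auto
qed

lemma finite_process_subset:
  assumes "finite_process M T" "B \<in> sets borel" "\<And>\<omega>. \<omega> \<in> space M \<Longrightarrow> T' \<omega> = T \<omega> \<inter> B"
  shows "finite_process M T'"
proof -
  have "(\<lambda>\<omega>. real (card (T' \<omega> \<inter> A))) \<in> borel_measurable M" if "A \<in> sets borel" for A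
    using finite_processD(2)[OF assms(1), of "B \<inter> A"] that assms(2)
    by (subst measurable_cong[of _ _ "\<lambda>\<omega>. real (card (T \<omega> \<inter> (B \<inter> A)))"]) (auto simp: assms(3) Int_assoc)
  then show ?thesis using assms unfolding finite_process_def by auto
qed

lemma finite_process_singleton:
  assumes "f \<in> borel_measurable M"
  shows "finite_process M (\<lambda>\<omega>. {f \<omega>})"
proof -
  have "real (card ({f \<omega>} \<inter> A)) = indicator A (f \<omega>)" for A \<omega>
    by (auto simp: indicator_def)
  then show ?thesis using assms by (auto simp: finite_process_def)
qed

lemma finite_process_compose:
  assumes "finite_process M T" "f \<in> measurable L M"
  shows "finite_process L (\<lambda>x. T (f x))"
  using assms unfolding finite_process_def
  by (auto intro: measurable_compose[OF assms(2)] dest: measurable_space)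

text \<open>Joint measurability in the parameter is obtained by making the parameter a point: on the
  product space the set of pairs {r} x T(\<omega>) is again a finite process, and F is summed over
  it.\<close>

lemma finite_process_sum_measurable2:
  fixes T :: "'w \<Rightarrow> 'e::second_countable_topology set" and F :: "'f::second_countable_topology \<Rightarrow> 'e \<Rightarrow> real"
  assumes T: "finite_process M T" and F: "(\<lambda>(r, x). F r x) \<in> borel_measurable borel"
  shows "(\<lambda>(\<omega>, r). \<Sum>x\<in>T \<omega>. F r x) \<in> borel_measurable (M \<Otimes>\<^sub>M borel)"
proof -
  have "finite_process (M \<Otimes>\<^sub>M borel) (\<lambda>p. {snd p :: 'f} \<times> T (fst p))"
    by (rule finite_process_times[OF finite_process_singleton finite_process_compose[OF T]]) auto
  from finite_process_sum_measurable[OF this F]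
  have "(\<lambda>p. \<Sum>(r, x)\<in>{snd p} \<times> T (fst p). F r x) \<in> borel_measurable (M \<Otimes>\<^sub>M borel)" .
  moreover have "(\<Sum>(r, x)\<in>{a} \<times> S. F r x) = (\<Sum>x\<in>S. F a x)" for a S
  proof -
    have "{a} \<times> S = Pair a ` S" by auto
    then show ?thesis by (simp add: sum.reindex inj_on_def)
  qed
  ultimately show ?thesis by (simp add: case_prod_beta')
qed

text \<open>Boundedness of F and integrability of the number of points dominate the sum. All kernels
  summed later are bounded, so no finer integrability condition is carried along.\<close>

lemma campbell:
  fixes F :: "'e::topological_space \<Rightarrow> real"
  assumes T: "finite_process M T" and int: "integrable M (\<lambda>\<omega>. real (card (T \<omega>)))"
    and F: "F \<in> borel_measurable borel" and bd: "\<And>x. \<bar>F x\<bar> \<le> C"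
  shows "integrable M (\<lambda>\<omega>. \<Sum>x\<in>T \<omega>. F x)" and "(LINT \<omega>|M. (\<Sum>x\<in>T \<omega>. F x)) = (LINT x|mean_measure M T. F x)"
proof -
  have int2: "integrable M (\<lambda>\<omega>. \<Sum>x\<in>T \<omega>. G x)" if "G \<in> borel_measurable borel" "\<And>x. \<bar>G x\<bar> \<le> C" for G :: "'e \<Rightarrow> real"
  proof (rule Bochner_Integration.integrable_bound)
    show "integrable M (\<lambda>\<omega>. C * real (card (T \<omega>)))" using int by simp
    show "(\<lambda>\<omega>. \<Sum>x\<in>T \<omega>. G x) \<in> borel_measurable M"
      by (rule finite_process_sum_measurable[OF T that(1)])
    have "\<bar>\<Sum>x\<in>T \<omega>. G x\<bar> \<le> C * real (card (T \<omega>))" for \<omega>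
    proof -
      have "\<bar>\<Sum>x\<in>T \<omega>. G x\<bar> \<le> (\<Sum>x\<in>T \<omega>. \<bar>G x\<bar>)" by (rule sum_abs)
      also have "\<dots> \<le> (\<Sum>x\<in>T \<omega>. C)" by (intro sum_mono that)
      finally show ?thesis by (simp add: mult.commute)
    qed
    then show "AE \<omega> in M. norm (\<Sum>x\<in>T \<omega>. G x) \<le> norm (C * real (card (T \<omega>)))"
      by (intro AE_I2) (metis abs_ge_self order_trans real_norm_def)
  qed
  show "integrable M (\<lambda>\<omega>. \<Sum>x\<in>T \<omega>. F x)" using F bd by (rule int2)
  have C: "0 \<le> C" using bd[of undefined] by simp
  have nonneg: "(\<integral>\<^sup>+x. ennreal (G x) \<partial>mean_measure M T) = ennreal (LINT \<omega>|M. (\<Sum>x\<in>T \<omega>. G x))"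
    if "G \<in> borel_measurable borel" "\<And>x. 0 \<le> G x" "\<And>x. G x \<le> C" for G :: "'e \<Rightarrow> real"
  proof -
    have "(\<integral>\<^sup>+x. ennreal (G x) \<partial>mean_measure M T) = (\<integral>\<^sup>+\<omega>. (\<Sum>x\<in>T \<omega>. ennreal (G x)) \<partial>M)"
      using campbell_nn[OF T, of "\<lambda>x. ennreal (G x)"] that by simp
    also have "\<dots> = (\<integral>\<^sup>+\<omega>. ennreal (\<Sum>x\<in>T \<omega>. G x) \<partial>M)" using that by simp
    also have "\<dots> = ennreal (LINT \<omega>|M. (\<Sum>x\<in>T \<omega>. G x))"
      using that by (intro nn_integral_eq_integral int2) (auto intro!: sum_nonneg)
    finally show ?thesis .
  qed
  define p q where "p x = max 0 (F x)" and "q x = max 0 (- F x)" for x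
  have pq: "F x = p x - q x" for x by (auto simp: p_def q_def)
  have b: "p x \<le> C" "q x \<le> C" "0 \<le> p x" "0 \<le> q x" for x
    using bd[of x] C by (auto simp: p_def q_def)
  have [measurable]: "p \<in> borel_measurable borel" "q \<in> borel_measurable borel"
    unfolding p_def q_def using F by auto
  have I: "integrable (mean_measure M T) G" "(LINT x|mean_measure M T. G x) = (LINT \<omega>|M. (\<Sum>x\<in>T \<omega>. G x))"
    if "G \<in> borel_measurable borel" "\<And>x. 0 \<le> G x" "\<And>x. G x \<le> C" for G :: "'e \<Rightarrow> real"
  proof -
    have "has_bochner_integral (mean_measure M T) G (LINT \<omega>|M. (\<Sum>x\<in>T \<omega>. G x))"
      using nonneg[OF that] that
      by (intro has_bochner_integral_nn_integral) (auto intro!: Bochner_Integration.integral_nonneg sum_nonneg)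
    then show "integrable (mean_measure M T) G" "(LINT x|mean_measure M T. G x) = (LINT \<omega>|M. (\<Sum>x\<in>T \<omega>. G x))"
      by (auto simp: has_bochner_integral_iff)
  qed
  have "(LINT x|mean_measure M T. F x) = (LINT x|mean_measure M T. p x) - (LINT x|mean_measure M T. q x)"
    unfolding pq using b by (intro Bochner_Integration.integral_diff I) auto
  also have "\<dots> = (LINT \<omega>|M. (\<Sum>x\<in>T \<omega>. p x)) - (LINT \<omega>|M. (\<Sum>x\<in>T \<omega>. q x))"
    using b by (simp add: I)
  also have "\<dots> = (LINT \<omega>|M. (\<Sum>x\<in>T \<omega>. F x))"
    unfolding pq sum_subtractf using b
    by (intro Bochner_Integration.integral_diff[symmetric] int2) (auto simp: abs_le_iff intro: order_trans[OF _ C])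
  finally show "(LINT \<omega>|M. (\<Sum>x\<in>T \<omega>. F x)) = (LINT x|mean_measure M T. F x)" by simp
qed

lemma finite_measure_mean_measure:
  assumes T: "finite_process M T" and int: "integrable M (\<lambda>\<omega>. real (card (T \<omega>)))"
  shows "finite_measure (mean_measure M T)"
proof
  have "emeasure (mean_measure M T) UNIV = (\<integral>\<^sup>+\<omega>. ennreal (real (card (T \<omega>))) \<partial>M)"
    using emeasure_mean_measure[OF T, of UNIV] by simp
  also have "\<dots> < \<infinity>" using int by (simp add: nn_integral_eq_integral)
  finally show "emeasure (mean_measure M T) (space (mean_measure M T)) \<noteq> \<infinity>" by simp
qed

section \<open>Signed functionals and reduced measures\<close>

text \<open>The abstract form of integration against a finite signed measure on bounded Borel
  functions: linearity and continuity under bounded pointwise convergence. Cumulants are alternating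
  sums of integrals over different product spaces, and these properties survive such sums without a
  single signed measure being chosen.\<close>

definition signed_functional :: "(('e::topological_space \<Rightarrow> real) \<Rightarrow> real) \<Rightarrow> bool" where
  "signed_functional \<Phi> \<longleftrightarrow>
     (\<forall>f g C. f \<in> borel_measurable borel \<and> g \<in> borel_measurable borel \<and> (\<forall>x. \<bar>f x\<bar> \<le> C) \<and> (\<forall>x. \<bar>g x\<bar> \<le> C) \<longrightarrow>
        \<Phi> (\<lambda>x. f x + g x) = \<Phi> f + \<Phi> g) \<and>
     (\<forall>f C c. f \<in> borel_measurable borel \<and> (\<forall>x. \<bar>f x\<bar> \<le> C) \<longrightarrow> \<Phi> (\<lambda>x. c * f x) = c * \<Phi> f) \<and>
     (\<forall>F f C. (\<forall>n. F n \<in> borel_measurable borel) \<and> (\<forall>n x. \<bar>F n x\<bar> \<le> C) \<and> (\<forall>x. (\<lambda>n::nat. F n x) \<longlonglongrightarrow> f x) \<longrightarrow>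
        (\<lambda>n. \<Phi> (F n)) \<longlonglongrightarrow> \<Phi> f)"

lemma signed_functionalD:
  assumes "signed_functional \<Phi>"
  shows "\<And>f g C. f \<in> borel_measurable borel \<Longrightarrow> g \<in> borel_measurable borel \<Longrightarrow>
      (\<And>x. \<bar>f x\<bar> \<le> C) \<Longrightarrow> (\<And>x. \<bar>g x\<bar> \<le> C) \<Longrightarrow> \<Phi> (\<lambda>x. f x + g x) = \<Phi> f + \<Phi> g"
    and "\<And>f C c. f \<in> borel_measurable borel \<Longrightarrow> (\<And>x. \<bar>f x\<bar> \<le> C) \<Longrightarrow> \<Phi> (\<lambda>x. c * f x) = c * \<Phi> f"
    and "\<And>F f C. (\<And>n. F n \<in> borel_measurable borel) \<Longrightarrow> (\<And>n x. \<bar>F n x\<bar> \<le> C) \<Longrightarrow>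
      (\<And>x. (\<lambda>n::nat. F n x) \<longlonglongrightarrow> f x) \<Longrightarrow> (\<lambda>n. \<Phi> (F n)) \<longlonglongrightarrow> \<Phi> f"
  using assms unfolding signed_functional_def by blast+

lemma signed_functional_add:
  assumes "signed_functional \<Phi>" "signed_functional \<Psi>"
  shows "signed_functional (\<lambda>f. \<Phi> f + \<Psi> f)"
  unfolding signed_functional_def
proof (intro conjI allI impI; elim conjE)
  fix f g :: "'a \<Rightarrow> real" and C
  assume "f \<in> borel_measurable borel" "g \<in> borel_measurable borel" "\<forall>x. \<bar>f x\<bar> \<le> C" "\<forall>x. \<bar>g x\<bar> \<le> C"
  then show "\<Phi> (\<lambda>x. f x + g x) + \<Psi> (\<lambda>x. f x + g x) = \<Phi> f + \<Psi> f + (\<Phi> g + \<Psi> g)"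
    using signed_functionalD(1)[OF assms(1), of f g C] signed_functionalD(1)[OF assms(2), of f g C] by simp
next
  fix f :: "'a \<Rightarrow> real" and C c
  assume "f \<in> borel_measurable borel" "\<forall>x. \<bar>f x\<bar> \<le> C"
  then show "\<Phi> (\<lambda>x. c * f x) + \<Psi> (\<lambda>x. c * f x) = c * (\<Phi> f + \<Psi> f)"
    using signed_functionalD(2)[OF assms(1), of f C] signed_functionalD(2)[OF assms(2), of f C]
    by (simp add: algebra_simps)
next
  fix F :: "nat \<Rightarrow> 'a \<Rightarrow> real" and f C
  assume "\<forall>n. F n \<in> borel_measurable borel" "\<forall>n x. \<bar>F n x\<bar> \<le> C" "\<forall>x. (\<lambda>n. F n x) \<longlonglongrightarrow> f x"
  then show "(\<lambda>n. \<Phi> (F n) + \<Psi> (F n)) \<longlonglongrightarrow> \<Phi> f + \<Psi> f"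
    by (intro tendsto_add signed_functionalD(3)[OF assms(1), of F C f] signed_functionalD(3)[OF assms(2), of F C f]) auto
qed

lemma signed_functional_cmult:
  assumes "signed_functional \<Phi>"
  shows "signed_functional (\<lambda>f. a * \<Phi> f)"
  unfolding signed_functional_def
proof (intro conjI allI impI; elim conjE)
  fix f g :: "'a \<Rightarrow> real" and C
  assume "f \<in> borel_measurable borel" "g \<in> borel_measurable borel" "\<forall>x. \<bar>f x\<bar> \<le> C" "\<forall>x. \<bar>g x\<bar> \<le> C"
  then show "a * \<Phi> (\<lambda>x. f x + g x) = a * \<Phi> f + a * \<Phi> g"
    using signed_functionalD(1)[OF assms(1), of f g C] by (simp add: algebra_simps)
next
  fix f :: "'a \<Rightarrow> real" and C c
  assume "f \<in> borel_measurable borel" "\<forall>x. \<bar>f x\<bar> \<le> C"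
  then show "a * \<Phi> (\<lambda>x. c * f x) = c * (a * \<Phi> f)"
    using signed_functionalD(2)[OF assms(1), of f C] by simp
next
  fix F :: "nat \<Rightarrow> 'a \<Rightarrow> real" and f C
  assume "\<forall>n. F n \<in> borel_measurable borel" "\<forall>n x. \<bar>F n x\<bar> \<le> C" "\<forall>x. (\<lambda>n. F n x) \<longlonglongrightarrow> f x"
  then show "(\<lambda>n. a * \<Phi> (F n)) \<longlonglongrightarrow> a * \<Phi> f"
    by (intro tendsto_mult tendsto_const signed_functionalD(3)[OF assms(1), of F C f]) auto
qed

lemma signed_functional_diff:
  assumes "signed_functional \<Phi>" "signed_functional \<Psi>"
  shows "signed_functional (\<lambda>f. \<Phi> f - \<Psi> f)"
  using signed_functional_add[OF assms(1) signed_functional_cmult[OF assms(2), of "-1"]] by simp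

lemma signed_functional_integral:
  assumes "finite_measure \<mu>" and [measurable]: "p \<in> \<mu> \<rightarrow>\<^sub>M borel"
  shows "signed_functional (\<lambda>f. LINT s|\<mu>. f (p s))"
  unfolding signed_functional_def
proof (intro conjI allI impI; elim conjE)
  interpret finite_measure \<mu> by fact
  have int: "integrable \<mu> (\<lambda>s. f (p s))" if [measurable]: "f \<in> borel_measurable borel" and "\<forall>x. \<bar>f x\<bar> \<le> C" for f :: "'b \<Rightarrow> real" and C
    using that(2) by (intro integrable_const_bound[of _ C]) auto
  { fix f g :: "'b \<Rightarrow> real" and C
    assume "f \<in> borel_measurable borel" "g \<in> borel_measurable borel" "\<forall>x. \<bar>f x\<bar> \<le> C" "\<forall>x. \<bar>g x\<bar> \<le> C"
    then show "(LINT s|\<mu>. f (p s) + g (p s)) = (LINT s|\<mu>. f (p s)) + (LINT s|\<mu>. g (p s))"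
      by (intro Bochner_Integration.integral_add int) }
  { fix f :: "'b \<Rightarrow> real" and C c
    show "(LINT s|\<mu>. c * f (p s)) = c * (LINT s|\<mu>. f (p s))" by simp }
  { fix F :: "nat \<Rightarrow> 'b \<Rightarrow> real" and f C
    assume F: "\<forall>n. F n \<in> borel_measurable borel" "\<forall>n x. \<bar>F n x\<bar> \<le> C" "\<forall>x. (\<lambda>n. F n x) \<longlonglongrightarrow> f x"
    then have [measurable]: "\<And>n. F n \<in> borel_measurable borel" "f \<in> borel_measurable borel"
      by (auto intro: borel_measurable_LIMSEQ_real)
    show "(\<lambda>n. LINT s|\<mu>. F n (p s)) \<longlonglongrightarrow> (LINT s|\<mu>. f (p s))"
      using F by (intro integral_dominated_convergence[where w = "\<lambda>_. C"]) auto }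
qed

lemma signed_functional_sum:
  assumes \<Phi>: "signed_functional \<Phi>" and "finite I"
    and "\<And>i. i \<in> I \<Longrightarrow> f i \<in> borel_measurable borel" "\<And>i x. i \<in> I \<Longrightarrow> \<bar>f i x\<bar> \<le> C"
  shows "\<Phi> (\<lambda>x. \<Sum>i\<in>I. f i x) = (\<Sum>i\<in>I. \<Phi> (f i))"
  using assms(2-)
proof (induction I rule: finite_induct)
  case empty
  then show ?case using signed_functionalD(2)[OF \<Phi>, of "\<lambda>_. 0" 0 0] by simp
next
  case (insert a I)
  have "\<bar>\<Sum>i\<in>I. f i x\<bar> \<le> real (card I) * \<bar>C\<bar>" for x
  proof -
    have "\<bar>\<Sum>i\<in>I. f i x\<bar> \<le> (\<Sum>i\<in>I. \<bar>f i x\<bar>)" by (rule sum_abs)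
    also have "\<dots> \<le> (\<Sum>i\<in>I. \<bar>C\<bar>)" using insert by (intro sum_mono) (metis abs_ge_self insertI2 order_trans)
    finally show ?thesis by simp
  qed
  then have b1: "\<bar>\<Sum>i\<in>I. f i x\<bar> \<le> real (card I) * \<bar>C\<bar> + \<bar>C\<bar>" for x
    by (metis abs_ge_zero add_increasing2)
  have b2: "\<bar>f a x\<bar> \<le> real (card I) * \<bar>C\<bar> + \<bar>C\<bar>" for x
  proof -
    have "\<bar>f a x\<bar> \<le> C" using insert by auto
    moreover have "0 \<le> real (card I) * \<bar>C\<bar>" by simp
    ultimately show ?thesis by linarith
  qed
  have "\<Phi> (\<lambda>x. f a x + (\<Sum>i\<in>I. f i x)) = \<Phi> (f a) + \<Phi> (\<lambda>x. \<Sum>i\<in>I. f i x)"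
    using insert.prems(1) b1 b2
    by (intro signed_functionalD(1)[OF \<Phi>, where C = "real (card I) * \<bar>C\<bar> + \<bar>C\<bar>"]) auto
  then show ?case using insert by simp
qed

text \<open>A substitute for the Hahn decomposition: the level sets on which \<Phi> is nonnegative
  are united into one set, those on which it is negative into another, and the bound K applies to
  each union. Hence the absolute values over all level sets add up to at most 2K.\<close>

lemma signed_functional_bound_simple:
  assumes \<Phi>: "signed_functional \<Phi>" and s: "s \<in> borel_measurable borel" "finite (range s)"
    and C: "\<And>x. \<bar>s x\<bar> \<le> C"
    and K: "\<And>Q. Q \<in> sets borel \<Longrightarrow> Q \<subseteq> {x. s x \<noteq> 0} \<Longrightarrow> \<bar>\<Phi> (indicat_real Q)\<bar> \<le> K"
  shows "\<bar>\<Phi> s\<bar> \<le> 2 * C * K"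
proof -
  note [measurable] = s(1)
  define I where "I = range s - {0}"
  have fin: "finite I" using s by (simp add: I_def)
  define A where "A v = {x. s x = v}" for v
  have A[measurable]: "A v \<in> sets borel" for v unfolding A_def by measurable
  have C0: "0 \<le> C" using C[of undefined] by simp
  have K0: "0 \<le> K" using K[of "{}"] by auto
  have "s x = (\<Sum>v\<in>I. v * indicat_real (A v) x)" for x
  proof -
    have "(\<Sum>v\<in>I. v * indicat_real (A v) x) = (\<Sum>v\<in>I. if v = s x then v else 0)"
      by (intro sum.cong) (auto simp: A_def)
    also have "\<dots> = (if s x \<in> I then s x else 0)" using fin by (simp add: sum.delta')
    also have "\<dots> = s x" by (auto simp: I_def)
    finally show ?thesis by simp
  qed
  then have "\<Phi> s = \<Phi> (\<lambda>x. \<Sum>v\<in>I. v * indicat_real (A v) x)" by presburger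
  also have "\<dots> = (\<Sum>v\<in>I. \<Phi> (\<lambda>x. v * indicat_real (A v) x))"
  proof (rule signed_functional_sum[OF \<Phi> fin, where C = C])
    fix v x assume "v \<in> I"
    then obtain y where "v = s y" by (auto simp: I_def)
    then show "\<bar>v * indicat_real (A v) x\<bar> \<le> C" using C[of y] C0 by (auto simp: indicator_def)
  qed auto
  also have "\<dots> = (\<Sum>v\<in>I. v * \<Phi> (indicat_real (A v)))"
    by (intro sum.cong refl signed_functionalD(2)[OF \<Phi>, where C = 1]) (auto simp: indicator_def)
  finally have eq: "\<Phi> s = (\<Sum>v\<in>I. v * \<Phi> (indicat_real (A v)))" .
  have part: "\<bar>\<Sum>v\<in>J. \<Phi> (indicat_real (A v))\<bar> \<le> K" if "J \<subseteq> I" for J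
  proof -
    have "finite J" using that fin finite_subset by blast
    have ind: "indicat_real (\<Union>v\<in>J. A v) = (\<lambda>x. \<Sum>v\<in>J. indicat_real (A v) x)"
    proof
      fix x
      have "(\<Sum>v\<in>J. indicat_real (A v) x) = (\<Sum>v\<in>J. if v = s x then 1 else 0)"
        by (intro sum.cong) (auto simp: A_def)
      also have "\<dots> = (if s x \<in> J then 1 else 0)" using \<open>finite J\<close> by (simp add: sum.delta')
      finally show "indicat_real (\<Union>v\<in>J. A v) x = (\<Sum>v\<in>J. indicat_real (A v) x)"
        by (auto simp: indicator_def A_def)
    qed
    have "(\<Sum>v\<in>J. \<Phi> (indicat_real (A v))) = \<Phi> (indicat_real (\<Union>v\<in>J. A v))"
      unfolding ind
      by (rule signed_functional_sum[OF \<Phi> \<open>finite J\<close>, where C = 1, symmetric]) (auto simp: indicator_def)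
    also have "\<bar>\<dots>\<bar> \<le> K"
      using \<open>finite J\<close> that by (intro K) (auto simp: A_def I_def)
    finally show ?thesis .
  qed
  define P where "P = {v \<in> I. 0 \<le> \<Phi> (indicat_real (A v))}"
  have "(\<Sum>v\<in>I. \<bar>\<Phi> (indicat_real (A v))\<bar>) = (\<Sum>v\<in>P. \<bar>\<Phi> (indicat_real (A v))\<bar>) + (\<Sum>v\<in>I - P. \<bar>\<Phi> (indicat_real (A v))\<bar>)"
    using fin by (subst sum.subset_diff[of P I]) (auto simp: P_def)
  also have "\<dots> = (\<Sum>v\<in>P. \<Phi> (indicat_real (A v))) - (\<Sum>v\<in>I - P. \<Phi> (indicat_real (A v)))"
    unfolding sum_negf[symmetric] diff_conv_add_uminus
    by (intro arg_cong2[where f = "(+)"] sum.cong) (auto simp: P_def)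
  also have "\<dots> \<le> 2 * K" using part[of P] part[of "I - P"] by (auto simp: P_def abs_le_iff)
  finally have sum2: "(\<Sum>v\<in>I. \<bar>\<Phi> (indicat_real (A v))\<bar>) \<le> 2 * K" .
  have "\<bar>\<Phi> s\<bar> \<le> (\<Sum>v\<in>I. C * \<bar>\<Phi> (indicat_real (A v))\<bar>)"
    unfolding eq
    by (rule order_trans[OF sum_abs], rule sum_mono) (use C in \<open>auto simp: abs_mult I_def intro!: mult_right_mono\<close>)
  also have "\<dots> \<le> C * (2 * K)"
    unfolding sum_distrib_left[symmetric] by (rule mult_left_mono[OF sum2 C0])
  finally show ?thesis by simp
qed

text \<open>The approximating simple functions satisfy |F_i| \<le> 2|f|, so they vanish where f does
  and the sets Q stay inside the support of f. The second factor 2 in the constant 4 is the price of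
  this.\<close>

lemma signed_functional_bound:
  assumes \<Phi>: "signed_functional \<Phi>" and f: "f \<in> borel_measurable borel"
    and C: "\<And>x. \<bar>f x\<bar> \<le> C"
    and K: "\<And>Q. Q \<in> sets borel \<Longrightarrow> Q \<subseteq> {x. f x \<noteq> 0} \<Longrightarrow> \<bar>\<Phi> (indicat_real Q)\<bar> \<le> K"
  shows "\<bar>\<Phi> f\<bar> \<le> 4 * C * K"
proof -
  from borel_measurable_implies_sequence_metric[OF f, of 0] obtain F
    where F: "\<And>i. simple_function borel (F i)" "\<And>x. (\<lambda>i. F i x) \<longlonglongrightarrow> f x"
      "\<And>i x. \<bar>F i x\<bar> \<le> 2 * \<bar>f x\<bar>"
    by (auto simp: dist_real_def)
  have b: "\<bar>F i x\<bar> \<le> 2 * C" for i x using F(3)[of i x] C[of x] by linarith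
  have [measurable]: "F i \<in> borel_measurable borel" for i using F(1) by (rule borel_measurable_simple_function)
  have "\<bar>\<Phi> (F i)\<bar> \<le> 2 * (2 * C) * K" for i
  proof (rule signed_functional_bound_simple[OF \<Phi>])
    show "finite (range (F i))" using simple_functionD(1)[OF F(1)[of i]] by simp
    fix Q assume "Q \<in> sets borel" "Q \<subseteq> {x. F i x \<noteq> 0}"
    moreover have "F i x = 0" if "f x = 0" for x using F(3)[of i x] that by simp
    ultimately show "\<bar>\<Phi> (indicat_real Q)\<bar> \<le> K" by (intro K) auto
  qed (use b in auto)
  moreover have "(\<lambda>i. \<bar>\<Phi> (F i)\<bar>) \<longlonglongrightarrow> \<bar>\<Phi> f\<bar>"
    using F b by (intro tendsto_rabs signed_functionalD(3)[OF \<Phi>, where C = "2 * C"]) auto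
  ultimately show ?thesis by (intro LIMSEQ_le_const2) (auto simp: mult.assoc)
qed

section \<open>Set functions on bounded Borel sets and reduced measures of sections\<close>

lemma signed_measure_on_empty:
  assumes "signed_measure_on J \<rho>"
  shows "\<rho> {} = 0"
proof -
  have "(\<lambda>n::nat. \<rho> {}) sums \<rho> (\<Union>n::nat. {})"
    using assms[unfolded signed_measure_on_def, rule_format, of "\<lambda>_. {}"]
    by (auto simp: bounded_borel_def disjoint_family_on_def)
  then have "(\<lambda>n::nat. \<rho> {}) \<longlonglongrightarrow> 0" by (intro summable_LIMSEQ_zero) (auto simp: sums_iff)
  then show ?thesis by (simp add: LIMSEQ_const_iff)
qed

lemma signed_measure_on_add:
  assumes \<rho>: "signed_measure_on J \<rho>" and AB: "A \<in> bounded_borel J" "B \<in> bounded_borel J" "A \<inter> B = {}"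
    and un: "A \<union> B \<in> bounded_borel J"
  shows "\<rho> (A \<union> B) = \<rho> A + \<rho> B"
proof -
  have e: "{} \<in> bounded_borel J" by (auto simp: bounded_borel_def)
  have "(\<lambda>n. \<rho> (binaryset A B n)) sums \<rho> (\<Union>n. binaryset A B n)"
    using AB e un
    by (intro \<rho>[unfolded signed_measure_on_def, rule_format])
       (auto simp: UN_binaryset_eq disjoint_family_on_def binaryset_def)
  moreover have "(\<lambda>n. \<rho> (binaryset A B n)) sums (\<rho> A + \<rho> B)"
    by (rule binaryset_sums) (rule signed_measure_on_empty[OF \<rho>])
  ultimately show ?thesis using sums_unique2 by (fastforce simp: UN_binaryset_eq)
qed

text \<open>The disintegration of a cumulant along the diagonal, once for all orders:
  \<open>s x\<close> sends the reduced coordinates u to the tuple with base point x, and the aim is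
  that \<Phi> of an indicator equals \<open>lam\<close> times the integral over x of \<rho> of the
  section at x. The set E, later a power of the window, confines the tuples so that the sections are
  bounded, since \<rho> has a meaning only there. G is the generator on which the defining equation
  of the reduced measure is available.\<close>

locale reduced_extension =
  fixes \<Phi> :: "('e::topological_space \<Rightarrow> real) \<Rightarrow> real"
    and s :: "'a::euclidean_space \<Rightarrow> (nat \<Rightarrow> 'a) \<Rightarrow> 'e"
    and J :: "nat set" and \<rho> :: "(nat \<Rightarrow> 'a) set \<Rightarrow> real"
    and E :: "'e set" and W :: "'a set" and lam r V :: real and G :: "'e set set"
  assumes \<Phi>: "signed_functional \<Phi>"
    and s [measurable]: "\<And>x. s x \<in> Pi\<^sub>M J (\<lambda>_. borel) \<rightarrow>\<^sub>M borel"
    and \<rho>: "signed_measure_on J \<rho>"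
    and V: "\<And>C. C \<in> bounded_borel J \<Longrightarrow> \<bar>\<rho> C\<bar> \<le> V"
    and E [measurable]: "E \<in> sets borel"
    and W [measurable]: "W \<in> sets borel" and Wb: "bounded W"
    and bdd: "\<And>x u. x \<in> W \<Longrightarrow> u \<in> space (Pi\<^sub>M J (\<lambda>_. borel)) \<Longrightarrow> s x u \<in> E \<Longrightarrow> u \<in> Pi\<^sub>E J (\<lambda>_. cball 0 r)"
    and G: "Int_stable G" "sets borel = sigma_sets UNIV G" "UNIV \<in> G"
    and lam: "0 \<le> lam"
begin

text \<open>The condition on x sits inside the section, so that the integrand vanishes off the
  window because \<rho> is 0 on the empty set.\<close>

definition sect :: "'e set \<Rightarrow> 'a \<Rightarrow> (nat \<Rightarrow> 'a) set" where
  "sect Q x = {u \<in> space (Pi\<^sub>M J (\<lambda>_. borel)). x \<in> W \<and> s x u \<in> Q \<inter> E}"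

lemma sect_bounded_borel: "Q \<in> sets borel \<Longrightarrow> sect Q x \<in> bounded_borel J"
proof -
  assume [measurable]: "Q \<in> sets borel"
  have "sect Q x \<in> sets (Pi\<^sub>M J (\<lambda>_. borel))" unfolding sect_def by measurable
  moreover have "sect Q x \<subseteq> Pi\<^sub>E J (\<lambda>_. cball 0 r)" using bdd by (fastforce simp: sect_def)
  ultimately show ?thesis unfolding bounded_borel_def by auto
qed

lemma sect_notin: "x \<notin> W \<Longrightarrow> sect Q x = {}"
  by (auto simp: sect_def)

text \<open>The sets satisfying the identity form a Dynkin class. That \<rho> of the section is
  measurable in x is not known beforehand; it is transported together with the identity, through
  differences for complements and limits for disjoint unions.\<close>

lemma extension:
  assumes base: "\<And>Q. Q \<in> G \<Longrightarrow> integrable lborel (\<lambda>x. \<rho> (sect Q x)) \<and>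
      \<Phi> (indicat_real Q) = lam * (LINT x|lborel. \<rho> (sect Q x))"
    and Q: "Q \<in> sets borel"
  shows "integrable lborel (\<lambda>x. \<rho> (sect Q x)) \<and> \<Phi> (indicat_real Q) = lam * (LINT x|lborel. \<rho> (sect Q x))"
proof -
  have Q': "Q \<in> sigma_sets UNIV G" using Q G(2) by simp
  have e: "\<rho> {} = 0" using signed_measure_on_empty[OF \<rho>] .
  show ?thesis
  proof (rule sigma_sets_induct_disjoint[OF G(1) _ Q'])
    show "G \<subseteq> Pow UNIV" by simp
    show "integrable lborel (\<lambda>x. \<rho> (sect {} x)) \<and> \<Phi> (indicat_real {}) = lam * (LINT x|lborel. \<rho> (sect {} x))"
      using signed_functionalD(2)[OF \<Phi>, of "\<lambda>_. 0" 0 0] by (simp add: sect_def e indicator_def[abs_def])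
  next
    fix A assume A: "A \<in> sigma_sets UNIV G"
      "integrable lborel (\<lambda>x. \<rho> (sect A x)) \<and> \<Phi> (indicat_real A) = lam * (LINT x|lborel. \<rho> (sect A x))"
    have As: "A \<in> sets borel" using A(1) G(2) by simp
    have 1: "\<rho> (sect (UNIV - A) x) = \<rho> (sect UNIV x) - \<rho> (sect A x)" for x
    proof -
      have un: "sect UNIV x = sect (UNIV - A) x \<union> sect A x" by (auto simp: sect_def)
      have "\<rho> (sect (UNIV - A) x \<union> sect A x) = \<rho> (sect (UNIV - A) x) + \<rho> (sect A x)"
      proof (rule signed_measure_on_add[OF \<rho>])
        show "sect (UNIV - A) x \<union> sect A x \<in> bounded_borel J"
          unfolding un[symmetric] by (rule sect_bounded_borel) simp
        show "sect (UNIV - A) x \<inter> sect A x = {}" by (auto simp: sect_def)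
      qed (use As in \<open>auto intro!: sect_bounded_borel\<close>)
      then show ?thesis using un by simp
    qed
    have U: "integrable lborel (\<lambda>x. \<rho> (sect UNIV x))" "\<Phi> (indicat_real UNIV) = lam * (LINT x|lborel. \<rho> (sect UNIV x))"
      using base[OF G(3)] by auto
    have "indicat_real (UNIV - A) = (\<lambda>x. indicat_real UNIV x + (-1) * indicat_real A x)"
      by (auto simp: indicator_def)
    then have "\<Phi> (indicat_real (UNIV - A)) = \<Phi> (indicat_real UNIV) + \<Phi> (\<lambda>x. (-1) * indicat_real A x)"
      using As by (simp only:) (rule signed_functionalD(1)[OF \<Phi>, where C = 1]; simp add: indicator_def)
    also have "\<Phi> (\<lambda>x. (-1) * indicat_real A x) = (-1) * \<Phi> (indicat_real A)"
      using As by (intro signed_functionalD(2)[OF \<Phi>, where C = 1]) (auto simp: indicator_def)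
    finally show "integrable lborel (\<lambda>x. \<rho> (sect (UNIV - A) x)) \<and>
        \<Phi> (indicat_real (UNIV - A)) = lam * (LINT x|lborel. \<rho> (sect (UNIV - A) x))"
      unfolding 1 using U A(2) by (auto simp: algebra_simps)
  next
    fix A :: "nat \<Rightarrow> 'e set"
    assume A: "disjoint_family A" "range A \<subseteq> sigma_sets UNIV G"
      "\<And>i. integrable lborel (\<lambda>x. \<rho> (sect (A i) x)) \<and> \<Phi> (indicat_real (A i)) = lam * (LINT x|lborel. \<rho> (sect (A i) x))"
    have As [measurable]: "A i \<in> sets borel" for i using A(2) G(2) by auto
    have sectU: "sect (\<Union>i. A i) x = (\<Union>i. sect (A i) x)" for x by (auto simp: sect_def)
    have sums: "(\<lambda>i. \<rho> (sect (A i) x)) sums \<rho> (sect (\<Union>i. A i) x)" for x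
      unfolding sectU
    proof (rule \<rho>[unfolded signed_measure_on_def, rule_format], intro conjI)
      show "(\<Union>i. sect (A i) x) \<in> bounded_borel J"
        unfolding sectU[symmetric] by (rule sect_bounded_borel) measurable
      show "disjoint_family (\<lambda>i. sect (A i) x)" using A(1) by (auto simp: disjoint_family_on_def sect_def)
    qed (auto intro!: sect_bounded_borel As)
    have finU: "sect (\<Union>i<n. A i) x = (\<Union>i<n. sect (A i) x)" for x n by (auto simp: sect_def)
    \<comment> \<open>Partial sums are again values of \<rho> on a bounded set, hence at most V in
      absolute value. This yields the dominating function V times the indicator of W without summing
      absolute values.\<close>
    have fin: "(\<Sum>i<n. \<rho> (sect (A i) x)) = \<rho> (sect (\<Union>i<n. A i) x)" for x n
    proof (induction n)
      case 0
      then show ?case by (simp add: sect_def e)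
    next
      case (Suc n)
      have un: "sect (\<Union>i<Suc n. A i) x = sect (\<Union>i<n. A i) x \<union> sect (A n) x"
        by (auto simp: sect_def lessThan_Suc)
      have "\<rho> (sect (\<Union>i<n. A i) x \<union> sect (A n) x) = \<rho> (sect (\<Union>i<n. A i) x) + \<rho> (sect (A n) x)"
      proof (rule signed_measure_on_add[OF \<rho>])
        show "sect (\<Union>i<n. A i) x \<union> sect (A n) x \<in> bounded_borel J"
          unfolding un[symmetric] by (rule sect_bounded_borel) measurable
        show "sect (\<Union>i<n. A i) x \<inter> sect (A n) x = {}"
        proof -
          have "A i \<inter> A n = {}" if "i < n" for i using A(1) that by (auto simp: disjoint_family_on_def)
          then show ?thesis by (auto simp: sect_def)
        qed
      qed (auto intro!: sect_bounded_borel As)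
      then show ?case using Suc un by simp
    qed
    have [measurable]: "(\<lambda>x. \<rho> (sect (A i) x)) \<in> borel_measurable lborel" for i
      using A(3)[of i] by (auto dest: borel_measurable_integrable)
    have lim: "(\<lambda>n. \<Sum>i<n. \<rho> (sect (A i) x)) \<longlonglongrightarrow> \<rho> (sect (\<Union>i. A i) x)" for x
      using sums[of x] by (simp add: sums_def)
    have [measurable]: "(\<lambda>x. \<rho> (sect (\<Union>i. A i) x)) \<in> borel_measurable lborel"
      by (rule borel_measurable_LIMSEQ_real[OF lim]) measurable
    have Wint: "integrable lborel (\<lambda>x. V * indicat_real W x)"
      using emeasure_bounded_finite[OF Wb] by (intro integrable_mult_right integrable_real_indicator) auto
    have V0: "0 \<le> V" using V[of "{}"] by (auto simp: bounded_borel_def)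
    have bnd: "\<bar>\<rho> (sect Q x)\<bar> \<le> V * indicat_real W x" if "Q \<in> sets borel" for Q x
      using V[OF sect_bounded_borel[OF that], of x] sect_notin[of x Q] e by (auto simp: indicator_def)
    have "integrable lborel (\<lambda>x. \<rho> (sect (\<Union>i. A i) x))"
      using bnd[of "\<Union>i. A i"] by (intro Bochner_Integration.integrable_bound[OF Wint]) (auto intro!: AE_I2 order_trans[OF _ abs_ge_self])
    moreover have "(\<lambda>n. LINT x|lborel. (\<Sum>i<n. \<rho> (sect (A i) x))) \<longlonglongrightarrow> (LINT x|lborel. \<rho> (sect (\<Union>i. A i) x))"
    proof (rule integral_dominated_convergence[OF _ _ Wint])
      show "AE x in lborel. norm (\<Sum>i<n. \<rho> (sect (A i) x)) \<le> V * indicat_real W x" for n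
        using bnd[of "\<Union>i<n. A i"] by (auto simp: fin)
    qed (use lim in auto)
    moreover have "(\<lambda>n. \<Phi> (\<lambda>x. \<Sum>i<n. indicat_real (A i) x)) \<longlonglongrightarrow> \<Phi> (indicat_real (\<Union>i. A i))"
    proof (rule signed_functionalD(3)[OF \<Phi>])
      have *: "(\<Sum>i<n. indicat_real (A i) x) = indicat_real (\<Union>i<n. A i) x" for n x
        using A(1) by (intro indicator_UN_disjoint[symmetric]) (auto simp: disjoint_family_on_def)
      show "\<bar>\<Sum>i<n. indicat_real (A i) x\<bar> \<le> 1" for n x unfolding * by (auto simp: indicator_def)
      show "(\<lambda>n. \<Sum>i<n. indicat_real (A i) x) \<longlonglongrightarrow> indicat_real (\<Union>i. A i) x" for x
        using A(1) indicator_sums[of A x] by (auto simp: sums_def disjoint_family_on_def)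
    qed auto
    moreover have "\<Phi> (\<lambda>x. \<Sum>i<n. indicat_real (A i) x) = lam * (LINT x|lborel. (\<Sum>i<n. \<rho> (sect (A i) x)))" for n
    proof -
      have "\<Phi> (\<lambda>x. \<Sum>i<n. indicat_real (A i) x) = (\<Sum>i<n. \<Phi> (indicat_real (A i)))"
        by (rule signed_functional_sum[OF \<Phi>, where C = 1]) (auto simp: indicator_def)
      also have "\<dots> = lam * (LINT x|lborel. (\<Sum>i<n. \<rho> (sect (A i) x)))"
        using A(3) by (subst Bochner_Integration.integral_sum) (auto simp: sum_distrib_left)
      finally show ?thesis .
    qed
    ultimately show "integrable lborel (\<lambda>x. \<rho> (sect (\<Union>i. A i) x)) \<and>
        \<Phi> (indicat_real (\<Union>i. A i)) = lam * (LINT x|lborel. \<rho> (sect (\<Union>i. A i) x))"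
      using LIMSEQ_unique[OF _ tendsto_mult_left] by fastforce
  qed (use base in auto)
qed

text \<open>Two quantities can improve on the global bound V: D localizes the base points that
  contribute, and v may be a tail bound valid only for sections of subsets of the support of f. The
  volume of W \<inter> D comes from the integration over the base point.\<close>

lemma functional_bound:
  assumes base: "\<And>Q. Q \<in> G \<Longrightarrow> integrable lborel (\<lambda>x. \<rho> (sect Q x)) \<and>
      \<Phi> (indicat_real Q) = lam * (LINT x|lborel. \<rho> (sect Q x))"
    and f: "f \<in> borel_measurable borel" "\<And>y. \<bar>f y\<bar> \<le> C"
    and D [measurable]: "D \<in> sets borel"
    and v: "0 \<le> v" "\<And>Q x. Q \<in> sets borel \<Longrightarrow> Q \<subseteq> {y. f y \<noteq> 0} \<Longrightarrow> \<bar>\<rho> (sect Q x)\<bar> \<le> v * indicat_real D x"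
  shows "\<bar>\<Phi> f\<bar> \<le> 4 * C * (lam * (v * measure lborel (W \<inter> D)))"
proof (rule signed_functional_bound[OF \<Phi> f])
  fix Q assume Q: "Q \<in> sets borel" "Q \<subseteq> {y. f y \<noteq> 0}"
  note ext = extension[OF base Q(1)]
  have fin: "emeasure lborel (W \<inter> D) < \<infinity>"
    using Wb by (intro emeasure_bounded_finite) (auto intro: bounded_subset)
  have "\<bar>LINT x|lborel. \<rho> (sect Q x)\<bar> \<le> (LINT x|lborel. \<bar>\<rho> (sect Q x)\<bar>)"
    by (rule integral_abs_bound)
  also have "\<dots> \<le> (LINT x|lborel. v * indicat_real (W \<inter> D) x)"
  proof (rule integral_mono)
    show "integrable lborel (\<lambda>x. \<bar>\<rho> (sect Q x)\<bar>)" using ext by auto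
    show "integrable lborel (\<lambda>x. v * indicat_real (W \<inter> D) x)"
      using fin by (intro integrable_mult_right integrable_real_indicator) auto
    show "\<bar>\<rho> (sect Q x)\<bar> \<le> v * indicat_real (W \<inter> D) x" for x
      using v(2)[OF Q, of x] sect_notin[of x Q] signed_measure_on_empty[OF \<rho>] by (auto simp: indicator_def)
  qed
  also have "\<dots> = v * measure lborel (W \<inter> D)" by simp
  finally have "\<bar>LINT x|lborel. \<rho> (sect Q x)\<bar> \<le> v * measure lborel (W \<inter> D)" .
  then show "\<bar>\<Phi> (indicat_real Q)\<bar> \<le> lam * (v * measure lborel (W \<inter> D))"
    using ext lam by (simp add: abs_mult mult_left_mono)
qed

end

section \<open>Sums over partitions\<close>

text \<open>The inner sum of \<open>fact_cumulant\<close>, but over an arbitrary index set, which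
  makes a recursion over that set possible.\<close>

definition csum :: "('i set \<Rightarrow> real) \<Rightarrow> 'i set \<Rightarrow> nat \<Rightarrow> real" where
  "csum m A j = (\<Sum>P | partition_on A P \<and> card P = j. \<Prod>K\<in>P. m K)"

lemma csum_empty: "csum m {} j = (if j = 0 then 1 else 0)"
proof -
  have *: "{P. partition_on {} P \<and> card P = j} = (if j = 0 then {{}} else {})"
    by (auto simp: partition_on_empty)
  show ?thesis unfolding csum_def * by simp
qed

lemma csum_0:
  assumes "finite A" "A \<noteq> {}"
  shows "csum m A 0 = 0"
proof -
  have "{P. partition_on A P \<and> card P = 0} = {}"
    using assms finite_elements[OF assms(1)] by (auto simp: partition_on_def)
  then show ?thesis by (simp only: csum_def sum.empty)
qed

text \<open>Partitions are sorted by the block \<open>insert a T\<close> that contains a; removing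
  it leaves a partition of A - T with one block fewer. Iterating this lets the simplifier expand the
  cumulants of orders 2, 3 and 4.\<close>

lemma csum_insert:
  assumes "finite A" "a \<notin> A"
  shows "csum m (insert a A) (Suc j) = (\<Sum>T\<in>Pow A. m (insert a T) * csum m (A - T) j)"
proof -
  define S where "S = (SIGMA T:Pow A. {Q. partition_on (A - T) Q \<and> card Q = j})"
  have finQ: "finite {Q. partition_on B Q \<and> card Q = j}" if "finite B" for B :: "'a set"
    by (rule finite_subset[OF _ finitely_many_partition_on[OF that]]) auto
  define blk where "blk P = (THE K. K \<in> P \<and> a \<in> K)" for P :: "'a set set"
  have blk: "blk P \<in> P \<and> a \<in> blk P" "\<And>K. K \<in> P \<Longrightarrow> a \<in> K \<Longrightarrow> K = blk P"
    if P: "partition_on (insert a A) P" for P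
  proof -
    have ex: "\<exists>!K. K \<in> P \<and> a \<in> K"
      
    proof -
      have "a \<in> \<Union>P" using partition_onD1[OF P] by auto
      then obtain K where K: "K \<in> P" "a \<in> K" by blast
      moreover have "K' = K" if "K' \<in> P" "a \<in> K'" for K'
        using disjointD[OF partition_onD2[OF P] that(1) K(1)] that K by auto
      ultimately show ?thesis by blast
    qed
    show 1: "blk P \<in> P \<and> a \<in> blk P" unfolding blk_def by (rule theI'[OF ex])
    show "K = blk P" if "K \<in> P" "a \<in> K" for K using ex 1 that by auto
  qed
  have "(\<Sum>P | partition_on (insert a A) P \<and> card P = Suc j. \<Prod>K\<in>P. m K)
      = (\<Sum>(T, Q)\<in>S. m (insert a T) * (\<Prod>K\<in>Q. m K))"
  proof (rule sum.reindex_bij_witness[where i = "\<lambda>(T, Q). insert (insert a T) Q" and j = "\<lambda>P. (blk P - {a}, P - {blk P})"])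
    fix P assume "P \<in> {P. partition_on (insert a A) P \<and> card P = Suc j}"
    then have P: "partition_on (insert a A) P" "card P = Suc j" by auto
    have finP: "finite P" using P(2) by (metis card.infinite nat.distinct(1))
    have b: "blk P \<in> P" "a \<in> blk P" using blk(1)[OF P(1)] by auto
    show "(case (blk P - {a}, P - {blk P}) of (T, Q) \<Rightarrow> insert (insert a T) Q) = P"
      using b by (simp add: insert_absorb)
    have sub: "blk P \<subseteq> insert a A" using partition_onD1[OF P(1)] b by blast
    have "\<Union>(P - {blk P}) = insert a A - blk P"
    proof -
      have "K \<inter> blk P = {}" if "K \<in> P - {blk P}" for K
        using disjointD[OF partition_onD2[OF P(1)], of K "blk P"] that b(1) by auto
      then show ?thesis using partition_onD1[OF P(1)] b(1) by auto
    qed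
    then have "partition_on (A - (blk P - {a})) (P - {blk P})"
      using P(1) b(2) assms(2) unfolding partition_on_def disjoint_def by auto
    then show "(blk P - {a}, P - {blk P}) \<in> S"
      using P(2) finP b sub by (auto simp: S_def)
    show "(case (blk P - {a}, P - {blk P}) of (T, Q) \<Rightarrow> m (insert a T) * (\<Prod>K\<in>Q. m K)) = (\<Prod>K\<in>P. m K)"
      using b finP by (simp add: insert_absorb prod.remove)
  next
    fix p assume "p \<in> S"
    then obtain T Q where p: "p = (T, Q)" "T \<subseteq> A" "partition_on (A - T) Q" "card Q = j"
      by (auto simp: S_def)
    have finQ: "finite Q" using finite_elements[OF _ p(3)] assms by auto
    have aQ: "a \<notin> K" "K \<inter> T = {}" if "K \<in> Q" for K using partition_onD1[OF p(3)] that assms(2) by blast+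
    have part: "partition_on (insert a A) (insert (insert a T) Q)"
    proof (rule partition_onI)
      show "\<Union>(insert (insert a T) Q) = insert a A" using partition_onD1[OF p(3)] p(2) by auto
      show "{} \<notin> insert (insert a T) Q" using partition_onD3[OF p(3)] by auto
      have "K \<inter> insert a T = {}" if "K \<in> Q" for K using aQ[OF that] by auto
      then show "disjnt K K'" if "K \<in> insert (insert a T) Q" "K' \<in> insert (insert a T) Q" "K \<noteq> K'" for K K'
        using that disjointD[OF partition_onD2[OF p(3)], of K K'] unfolding disjnt_def by (metis inf_commute insertE)
    qed
    have nin: "insert a T \<notin> Q" using aQ by blast
    have "blk (insert (insert a T) Q) = insert a T" using blk(2)[OF part, of "insert a T"] by simp
    then show "(blk (case p of (T, Q) \<Rightarrow> insert (insert a T) Q) - {a}, (case p of (T, Q) \<Rightarrow> insert (insert a T) Q) -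
        {blk (case p of (T, Q) \<Rightarrow> insert (insert a T) Q)}) = p"
      using p nin assms(2) by auto
    show "(case p of (T, Q) \<Rightarrow> insert (insert a T) Q) \<in> {P. partition_on (insert a A) P \<and> card P = Suc j}"
      using p part nin finQ by auto
  qed
  also have "\<dots> = (\<Sum>T\<in>Pow A. \<Sum>Q | partition_on (A - T) Q \<and> card Q = j. m (insert a T) * (\<Prod>K\<in>Q. m K))"
    unfolding S_def using assms(1) by (subst sum.Sigma) (auto intro!: finQ)
  finally show ?thesis by (simp add: csum_def sum_distrib_left)
qed

lemma sum_Pow_insert:
  assumes "finite A" "a \<notin> A"
  shows "(\<Sum>T\<in>Pow (insert a A). f T) = (\<Sum>T\<in>Pow A. f T) + (\<Sum>T\<in>Pow A. f (insert a T) :: real)"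
proof -
  have "Pow A \<inter> insert a ` Pow A = {}" "inj_on (insert a) (Pow A)"
    using assms(2) by (auto simp: inj_on_def)
  then show ?thesis unfolding Pow_insert using assms(1) by (simp add: sum.union_disjoint sum.reindex)
qed

section \<open>Explicit factorial cumulants of orders two to four\<close>

lemma fact_cumulant_csum:
  "fact_cumulant M N k A = (\<Sum>j=1..k. (-1) ^ (j - 1) * fact (j - 1) * csum (\<lambda>K. enn2real (fact_moment M N K A)) {1..k} j)"
  unfolding fact_cumulant_def csum_def ..

lemma fact_cumulant_2:
  "fact_cumulant M N 2 A = (let m = \<lambda>K. enn2real (fact_moment M N K A) in m {1,2} - m {1} * m {2})"
proof -
  have I: "{1..2::nat} = {1,2}" by auto
  show ?thesis
    unfolding fact_cumulant_csum I Let_def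
    by (simp add: numeral_eq_Suc csum_insert csum_empty csum_0 sum_Pow_insert)
qed

lemma fact_cumulant_3:
  "fact_cumulant M N 3 A = (let m = \<lambda>K. enn2real (fact_moment M N K A) in
     m {1,2,3} - m {1,2} * m {3} - m {1,3} * m {2} - m {1} * m {2,3} + 2 * (m {1} * m {2} * m {3}))"
proof -
  have I: "{1..3::nat} = {1,2,3}" by auto
  show ?thesis
    unfolding fact_cumulant_csum I Let_def
    by (simp add: numeral_eq_Suc csum_insert csum_empty csum_0 sum_Pow_insert insert_Diff_if
      algebra_simps)
qed

lemma fact_cumulant_4:
  "fact_cumulant M N 4 A = (let m = \<lambda>K. enn2real (fact_moment M N K A) in
     m {1,2,3,4}
     - m {1,2,3} * m {4} - m {1,2,4} * m {3} - m {1,3,4} * m {2} - m {2,3,4} * m {1}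
     - m {1,2} * m {3,4} - m {1,3} * m {2,4} - m {1,4} * m {2,3}
     + 2 * (m {1,2} * m {3} * m {4} + m {1,3} * m {2} * m {4} + m {1,4} * m {2} * m {3}
       + m {2,3} * m {1} * m {4} + m {2,4} * m {1} * m {3} + m {3,4} * m {1} * m {2})
     - 6 * (m {1} * m {2} * m {3} * m {4}))"
proof -
  have I: "{1..4::nat} = {1,2,3,4}" by auto
  show ?thesis
    unfolding fact_cumulant_csum I Let_def
    by (simp add: numeral_eq_Suc csum_insert csum_empty csum_0 sum_Pow_insert insert_Diff_if
      algebra_simps)
qed

section \<open>Moment measures\<close>

lemma lborel_affine_nn_integral:
  fixes t :: "'a::euclidean_space"
  assumes "c \<noteq> 0" and [measurable]: "f \<in> borel_measurable borel"
  shows "(\<integral>\<^sup>+x. f x \<partial>lborel) = ennreal (\<bar>c\<bar> ^ DIM('a)) * (\<integral>\<^sup>+x. f (t + c *\<^sub>R x) \<partial>lborel)"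
  by (subst lborel_affine[OF assms(1), of t])
     (simp add: nn_integral_density nn_integral_distr nn_integral_cmult)

lemma lborel_affine_integral:
  fixes t :: "'a::euclidean_space" and f :: "'a \<Rightarrow> real"
  assumes "c \<noteq> 0" and [measurable]: "f \<in> borel_measurable borel"
  shows "(LINT x|lborel. f x) = \<bar>c\<bar> ^ DIM('a) * (LINT x|lborel. f (t + c *\<^sub>R x))"
  by (subst lborel_affine[OF assms(1), of t]) (simp add: integral_density integral_distr)

section \<open>Tuples of pairwise distinct points\<close>

definition triples :: "'a set \<Rightarrow> ('a \<times> 'a \<times> 'a) set" where
  "triples S = {(x, y, z). x \<in> S \<and> y \<in> S \<and> z \<in> S \<and> x \<noteq> y \<and> x \<noteq> z \<and> y \<noteq> z}"

definition quads :: "'a set \<Rightarrow> ('a \<times> 'a \<times> 'a \<times> 'a) set" where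
  "quads S = {(x, y, z, u). x \<in> S \<and> y \<in> S \<and> z \<in> S \<and> u \<in> S \<and>
     x \<noteq> y \<and> x \<noteq> z \<and> x \<noteq> u \<and> y \<noteq> z \<and> y \<noteq> u \<and> z \<noteq> u}"

text \<open>The tuples of distinct points are the trace of a power of the set on the complement of
  the diagonals, which is open and therefore Borel.\<close>

lemma finite_process_tuples:
  fixes S :: "'w \<Rightarrow> 'a::euclidean_space set"
  assumes S: "finite_process M S"
  shows "finite_process M (\<lambda>\<omega>. distinct_pairs (S \<omega>))"
    and "finite_process M (\<lambda>\<omega>. triples (S \<omega>))"
    and "finite_process M (\<lambda>\<omega>. quads (S \<omega>))"
proof -
  note S2 = finite_process_times[OF S S]
  note S3 = finite_process_times[OF S S2]
  note S4 = finite_process_times[OF S S3]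
  have "open {p :: 'a \<times> 'a. fst p \<noteq> snd p}" by (intro open_Collect_neq continuous_intros)
  then show "finite_process M (\<lambda>\<omega>. distinct_pairs (S \<omega>))"
    by (intro finite_process_subset[OF S2, of "{p. fst p \<noteq> snd p}"]) (auto simp: distinct_pairs_def)
  have "open {p :: 'a \<times> 'a \<times> 'a. fst p \<noteq> fst (snd p) \<and> fst p \<noteq> snd (snd p) \<and> fst (snd p) \<noteq> snd (snd p)}"
    by (intro open_Collect_conj open_Collect_neq continuous_intros)
  then show "finite_process M (\<lambda>\<omega>. triples (S \<omega>))"
    by (intro finite_process_subset[OF S3, of "{p. fst p \<noteq> fst (snd p) \<and> fst p \<noteq> snd (snd p) \<and> fst (snd p) \<noteq> snd (snd p)}"])
       (auto simp: triples_def)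
  let ?D = "{p :: 'a \<times> 'a \<times> 'a \<times> 'a. fst p \<noteq> fst (snd p) \<and> fst p \<noteq> fst (snd (snd p)) \<and> fst p \<noteq> snd (snd (snd p))
      \<and> fst (snd p) \<noteq> fst (snd (snd p)) \<and> fst (snd p) \<noteq> snd (snd (snd p)) \<and> fst (snd (snd p)) \<noteq> snd (snd (snd p))}"
  have "open ?D"
    by (intro open_Collect_conj open_Collect_neq continuous_intros)
  then show "finite_process M (\<lambda>\<omega>. quads (S \<omega>))"
    by (intro finite_process_subset[OF S4, of ?D]) (auto simp: quads_def)
qed

lemma card_tuples_le:
  assumes "finite S"
  shows "card (distinct_pairs S) \<le> card S ^ 2" "card (triples S) \<le> card S ^ 3" "card (quads S) \<le> card S ^ 4"
    "finite (distinct_pairs S)" "finite (triples S)" "finite (quads S)"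
proof -
  have 2: "distinct_pairs S \<subseteq> S \<times> S" and 3: "triples S \<subseteq> S \<times> S \<times> S" and 4: "quads S \<subseteq> S \<times> S \<times> S \<times> S"
    by (auto simp: distinct_pairs_def triples_def quads_def)
  have f: "finite (S \<times> S)" "finite (S \<times> S \<times> S)" "finite (S \<times> S \<times> S \<times> S)" using assms by auto
  show "card (distinct_pairs S) \<le> card S ^ 2" "card (triples S) \<le> card S ^ 3" "card (quads S) \<le> card S ^ 4"
    using card_mono[OF f(1) 2] card_mono[OF f(2) 3] card_mono[OF f(3) 4]
    by (simp_all add: card_cartesian_product eval_nat_numeral)
  show "finite (distinct_pairs S)" "finite (triples S)" "finite (quads S)"
    using finite_subset[OF 2 f(1)] finite_subset[OF 3 f(2)] finite_subset[OF 4 f(3)] by auto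
qed

text \<open>\<open>fact_moment\<close> counts injective functions on an index set, whereas the
  measures are built on nested pairs; listing the values in a fixed order is a bijection between the
  two. The indices are arbitrary because cumulants use blocks such as {1,3}.\<close>

lemma card_injective_tuples:
  fixes i j k l :: nat
  shows "card {x \<in> Pi\<^sub>E {i} (\<lambda>i. S \<inter> A i). inj_on x {i}} = card (S \<inter> A i)"
    and "i \<noteq> j \<Longrightarrow> card {x \<in> Pi\<^sub>E {i,j} (\<lambda>i. S \<inter> A i). inj_on x {i,j}} = card (distinct_pairs S \<inter> A i \<times> A j)"
    and "distinct [i,j,k] \<Longrightarrow> card {x \<in> Pi\<^sub>E {i,j,k} (\<lambda>i. S \<inter> A i). inj_on x {i,j,k}} = card (triples S \<inter> A i \<times> A j \<times> A k)"
    and "distinct [i,j,k,l] \<Longrightarrow> card {x \<in> Pi\<^sub>E {i,j,k,l} (\<lambda>i. S \<inter> A i). inj_on x {i,j,k,l}} = card (quads S \<inter> A i \<times> A j \<times> A k \<times> A l)"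
proof -
  show "card {x \<in> Pi\<^sub>E {i} (\<lambda>i. S \<inter> A i). inj_on x {i}} = card (S \<inter> A i)"
    by (rule bij_betw_same_card[of "\<lambda>x. x i"], rule bij_betw_byWitness[where f' = "\<lambda>a. (\<lambda>_. undefined)(i := a)"])
       (auto simp: PiE_def extensional_def fun_eq_iff)
  show "card {x \<in> Pi\<^sub>E {i,j} (\<lambda>i. S \<inter> A i). inj_on x {i,j}} = card (distinct_pairs S \<inter> A i \<times> A j)" if "i \<noteq> j"
    using that
    by (intro bij_betw_same_card[of "\<lambda>x. (x i, x j)"] bij_betw_byWitness[where f' = "\<lambda>(a, b). (\<lambda>_. undefined)(i := a, j := b)"])
       (auto simp: PiE_def extensional_def fun_eq_iff distinct_pairs_def)
  show "card {x \<in> Pi\<^sub>E {i,j,k} (\<lambda>i. S \<inter> A i). inj_on x {i,j,k}} = card (triples S \<inter> A i \<times> A j \<times> A k)" if "distinct [i,j,k]"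
    using that
    by (intro bij_betw_same_card[of "\<lambda>x. (x i, x j, x k)"] bij_betw_byWitness[where f' = "\<lambda>(a, b, c). (\<lambda>_. undefined)(i := a, j := b, k := c)"])
       (auto simp: PiE_def extensional_def fun_eq_iff triples_def)
  show "card {x \<in> Pi\<^sub>E {i,j,k,l} (\<lambda>i. S \<inter> A i). inj_on x {i,j,k,l}} = card (quads S \<inter> A i \<times> A j \<times> A k \<times> A l)" if "distinct [i,j,k,l]"
    using that
    by (intro bij_betw_same_card[of "\<lambda>x. (x i, x j, x k, x l)"] bij_betw_byWitness[where f' = "\<lambda>(a, b, c, d). (\<lambda>_. undefined)(i := a, j := b, k := c, l := d)"])
       (auto simp: PiE_def extensional_def fun_eq_iff quads_def)
qed

lemma finite_injective_tuples:
  assumes "finite I" "finite S"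
  shows "finite {x \<in> Pi\<^sub>E I (\<lambda>i. S \<inter> A i). inj_on x I}"
  by (rule finite_subset[OF _ finite_PiE[of I "\<lambda>_. S"]]) (use assms in \<open>auto simp: PiE_def\<close>)

text \<open>Shift invariance concerns factorial moments, so the power has to be controlled by
  n(n-1)(n-2)(n-3). For n \<le> 4 the constant 256 = 4^4 suffices; for larger n the factors are at
  least n, 3n/4, n/2 and n/4, with product 3n^4/32.\<close>

lemma power4_le_quads:
  assumes "finite S"
  shows "real (card S) ^ 4 \<le> 256 + 32 / 3 * real (card (quads S))"
proof -
  have "card {x \<in> {1,2,3,4::nat} \<rightarrow>\<^sub>E S. inj_on x {1,2,3,4}} = card (quads S)"
    using card_injective_tuples(4)[of 1 2 3 4 S "\<lambda>_. UNIV"] by (simp del: inj_on_insert)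
  moreover have "card {f \<in> {1,2,3,4::nat} \<rightarrow>\<^sub>E S. inj_on f {1,2,3,4}} = prod ((-) (card S)) {0..<4}"
    proof -
    have "card {1,2,3,4::nat} = 4" by simp
    then show ?thesis
      using card_inj_on_subset_funcset[of "{1,2,3,4::nat}" S "{1,2,3,4}"] assms
      by (simp only: finite.intros subset_refl diff_self_eq_0 power_0 mult_1)
  qed
  moreover have "prod ((-) (card S)) {0..<4} = card S * (card S - 1) * (card S - 2) * (card S - 3)"
    by (simp add: numeral_eq_Suc)
  ultimately have q: "card (quads S) = card S * (card S - 1) * (card S - 2) * (card S - 3)"
    by simp
  define n where "n = card S"
  show ?thesis
  proof (cases "n \<le> 4")
    case True
    then have "real n ^ 4 \<le> 4 ^ 4" by (intro power_mono) auto
    then show ?thesis by (simp add: n_def)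
  next
    case False
    define x where "x = real n"
    have x: "x \<ge> 4" using False by (simp add: x_def)
    have "real (card (quads S)) = x * (x - 1) * (x - 2) * (x - 3)"
      using False unfolding q n_def[symmetric] x_def by (simp add: of_nat_diff)
    moreover have "x * (3/4 * x) * (1/2 * x) * (1/4 * x) \<le> x * (x - 1) * (x - 2) * (x - 3)"
      using x by (intro mult_mono) auto
    ultimately have "32/3 * (x * (3/4 * x) * (1/2 * x) * (1/4 * x)) \<le> 32 / 3 * real (card (quads S))" by simp
    then show ?thesis by (simp add: n_def[symmetric] x_def power4_eq_xxxx field_simps)
  qed
qed

section \<open>Configurations in bounded sets, and fourth moments\<close>

lemma space_config_algebra: "space config_algebra = configs"
  unfolding config_algebra_def by (intro space_measure_of) auto

text \<open>Stated on the space of configurations itself: composed with N it gives the process in a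
  window, and used directly it gives measurability of the estimators as functions of a
  configuration, which is what an argument by equality in law requires.\<close>

lemma finite_process_config:
  fixes K :: "'a::euclidean_space set"
  assumes K: "K \<in> sets borel" "bounded K"
  shows "finite_process config_algebra (\<lambda>S. S \<inter> K)"
  unfolding finite_process_def
proof (intro conjI ballI)
  fix S :: "'a set" assume "S \<in> space config_algebra"
  then have S: "\<And>r. finite (S \<inter> cball 0 r)" by (simp add: space_config_algebra configs_def)
  from K(2) obtain r where "K \<subseteq> cball 0 r" by (auto simp: bounded_iff subset_eq)
  then show "finite (S \<inter> K)" by (intro finite_subset[OF _ S[of r]]) auto
next
  fix A :: "'a set" assume A: "A \<in> sets borel"
  have "(\<lambda>S. card (S \<inter> (K \<inter> A))) \<in> config_algebra \<rightarrow>\<^sub>M count_space (UNIV :: nat set)"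
  proof (subst measurable_count_space_eq2_countable, intro conjI ballI)
    fix m :: nat
    have "(\<lambda>S. card (S \<inter> (K \<inter> A))) -` {m} \<inter> space config_algebra = {S \<in> configs. card (S \<inter> (K \<inter> A)) = m}"
      by (auto simp: space_config_algebra)
    also have "\<dots> \<in> sets config_algebra"
      unfolding config_algebra_def using A K
      by (subst sets_measure_of) (auto intro!: sigma_sets.Basic exI[of _ "K \<inter> A"] bounded_subset[OF K(2)])
    finally show "(\<lambda>S. card (S \<inter> (K \<inter> A))) -` {m} \<inter> space config_algebra \<in> sets config_algebra" .
  qed auto
  then have "(\<lambda>S. real (card (S \<inter> (K \<inter> A)))) \<in> borel_measurable config_algebra"
    by (rule measurable_compose) simp
  then show "(\<lambda>S. real (card (S \<inter> K \<inter> A))) \<in> borel_measurable config_algebra" by (simp add: Int_assoc)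
qed

lemma unit_cube_facts:
  shows "(unit_cube :: 'a::euclidean_space set) \<in> sets borel" "bounded (unit_cube :: 'a set)"
    "emeasure lborel (unit_cube :: 'a set) = 1" "box 0 One \<subseteq> (unit_cube :: 'a set)"
proof -
  have sub: "box 0 One \<subseteq> (unit_cube :: 'a set)" "(unit_cube :: 'a set) \<subseteq> cbox 0 One"
    by (auto simp: unit_cube_def box_def cbox_def inner_sum_left_Basis less_imp_le)
  have "(unit_cube :: 'a set) = (\<Inter>e\<in>Basis. {x. 0 \<le> x \<bullet> e} \<inter> {x. x \<bullet> e < 1})"
    by (auto simp: unit_cube_def)
  also have "\<dots> \<in> sets borel"
    by (intro sets.finite_INT) auto
  finally show m: "(unit_cube :: 'a set) \<in> sets borel" .
  show "bounded (unit_cube :: 'a set)" using bounded_subset[OF bounded_cbox sub(2)] .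
  show "box 0 One \<subseteq> (unit_cube :: 'a set)" by fact
  have "emeasure lborel (box 0 One :: 'a set) = 1" "emeasure lborel (cbox 0 One :: 'a set) = 1"
    by (simp_all add: emeasure_lborel_box_eq emeasure_lborel_cbox_eq inner_sum_left_Basis)
  note 1 = this
  have "emeasure lborel (box 0 One :: 'a set) \<le> emeasure lborel (unit_cube :: 'a set)"
    "emeasure lborel (unit_cube :: 'a set) \<le> emeasure lborel (cbox 0 One :: 'a set)"
    using sub m by (intro emeasure_mono; simp)+
  then show "emeasure lborel (unit_cube :: 'a set) = 1" unfolding 1 by (rule antisym[rotated])
qed

text \<open>Open cubes supply the finite subcover; the half-open ones, which carry the moment
  assumption, contain them.\<close>

lemma bounded_finite_cube_cover:
  fixes K :: "'a::euclidean_space set"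
  assumes "bounded K"
  obtains F where "finite F" "K \<subseteq> (\<Union>x\<in>F. (\<lambda>y. y + x) ` unit_cube)"
proof -
  obtain r where r: "K \<subseteq> cball 0 r" using assms by (auto simp: bounded_iff subset_eq)
  define c where "c = (1/2) *\<^sub>R (One :: 'a)"
  have c: "c \<in> box 0 One" by (auto simp: c_def box_def inner_sum_left_Basis)
  have "\<forall>B\<in>(\<lambda>x. (\<lambda>y. y + x) ` (box 0 One)) ` (UNIV :: 'a set). open B"
    by (auto simp: add.commute intro!: open_translation)
  moreover have "cball 0 r \<subseteq> (\<Union>x. (\<lambda>y. y + x) ` (box 0 One :: 'a set))"
  proof
    fix z :: 'a
    have "z \<in> (\<lambda>y. y + (z - c)) ` (box 0 One)" using c by (intro image_eqI[of _ _ c]) auto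
    then show "z \<in> (\<Union>x. (\<lambda>y. y + x) ` (box 0 One :: 'a set))" by blast
  qed
  ultimately obtain F where F: "finite F" "cball 0 r \<subseteq> (\<Union>x\<in>F. (\<lambda>y. y + x) ` (box 0 One :: 'a set))"
    using compactE_image[OF compact_cball, of UNIV "\<lambda>x. (\<lambda>y. y + x) ` (box 0 One)" 0 r] by auto
  have "K \<subseteq> (\<Union>x\<in>F. (\<lambda>y. y + x) ` unit_cube)"
    using r F(2) unit_cube_facts(4) by blast
  with F(1) show ?thesis using that by blast
qed

text \<open>Each summand is at most the largest one, whose fourth power occurs on the right.\<close>

lemma sum_power4_le:
  fixes a :: "'i \<Rightarrow> real"
  assumes F: "finite F" and a: "\<And>i. i \<in> F \<Longrightarrow> 0 \<le> a i"
  shows "(\<Sum>i\<in>F. a i) ^ 4 \<le> real (card F) ^ 4 * (\<Sum>i\<in>F. a i ^ 4)"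
proof (cases "F = {}")
  case False
  then have "Max (a ` F) \<in> a ` F" using F by (intro Max_in) auto
  then obtain j where "j \<in> F" "Max (a ` F) = a j" by auto
  moreover have "a i \<le> Max (a ` F)" if "i \<in> F" for i using that F by (intro Max_ge) auto
  ultimately have j: "j \<in> F" "\<And>i. i \<in> F \<Longrightarrow> a i \<le> a j" by auto
  have "(\<Sum>i\<in>F. a i) \<le> real (card F) * a j" using j(2) sum_bounded_above[of F a "a j"] by simp
  then have "(\<Sum>i\<in>F. a i) ^ 4 \<le> (real (card F) * a j) ^ 4" by (intro power_mono sum_nonneg a) auto
  also have "\<dots> \<le> real (card F) ^ 4 * (\<Sum>i\<in>F. a i ^ 4)"
    unfolding power_mult_distrib using j(1) F a by (intro mult_left_mono member_le_sum) auto
  finally show ?thesis .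
qed simp

locale mixing_process =
  fixes M :: "'w measure" and N :: "'w \<Rightarrow> 'a::euclidean_space set"
  assumes pp: "point_process M N" and B4: "B4_mixing M N"
begin

abbreviation "lam \<equiv> intensity M N"

lemma prob_space_M: "prob_space M" using pp by (simp add: point_process_def)

sublocale prob_space M by (rule prob_space_M)

lemma lam_pos: "0 < lam" using pp by (simp add: point_process_def)

lemma finite_process_N:
  assumes "K \<in> sets borel" "bounded K"
  shows "finite_process M (\<lambda>\<omega>. N \<omega> \<inter> K)"
  using pp by (intro finite_process_compose[OF finite_process_config[OF assms], of N]) (simp add: point_process_def)

text \<open>Only points of the bounded set K can occur in the tuples, so the counting measure of the
  set of tuples becomes a finite cardinality and the results on finite processes apply.\<close>

lemma fact_moment_eq:
  fixes A :: "nat \<Rightarrow> 'a set"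
  assumes "K \<in> sets borel" "bounded K" "finite I" "\<And>i. i \<in> I \<Longrightarrow> A i \<subseteq> K"
  shows "fact_moment M N I A = (\<integral>\<^sup>+\<omega>. ennreal (real (card {x \<in> Pi\<^sub>E I (\<lambda>i. (N \<omega> \<inter> K) \<inter> A i). inj_on x I})) \<partial>M)"
  unfolding fact_moment_def
proof (rule nn_integral_cong)
  fix \<omega> assume "\<omega> \<in> space M"
  then have "finite (N \<omega> \<inter> K)" by (rule finite_processD(1)[OF finite_process_N[OF assms(1,2)]])
  moreover have "Pi\<^sub>E I (\<lambda>i. N \<omega> \<inter> A i) = Pi\<^sub>E I (\<lambda>i. (N \<omega> \<inter> K) \<inter> A i)"
    using assms(4) by (intro PiE_cong) auto
  ultimately show "emeasure (count_space UNIV) {x \<in> Pi\<^sub>E I (\<lambda>i. N \<omega> \<inter> A i). inj_on x I} =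
      ennreal (real (card {x \<in> Pi\<^sub>E I (\<lambda>i. (N \<omega> \<inter> K) \<inter> A i). inj_on x I}))"
    using finite_injective_tuples[OF assms(3), of "N \<omega> \<inter> K" A]
    by (simp add: emeasure_count_space_finite ennreal_of_nat_eq_real_of_nat)
qed

lemma stationary: "stationary_of_order 4 M N" using B4 by (simp add: B4_mixing_def)

lemma translate_borel:
  "A \<in> sets borel \<Longrightarrow> (\<lambda>y. y + x) ` A \<in> sets borel" for A :: "'a set" and x
proof -
  assume A: "A \<in> sets borel"
  have "(\<lambda>y. y + x) ` A = (\<lambda>y. y - x) -` A \<inter> space borel" by force
  then show ?thesis using A measurable_sets[of "\<lambda>y. y - x" borel borel A] by simp
qed

lemma translate_bounded: "bounded A \<Longrightarrow> bounded ((\<lambda>y. y + x) ` A)" for A :: "'a set" and x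
  using bounded_translation[of A x] by (simp add: add.commute)

text \<open>The moment assumption is about the cube at the origin and the invariance is about
  factorial moments: pass from the fourth power to \<open>quads\<close>, shift, and bound the result
  by the fourth power at the origin.\<close>

lemma integrable_card_cube: "(\<integral>\<^sup>+\<omega>. ennreal (real (card (N \<omega> \<inter> (\<lambda>y. y + x) ` unit_cube)) ^ 4) \<partial>M) < \<infinity>"
proof -
  note c = unit_cube_facts[where 'a='a]
  let ?Q = "(\<lambda>y. y + x) ` (unit_cube :: 'a set)"
  have I: "{1..4::nat} = {1,2,3,4}" by auto
  have fm: "fact_moment M N {1..4} (\<lambda>_. K) = (\<integral>\<^sup>+\<omega>. ennreal (real (card (quads (N \<omega> \<inter> K)))) \<partial>M)"
    if "K \<in> sets borel" "bounded K" for K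
    unfolding I
  proof -
    have q: "card (quads S \<inter> K \<times> K \<times> K \<times> K) = card (quads S)" if "S \<subseteq> K" for S
      using that by (intro arg_cong[where f = card]) (auto simp: quads_def)
    have d: "distinct [1, 2, 3, 4 :: nat]" by simp
    have "fact_moment M N {1,2,3,4} (\<lambda>_. K) = (\<integral>\<^sup>+\<omega>. ennreal (real (card (quads (N \<omega> \<inter> K) \<inter> K \<times> K \<times> K \<times> K))) \<partial>M)"
      by (subst fact_moment_eq[OF that]) (simp_all only: card_injective_tuples(4)[OF d] finite.intros order_refl)
    then show "fact_moment M N {1,2,3,4} (\<lambda>_. K) = (\<integral>\<^sup>+\<omega>. ennreal (real (card (quads (N \<omega> \<inter> K)))) \<partial>M)"
      by (simp add: q)
  qed
  note fpQ = finite_process_N[OF translate_borel[OF c(1)] translate_bounded[OF c(2)], of x]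
  note fpC = finite_process_N[OF c(1,2)]
  have [measurable]: "(\<lambda>\<omega>. real (card (quads (N \<omega> \<inter> ?Q)))) \<in> borel_measurable M"
    using finite_processD(2)[OF finite_process_tuples(3)[OF fpQ] space_in_borel] by simp
  have "(\<integral>\<^sup>+\<omega>. ennreal (real (card (N \<omega> \<inter> ?Q)) ^ 4) \<partial>M) \<le> (\<integral>\<^sup>+\<omega>. ennreal (256 + 32/3 * real (card (quads (N \<omega> \<inter> ?Q)))) \<partial>M)"
    using power4_le_quads[OF finite_processD(1)[OF fpQ]] by (intro nn_integral_mono ennreal_leI)
  also have "\<dots> = (\<integral>\<^sup>+\<omega>. 256 + ennreal (32/3) * ennreal (real (card (quads (N \<omega> \<inter> ?Q)))) \<partial>M)"
    by (intro nn_integral_cong, subst ennreal_plus) (simp_all add: ennreal_mult[symmetric])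
  also have "\<dots> = 256 + ennreal (32/3) * (\<integral>\<^sup>+\<omega>. ennreal (real (card (quads (N \<omega> \<inter> ?Q)))) \<partial>M)"
    by (simp add: nn_integral_add nn_integral_cmult emeasure_space_1)
  also have "(\<integral>\<^sup>+\<omega>. ennreal (real (card (quads (N \<omega> \<inter> ?Q)))) \<partial>M) = fact_moment M N {1..4} (\<lambda>_. ?Q)"
    by (rule fm[symmetric]) (intro translate_borel translate_bounded c)+
  also have "\<dots> = fact_moment M N {1..4} (\<lambda>_. unit_cube)"
    using stationary c(1) unfolding stationary_of_order_def by auto
  also have "\<dots> = (\<integral>\<^sup>+\<omega>. ennreal (real (card (quads (N \<omega> \<inter> unit_cube)))) \<partial>M)" by (rule fm) (use c in auto)
  also have "256 + ennreal (32/3) * \<dots> < \<infinity>"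
  proof -
    have "(\<integral>\<^sup>+\<omega>. ennreal (real (card (quads (N \<omega> \<inter> unit_cube)))) \<partial>M) \<le> (\<integral>\<^sup>+\<omega>. of_nat (card (N \<omega> \<inter> unit_cube)) ^ 4 \<partial>M)"
      using card_tuples_le(3)[OF finite_processD(1)[OF fpC]]
      by (intro nn_integral_mono) (simp add: ennreal_of_nat_eq_real_of_nat ennreal_power of_nat_power[symmetric] del: of_nat_power)
    also have "\<dots> < \<infinity>" using stationary by (simp add: stationary_of_order_def)
    finally show ?thesis by (simp add: ennreal_mult_less_top)
  qed
  finally show ?thesis .
qed

lemma integrable_card4:
  assumes K: "K \<in> sets borel" "bounded K"
  shows "integrable M (\<lambda>\<omega>. real (card (N \<omega> \<inter> K)) ^ 4)"
proof (rule integrableI_bounded)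
  note c = unit_cube_facts[where 'a='a]
  note fp = finite_process_N[OF K]
  have [measurable]: "(\<lambda>\<omega>. real (card (N \<omega> \<inter> K))) \<in> borel_measurable M"
    using finite_processD(2)[OF fp space_in_borel] by simp
  show "(\<lambda>\<omega>. real (card (N \<omega> \<inter> K)) ^ 4) \<in> borel_measurable M" by measurable
  obtain F where F: "finite F" "K \<subseteq> (\<Union>x\<in>F. (\<lambda>y. y + x) ` unit_cube)"
    using bounded_finite_cube_cover[OF K(2)] by blast
  let ?Q = "\<lambda>x. (\<lambda>y. y + x) ` (unit_cube :: 'a set)"
  note fpQ = finite_process_N[OF translate_borel[OF c(1)] translate_bounded[OF c(2)]]
  have [measurable]: "(\<lambda>\<omega>. real (card (N \<omega> \<inter> ?Q x))) \<in> borel_measurable M" for x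
    using finite_processD(2)[OF fpQ[of x] space_in_borel] by simp
  have "real (card (N \<omega> \<inter> K)) ^ 4 \<le> real (card F) ^ 4 * (\<Sum>x\<in>F. real (card (N \<omega> \<inter> ?Q x)) ^ 4)" if "\<omega> \<in> space M" for \<omega>
  proof -
    have "card (N \<omega> \<inter> K) \<le> card (\<Union>x\<in>F. N \<omega> \<inter> ?Q x)"
      using F finite_processD(1)[OF fpQ that] by (intro card_mono finite_UN_I) auto
    also have "\<dots> \<le> (\<Sum>x\<in>F. card (N \<omega> \<inter> ?Q x))" using F(1) by (rule card_UN_le)
    finally have "real (card (N \<omega> \<inter> K)) \<le> (\<Sum>x\<in>F. real (card (N \<omega> \<inter> ?Q x)))" by (metis of_nat_le_iff of_nat_sum)
    then have "real (card (N \<omega> \<inter> K)) ^ 4 \<le> (\<Sum>x\<in>F. real (card (N \<omega> \<inter> ?Q x))) ^ 4" by (intro power_mono) auto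
    also have "\<dots> \<le> real (card F) ^ 4 * (\<Sum>x\<in>F. real (card (N \<omega> \<inter> ?Q x)) ^ 4)" by (rule sum_power4_le[OF F(1)]) simp
    finally show ?thesis .
  qed
  then have "(\<integral>\<^sup>+\<omega>. ennreal (norm (real (card (N \<omega> \<inter> K)) ^ 4)) \<partial>M)
      \<le> (\<integral>\<^sup>+\<omega>. ennreal (real (card F) ^ 4) * (\<Sum>x\<in>F. ennreal (real (card (N \<omega> \<inter> ?Q x)) ^ 4)) \<partial>M)"
    by (intro nn_integral_mono) (simp add: ennreal_mult[symmetric] sum_nonneg)
  also have "\<dots> = ennreal (real (card F) ^ 4) * (\<Sum>x\<in>F. \<integral>\<^sup>+\<omega>. ennreal (real (card (N \<omega> \<inter> ?Q x)) ^ 4) \<partial>M)"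
    by (subst nn_integral_cmult) (auto simp: nn_integral_sum simp del: sum_ennreal)
  also have "\<dots> < \<infinity>"
    using integrable_card_cube by (auto simp: ennreal_mult_less_top F(1))
  finally show "(\<integral>\<^sup>+\<omega>. ennreal (norm (real (card (N \<omega> \<inter> K)) ^ 4)) \<partial>M) < \<infinity>" .
qed

lemma integrable_tuples:
  assumes K: "K \<in> sets borel" "bounded K"
  shows "integrable M (\<lambda>\<omega>. real (card (N \<omega> \<inter> K)))"
    and "integrable M (\<lambda>\<omega>. real (card (distinct_pairs (N \<omega> \<inter> K))))"
    and "integrable M (\<lambda>\<omega>. real (card (triples (N \<omega> \<inter> K))))"
    and "integrable M (\<lambda>\<omega>. real (card (quads (N \<omega> \<inter> K))))"
proof -
  note fp = finite_process_N[OF K]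
  note fpt = finite_process_tuples[OF fp]
  have le: "real n ^ j \<le> real n ^ 4" if "j \<in> {1,2,3,4}" for n j :: nat
    using that by (cases "n = 0") (auto intro!: power_increasing)
  have int: "integrable M (\<lambda>\<omega>. real (X \<omega>))"
    if "(\<lambda>\<omega>. real (X \<omega>)) \<in> borel_measurable M" "\<And>\<omega>. \<omega> \<in> space M \<Longrightarrow> X \<omega> \<le> card (N \<omega> \<inter> K) ^ j" "j \<in> {1,2,3,4}" for X :: "'w \<Rightarrow> nat" and j
  proof (rule Bochner_Integration.integrable_bound[OF integrable_card4[OF K] that(1)], rule AE_I2)
    fix \<omega> assume "\<omega> \<in> space M"
    then have "real (X \<omega>) \<le> real (card (N \<omega> \<inter> K)) ^ j" using that(2) by (metis of_nat_le_iff of_nat_power)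
    also have "\<dots> \<le> real (card (N \<omega> \<inter> K)) ^ 4" by (rule le[OF that(3)])
    finally show "norm (real (X \<omega>)) \<le> norm (real (card (N \<omega> \<inter> K)) ^ 4)" by simp
  qed
  show "integrable M (\<lambda>\<omega>. real (card (N \<omega> \<inter> K)))"
    using finite_processD(2)[OF fp space_in_borel] by (intro int[of _ 1]) auto
  show "integrable M (\<lambda>\<omega>. real (card (distinct_pairs (N \<omega> \<inter> K))))"
    using finite_processD(2)[OF fpt(1) space_in_borel] card_tuples_le(1) finite_processD(1)[OF fp] by (intro int[of _ 2]) auto
  show "integrable M (\<lambda>\<omega>. real (card (triples (N \<omega> \<inter> K))))"
    using finite_processD(2)[OF fpt(2) space_in_borel] card_tuples_le(2) finite_processD(1)[OF fp] by (intro int[of _ 3]) auto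
  show "integrable M (\<lambda>\<omega>. real (card (quads (N \<omega> \<inter> K))))"
    using finite_processD(2)[OF fpt(3) space_in_borel] card_tuples_le(3) finite_processD(1)[OF fp] by (intro int[of _ 4]) auto
qed

text \<open>Uniqueness of Haar measure: integrate \<open>1\<^sub>A(x) 1\<^sub>Q(x - y)\<close> for the unit cube \<open>Q\<close>
  against \<open>\<mu>(dx) dy\<close> in both orders.\<close>

lemma mean_count:
  assumes A: "A \<in> sets borel" "bounded A"
  shows "(\<integral>\<^sup>+\<omega>. ennreal (real (card (N \<omega> \<inter> A))) \<partial>M) = ennreal lam * emeasure lborel A"
proof -
  note c = unit_cube_facts[where 'a='a]
  define Q where "Q = (unit_cube :: 'a set)"
  define \<nu> where "\<nu> A = (\<integral>\<^sup>+\<omega>. ennreal (real (card (N \<omega> \<inter> A))) \<partial>M)" for A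
  have \<nu>: "\<nu> A = fact_moment M N {1..1} (\<lambda>_. A)" if "A \<in> sets borel" "bounded A" for A
  proof -
    have I: "{1..1::nat} = {1}" by auto
    have "fact_moment M N {1} (\<lambda>_. A) = (\<integral>\<^sup>+\<omega>. ennreal (real (card ((N \<omega> \<inter> A) \<inter> A))) \<partial>M)"
      by (subst fact_moment_eq[OF that]) (simp_all only: card_injective_tuples(1) finite.intros order_refl)
    then show ?thesis by (simp only: I \<nu>_def Int_assoc Int_absorb)
  qed
  have shift: "\<nu> ((\<lambda>y. y + x) ` A) = \<nu> A" if A: "A \<in> sets borel" "bounded A" for A x
    using stationary[unfolded stationary_of_order_def, THEN conjunct2, rule_format, of 1 "\<lambda>_. A" x]
      A translate_borel[OF A(1), of x] translate_bounded[OF A(2), of x] by (simp add: \<nu>)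
  have Q: "Q \<in> sets borel" "bounded Q" using c by (auto simp: Q_def)
  \<comment> \<open>One bounded set containing both A and Q, so that the same finite measure m
    serves in both orders of integration.\<close>
  define K where "K = A \<union> Q"
  have K: "K \<in> sets borel" "bounded K" using A Q by (auto simp: K_def)
  define m where "m = mean_measure M (\<lambda>\<omega>. N \<omega> \<inter> K)"
  interpret m: finite_measure m
    unfolding m_def by (rule finite_measure_mean_measure[OF finite_process_N[OF K] integrable_tuples(1)[OF K]])
  have [measurable_cong]: "sets m = sets borel" by (simp add: m_def)
  have m: "emeasure m B = \<nu> (K \<inter> B)" if "B \<in> sets borel" for B
    unfolding m_def using emeasure_mean_measure[OF finite_process_N[OF K] that] by (simp add: \<nu>_def Int_assoc)
  interpret P: pair_sigma_finite m lborel ..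
  note [measurable] = A(1) Q(1)
  have "\<nu> A * emeasure lborel Q = (\<integral>\<^sup>+x. indicator A x * emeasure lborel Q \<partial>m)"
    using A m[of A] by (simp add: nn_integral_multc K_def Int_absorb1 Int_commute)
  also have "\<dots> = (\<integral>\<^sup>+x. (\<integral>\<^sup>+y. indicator A x * indicator Q (x - y) \<partial>lborel) \<partial>m)"
  proof (rule nn_integral_cong)
    fix x
    have "emeasure lborel Q = (\<integral>\<^sup>+y. indicator Q y \<partial>lborel)" by simp
    also have "\<dots> = (\<integral>\<^sup>+y. indicator Q (x - y) \<partial>lborel)"
      using lborel_affine_nn_integral[of "-1" "indicator Q" x] by simp
    finally show "indicator A x * emeasure lborel Q = (\<integral>\<^sup>+y. indicator A x * indicator Q (x - y) \<partial>lborel)"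
      by (subst nn_integral_cmult) auto
  qed
  also have "\<dots> = (\<integral>\<^sup>+y. (\<integral>\<^sup>+x. indicator A x * indicator Q (x - y) \<partial>m) \<partial>lborel)"
    by (rule P.Fubini'[symmetric]) measurable
  also have "\<dots> = (\<integral>\<^sup>+y. (\<integral>\<^sup>+x. indicator A (x + y) * indicator Q x \<partial>m) \<partial>lborel)"
  proof (rule nn_integral_cong)
    fix y
    define B where "B = {x. x + y \<in> A \<and> x \<in> Q}"
    have [measurable]: "B \<in> sets borel" unfolding B_def by measurable
    have Bb: "bounded B" by (rule bounded_subset[OF Q(2)]) (auto simp: B_def)
    have img: "{x. x \<in> A \<and> x - y \<in> Q} = (\<lambda>z. z + y) ` B" by (force simp: B_def)
    have "(\<integral>\<^sup>+x. indicator A x * indicator Q (x - y) \<partial>m) = (\<integral>\<^sup>+x. indicator {x. x \<in> A \<and> x - y \<in> Q} x \<partial>m)"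
      by (intro nn_integral_cong) (auto simp: indicator_def)
    also have "\<dots> = emeasure m {x. x \<in> A \<and> x - y \<in> Q}" by (rule nn_integral_indicator) measurable
    also have "\<dots> = \<nu> ((\<lambda>z. z + y) ` B)"
      by (subst m) (auto simp: img[symmetric] K_def intro!: arg_cong[where f = \<nu>])
    also have "\<dots> = \<nu> B" by (rule shift) (use Bb in auto)
    also have "\<dots> = emeasure m B" by (subst m) (auto simp: K_def B_def intro!: arg_cong[where f = \<nu>])
    also have "\<dots> = (\<integral>\<^sup>+x. indicator B x \<partial>m)" by (rule nn_integral_indicator[symmetric]) measurable
    also have "\<dots> = (\<integral>\<^sup>+x. indicator A (x + y) * indicator Q x \<partial>m)"
      by (intro nn_integral_cong) (auto simp: indicator_def B_def)
    finally show "(\<integral>\<^sup>+x. indicator A x * indicator Q (x - y) \<partial>m) = (\<integral>\<^sup>+x. indicator A (x + y) * indicator Q x \<partial>m)" .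
  qed
  also have "\<dots> = (\<integral>\<^sup>+x. (\<integral>\<^sup>+y. indicator A (x + y) * indicator Q x \<partial>lborel) \<partial>m)"
    by (rule P.Fubini') measurable
  also have "\<dots> = (\<integral>\<^sup>+x. emeasure lborel A * indicator Q x \<partial>m)"
  proof (rule nn_integral_cong)
    fix x
    have "emeasure lborel A = (\<integral>\<^sup>+y. indicator A y \<partial>lborel)" by simp
    also have "\<dots> = (\<integral>\<^sup>+y. indicator A (x + y) \<partial>lborel)"
      using lborel_affine_nn_integral[of "1" "indicator A" x] by simp
    finally show "(\<integral>\<^sup>+y. indicator A (x + y) * indicator Q x \<partial>lborel) = emeasure lborel A * indicator Q x"
      by (subst nn_integral_multc) auto
  qed
  also have "\<dots> = emeasure lborel A * \<nu> Q"
    using m[OF Q(1)] by (simp add: nn_integral_cmult K_def Int_absorb1 Int_commute)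
  finally have "\<nu> A = emeasure lborel A * \<nu> Q" using c(3) by (simp add: Q_def)
  moreover have "\<nu> Q = ennreal lam"
    unfolding \<nu>_def intensity_def Q_def
    by (rule nn_integral_eq_integral[OF integrable_tuples(1)]) (use c in auto)
  ultimately show ?thesis by (simp add: \<nu>_def mult.commute)
qed

end

section \<open>Cumulant functionals in a window\<close>

lemma borel_measurable_fst_raw [measurable (raw)]:
  fixes f :: "'m \<Rightarrow> 'b::second_countable_topology \<times> 'c::second_countable_topology"
  assumes "f \<in> M \<rightarrow>\<^sub>M borel"
  shows "(\<lambda>x. fst (f x)) \<in> M \<rightarrow>\<^sub>M borel" "(\<lambda>x. snd (f x)) \<in> M \<rightarrow>\<^sub>M borel"
  using assms by (auto intro!: measurable_compose[OF assms] borel_measurable_continuous_onI continuous_intros)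

text \<open>The integrand is only required to agree pointwise with the indicator of a rectangle,
  because in the cumulant terms the coordinates appear permuted and regrouped by blocks.\<close>

lemma integral_rectangle:
  fixes m :: "'b::second_countable_topology measure" and m' :: "'c::second_countable_topology measure"
  assumes "finite_measure m" "finite_measure m'" "sets m = sets borel" "sets m' = sets borel"
    and "X \<in> sets borel" "Y \<in> sets borel"
    and g: "\<And>p. g p = indicat_real (X \<times> Y) p"
  shows "(LINT p|(m \<Otimes>\<^sub>M m'). g p) = measure m X * measure m' Y"
proof -
  interpret m: finite_measure m by fact
  interpret m': finite_measure m' by fact
  have "measure (m \<Otimes>\<^sub>M m') (X \<times> Y) = measure m X * measure m' Y"
    using assms by (simp add: measure_def m'.emeasure_pair_measure_Times enn2real_mult)
  then show ?thesis
    using assms sets_pair_measure_cong[OF assms(3,4)] by (simp add: g[abs_def])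
qed

lemma measure_times_borel:
  fixes m :: "'b::second_countable_topology measure" and m' :: "'c::second_countable_topology measure"
  assumes "finite_measure m" "finite_measure m'" "sets m = sets borel" "sets m' = sets borel"
    and "X \<in> sets borel" "Y \<in> sets borel"
  shows "measure (m \<Otimes>\<^sub>M m') (X \<times> Y) = measure m X * measure m' Y"
proof -
  have "X \<times> Y \<in> sets (m \<Otimes>\<^sub>M m')" using assms by auto
  then show ?thesis using integral_rectangle[OF assms, of "indicator (X \<times> Y)"] by simp
qed

lemma sets_pair_borel:
  fixes m :: "'b::second_countable_topology measure" and m' :: "'c::second_countable_topology measure"
  assumes "sets m = sets borel" "sets m' = sets borel"
  shows "sets (m \<Otimes>\<^sub>M m') = sets borel"
  using sets_pair_measure_cong[OF assms] unfolding borel_prod .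

section \<open>Rectangles generating the Borel algebras of powers\<close>

lemma box_times: "box (a, c) (b, d) = box a b \<times> box c d"
  by (auto simp: mem_box Basis_prod_def ball_Un)

text \<open>The sides come from one sequence B of sets, the form in which
  \<open>fact_cumulant\<close> takes its argument.\<close>

definition rect2 :: "('a::euclidean_space \<times> 'a) set set" where
  "rect2 = {B 1 \<times> B 2 | B. \<forall>i::nat. (B i :: 'a set) \<in> sets borel}"

lemma rect2:
  "Int_stable (rect2 :: ('a::euclidean_space \<times> 'a) set set)" "sets borel = sigma_sets UNIV (rect2 :: ('a::euclidean_space \<times> 'a) set set)" "UNIV \<in> (rect2 :: ('a \<times> 'a) set set)"
proof -
  show "Int_stable (rect2 :: ('a \<times> 'a) set set)"
  proof (rule Int_stableI)
    fix a b :: "('a \<times> 'a) set" assume "a \<in> rect2" "b \<in> rect2"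
    obtain A :: "nat \<Rightarrow> 'a set" where A: "a = A 1 \<times> A 2" "\<forall>i. A i \<in> sets borel"
      using \<open>a \<in> rect2\<close> unfolding rect2_def by (elim CollectE exE conjE) (rule that)
    obtain B :: "nat \<Rightarrow> 'a set" where B: "b = B 1 \<times> B 2" "\<forall>i. B i \<in> sets borel"
      using \<open>b \<in> rect2\<close> unfolding rect2_def by (elim CollectE exE conjE) (rule that)
    note AB = A(1) B(1) A(2) B(2)
    show "a \<inter> b \<in> rect2"
      unfolding rect2_def AB(1,2)
      by (rule CollectI, rule exI[of _ "\<lambda>i. A i \<inter> B i"], rule conjI, simp only: Times_Int_Times)
        (use AB(3,4) in \<open>auto intro: sets.Int\<close>)
  qed
  show "UNIV \<in> (rect2 :: ('a \<times> 'a) set set)"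
    unfolding rect2_def by (rule CollectI, rule exI[of _ "\<lambda>i. UNIV"]) auto
  show "sets borel = sigma_sets UNIV (rect2 :: ('a \<times> 'a) set set)"
  proof
    have "range (\<lambda>(p, q). box p q) \<subseteq> (rect2 :: ('a \<times> 'a) set set)"
    proof clarify
      fix p q :: "('a \<times> 'a)"
      show "box p q \<in> rect2"
        unfolding rect2_def
        by (rule CollectI, rule exI[of _ "(\<lambda>_. UNIV)(1 := box (fst p) (fst q), 2 := box (snd p) (snd q))"])
           (cases p; cases q; simp add: box_times)
    qed
    then have "sigma_sets UNIV (range (\<lambda>(p, q). box p q)) \<subseteq> sigma_sets UNIV (rect2 :: ('a \<times> 'a) set set)"
      by (rule sigma_sets_mono')
    then show "sets borel \<subseteq> sigma_sets UNIV (rect2 :: ('a \<times> 'a) set set)"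
      by (subst borel_eq_box) (simp add: case_prod_beta')
    have "(rect2 :: ('a \<times> 'a) set set) \<subseteq> sets borel"
      unfolding rect2_def by (auto intro!: borel_Times)
    then show "sigma_sets UNIV (rect2 :: ('a \<times> 'a) set set) \<subseteq> sets borel"
      using sets.sigma_sets_subset[of "rect2" borel] by simp
  qed
qed

definition rect3 :: "('a::euclidean_space \<times> 'a \<times> 'a) set set" where
  "rect3 = {B 1 \<times> B 2 \<times> B 3 | B. \<forall>i::nat. (B i :: 'a set) \<in> sets borel}"

lemma rect3:
  "Int_stable (rect3 :: ('a::euclidean_space \<times> 'a \<times> 'a) set set)" "sets borel = sigma_sets UNIV (rect3 :: ('a::euclidean_space \<times> 'a \<times> 'a) set set)" "UNIV \<in> (rect3 :: ('a \<times> 'a \<times> 'a) set set)"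
proof -
  show "Int_stable (rect3 :: ('a \<times> 'a \<times> 'a) set set)"
  proof (rule Int_stableI)
    fix a b :: "('a \<times> 'a \<times> 'a) set" assume "a \<in> rect3" "b \<in> rect3"
    obtain A :: "nat \<Rightarrow> 'a set" where A: "a = A 1 \<times> A 2 \<times> A 3" "\<forall>i. A i \<in> sets borel"
      using \<open>a \<in> rect3\<close> unfolding rect3_def by (elim CollectE exE conjE) (rule that)
    obtain B :: "nat \<Rightarrow> 'a set" where B: "b = B 1 \<times> B 2 \<times> B 3" "\<forall>i. B i \<in> sets borel"
      using \<open>b \<in> rect3\<close> unfolding rect3_def by (elim CollectE exE conjE) (rule that)
    note AB = A(1) B(1) A(2) B(2)
    show "a \<inter> b \<in> rect3"
      unfolding rect3_def AB(1,2)
      by (rule CollectI, rule exI[of _ "\<lambda>i. A i \<inter> B i"], rule conjI, simp only: Times_Int_Times)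
        (use AB(3,4) in \<open>auto intro: sets.Int\<close>)
  qed
  show "UNIV \<in> (rect3 :: ('a \<times> 'a \<times> 'a) set set)"
    unfolding rect3_def by (rule CollectI, rule exI[of _ "\<lambda>i. UNIV"]) auto
  show "sets borel = sigma_sets UNIV (rect3 :: ('a \<times> 'a \<times> 'a) set set)"
  proof
    have "range (\<lambda>(p, q). box p q) \<subseteq> (rect3 :: ('a \<times> 'a \<times> 'a) set set)"
    proof clarify
      fix p q :: "('a \<times> 'a \<times> 'a)"
      show "box p q \<in> rect3"
        unfolding rect3_def
        by (rule CollectI, rule exI[of _ "(\<lambda>_. UNIV)(1 := box (fst p) (fst q), 2 := box (fst (snd p)) (fst (snd q)), 3 := box (snd (snd p)) (snd (snd q)))"])
           (cases p; cases q; simp add: box_times)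
    qed
    then have "sigma_sets UNIV (range (\<lambda>(p, q). box p q)) \<subseteq> sigma_sets UNIV (rect3 :: ('a \<times> 'a \<times> 'a) set set)"
      by (rule sigma_sets_mono')
    then show "sets borel \<subseteq> sigma_sets UNIV (rect3 :: ('a \<times> 'a \<times> 'a) set set)"
      by (subst borel_eq_box) (simp add: case_prod_beta')
    have "(rect3 :: ('a \<times> 'a \<times> 'a) set set) \<subseteq> sets borel"
      unfolding rect3_def by (auto intro!: borel_Times)
    then show "sigma_sets UNIV (rect3 :: ('a \<times> 'a \<times> 'a) set set) \<subseteq> sets borel"
      using sets.sigma_sets_subset[of "rect3" borel] by simp
  qed
qed

definition rect4 :: "('a::euclidean_space \<times> 'a \<times> 'a \<times> 'a) set set" where
  "rect4 = {B 1 \<times> B 2 \<times> B 3 \<times> B 4 | B. \<forall>i::nat. (B i :: 'a set) \<in> sets borel}"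

lemma rect4:
  "Int_stable (rect4 :: ('a::euclidean_space \<times> 'a \<times> 'a \<times> 'a) set set)" "sets borel = sigma_sets UNIV (rect4 :: ('a::euclidean_space \<times> 'a \<times> 'a \<times> 'a) set set)" "UNIV \<in> (rect4 :: ('a \<times> 'a \<times> 'a \<times> 'a) set set)"
proof -
  show "Int_stable (rect4 :: ('a \<times> 'a \<times> 'a \<times> 'a) set set)"
  proof (rule Int_stableI)
    fix a b :: "('a \<times> 'a \<times> 'a \<times> 'a) set" assume "a \<in> rect4" "b \<in> rect4"
    obtain A :: "nat \<Rightarrow> 'a set" where A: "a = A 1 \<times> A 2 \<times> A 3 \<times> A 4" "\<forall>i. A i \<in> sets borel"
      using \<open>a \<in> rect4\<close> unfolding rect4_def by (elim CollectE exE conjE) (rule that)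
    obtain B :: "nat \<Rightarrow> 'a set" where B: "b = B 1 \<times> B 2 \<times> B 3 \<times> B 4" "\<forall>i. B i \<in> sets borel"
      using \<open>b \<in> rect4\<close> unfolding rect4_def by (elim CollectE exE conjE) (rule that)
    note AB = A(1) B(1) A(2) B(2)
    show "a \<inter> b \<in> rect4"
      unfolding rect4_def AB(1,2)
      by (rule CollectI, rule exI[of _ "\<lambda>i. A i \<inter> B i"], rule conjI, simp only: Times_Int_Times)
        (use AB(3,4) in \<open>auto intro: sets.Int\<close>)
  qed
  show "UNIV \<in> (rect4 :: ('a \<times> 'a \<times> 'a \<times> 'a) set set)"
    unfolding rect4_def by (rule CollectI, rule exI[of _ "\<lambda>i. UNIV"]) auto
  show "sets borel = sigma_sets UNIV (rect4 :: ('a \<times> 'a \<times> 'a \<times> 'a) set set)"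
  proof
    have "range (\<lambda>(p, q). box p q) \<subseteq> (rect4 :: ('a \<times> 'a \<times> 'a \<times> 'a) set set)"
    proof clarify
      fix p q :: "('a \<times> 'a \<times> 'a \<times> 'a)"
      show "box p q \<in> rect4"
        unfolding rect4_def
        by (rule CollectI, rule exI[of _ "(\<lambda>_. UNIV)(1 := box (fst p) (fst q), 2 := box (fst (snd p)) (fst (snd q)), 3 := box (fst (snd (snd p))) (fst (snd (snd q))), 4 := box (snd (snd (snd p))) (snd (snd (snd q))))"])
           (cases p; cases q; simp add: box_times)
    qed
    then have "sigma_sets UNIV (range (\<lambda>(p, q). box p q)) \<subseteq> sigma_sets UNIV (rect4 :: ('a \<times> 'a \<times> 'a \<times> 'a) set set)"
      by (rule sigma_sets_mono')
    then show "sets borel \<subseteq> sigma_sets UNIV (rect4 :: ('a \<times> 'a \<times> 'a \<times> 'a) set set)"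
      by (subst borel_eq_box) (simp add: case_prod_beta')
    have "(rect4 :: ('a \<times> 'a \<times> 'a \<times> 'a) set set) \<subseteq> sets borel"
      unfolding rect4_def by (auto intro!: borel_Times)
    then show "sigma_sets UNIV (rect4 :: ('a \<times> 'a \<times> 'a \<times> 'a) set set) \<subseteq> sets borel"
      using sets.sigma_sets_subset[of "rect4" borel] by simp
  qed
qed

text \<open>In a single bounded Borel window all moment measures are finite, so their products and
  Fubini's theorem are available throughout.\<close>

locale window = mixing_process M N for M :: "'w measure" and N :: "'w \<Rightarrow> 'a::euclidean_space set" +
  fixes W :: "'a set"
  assumes W: "W \<in> sets borel" "bounded W"
begin

definition m1 where "m1 = mean_measure M (\<lambda>\<omega>. N \<omega> \<inter> W)"
definition m2 where "m2 = mean_measure M (\<lambda>\<omega>. distinct_pairs (N \<omega> \<inter> W))"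
definition m3 where "m3 = mean_measure M (\<lambda>\<omega>. triples (N \<omega> \<inter> W))"
definition m4 where "m4 = mean_measure M (\<lambda>\<omega>. quads (N \<omega> \<inter> W))"

lemma sets_m [simp, measurable_cong]:
  "sets m1 = sets borel" "sets m2 = sets borel" "sets m3 = sets borel" "sets m4 = sets borel"
  by (simp_all add: m1_def m2_def m3_def m4_def)

lemma space_m [simp]: "space m1 = UNIV" "space m2 = UNIV" "space m3 = UNIV" "space m4 = UNIV"
  by (simp_all add: m1_def m2_def m3_def m4_def)

lemmas fp1 = finite_process_N[OF W]
lemmas fp234 = finite_process_tuples[OF fp1]
lemmas integrable_tuples_W = integrable_tuples[OF W]

sublocale m1: finite_measure m1
  unfolding m1_def by (rule finite_measure_mean_measure[OF fp1 integrable_tuples_W(1)])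
sublocale m2: finite_measure m2
  unfolding m2_def by (rule finite_measure_mean_measure[OF fp234(1) integrable_tuples_W(2)])
sublocale m3: finite_measure m3
  unfolding m3_def by (rule finite_measure_mean_measure[OF fp234(2) integrable_tuples_W(3)])
sublocale m4: finite_measure m4
  unfolding m4_def by (rule finite_measure_mean_measure[OF fp234(3) integrable_tuples_W(4)])

abbreviation "m11 \<equiv> m1 \<Otimes>\<^sub>M m1"
abbreviation "m111 \<equiv> m1 \<Otimes>\<^sub>M m11"
abbreviation "m1111 \<equiv> m1 \<Otimes>\<^sub>M m111"
abbreviation "m21 \<equiv> m2 \<Otimes>\<^sub>M m1"
abbreviation "m31 \<equiv> m3 \<Otimes>\<^sub>M m1"
abbreviation "m22 \<equiv> m2 \<Otimes>\<^sub>M m2"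
abbreviation "m211 \<equiv> m2 \<Otimes>\<^sub>M m11"

sublocale m11: finite_measure m11
  by (rule finite_measure_pair_measure; unfold_locales)
sublocale m111: finite_measure m111
  by (rule finite_measure_pair_measure; unfold_locales)
sublocale m1111: finite_measure m1111
  by (rule finite_measure_pair_measure; unfold_locales)
sublocale m21: finite_measure m21
  by (rule finite_measure_pair_measure; unfold_locales)
sublocale m31: finite_measure m31
  by (rule finite_measure_pair_measure; unfold_locales)
sublocale m22: finite_measure m22
  by (rule finite_measure_pair_measure; unfold_locales)
sublocale m211: finite_measure m211
  by (rule finite_measure_pair_measure; unfold_locales)

lemma sets_mm [simp, measurable_cong]:
  "sets m11 = sets borel" "sets m111 = sets borel" "sets m1111 = sets borel" "sets m21 = sets borel"
  "sets m31 = sets borel" "sets m22 = sets borel" "sets m211 = sets borel"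
  by (intro sets_pair_borel sets_m)+

text \<open>Replaces the set function \<open>fact_moment\<close> on products by the measures
  \<open>m1\<close> to \<open>m4\<close>, against which functions can be integrated.\<close>

lemma fact_moment_mean:
  fixes B :: "nat \<Rightarrow> 'a set" and i j k l :: nat
  assumes B: "\<And>i. B i \<in> sets borel"
  shows "enn2real (fact_moment M N {i} (\<lambda>t. B t \<inter> W)) = measure m1 (B i)"
    and "i \<noteq> j \<Longrightarrow> enn2real (fact_moment M N {i,j} (\<lambda>t. B t \<inter> W)) = measure m2 (B i \<times> B j)"
    and "distinct [i,j,k] \<Longrightarrow> enn2real (fact_moment M N {i,j,k} (\<lambda>t. B t \<inter> W)) = measure m3 (B i \<times> B j \<times> B k)"
    and "distinct [i,j,k,l] \<Longrightarrow> enn2real (fact_moment M N {i,j,k,l} (\<lambda>t. B t \<inter> W)) = measure m4 (B i \<times> B j \<times> B k \<times> B l)"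
proof -
  have fm: "fact_moment M N I (\<lambda>t. B t \<inter> W) = (\<integral>\<^sup>+\<omega>. ennreal (real (card {x \<in> Pi\<^sub>E I (\<lambda>i. (N \<omega> \<inter> W) \<inter> B i). inj_on x I})) \<partial>M)"
    if "finite I" for I
  proof -
    have "(N \<omega> \<inter> W) \<inter> (B i \<inter> W) = (N \<omega> \<inter> W) \<inter> B i" for \<omega> i by auto
    then show ?thesis using fact_moment_eq[OF W that, of "\<lambda>t. B t \<inter> W"] by simp
  qed
  show "enn2real (fact_moment M N {i} (\<lambda>t. B t \<inter> W)) = measure m1 (B i)"
    unfolding fm[OF finite.insertI[OF finite.emptyI]] card_injective_tuples(1) measure_def m1_def
    by (subst emeasure_mean_measure[OF fp1]) (use B in auto)
  show "enn2real (fact_moment M N {i,j} (\<lambda>t. B t \<inter> W)) = measure m2 (B i \<times> B j)" if "i \<noteq> j"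
    unfolding fm[OF finite.insertI[OF finite.insertI[OF finite.emptyI]]] card_injective_tuples(2)[OF that] measure_def m2_def
    by (subst emeasure_mean_measure[OF fp234(1)]) (use B in \<open>auto intro!: borel_Times\<close>)
  show "enn2real (fact_moment M N {i,j,k} (\<lambda>t. B t \<inter> W)) = measure m3 (B i \<times> B j \<times> B k)" if "distinct [i,j,k]"
    unfolding fm[OF finite.insertI[OF finite.insertI[OF finite.insertI[OF finite.emptyI]]]] card_injective_tuples(3)[OF that] measure_def m3_def
    by (subst emeasure_mean_measure[OF fp234(2)]) (use B in \<open>auto intro!: borel_Times\<close>)
  show "enn2real (fact_moment M N {i,j,k,l} (\<lambda>t. B t \<inter> W)) = measure m4 (B i \<times> B j \<times> B k \<times> B l)" if "distinct [i,j,k,l]"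
    unfolding fm[OF finite.insertI[OF finite.insertI[OF finite.insertI[OF finite.insertI[OF finite.emptyI]]]]] card_injective_tuples(4)[OF that] measure_def m4_def
    by (subst emeasure_mean_measure[OF fp234(3)]) (use B in \<open>auto intro!: borel_Times\<close>)
qed

text \<open>The integral against the factorial cumulant measure restricted to the window, with one term for
  each partition of the coordinates.\<close>

definition cum2 :: "('a \<times> 'a \<Rightarrow> real) \<Rightarrow> real" where
  "cum2 f = (LINT p|m2. f p) - (LINT p|m11. f p)"

definition cum3 :: "('a \<times> 'a \<times> 'a \<Rightarrow> real) \<Rightarrow> real" where
  "cum3 f = (LINT p|m3. f p)
     - (LINT p|m21. f (fst (fst p), snd (fst p), snd p))
     - (LINT p|m21. f (fst (fst p), snd p, snd (fst p)))
     - (LINT p|m21. f (snd p, fst (fst p), snd (fst p)))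
     + 2 * (LINT p|m111. f p)"

definition cum4 :: "('a \<times> 'a \<times> 'a \<times> 'a \<Rightarrow> real) \<Rightarrow> real" where
  "cum4 f = (LINT p|m4. f p)
     - (LINT p|m31. f (fst (fst p), fst (snd (fst p)), snd (snd (fst p)), snd p))
     - (LINT p|m31. f (fst (fst p), fst (snd (fst p)), snd p, snd (snd (fst p))))
     - (LINT p|m31. f (fst (fst p), snd p, fst (snd (fst p)), snd (snd (fst p))))
     - (LINT p|m31. f (snd p, fst (fst p), fst (snd (fst p)), snd (snd (fst p))))
     - (LINT p|m22. f (fst (fst p), snd (fst p), fst (snd p), snd (snd p)))
     - (LINT p|m22. f (fst (fst p), fst (snd p), snd (fst p), snd (snd p)))
     - (LINT p|m22. f (fst (fst p), fst (snd p), snd (snd p), snd (fst p)))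
     + 2 * ((LINT p|m211. f (fst (fst p), snd (fst p), fst (snd p), snd (snd p)))
       + (LINT p|m211. f (fst (fst p), fst (snd p), snd (fst p), snd (snd p)))
       + (LINT p|m211. f (fst (fst p), fst (snd p), snd (snd p), snd (fst p)))
       + (LINT p|m211. f (fst (snd p), fst (fst p), snd (fst p), snd (snd p)))
       + (LINT p|m211. f (fst (snd p), fst (fst p), snd (snd p), snd (fst p)))
       + (LINT p|m211. f (fst (snd p), snd (snd p), fst (fst p), snd (fst p))))
     - 6 * (LINT p|m1111. f p)"

lemma signed_functional_cum: "signed_functional cum2" "signed_functional cum3" "signed_functional cum4"
proof -
  note fin = m11.finite_measure_axioms m111.finite_measure_axioms m1111.finite_measure_axioms m21.finite_measure_axioms
    m31.finite_measure_axioms m22.finite_measure_axioms m211.finite_measure_axioms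
    m2.finite_measure_axioms m3.finite_measure_axioms m4.finite_measure_axioms
  note sf = signed_functional_add signed_functional_diff signed_functional_cmult signed_functional_integral[OF fin(1)]
    signed_functional_integral[OF fin(2)] signed_functional_integral[OF fin(3)] signed_functional_integral[OF fin(4)]
    signed_functional_integral[OF fin(5)] signed_functional_integral[OF fin(6)] signed_functional_integral[OF fin(7)]
    signed_functional_integral[OF fin(8)] signed_functional_integral[OF fin(9)] signed_functional_integral[OF fin(10)]
  have id: "(\<lambda>p. p) \<in> m \<rightarrow>\<^sub>M borel" if "sets m = sets borel" for m :: "'b::topological_space measure"
    by (subst measurable_cong_sets[OF that refl]) (rule measurable_ident[unfolded id_def])
  note M = borel_measurable_Pair borel_measurable_fst_raw id sets_m sets_mm
  show "signed_functional cum2" unfolding cum2_def[abs_def] by (intro sf M)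
  show "signed_functional cum3" unfolding cum3_def[abs_def] by (intro sf M)
  show "signed_functional cum4" unfolding cum4_def[abs_def] by (intro sf M)
qed

text \<open>On a rectangle each integral factorizes over the blocks of its partition, which turns
  the functional into the formula for the factorial cumulant with sides cut down to the window. The
  same argument serves orders 3 and 4.\<close>

lemma cum2_rect:
  assumes B [measurable]: "\<And>i. B i \<in> sets borel"
  shows "cum2 (indicat_real (B 1 \<times> B 2)) = fact_cumulant M N 2 (\<lambda>t. B t \<inter> W)"
proof -
  have [measurable]: "B 1 \<times> B 2 \<in> sets borel" using B by (auto intro!: borel_Times)
  have "(LINT p|m11. indicat_real (B 1 \<times> B 2) p) = measure m1 (B 1) * measure m1 (B 2)"
    by (rule integral_rectangle) (use m1.finite_measure_axioms in auto)
  then show ?thesis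
    unfolding cum2_def fact_cumulant_2 Let_def by (simp add: fact_moment_mean[OF B])
qed

lemma cum3_rect:
  assumes B [measurable]: "\<And>i. B i \<in> sets borel"
  shows "cum3 (indicat_real (B 1 \<times> B 2 \<times> B 3)) = fact_cumulant M N 3 (\<lambda>t. B t \<inter> W)"
proof -
  note T = borel_Times[OF B borel_Times[OF B B]] borel_Times[OF B B] B
  note fin = m1.finite_measure_axioms m2.finite_measure_axioms m11.finite_measure_axioms
  have "(LINT p|m21. indicat_real (B 1 \<times> B 2 \<times> B 3) (fst (fst p), snd (fst p), snd p)) = measure m2 (B 1 \<times> B 2) * measure m1 (B 3)"
    "(LINT p|m21. indicat_real (B 1 \<times> B 2 \<times> B 3) (fst (fst p), snd p, snd (fst p))) = measure m2 (B 1 \<times> B 3) * measure m1 (B 2)"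
    "(LINT p|m21. indicat_real (B 1 \<times> B 2 \<times> B 3) (snd p, fst (fst p), snd (fst p))) = measure m2 (B 2 \<times> B 3) * measure m1 (B 1)"
    by (rule integral_rectangle; (intro fin sets_m T)?; auto simp: indicator_def)+
  moreover have "(LINT p|m111. indicat_real (B 1 \<times> B 2 \<times> B 3) p) = measure m1 (B 1) * (measure m1 (B 2) * measure m1 (B 3))"
    unfolding measure_times_borel[OF fin(1) fin(1) sets_m(1) sets_m(1) B B, symmetric]
    by (rule integral_rectangle) (intro fin sets_m sets_mm T refl)+
  moreover have "(LINT p|m3. indicat_real (B 1 \<times> B 2 \<times> B 3) p) = measure m3 (B 1 \<times> B 2 \<times> B 3)" using T by simp
  ultimately show ?thesis
    unfolding cum3_def fact_cumulant_3 Let_def by (simp add: fact_moment_mean[OF B])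
qed

lemma cum4_rect:
  assumes B [measurable]: "\<And>i. B i \<in> sets borel"
  shows "cum4 (indicat_real (B 1 \<times> B 2 \<times> B 3 \<times> B 4)) = fact_cumulant M N 4 (\<lambda>t. B t \<inter> W)"
proof -
  let ?Q = "B 1 \<times> B 2 \<times> B 3 \<times> B 4"
  note T = borel_Times[OF B borel_Times[OF B borel_Times[OF B B]]] borel_Times[OF B borel_Times[OF B B]] borel_Times[OF B B] B
  note fin = m1.finite_measure_axioms m2.finite_measure_axioms m3.finite_measure_axioms m11.finite_measure_axioms m111.finite_measure_axioms
  note mt = measure_times_borel[OF fin(1) fin(1) sets_m(1) sets_m(1) B B]
  note mt3 = measure_times_borel[OF fin(1) fin(4) sets_m(1) sets_mm(1) B borel_Times[OF B B]]
  have 31: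
    "(LINT p|m31. indicat_real ?Q (fst (fst p), fst (snd (fst p)), snd (snd (fst p)), snd p)) = measure m3 (B 1 \<times> B 2 \<times> B 3) * measure m1 (B 4)"
    "(LINT p|m31. indicat_real ?Q (fst (fst p), fst (snd (fst p)), snd p, snd (snd (fst p)))) = measure m3 (B 1 \<times> B 2 \<times> B 4) * measure m1 (B 3)"
    "(LINT p|m31. indicat_real ?Q (fst (fst p), snd p, fst (snd (fst p)), snd (snd (fst p)))) = measure m3 (B 1 \<times> B 3 \<times> B 4) * measure m1 (B 2)"
    "(LINT p|m31. indicat_real ?Q (snd p, fst (fst p), fst (snd (fst p)), snd (snd (fst p)))) = measure m3 (B 2 \<times> B 3 \<times> B 4) * measure m1 (B 1)"
    by (rule integral_rectangle; (intro fin sets_m T)?; auto simp: indicator_def)+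
  have 22:
    "(LINT p|m22. indicat_real ?Q (fst (fst p), snd (fst p), fst (snd p), snd (snd p))) = measure m2 (B 1 \<times> B 2) * measure m2 (B 3 \<times> B 4)"
    "(LINT p|m22. indicat_real ?Q (fst (fst p), fst (snd p), snd (fst p), snd (snd p))) = measure m2 (B 1 \<times> B 3) * measure m2 (B 2 \<times> B 4)"
    "(LINT p|m22. indicat_real ?Q (fst (fst p), fst (snd p), snd (snd p), snd (fst p))) = measure m2 (B 1 \<times> B 4) * measure m2 (B 2 \<times> B 3)"
    by (rule integral_rectangle; (intro fin sets_m T)?; auto simp: indicator_def)+
  have 211:
    "(LINT p|m211. indicat_real ?Q (fst (fst p), snd (fst p), fst (snd p), snd (snd p))) = measure m2 (B 1 \<times> B 2) * measure m11 (B 3 \<times> B 4)"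
    "(LINT p|m211. indicat_real ?Q (fst (fst p), fst (snd p), snd (fst p), snd (snd p))) = measure m2 (B 1 \<times> B 3) * measure m11 (B 2 \<times> B 4)"
    "(LINT p|m211. indicat_real ?Q (fst (fst p), fst (snd p), snd (snd p), snd (fst p))) = measure m2 (B 1 \<times> B 4) * measure m11 (B 2 \<times> B 3)"
    "(LINT p|m211. indicat_real ?Q (fst (snd p), fst (fst p), snd (fst p), snd (snd p))) = measure m2 (B 2 \<times> B 3) * measure m11 (B 1 \<times> B 4)"
    "(LINT p|m211. indicat_real ?Q (fst (snd p), fst (fst p), snd (snd p), snd (fst p))) = measure m2 (B 2 \<times> B 4) * measure m11 (B 1 \<times> B 3)"
    "(LINT p|m211. indicat_real ?Q (fst (snd p), snd (snd p), fst (fst p), snd (fst p))) = measure m2 (B 3 \<times> B 4) * measure m11 (B 1 \<times> B 2)"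
    by (rule integral_rectangle; (intro fin sets_m sets_mm T)?; auto simp: indicator_def)+
  have 1111: "(LINT p|m1111. indicat_real ?Q p) = measure m1 (B 1) * measure m111 (B 2 \<times> B 3 \<times> B 4)"
    by (rule integral_rectangle) (intro fin sets_m sets_mm T refl)+
  have "(LINT p|m4. indicat_real ?Q p) = measure m4 ?Q" using T by simp
  then show ?thesis
    unfolding cum4_def fact_cumulant_4 Let_def 31 22 211 1111 mt mt3 by (simp add: fact_moment_mean[OF B] algebra_simps)
qed

section \<open>Bounding cumulant functionals by the total variation of reduced measures\<close>

definition rad :: real where "rad = (SOME r. W \<subseteq> cball 0 r)"

lemma rad: "W \<subseteq> cball 0 rad"
proof -
  obtain r where "W \<subseteq> cball 0 r" using W(2) by (auto simp: bounded_iff subset_eq)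
  then show ?thesis unfolding rad_def by (rule someI)
qed

abbreviation "red2 \<equiv> cumulant_red M N 2"
definition var2 :: real where "var2 = enn2real (variation_norm {1..<2} red2)"

text \<open>A single set is an admissible family in the supremum defining
  \<open>variation_norm\<close>. This bound on single sets is the form in which the total variation
  enters the estimates in a window.\<close>

lemma red2: "signed_measure_on {1..<2} red2" "\<And>C. C \<in> bounded_borel {1..<2} \<Longrightarrow> \<bar>red2 C\<bar> \<le> var2"
  and red2_reduced: "is_reduced lam 2 (fact_cumulant M N 2) red2"
proof -
  have B: "is_reduced lam 2 (fact_cumulant M N 2) red2" "variation_norm {1..<2} red2 < \<infinity>"
    using B4 unfolding B4_mixing_def by auto
  then show "signed_measure_on {1..<2} red2" "is_reduced lam 2 (fact_cumulant M N 2) red2"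
    by (auto simp: is_reduced_def)
  fix C :: "(nat \<Rightarrow> 'a) set" assume "C \<in> bounded_borel {1..<2}"
  then have "(\<Sum>C\<in>{C}. ennreal \<bar>red2 C\<bar>) \<le> variation_norm {1..<2} red2"
    unfolding variation_norm_def by (intro SUP_upper) auto
  then show "\<bar>red2 C\<bar> \<le> var2"
    using B(2) enn2real_mono[of "ennreal \<bar>red2 C\<bar>"] unfolding var2_def by simp
qed

abbreviation "red3 \<equiv> cumulant_red M N 3"
definition var3 :: real where "var3 = enn2real (variation_norm {1..<3} red3)"

lemma red3: "signed_measure_on {1..<3} red3" "\<And>C. C \<in> bounded_borel {1..<3} \<Longrightarrow> \<bar>red3 C\<bar> \<le> var3"
  and red3_reduced: "is_reduced lam 3 (fact_cumulant M N 3) red3"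
proof -
  have B: "is_reduced lam 3 (fact_cumulant M N 3) red3" "variation_norm {1..<3} red3 < \<infinity>"
    using B4 unfolding B4_mixing_def by auto
  then show "signed_measure_on {1..<3} red3" "is_reduced lam 3 (fact_cumulant M N 3) red3"
    by (auto simp: is_reduced_def)
  fix C :: "(nat \<Rightarrow> 'a) set" assume "C \<in> bounded_borel {1..<3}"
  then have "(\<Sum>C\<in>{C}. ennreal \<bar>red3 C\<bar>) \<le> variation_norm {1..<3} red3"
    unfolding variation_norm_def by (intro SUP_upper) auto
  then show "\<bar>red3 C\<bar> \<le> var3"
    using B(2) enn2real_mono[of "ennreal \<bar>red3 C\<bar>"] unfolding var3_def by simp
qed

abbreviation "red4 \<equiv> cumulant_red M N 4"
definition var4 :: real where "var4 = enn2real (variation_norm {1..<4} red4)"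

lemma red4: "signed_measure_on {1..<4} red4" "\<And>C. C \<in> bounded_borel {1..<4} \<Longrightarrow> \<bar>red4 C\<bar> \<le> var4"
  and red4_reduced: "is_reduced lam 4 (fact_cumulant M N 4) red4"
proof -
  have B: "is_reduced lam 4 (fact_cumulant M N 4) red4" "variation_norm {1..<4} red4 < \<infinity>"
    using B4 unfolding B4_mixing_def by auto
  then show "signed_measure_on {1..<4} red4" "is_reduced lam 4 (fact_cumulant M N 4) red4"
    by (auto simp: is_reduced_def)
  fix C :: "(nat \<Rightarrow> 'a) set" assume "C \<in> bounded_borel {1..<4}"
  then have "(\<Sum>C\<in>{C}. ennreal \<bar>red4 C\<bar>) \<le> variation_norm {1..<4} red4"
    unfolding variation_norm_def by (intro SUP_upper) auto
  then show "\<bar>red4 C\<bar> \<le> var4"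
    using B(2) enn2real_mono[of "ennreal \<bar>red4 C\<bar>"] unfolding var4_def by simp
qed

text \<open>The last coordinate is the base point and the other is recorded by its difference to it,
  as in \<open>is_reduced\<close>. Two points of W differ by at most 2 \<open>rad\<close>, which
  bounds the sections.\<close>

sublocale c2: reduced_extension cum2 "\<lambda>x u. (u 1 + x, x)" "{1..<2::nat}" red2 "W \<times> W" W lam "2 * rad" var2 rect2
proof
  show "signed_functional cum2" by (rule signed_functional_cum)
  show "(\<lambda>u. (u 1 + x, x)) \<in> Pi\<^sub>M {1..<2::nat} (\<lambda>_. borel) \<rightarrow>\<^sub>M borel" for x :: 'a
    by measurable
  show "W \<times> W \<in> sets borel" using W by (auto intro!: borel_Times)
  show "u \<in> Pi\<^sub>E {1..<2::nat} (\<lambda>_. cball 0 (2 * rad))"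
    if "x \<in> W" "u \<in> space (Pi\<^sub>M {1..<2::nat} (\<lambda>_. borel))" "(u 1 + x, x) \<in> W \<times> W" for x u
  proof -
    have "norm (u i) \<le> 2 * rad" if "u i + x \<in> W" for i
    proof -
      have "norm (u i + x) \<le> rad" "norm x \<le> rad" using that \<open>x \<in> W\<close> rad by auto
      then show ?thesis using norm_triangle_ineq4[of "u i + x" x] by simp
    qed
    then show ?thesis using that unfolding space_PiM PiE_def
      by (auto simp: numeral_eq_Suc less_Suc_eq)
  qed
qed (use W lam_pos rect2 red2 in auto)

text \<open>For a rectangle the section at x is the product of the shifted sides if x lies in the
  last side, and empty otherwise; so the defining equation of the reduced measure is the required
  identity, with the indicator of the last side absorbed into the section.\<close>

lemma cum2_base:
  assumes "Q \<in> rect2"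
  shows "integrable lborel (\<lambda>x. red2 (c2.sect Q x)) \<and> cum2 (indicat_real Q) = lam * (LINT x|lborel. red2 (c2.sect Q x))"
proof -
  obtain B where B: "Q = B 1 \<times> B 2" "\<And>i::nat. B i \<in> sets borel"
    using assms unfolding rect2_def by (elim CollectE exE conjE) (metis that)
  let ?A = "\<lambda>t. B t \<inter> W"
  have A: "\<And>i. i \<in> {1..2} \<Longrightarrow> ?A i \<in> sets borel \<and> bounded (?A i)" using B W by (auto intro: bounded_subset)
  have sect: "red2 (c2.sect Q x) = indicat_real (?A 2) x *\<^sub>R red2 (Pi\<^sub>E {1..<2} (\<lambda>i. (\<lambda>y. y - x) ` ?A i))" for x
  proof (cases "x \<in> ?A 2")
    case True
    have im: "v \<in> (\<lambda>y. y - x) ` ?A i \<longleftrightarrow> v + x \<in> ?A i" for v i by force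
    have "c2.sect Q x = Pi\<^sub>E {1..<2} (\<lambda>i. (\<lambda>y. y - x) ` ?A i)"
      unfolding c2.sect_def B(1) PiE_def Pi_def im space_PiM using True
      by (auto simp: numeral_eq_Suc less_Suc_eq)
    then show ?thesis using True by simp
  next
    case False
    then have "c2.sect Q x = {}" unfolding c2.sect_def B(1) by auto
    then show ?thesis using False signed_measure_on_empty[OF red2(1)] by simp
  qed
  show ?thesis
    using red2_reduced[unfolded is_reduced_def, THEN conjunct2, rule_format, of ?A, OF A] B
    unfolding sect unfolding B(1) cum2_rect[of B, OF B(2)]
    by (simp add: set_integrable_def set_lebesgue_integral_def)
qed

text \<open>Only the last coordinate is localized. Given the base point, the other coordinate
  contributes the total variation and no volume, which is the gain of mixing over a mere moment
  bound.\<close>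

lemma cum2_bound:
  assumes f: "f \<in> borel_measurable borel" "\<And>p. \<bar>f p\<bar> \<le> C" and D: "D \<in> sets borel"
    and supp: "\<And>p. f p \<noteq> 0 \<Longrightarrow> snd p \<in> D"
  shows "\<bar>cum2 f\<bar> \<le> 4 * C * (lam * (var2 * measure lborel (W \<inter> D)))"
proof (rule c2.functional_bound[OF cum2_base f D])
  show "0 \<le> var2" by (simp add: var2_def)
  fix Q x assume Q: "Q \<in> sets borel" "Q \<subseteq> {p. f p \<noteq> 0}"
  have "c2.sect Q x = {}" if "x \<notin> D"
  proof (rule equals0I)
    fix u assume "u \<in> c2.sect Q x"
    then have "f (u 1 + x, x) \<noteq> 0" using Q(2) unfolding c2.sect_def by auto
    from supp[OF this] that show False by simp
  qed
  then show "\<bar>red2 (c2.sect Q x)\<bar> \<le> var2 * indicat_real D x"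
    using red2(2)[OF c2.sect_bounded_borel[OF Q(1)], of x] signed_measure_on_empty[OF red2(1)]
    by (auto simp: indicator_def)
qed

sublocale c3: reduced_extension cum3 "\<lambda>x u. (u 1 + x, u 2 + x, x)" "{1..<3::nat}" red3 "W \<times> W \<times> W" W lam "2 * rad" var3 rect3
proof
  show "signed_functional cum3" by (rule signed_functional_cum)
  show "(\<lambda>u. (u 1 + x, u 2 + x, x)) \<in> Pi\<^sub>M {1..<3::nat} (\<lambda>_. borel) \<rightarrow>\<^sub>M borel" for x :: 'a
    by measurable
  show "W \<times> W \<times> W \<in> sets borel" using W by (auto intro!: borel_Times)
  show "u \<in> Pi\<^sub>E {1..<3::nat} (\<lambda>_. cball 0 (2 * rad))"
    if "x \<in> W" "u \<in> space (Pi\<^sub>M {1..<3::nat} (\<lambda>_. borel))" "(u 1 + x, u 2 + x, x) \<in> W \<times> W \<times> W" for x u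
  proof -
    have "norm (u i) \<le> 2 * rad" if "u i + x \<in> W" for i
    proof -
      have "norm (u i + x) \<le> rad" "norm x \<le> rad" using that \<open>x \<in> W\<close> rad by auto
      then show ?thesis using norm_triangle_ineq4[of "u i + x" x] by simp
    qed
    then show ?thesis using that unfolding space_PiM PiE_def
      by (auto simp: numeral_eq_Suc less_Suc_eq)
  qed
qed (use W lam_pos rect3 red3 in auto)

lemma cum3_base:
  assumes "Q \<in> rect3"
  shows "integrable lborel (\<lambda>x. red3 (c3.sect Q x)) \<and> cum3 (indicat_real Q) = lam * (LINT x|lborel. red3 (c3.sect Q x))"
proof -
  obtain B where B: "Q = B 1 \<times> B 2 \<times> B 3" "\<And>i::nat. B i \<in> sets borel"
    using assms unfolding rect3_def by (elim CollectE exE conjE) (metis that)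
  let ?A = "\<lambda>t. B t \<inter> W"
  have A: "\<And>i. i \<in> {1..3} \<Longrightarrow> ?A i \<in> sets borel \<and> bounded (?A i)" using B W by (auto intro: bounded_subset)
  have sect: "red3 (c3.sect Q x) = indicat_real (?A 3) x *\<^sub>R red3 (Pi\<^sub>E {1..<3} (\<lambda>i. (\<lambda>y. y - x) ` ?A i))" for x
  proof (cases "x \<in> ?A 3")
    case True
    have im: "v \<in> (\<lambda>y. y - x) ` ?A i \<longleftrightarrow> v + x \<in> ?A i" for v i by force
    have "c3.sect Q x = Pi\<^sub>E {1..<3} (\<lambda>i. (\<lambda>y. y - x) ` ?A i)"
      unfolding c3.sect_def B(1) PiE_def Pi_def im space_PiM using True
      by (auto simp: numeral_eq_Suc less_Suc_eq)
    then show ?thesis using True by simp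
  next
    case False
    then have "c3.sect Q x = {}" unfolding c3.sect_def B(1) by auto
    then show ?thesis using False signed_measure_on_empty[OF red3(1)] by simp
  qed
  show ?thesis
    using red3_reduced[unfolded is_reduced_def, THEN conjunct2, rule_format, of ?A, OF A] B
    unfolding sect unfolding B(1) cum3_rect[of B, OF B(2)]
    by (simp add: set_integrable_def set_lebesgue_integral_def)
qed

lemma cum3_bound:
  assumes f: "f \<in> borel_measurable borel" "\<And>p. \<bar>f p\<bar> \<le> C" and D: "D \<in> sets borel"
    and supp: "\<And>p. f p \<noteq> 0 \<Longrightarrow> snd (snd p) \<in> D"
  shows "\<bar>cum3 f\<bar> \<le> 4 * C * (lam * (var3 * measure lborel (W \<inter> D)))"
proof (rule c3.functional_bound[OF cum3_base f D])
  show "0 \<le> var3" by (simp add: var3_def)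
  fix Q x assume Q: "Q \<in> sets borel" "Q \<subseteq> {p. f p \<noteq> 0}"
  have "c3.sect Q x = {}" if "x \<notin> D"
  proof (rule equals0I)
    fix u assume "u \<in> c3.sect Q x"
    then have "f (u 1 + x, u 2 + x, x) \<noteq> 0" using Q(2) unfolding c3.sect_def by auto
    from supp[OF this] that show False by simp
  qed
  then show "\<bar>red3 (c3.sect Q x)\<bar> \<le> var3 * indicat_real D x"
    using red3(2)[OF c3.sect_bounded_borel[OF Q(1)], of x] signed_measure_on_empty[OF red3(1)]
    by (auto simp: indicator_def)
qed

sublocale c4: reduced_extension cum4 "\<lambda>x u. (u 1 + x, u 2 + x, u 3 + x, x)" "{1..<4::nat}" red4 "W \<times> W \<times> W \<times> W" W lam "2 * rad" var4 rect4
proof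
  show "signed_functional cum4" by (rule signed_functional_cum)
  show "(\<lambda>u. (u 1 + x, u 2 + x, u 3 + x, x)) \<in> Pi\<^sub>M {1..<4::nat} (\<lambda>_. borel) \<rightarrow>\<^sub>M borel" for x :: 'a
    by measurable
  show "W \<times> W \<times> W \<times> W \<in> sets borel" using W by (auto intro!: borel_Times)
  show "u \<in> Pi\<^sub>E {1..<4::nat} (\<lambda>_. cball 0 (2 * rad))"
    if "x \<in> W" "u \<in> space (Pi\<^sub>M {1..<4::nat} (\<lambda>_. borel))" "(u 1 + x, u 2 + x, u 3 + x, x) \<in> W \<times> W \<times> W \<times> W" for x u
  proof -
    have "norm (u i) \<le> 2 * rad" if "u i + x \<in> W" for i
    proof -
      have "norm (u i + x) \<le> rad" "norm x \<le> rad" using that \<open>x \<in> W\<close> rad by auto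
      then show ?thesis using norm_triangle_ineq4[of "u i + x" x] by simp
    qed
    then show ?thesis using that unfolding space_PiM PiE_def
      by (auto simp: numeral_eq_Suc less_Suc_eq)
  qed
qed (use W lam_pos rect4 red4 in auto)

lemma cum4_base:
  assumes "Q \<in> rect4"
  shows "integrable lborel (\<lambda>x. red4 (c4.sect Q x)) \<and> cum4 (indicat_real Q) = lam * (LINT x|lborel. red4 (c4.sect Q x))"
proof -
  obtain B where B: "Q = B 1 \<times> B 2 \<times> B 3 \<times> B 4" "\<And>i::nat. B i \<in> sets borel"
    using assms unfolding rect4_def by (elim CollectE exE conjE) (metis that)
  let ?A = "\<lambda>t. B t \<inter> W"
  have A: "\<And>i. i \<in> {1..4} \<Longrightarrow> ?A i \<in> sets borel \<and> bounded (?A i)" using B W by (auto intro: bounded_subset)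
  have sect: "red4 (c4.sect Q x) = indicat_real (?A 4) x *\<^sub>R red4 (Pi\<^sub>E {1..<4} (\<lambda>i. (\<lambda>y. y - x) ` ?A i))" for x
  proof (cases "x \<in> ?A 4")
    case True
    have im: "v \<in> (\<lambda>y. y - x) ` ?A i \<longleftrightarrow> v + x \<in> ?A i" for v i by force
    have "c4.sect Q x = Pi\<^sub>E {1..<4} (\<lambda>i. (\<lambda>y. y - x) ` ?A i)"
      unfolding c4.sect_def B(1) PiE_def Pi_def im space_PiM using True
      by (auto simp: numeral_eq_Suc less_Suc_eq)
    then show ?thesis using True by simp
  next
    case False
    then have "c4.sect Q x = {}" unfolding c4.sect_def B(1) by auto
    then show ?thesis using False signed_measure_on_empty[OF red4(1)] by simp
  qed
  show ?thesis
    using red4_reduced[unfolded is_reduced_def, THEN conjunct2, rule_format, of ?A, OF A] B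
    unfolding sect unfolding B(1) cum4_rect[of B, OF B(2)]
    by (simp add: set_integrable_def set_lebesgue_integral_def)
qed

lemma cum4_bound:
  assumes f: "f \<in> borel_measurable borel" "\<And>p. \<bar>f p\<bar> \<le> C" and D: "D \<in> sets borel"
    and supp: "\<And>p. f p \<noteq> 0 \<Longrightarrow> snd (snd (snd p)) \<in> D"
  shows "\<bar>cum4 f\<bar> \<le> 4 * C * (lam * (var4 * measure lborel (W \<inter> D)))"
proof (rule c4.functional_bound[OF cum4_base f D])
  show "0 \<le> var4" by (simp add: var4_def)
  fix Q x assume Q: "Q \<in> sets borel" "Q \<subseteq> {p. f p \<noteq> 0}"
  have "c4.sect Q x = {}" if "x \<notin> D"
  proof (rule equals0I)
    fix u assume "u \<in> c4.sect Q x"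
    then have "f (u 1 + x, u 2 + x, u 3 + x, x) \<noteq> 0" using Q(2) unfolding c4.sect_def by auto
    from supp[OF this] that show False by simp
  qed
  then show "\<bar>red4 (c4.sect Q x)\<bar> \<le> var4 * indicat_real D x"
    using red4(2)[OF c4.sect_bounded_borel[OF Q(1)], of x] signed_measure_on_empty[OF red4(1)]
    by (auto simp: indicator_def)
qed

end

section \<open>Variances of linear and pair statistics\<close>

text \<open>Ordered pairs of pairs are sorted by their shared points: none, exactly one in four
  possible positions, or the same two points in either order. Symmetry of \<psi> makes the four
  positions equal and likewise the two orders, whence the factors 4 and 2.\<close>

lemma sum_pairs_sq:
  fixes \<psi> :: "'a \<Rightarrow> 'a \<Rightarrow> real"
  assumes S: "finite S" and sym: "\<And>x y. \<psi> x y = \<psi> y x"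
  shows "(\<Sum>(x, y)\<in>distinct_pairs S. \<psi> x y)\<^sup>2 =
    (\<Sum>(x, y, z, u)\<in>quads S. \<psi> x y * \<psi> z u) + 4 * (\<Sum>(x, y, z)\<in>triples S. \<psi> x y * \<psi> y z)
    + 2 * (\<Sum>(x, y)\<in>distinct_pairs S. (\<psi> x y)\<^sup>2)"
proof -
  define P where "P = distinct_pairs S"
  define F where "F = (\<lambda>(p, q). \<psi> (fst p) (snd p) * \<psi> (fst q) (snd q))"
  have fin: "finite (P \<times> P)" using card_tuples_le(4)[OF S] by (simp add: P_def)
  have part: "P \<times> P = {r\<in>P \<times> P. case r of ((x, y), (z, u)) \<Rightarrow> z \<noteq> x \<and> z \<noteq> y \<and> u \<noteq> x \<and> u \<noteq> y}
    \<union> ({r\<in>P \<times> P. case r of ((x, y), (z, u)) \<Rightarrow> z = y \<and> u \<noteq> x}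
    \<union> ({r\<in>P \<times> P. case r of ((x, y), (z, u)) \<Rightarrow> z = x \<and> u \<noteq> y}
    \<union> ({r\<in>P \<times> P. case r of ((x, y), (z, u)) \<Rightarrow> u = x \<and> z \<noteq> y}
    \<union> ({r\<in>P \<times> P. case r of ((x, y), (z, u)) \<Rightarrow> u = y \<and> z \<noteq> x}
    \<union> ({r\<in>P \<times> P. case r of ((x, y), (z, u)) \<Rightarrow> z = x \<and> u = y}
    \<union> {r\<in>P \<times> P. case r of ((x, y), (z, u)) \<Rightarrow> z = y \<and> u = x})))))"
    (is "_ = ?A1 \<union> (?A2 \<union> (?A3 \<union> (?A4 \<union> (?A5 \<union> (?A6 \<union> ?A7)))))")
    by auto
  have fins: "finite ?A1" "finite ?A2" "finite ?A3" "finite ?A4" "finite ?A5" "finite ?A6" "finite ?A7"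
    using fin by (auto intro: finite_subset[OF _ fin])
  have "(\<Sum>(x, y)\<in>P. \<psi> x y)\<^sup>2 = sum F (P \<times> P)"
    unfolding power2_eq_square sum_product sum.cartesian_product F_def by (simp add: case_prod_beta')
  also have "\<dots> = sum F ?A1 + (sum F ?A2 + (sum F ?A3 + (sum F ?A4 + (sum F ?A5 + (sum F ?A6 + sum F ?A7)))))"
    unfolding part[THEN arg_cong, of "sum F"]
    by (subst sum.union_disjoint, use fins in \<open>auto simp: P_def distinct_pairs_def\<close>)+
  also have "sum F ?A1 = (\<Sum>(x, y, z, u)\<in>quads S. \<psi> x y * \<psi> z u)"
    by (rule sum.reindex_bij_witness[where i = "\<lambda>(x, y, z, u). ((x, y), (z, u))" and j = "\<lambda>((x, y), (z, u)). (x, y, z, u)"])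
       (auto simp: P_def F_def distinct_pairs_def quads_def)
  also have "sum F ?A2 = (\<Sum>(x, y, z)\<in>triples S. \<psi> x y * \<psi> y z)"
    by (rule sum.reindex_bij_witness[where i = "\<lambda>(x, y, z). ((x, y), (y, z))" and j = "\<lambda>((x, y), (z, u)). (x, y, u)"])
       (auto simp: P_def F_def distinct_pairs_def triples_def)
  also have "sum F ?A3 = (\<Sum>(x, y, z)\<in>triples S. \<psi> x y * \<psi> y z)"
    by (rule sum.reindex_bij_witness[where i = "\<lambda>(x, y, z). ((y, x), (y, z))" and j = "\<lambda>((x, y), (z, u)). (y, x, u)"])
       (auto simp: P_def F_def distinct_pairs_def triples_def sym)
  also have "sum F ?A4 = (\<Sum>(x, y, z)\<in>triples S. \<psi> x y * \<psi> y z)"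
    by (rule sum.reindex_bij_witness[where i = "\<lambda>(x, y, z). ((y, x), (z, y))" and j = "\<lambda>((x, y), (z, u)). (y, x, z)"])
       (auto simp: P_def F_def distinct_pairs_def triples_def sym)
  also have "sum F ?A5 = (\<Sum>(x, y, z)\<in>triples S. \<psi> x y * \<psi> y z)"
    by (rule sum.reindex_bij_witness[where i = "\<lambda>(x, y, z). ((x, y), (z, y))" and j = "\<lambda>((x, y), (z, u)). (x, y, z)"])
       (auto simp: P_def F_def distinct_pairs_def triples_def sym)
  also have "sum F ?A6 = (\<Sum>(x, y)\<in>P. (\<psi> x y)\<^sup>2)"
    by (rule sum.reindex_bij_witness[where i = "\<lambda>(x, y). ((x, y), (x, y))" and j = "\<lambda>((x, y), (z, u)). (x, y)"])
       (auto simp: P_def F_def distinct_pairs_def power2_eq_square)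
  also have "sum F ?A7 = (\<Sum>(x, y)\<in>P. (\<psi> x y)\<^sup>2)"
    by (rule sum.reindex_bij_witness[where i = "\<lambda>(x, y). ((x, y), (y, x))" and j = "\<lambda>((x, y), (z, u)). (x, y)"])
       (auto simp: P_def F_def distinct_pairs_def power2_eq_square sym)
  finally show ?thesis by (simp add: P_def)
qed

lemma sum_pairs_times_sum:
  fixes \<psi> :: "'a \<Rightarrow> 'a \<Rightarrow> real"
  assumes S: "finite S" and sym: "\<And>x y. \<psi> x y = \<psi> y x"
  shows "(\<Sum>(x, y)\<in>distinct_pairs S. \<psi> x y) * (\<Sum>x\<in>S. g x) =
    (\<Sum>(x, y, z)\<in>triples S. \<psi> x y * g z) + 2 * (\<Sum>(x, y)\<in>distinct_pairs S. \<psi> x y * g y)"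
proof -
  define P where "P = distinct_pairs S"
  define F where "F = (\<lambda>(p, z). \<psi> (fst p) (snd p) * g z)"
  have fin: "finite (P \<times> S)" using card_tuples_le(4)[OF S] S by (simp add: P_def)
  have part: "P \<times> S = {r\<in>P \<times> S. case r of ((x, y), z) \<Rightarrow> z \<noteq> x \<and> z \<noteq> y}
    \<union> ({r\<in>P \<times> S. case r of ((x, y), z) \<Rightarrow> z = y} \<union> {r\<in>P \<times> S. case r of ((x, y), z) \<Rightarrow> z = x})"
    (is "_ = ?A1 \<union> (?A2 \<union> ?A3)") by auto
  have fins: "finite ?A1" "finite ?A2" "finite ?A3"
    using fin by (auto intro: finite_subset[OF _ fin])
  have "(\<Sum>(x, y)\<in>P. \<psi> x y) * (\<Sum>x\<in>S. g x) = sum F (P \<times> S)"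
    unfolding sum_product sum.cartesian_product F_def by (simp add: case_prod_beta')
  also have "\<dots> = sum F ?A1 + (sum F ?A2 + sum F ?A3)"
    unfolding part[THEN arg_cong, of "sum F"]
    by (subst sum.union_disjoint, use fins in \<open>auto simp: P_def distinct_pairs_def\<close>)+
  also have "sum F ?A1 = (\<Sum>(x, y, z)\<in>triples S. \<psi> x y * g z)"
    by (rule sum.reindex_bij_witness[where i = "\<lambda>(x, y, z). ((x, y), z)" and j = "\<lambda>((x, y), z). (x, y, z)"])
       (auto simp: P_def F_def distinct_pairs_def triples_def)
  also have "sum F ?A2 = (\<Sum>(x, y)\<in>P. \<psi> x y * g y)"
    by (rule sum.reindex_bij_witness[where i = "\<lambda>(x, y). ((x, y), y)" and j = "\<lambda>((x, y), z). (x, y)"])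
       (auto simp: P_def F_def distinct_pairs_def)
  also have "sum F ?A3 = (\<Sum>(x, y)\<in>P. \<psi> x y * g y)"
    by (rule sum.reindex_bij_witness[where i = "\<lambda>(x, y). ((y, x), y)" and j = "\<lambda>((x, y), z). (y, x)"])
       (auto simp: P_def F_def distinct_pairs_def sym)
  finally show ?thesis by (simp add: P_def)
qed

lemma sum_sq_pairs:
  fixes g :: "'a \<Rightarrow> real"
  assumes S: "finite S"
  shows "(\<Sum>x\<in>S. g x)\<^sup>2 = (\<Sum>(x, y)\<in>distinct_pairs S. g x * g y) + (\<Sum>x\<in>S. (g x)\<^sup>2)"
proof -
  define F where "F = (\<lambda>(x, y). g x * g y)"
  have part: "S \<times> S = distinct_pairs S \<union> {r\<in>S \<times> S. fst r = snd r}" (is "_ = _ \<union> ?D")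
    by (auto simp: distinct_pairs_def)
  have "(\<Sum>x\<in>S. g x)\<^sup>2 = sum F (S \<times> S)"
    unfolding power2_eq_square sum_product sum.cartesian_product F_def by simp
  also have "\<dots> = sum F (distinct_pairs S) + sum F ?D"
    unfolding part[THEN arg_cong, of "sum F"]
    using S card_tuples_le(4)[OF S] by (subst sum.union_disjoint) (auto simp: distinct_pairs_def)
  also have "sum F ?D = (\<Sum>x\<in>S. (g x)\<^sup>2)"
    by (rule sum.reindex_bij_witness[where i = "\<lambda>x. (x, x)" and j = fst])
       (auto simp: F_def power2_eq_square)
  finally show ?thesis by (simp add: F_def)
qed

section \<open>Integration tools and the variance of linear statistics\<close>

lemma translate_preimage_borel:
  fixes D :: "'a::euclidean_space set"
  assumes "D \<in> sets borel"
  shows "{y. y - x \<in> D} \<in> sets borel"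
proof -
  have "{y. y - x \<in> D} = (\<lambda>y. y - x) -` D \<inter> space borel" by auto
  also have "\<dots> \<in> sets borel" using assms by (intro measurable_sets[of _ _ borel]) auto
  finally show ?thesis .
qed

lemma measure_translate_preimage:
  fixes D :: "'a::euclidean_space set"
  assumes [measurable]: "D \<in> sets borel"
  shows "measure lborel {y. y - x \<in> D} = measure lborel D"
proof -
  have [measurable]: "{y. y - x \<in> D} \<in> sets borel" by (rule translate_preimage_borel) fact
  have "emeasure lborel {y. y - x \<in> D} = (\<integral>\<^sup>+y. indicator {y. y - x \<in> D} y \<partial>lborel)" by simp
  also have "\<dots> = (\<integral>\<^sup>+y. indicator {y. y - x \<in> D} (x + 1 *\<^sub>R y) \<partial>lborel)"
    by (subst lborel_affine_nn_integral[of 1 _ x]) auto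
  also have "\<dots> = (\<integral>\<^sup>+y. indicator D y \<partial>lborel)" by (intro nn_integral_cong) (auto simp: indicator_def)
  also have "\<dots> = emeasure lborel D" by simp
  finally show ?thesis by (simp add: measure_def)
qed

lemma pair_integral_iterated:
  fixes m :: "'b::second_countable_topology measure" and m' :: "'c::second_countable_topology measure"
  assumes "finite_measure m" "finite_measure m'" "sets m = sets borel" "sets m' = sets borel"
    and f: "f \<in> borel_measurable borel" "\<And>p. \<bar>f p\<bar> \<le> (C::real)"
  shows "(LINT p|(m \<Otimes>\<^sub>M m'). f p) = (LINT x|m. (LINT y|m'. f (x, y)))"
    and "(LINT p|(m \<Otimes>\<^sub>M m'). f p) = (LINT y|m'. (LINT x|m. f (x, y)))"
    and "(\<lambda>x. LINT y|m'. f (x, y)) \<in> borel_measurable borel"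
proof -
  interpret m: finite_measure m by fact
  interpret m': finite_measure m' by fact
  interpret P: pair_sigma_finite m m' ..
  interpret mm: finite_measure "m \<Otimes>\<^sub>M m'" by (rule finite_measure_pair_measure; unfold_locales)
  have s: "sets (m \<Otimes>\<^sub>M m') = sets borel" by (rule sets_pair_borel) fact+
  have fm: "f \<in> borel_measurable (m \<Otimes>\<^sub>M m')" using f(1) by (subst measurable_cong_sets[OF s refl])
  have i: "integrable (m \<Otimes>\<^sub>M m') (case_prod (\<lambda>x y. f (x, y)))"
    using fm f(2) by (intro mm.integrable_const_bound[of _ C]) auto
  show 1: "(LINT p|(m \<Otimes>\<^sub>M m'). f p) = (LINT x|m. (LINT y|m'. f (x, y)))"
    using P.integral_fst[OF i] by simp
  show "(LINT p|(m \<Otimes>\<^sub>M m'). f p) = (LINT y|m'. (LINT x|m. f (x, y)))"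
    using P.integral_snd[OF i] by simp
  have "(\<lambda>x. LINT y|m'. f (x, y)) \<in> borel_measurable m"
    using fm by (intro m'.borel_measurable_lebesgue_integral) simp
  then show "(\<lambda>x. LINT y|m'. f (x, y)) \<in> borel_measurable borel"
    by (subst (asm) measurable_cong_sets[OF assms(3) refl])
qed

text \<open>No measurability is assumed: the integral of a non-integrable function is 0 by
  convention, and C is nonnegative.\<close>

lemma integral_abs_le:
  assumes "finite_measure m" "\<And>x. \<bar>f x\<bar> \<le> (C::real)"
  shows "\<bar>LINT x|m. f x\<bar> \<le> C * measure m (space m)"
proof (cases "integrable m f")
  case True
  interpret finite_measure m by fact
  have "\<bar>LINT x|m. f x\<bar> \<le> (LINT x|m. \<bar>f x\<bar>)" by (rule integral_abs_bound)
  also have "\<dots> \<le> (LINT x|m. C)" using True assms(2) by (intro integral_mono) auto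
  finally show ?thesis by (simp add: mult.commute)
next
  case False
  moreover have "0 \<le> C" using assms(2)[of undefined] by simp
  ultimately show ?thesis by (simp add: not_integrable_integral_eq)
qed

context window
begin

lemma m1_density: "m1 = density lborel (\<lambda>x. ennreal lam * indicator W x)"
proof (rule measure_eqI)
  fix A assume "A \<in> sets m1"
  then have A [measurable]: "A \<in> sets borel" by simp
  note [measurable] = W(1)
  have "emeasure m1 A = (\<integral>\<^sup>+\<omega>. ennreal (real (card (N \<omega> \<inter> (W \<inter> A)))) \<partial>M)"
    unfolding m1_def by (subst emeasure_mean_measure[OF fp1 A]) (simp add: Int_assoc)
  also have "\<dots> = ennreal lam * emeasure lborel (W \<inter> A)"
    using W by (intro mean_count) (auto intro: bounded_subset)
  also have "\<dots> = (\<integral>\<^sup>+x. ennreal lam * indicator (W \<inter> A) x \<partial>lborel)"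
    by (subst nn_integral_cmult_indicator) auto
  also have "\<dots> = emeasure (density lborel (\<lambda>x. ennreal lam * indicator W x)) A"
    by (subst emeasure_density) (auto intro!: nn_integral_cong simp: indicator_def)
  finally show "emeasure m1 A = emeasure (density lborel (\<lambda>x. ennreal lam * indicator W x)) A" .
qed simp

lemma integral_m1:
  assumes [measurable]: "f \<in> borel_measurable borel"
  shows "(LINT x|m1. f x) = lam * (LINT x|lborel. indicat_real W x * f x)"
proof -
  note [measurable] = W(1)
  have "m1 = density lborel (\<lambda>x. ennreal (lam * indicat_real W x))"
    unfolding m1_density using lam_pos by (intro arg_cong[where f = "density lborel"] ext) (auto simp: indicator_def)
  then have "(LINT x|m1. f x) = (LINT x|lborel. (lam * indicat_real W x) *\<^sub>R f x)"
    using lam_pos by (simp add: integral_density)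
  then show ?thesis by (simp add: mult.assoc)
qed

lemma measure_m1:
  assumes A [measurable]: "A \<in> sets borel"
  shows "measure m1 A = lam * measure lborel (W \<inter> A)"
proof -
  note [measurable] = W(1)
  have "measure m1 A = (LINT x|m1. indicat_real A x)" by simp
  also have "\<dots> = lam * (LINT x|lborel. indicat_real (W \<inter> A) x)"
    by (subst integral_m1) (simp_all add: indicator_inter_arith[abs_def])
  finally show ?thesis by simp
qed

lemma campbell_W:
  fixes F1 :: "'a \<Rightarrow> real"
  shows "F1 \<in> borel_measurable borel \<Longrightarrow> (\<And>x. \<bar>F1 x\<bar> \<le> C) \<Longrightarrow> integrable M (\<lambda>\<omega>. \<Sum>x\<in>N \<omega> \<inter> W. F1 x)
      \<and> (LINT \<omega>|M. (\<Sum>x\<in>N \<omega> \<inter> W. F1 x)) = (LINT x|m1. F1 x)"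
    and "F2 \<in> borel_measurable borel \<Longrightarrow> (\<And>x. \<bar>F2 x\<bar> \<le> C) \<Longrightarrow> integrable M (\<lambda>\<omega>. \<Sum>x\<in>distinct_pairs (N \<omega> \<inter> W). F2 x)
      \<and> (LINT \<omega>|M. (\<Sum>x\<in>distinct_pairs (N \<omega> \<inter> W). F2 x)) = (LINT x|m2. F2 x)"
    and "F3 \<in> borel_measurable borel \<Longrightarrow> (\<And>x. \<bar>F3 x\<bar> \<le> C) \<Longrightarrow> integrable M (\<lambda>\<omega>. \<Sum>x\<in>triples (N \<omega> \<inter> W). F3 x)
      \<and> (LINT \<omega>|M. (\<Sum>x\<in>triples (N \<omega> \<inter> W). F3 x)) = (LINT x|m3. F3 x)"
    and "F4 \<in> borel_measurable borel \<Longrightarrow> (\<And>x. \<bar>F4 x\<bar> \<le> C) \<Longrightarrow> integrable M (\<lambda>\<omega>. \<Sum>x\<in>quads (N \<omega> \<inter> W). F4 x)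
      \<and> (LINT \<omega>|M. (\<Sum>x\<in>quads (N \<omega> \<inter> W). F4 x)) = (LINT x|m4. F4 x)"
  using campbell[OF fp1 integrable_tuples_W(1), of F1 C] campbell[OF fp234(1) integrable_tuples_W(2), of F2 C]
    campbell[OF fp234(2) integrable_tuples_W(3), of F3 C] campbell[OF fp234(3) integrable_tuples_W(4), of F4 C]
  unfolding m1_def m2_def m3_def m4_def by blast+

text \<open>The sum over all ordered pairs does not change when every pair is reversed, so its mean
  measure is symmetric; \<open>m3_rotate\<close> is the analogue for cyclic shifts of
  triples.\<close>

lemma m2_swap:
  assumes "F \<in> borel_measurable borel" "\<And>p. \<bar>F p\<bar> \<le> (C::real)"
  shows "(LINT p|m2. F (snd p, fst p)) = (LINT p|m2. F p)"
proof -
  have "(\<Sum>p\<in>distinct_pairs S. F (snd p, fst p)) = (\<Sum>p\<in>distinct_pairs S. F p)" for S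
    by (rule sum.reindex_bij_witness[where i = "\<lambda>(x, y). (y, x)" and j = "\<lambda>(x, y). (y, x)"])
       (auto simp: distinct_pairs_def)
  moreover have "(\<lambda>p. F (snd p, fst p)) \<in> borel_measurable borel"
    by (rule measurable_compose[OF _ assms(1)]) measurable
  ultimately show ?thesis using campbell_W(2)[of "\<lambda>p. F (snd p, fst p)" C] campbell_W(2)[of F C] assms by auto
qed

lemma m3_rotate:
  assumes "F \<in> borel_measurable borel" "\<And>p. \<bar>F p\<bar> \<le> (C::real)"
  shows "(LINT p|m3. F (fst (snd p), snd (snd p), fst p)) = (LINT p|m3. F p)"
proof -
  have "(\<Sum>p\<in>triples S. F (fst (snd p), snd (snd p), fst p)) = (\<Sum>p\<in>triples S. F p)" for S
    by (rule sum.reindex_bij_witness[where i = "\<lambda>(x, y, z). (z, x, y)" and j = "\<lambda>(x, y, z). (y, z, x)"])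
       (auto simp: triples_def)
  moreover have "(\<lambda>p. F (fst (snd p), snd (snd p), fst p)) \<in> borel_measurable borel"
    by (rule measurable_compose[OF _ assms(1)]) measurable
  ultimately show ?thesis using campbell_W(3)[of "\<lambda>p. F (fst (snd p), snd (snd p), fst p)" C] campbell_W(3)[of F C] assms by auto
qed

text \<open>The variance is the second cumulant of g(x) g(y) plus the diagonal term, the integral of
  g^2. The support D is recorded for the sake of the boundary layer, where g is not small but the
  volume is.\<close>

lemma linear_variance:
  assumes g [measurable]: "g \<in> borel_measurable borel" and c: "\<And>x. \<bar>g x\<bar> \<le> c"
    and D [measurable]: "D \<in> sets borel" and supp: "\<And>x. g x \<noteq> 0 \<Longrightarrow> x \<in> D"
  defines "G \<equiv> \<lambda>\<omega>. \<Sum>x\<in>N \<omega> \<inter> W. g x"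
  shows "integrable M (\<lambda>\<omega>. (G \<omega>)\<^sup>2)" "integrable M G"
    "(LINT \<omega>|M. (G \<omega> - (LINT \<omega>|M. G \<omega>))\<^sup>2) \<le> (4 * lam * var2 + lam) * c\<^sup>2 * measure lborel (W \<inter> D)"
proof -
  have c0: "0 \<le> c" using c[of undefined] by simp
  have gg: "(\<lambda>p. g (fst p) * g (snd p)) \<in> borel_measurable borel" by measurable
  have ggb: "\<bar>g (fst p) * g (snd p)\<bar> \<le> c\<^sup>2" for p
    using c[of "fst p"] c[of "snd p"] c0 by (simp add: abs_mult power2_eq_square mult_mono)
  have g2b: "\<bar>(g x)\<^sup>2\<bar> \<le> c\<^sup>2" for x using power_mono[OF c[of x], of 2] by simp
  have sq: "(G \<omega>)\<^sup>2 = (\<Sum>p\<in>distinct_pairs (N \<omega> \<inter> W). g (fst p) * g (snd p)) + (\<Sum>x\<in>N \<omega> \<inter> W. (g x)\<^sup>2)" if "\<omega> \<in> space M" for \<omega>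
    unfolding G_def by (subst sum_sq_pairs[OF finite_processD(1)[OF fp1 that]]) (simp add: case_prod_beta')
  note c1 = campbell_W(1)[OF g c] and c11 = campbell_W(2)[OF gg ggb] and c2 = campbell_W(1)[OF _ g2b]
  show iG: "integrable M G" unfolding G_def using c1 by simp
  have EG: "(LINT \<omega>|M. G \<omega>) = (LINT x|m1. g x)" unfolding G_def using c1 by simp
  show iG2: "integrable M (\<lambda>\<omega>. (G \<omega>)\<^sup>2)"
    using c11 c2 by (subst Bochner_Integration.integrable_cong[OF refl sq]) auto
  have EG2: "(LINT \<omega>|M. (G \<omega>)\<^sup>2) = (LINT p|m2. g (fst p) * g (snd p)) + (LINT x|m1. (g x)\<^sup>2)"
    using c11 c2 by (subst Bochner_Integration.integral_cong[OF refl sq]) auto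
  have "(LINT p|m11. g (fst p) * g (snd p)) = (LINT x|m1. g x)\<^sup>2"
    by (subst pair_integral_iterated(1)[OF m1.finite_measure_axioms m1.finite_measure_axioms sets_m(1) sets_m(1) gg ggb])
       (simp add: power2_eq_square)
  then have "(LINT \<omega>|M. (G \<omega>)\<^sup>2) - (LINT \<omega>|M. G \<omega>)\<^sup>2 = cum2 (\<lambda>p. g (fst p) * g (snd p)) + (LINT x|m1. (g x)\<^sup>2)"
    unfolding EG2 EG cum2_def by simp
  also have "(LINT x|m1. (g x)\<^sup>2) \<le> (LINT x|m1. c\<^sup>2 * indicat_real D x)"
  proof (rule integral_mono)
    show "integrable m1 (\<lambda>x. (g x)\<^sup>2)" using g2b by (intro m1.integrable_const_bound[of _ "c\<^sup>2"]) auto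
    show "integrable m1 (\<lambda>x. c\<^sup>2 * indicat_real D x)" by (intro m1.integrable_const_bound[of _ "c\<^sup>2"]) (auto simp: indicator_def)
    show "(g x)\<^sup>2 \<le> c\<^sup>2 * indicat_real D x" for x using g2b[of x] supp[of x] by (cases "g x = 0") (auto simp: indicator_def)
  qed
  also have "(LINT x|m1. c\<^sup>2 * indicat_real D x) = c\<^sup>2 * (lam * measure lborel (W \<inter> D))"
    using measure_m1[OF D] by simp
  also have "cum2 (\<lambda>p. g (fst p) * g (snd p)) \<le> 4 * c\<^sup>2 * (lam * (var2 * measure lborel (W \<inter> D)))"
    using cum2_bound[OF gg ggb D] supp by (simp add: abs_le_iff)
  finally have "(LINT \<omega>|M. (G \<omega>)\<^sup>2) - (LINT \<omega>|M. G \<omega>)\<^sup>2 \<le> (4 * lam * var2 + lam) * c\<^sup>2 * measure lborel (W \<inter> D)"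
    by (simp add: algebra_simps)
  then show "(LINT \<omega>|M. (G \<omega> - (LINT \<omega>|M. G \<omega>))\<^sup>2) \<le> (4 * lam * var2 + lam) * c\<^sup>2 * measure lborel (W \<inter> D)"
    using variance_eq[OF iG iG2] by simp
qed

end

text \<open>\<psi> is an arbitrary bounded symmetric kernel; confining the differences y - x to D
  means that integrating out one argument costs a factor |D| and not |W|.\<close>

locale pair_statistic = window M N W for M :: "'w measure" and N :: "'w \<Rightarrow> 'a::euclidean_space set" and W +
  fixes \<psi> :: "'a \<Rightarrow> 'a \<Rightarrow> real" and C :: real and D :: "'a set"
  assumes \<psi>: "(\<lambda>p. \<psi> (fst p) (snd p)) \<in> borel_measurable borel" and sym: "\<And>x y. \<psi> x y = \<psi> y x"
    and C: "\<And>x y. \<bar>\<psi> x y\<bar> \<le> C"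
    and D [measurable]: "D \<in> sets borel" and Db: "bounded D" and supp: "\<And>x y. \<psi> x y \<noteq> 0 \<Longrightarrow> y - x \<in> D"
begin

lemma \<psi>_measurable [measurable (raw)]:
  assumes "a \<in> L \<rightarrow>\<^sub>M borel" "b \<in> L \<rightarrow>\<^sub>M borel"
  shows "(\<lambda>x. \<psi> (a x) (b x)) \<in> borel_measurable L"
  using measurable_compose[OF borel_measurable_Pair[OF assms] \<psi>] by simp

definition g where "g x = (LINT y|m1. \<psi> x y)"
definition U where "U \<omega> = (\<Sum>(x, y)\<in>distinct_pairs (N \<omega> \<inter> W). \<psi> x y)"
definition G where "G \<omega> = (\<Sum>x\<in>N \<omega> \<inter> W. g x)"
text \<open>The coefficients collected in \<open>degenerate_variance\<close>: \<open>var4\<close>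
  stems from \<open>f4\<close>, the square of \<open>var2\<close> from \<open>h\<close>,
  \<open>var3\<close> from \<open>f3\<close>, \<open>16 * lam\<^sup>2 * var2\<close> from
  \<open>q\<close>, and the last two summands from the diagonal term with the square of
  \<psi>.\<close>

definition const where "const = 4 * lam * var4 + 32 * lam\<^sup>2 * var2\<^sup>2 + 16 * lam * var3 + 16 * lam\<^sup>2 * var2 + 8 * lam * var2 + 2 * lam\<^sup>2"

lemma C0: "0 \<le> C" using C[of undefined undefined] by simp

lemma preimage_D [measurable]: "{y. y - x \<in> D} \<in> sets borel"
  by (rule translate_preimage_borel[OF D])

lemma W_inter_D: "measure lborel (W \<inter> {y. y - x \<in> D}) \<le> measure lborel D"
proof -
  have "bounded {y. y - x \<in> D}"
    by (rule bounded_subset[OF bounded_translation[OF Db, of x]]) (force simp: image_iff)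
  then have "emeasure lborel {y. y - x \<in> D} < \<infinity>" by (rule emeasure_bounded_finite)
  then have "measure lborel (W \<inter> {y. y - x \<in> D}) \<le> measure lborel {y. y - x \<in> D}"
    using W by (intro measure_mono_fmeasurable fmeasurableI) auto
  also have "\<dots> = measure lborel D" by (rule measure_translate_preimage) simp
  finally show ?thesis .
qed

lemma g_measurable [measurable]: "g \<in> borel_measurable borel"
  unfolding g_def
  using pair_integral_iterated(3)[OF m1.finite_measure_axioms m1.finite_measure_axioms sets_m(1) sets_m(1) \<psi> C] by simp

text \<open>The support in a translate of D replaces the volume of W by that of D, uniformly in
  x.\<close>

lemma integral_supp_bound:
  assumes f: "\<And>y. \<bar>f y\<bar> \<le> c" "\<And>y. f y \<noteq> 0 \<Longrightarrow> y - x \<in> D" and [measurable]: "f \<in> borel_measurable borel"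
  shows "\<bar>LINT y|m1. f y\<bar> \<le> c * (lam * measure lborel D)"
proof -
  have c0: "0 \<le> c" using f(1)[of undefined] by simp
  have "\<bar>LINT y|m1. f y\<bar> \<le> (LINT y|m1. \<bar>f y\<bar>)" by (rule integral_abs_bound)
  also have "\<dots> \<le> (LINT y|m1. c * indicat_real {y. y - x \<in> D} y)"
  proof (rule integral_mono)
    show "integrable m1 (\<lambda>y. \<bar>f y\<bar>)" using f by (intro m1.integrable_const_bound[of _ c]) auto
    show "integrable m1 (\<lambda>y. c * indicat_real {y. y - x \<in> D} y)"
      using c0 by (intro m1.integrable_const_bound[of _ c]) (auto simp: indicator_def)
    show "\<bar>f y\<bar> \<le> c * indicat_real {y. y - x \<in> D} y" for y
      using f(1)[of y] f(2)[of y] by (cases "f y = 0") (auto simp: indicator_def c0)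
  qed
  also have "\<dots> = c * (lam * measure lborel (W \<inter> {y. y - x \<in> D}))"
    using measure_m1[OF preimage_D] by simp
  also have "\<dots> \<le> c * (lam * measure lborel D)"
    using W_inter_D lam_pos c0 by (intro mult_left_mono) auto
  finally show ?thesis .
qed

lemma g_bound: "\<bar>g x\<bar> \<le> C * (lam * measure lborel D)"
  unfolding g_def using C supp by (intro integral_supp_bound[where x = x]) auto

end

section \<open>Expansion of the variance into cumulant functionals\<close>

context pair_statistic
begin

text \<open>\<open>f4\<close> belongs to two pairs without a common point and \<open>f3\<close> to
  two pairs sharing the middle point; in \<open>q\<close> the shared point is integrated against the
  mean measure.\<close>

definition f4 where "f4 p = \<psi> (fst p) (fst (snd p)) * \<psi> (fst (snd (snd p))) (snd (snd (snd p)))"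
definition f3 where "f3 p = \<psi> (fst p) (fst (snd p)) * \<psi> (fst (snd p)) (snd (snd p))"
definition q where "q p = (LINT c|m1. \<psi> (fst p) c * \<psi> c (snd p))"
text \<open>The second points of two pairs are linked by the second cumulant while their first
  points are held fixed. Applying \<open>cum2\<close> to \<open>h\<close> links the first points as
  well: this is the contribution of two 2-blocks running across the pairs.\<close>

definition h where "h p = cum2 (\<lambda>r. \<psi> (fst p) (fst r) * \<psi> (snd p) (snd r))"

lemma \<psi>\<psi>: "\<bar>\<psi> a b * \<psi> c d\<bar> \<le> C\<^sup>2"
  using mult_mono[OF C[of a b] C[of c d] C0] by (simp add: abs_mult power2_eq_square)

lemma measurable_f [measurable]: "f4 \<in> borel_measurable borel" "f3 \<in> borel_measurable borel"
  unfolding f4_def f3_def by measurable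

definition Cg where "Cg = C * (lam * measure lborel D)"

lemma Cg0: "0 \<le> Cg" using lam_pos C0 by (simp add: Cg_def)

lemma g_le: "\<bar>g x\<bar> \<le> Cg" using g_bound by (simp add: Cg_def)

lemma \<psi>g: "\<bar>\<psi> a b * g c\<bar> \<le> C * Cg" "\<bar>g a * g b\<bar> \<le> Cg * Cg"
  using mult_mono[OF C[of a b] g_le[of c] C0] mult_mono[OF g_le[of a] g_le[of b] Cg0] by (simp_all add: abs_mult)

lemmas fin = m1.finite_measure_axioms m2.finite_measure_axioms m3.finite_measure_axioms m11.finite_measure_axioms
  m111.finite_measure_axioms

lemma g_swap: "(LINT y|m1. \<psi> y x) = g x"
  unfolding g_def by (rule Bochner_Integration.integral_cong[OF refl]) (rule sym)

definition I2 where "I2 = (LINT p|m2. \<psi> (fst p) (snd p))"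
definition I0 where "I0 = (LINT x|m1. g x)"
definition I3g where "I3g = (LINT p|m3. \<psi> (fst p) (fst (snd p)) * g (snd (snd p)))"
definition Igg where "Igg = (LINT p|m2. g (fst p) * g (snd p))"
definition Ipg where "Ipg = (LINT p|m2. \<psi> (fst p) (snd p) * g (snd p))"
definition Ig2 where "Ig2 = (LINT x|m1. (g x)\<^sup>2)"
definition X where "X = (LINT p|m2. (LINT r|m2. \<psi> (fst p) (fst r) * \<psi> (snd p) (snd r)))"

lemma I11: "(LINT p|m11. \<psi> (fst p) (snd p)) = I0"
  unfolding I0_def g_def
  by (subst pair_integral_iterated(1)[OF fin(1) fin(1) sets_m(1) sets_m(1) \<psi> C]) simp

lemma m31_iterated:
  assumes "f \<in> borel_measurable borel" "\<And>p. \<bar>f p\<bar> \<le> (K::real)"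
  shows "(LINT p|m31. f p) = (LINT x|m3. (LINT y|m1. f (x, y)))"
  by (rule pair_integral_iterated(1)[OF fin(3) fin(1) sets_m(3) sets_m(1) assms])

lemma m21_iterated:
  assumes "f \<in> borel_measurable borel" "\<And>p. \<bar>f p\<bar> \<le> (K::real)"
  shows "(LINT p|m21. f p) = (LINT x|m2. (LINT y|m1. f (x, y)))"
  by (rule pair_integral_iterated(1)[OF fin(2) fin(1) sets_m(2) sets_m(1) assms])

lemma m22_iterated:
  assumes "f \<in> borel_measurable borel" "\<And>p. \<bar>f p\<bar> \<le> (K::real)"
  shows "(LINT p|m22. f p) = (LINT x|m2. (LINT y|m2. f (x, y)))"
  by (rule pair_integral_iterated(1)[OF fin(2) fin(2) sets_m(2) sets_m(2) assms])

lemma m211_iterated: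
  assumes f: "f \<in> borel_measurable borel" "\<And>p. \<bar>f p\<bar> \<le> (K::real)"
  shows "(LINT p|m211. f p) = (LINT x|m2. (LINT y|m1. (LINT z|m1. f (x, y, z))))"
proof -
  have "(LINT r|m11. f (x, r)) = (LINT y|m1. (LINT z|m1. f (x, y, z)))" for x
    by (rule pair_integral_iterated(1)[OF fin(1) fin(1) sets_m(1) sets_m(1)])
       (auto intro!: measurable_compose[OF _ f(1)] f(2))
  then show ?thesis
    using pair_integral_iterated(1)[OF fin(2) fin(4) sets_m(2) sets_mm(1) f] by simp
qed

lemma m111_iterated:
  assumes f: "f \<in> borel_measurable borel" "\<And>p. \<bar>f p\<bar> \<le> (K::real)"
  shows "(LINT p|m111. f p) = (LINT x|m1. (LINT y|m1. (LINT z|m1. f (x, y, z))))"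
proof -
  have "(LINT r|m11. f (x, r)) = (LINT y|m1. (LINT z|m1. f (x, y, z)))" for x
    by (rule pair_integral_iterated(1)[OF fin(1) fin(1) sets_m(1) sets_m(1)])
       (auto intro!: measurable_compose[OF _ f(1)] f(2))
  then show ?thesis
    using pair_integral_iterated(1)[OF fin(1) fin(4) sets_m(1) sets_mm(1) f] by simp
qed

lemma m1111_iterated:
  assumes f: "f \<in> borel_measurable borel" "\<And>p. \<bar>f p\<bar> \<le> (K::real)"
  shows "(LINT p|m1111. f p) = (LINT x|m1. (LINT y|m1. (LINT z|m1. (LINT u|m1. f (x, y, z, u)))))"
proof -
  have "(LINT r|m111. f (x, r)) = (LINT y|m1. (LINT z|m1. (LINT u|m1. f (x, y, z, u))))" for x
    by (rule m111_iterated) (auto intro!: measurable_compose[OF _ f(1)] f(2))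
  then show ?thesis
    using pair_integral_iterated(1)[OF fin(1) fin(5) sets_m(1) sets_mm(2) f] by simp
qed

lemma q_measurable [measurable]: "q \<in> borel_measurable borel"
  unfolding q_def
  using pair_integral_iterated(3)[OF fin(2) fin(1) sets_m(2) sets_m(1), of "\<lambda>r. \<psi> (fst (fst r)) (snd r) * \<psi> (snd r) (snd (fst r))" "C\<^sup>2"] \<psi>\<psi>
  by simp

lemma inner2_measurable [measurable]:
  "(\<lambda>p. LINT r|m2. \<psi> (fst p) (fst r) * \<psi> (snd p) (snd r)) \<in> borel_measurable borel"
  using pair_integral_iterated(3)[OF fin(2) fin(2) sets_m(2) sets_m(2), of "\<lambda>r. \<psi> (fst (fst r)) (fst (snd r)) * \<psi> (snd (fst r)) (snd (snd r))" "C\<^sup>2"] \<psi>\<psi>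
  by simp

lemma inner2_bound: "\<bar>LINT r|m2. \<psi> (fst p) (fst r) * \<psi> (snd p) (snd r)\<bar> \<le> C\<^sup>2 * measure m2 UNIV"
  using integral_abs_le[OF fin(2) \<psi>\<psi>] by simp

lemma q_bound: "\<bar>q p\<bar> \<le> C\<^sup>2 * (lam * measure lborel D)"
  unfolding q_def using supp
  by (intro integral_supp_bound[where x = "fst p"]) (auto intro: \<psi>\<psi>)

lemma m11_inner: "(LINT r|m11. \<psi> a (fst r) * \<psi> b (snd r)) = g a * g b"
proof -
  have "(LINT r|m11. \<psi> a (fst r) * \<psi> b (snd r)) = (LINT y|m1. (LINT z|m1. \<psi> a y * \<psi> b z))"
    by (subst pair_integral_iterated(1)[OF fin(1) fin(1) sets_m(1) sets_m(1), where C = "C\<^sup>2"]) (auto intro: \<psi>\<psi>)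
  then show ?thesis by (simp add: g_def)
qed

lemma h_eq: "h p = (LINT r|m2. \<psi> (fst p) (fst r) * \<psi> (snd p) (snd r)) - g (fst p) * g (snd p)"
  unfolding h_def cum2_def m11_inner ..

lemma h_measurable [measurable]: "h \<in> borel_measurable borel"
  unfolding h_eq[abs_def] by measurable

text \<open>The base point is confined to a translate of D and the other point is absorbed by the
  total variation, so only one factor |D| appears where the product g(a) g(b) has two.\<close>

lemma h_bound: "\<bar>h p\<bar> \<le> 4 * C\<^sup>2 * (lam * (var2 * measure lborel D))"
proof -
  have "\<bar>h p\<bar> \<le> 4 * C\<^sup>2 * (lam * (var2 * measure lborel (W \<inter> {y. y - snd p \<in> D})))"
    unfolding h_def using supp by (intro cum2_bound) (auto intro: \<psi>\<psi> preimage_D)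
  also have "\<dots> \<le> 4 * C\<^sup>2 * (lam * (var2 * measure lborel D))"
    using W_inter_D lam_pos by (intro mult_left_mono) (auto simp: var2_def)
  finally show ?thesis .
qed

text \<open>By \<open>h_eq\<close>, \<open>h\<close> is a moment part minus g(a) g(b). Integrating
  the moment part over independent first points exchanges the roles of the two arguments, by
  symmetry of \<psi>, and produces \<open>Igg\<close> once more; hence the coefficient 2.\<close>

lemma cum2_h: "cum2 h = X - 2 * Igg + I0\<^sup>2"
proof -
  let ?A = "\<lambda>p. LINT r|m2. \<psi> (fst p) (fst r) * \<psi> (snd p) (snd r)"
  have iA: "integrable m2 ?A" "integrable m11 ?A"
    using inner2_bound inner2_measurable
    by (auto intro!: m2.integrable_const_bound[of _ "C\<^sup>2 * measure m2 UNIV"] m11.integrable_const_bound[of _ "C\<^sup>2 * measure m2 UNIV"])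
  have iB: "integrable m2 (\<lambda>p. g (fst p) * g (snd p))" "integrable m11 (\<lambda>p. g (fst p) * g (snd p))"
    using \<psi>g(2) by (auto intro!: m2.integrable_const_bound[of _ "Cg * Cg"] m11.integrable_const_bound[of _ "Cg * Cg"])
  have "(LINT p|m2. h p) = X - Igg"
    unfolding h_eq X_def Igg_def using iA iB by simp
  moreover have "(LINT p|m11. h p) = Igg - I0\<^sup>2"
  proof -
    have "(LINT p|m11. ?A p) = (LINT r|m2. (LINT p|m11. \<psi> (fst p) (fst r) * \<psi> (snd p) (snd r)))"
      using pair_integral_iterated[OF fin(4) fin(2) sets_mm(1) sets_m(2), of "\<lambda>s. \<psi> (fst (fst s)) (fst (snd s)) * \<psi> (snd (fst s)) (snd (snd s))" "C\<^sup>2"] \<psi>\<psi>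
      by simp
    also have "\<dots> = (LINT r|m2. g (fst r) * g (snd r))"
    proof -
      have "\<psi> (fst p) (fst r) * \<psi> (snd p) (snd r) = \<psi> (fst r) (fst p) * \<psi> (snd r) (snd p)" for p r
        by (simp only: sym[of "fst p"] sym[of "snd p"])
      then show ?thesis by (simp only: m11_inner)
    qed
    finally have 1: "(LINT p|m11. ?A p) = Igg" by (simp add: Igg_def)
    have "(LINT p|m11. g (fst p) * g (snd p)) = (LINT x|m1. (LINT y|m1. g x * g y))"
      by (subst pair_integral_iterated(1)[OF fin(1) fin(1) sets_m(1) sets_m(1), where C = "Cg * Cg"]) (auto intro: \<psi>g(2))
    also have "\<dots> = I0\<^sup>2" by (simp add: I0_def power2_eq_square)
    finally show ?thesis unfolding h_eq using 1 iA iB by simp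
  qed
  ultimately show ?thesis by (simp add: cum2_def)
qed

lemma cum2_q: "cum2 q = (LINT p|m2. q p) - Ig2"
proof -
  have "(LINT p|m11. q p) = (LINT c|m1. (LINT p|m11. \<psi> (fst p) c * \<psi> c (snd p)))"
    unfolding q_def
    using pair_integral_iterated[OF fin(4) fin(1) sets_mm(1) sets_m(1), of "\<lambda>s. \<psi> (fst (fst s)) (snd s) * \<psi> (snd s) (snd (fst s))" "C\<^sup>2"] \<psi>\<psi>
    by simp
  also have "\<dots> = (LINT c|m1. g c * g c)"
  proof -
    have "\<psi> (fst p) c * \<psi> c (snd p) = \<psi> c (fst p) * \<psi> c (snd p)" for p c by (simp only: sym[of "fst p"])
    then show ?thesis by (simp only: m11_inner)
  qed
  finally show ?thesis by (simp add: cum2_def Ig2_def power2_eq_square)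
qed

text \<open>Detaching an outer point leaves \<psi> times g, in two mirror images that agree by
  \<open>m2_swap\<close>; detaching the middle point leaves \<open>q\<close>; detaching all points
  leaves the integral of g^2.\<close>

lemma cum3_f3: "cum3 f3 = (LINT p|m3. f3 p) - 2 * Ipg - (LINT p|m2. q p) + 2 * Ig2"
proof -
  have b: "\<bar>f3 p\<bar> \<le> C\<^sup>2" for p unfolding f3_def by (rule \<psi>\<psi>)
  have 1: "(LINT p|m21. f3 (fst (fst p), snd (fst p), snd p)) = Ipg"
    by (subst m21_iterated[where K = "C\<^sup>2"]) (auto intro: b \<psi>\<psi> simp: f3_def Ipg_def g_def)
  have 2: "(LINT p|m21. f3 (fst (fst p), snd p, snd (fst p))) = (LINT p|m2. q p)"
    by (subst m21_iterated[where K = "C\<^sup>2"]) (auto intro: b \<psi>\<psi> simp: f3_def q_def[abs_def])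
  have sw: "\<psi> (fst p) (snd p) = \<psi> (snd p) (fst p)" for p by (rule sym)
  have "(LINT p|m21. f3 (snd p, fst (fst p), snd (fst p))) = (LINT p|m2. \<psi> (fst p) (snd p) * g (fst p))"
    by (subst m21_iterated[where K = "C\<^sup>2"]) (auto intro: b \<psi>\<psi> simp: f3_def g_swap mult.commute)
  also have "\<dots> = (LINT p|m2. \<psi> (snd p) (fst p) * g (fst p))" unfolding sw ..
  also have "\<dots> = Ipg"
    unfolding Ipg_def using m2_swap[of "\<lambda>p. \<psi> (fst p) (snd p) * g (snd p)", OF _ \<psi>g(1)] by simp
  finally have 3: "(LINT p|m21. f3 (snd p, fst (fst p), snd (fst p))) = Ipg" .
  have "(LINT p|m111. f3 p) = (LINT x|m1. (LINT y|m1. \<psi> x y * g y))"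
    by (subst m111_iterated[OF _ b]) (auto simp: f3_def g_def)
  also have "\<dots> = (LINT y|m1. (LINT x|m1. \<psi> x y * g y))"
    using pair_integral_iterated(1,2)[OF fin(1) fin(1) sets_m(1) sets_m(1), of "\<lambda>p. \<psi> (fst p) (snd p) * g (snd p)", OF _ \<psi>g(1)] by simp
  also have "\<dots> = Ig2" by (simp add: g_swap Ig2_def power2_eq_square)
  finally have 4: "(LINT p|m111. f3 p) = Ig2" .
  show ?thesis unfolding cum3_def 1 2 3 4 by simp
qed

lemma I3g_rotate: "(LINT p|m3. \<psi> (fst (snd p)) (snd (snd p)) * g (fst p)) = I3g"
  unfolding I3g_def using m3_rotate[of "\<lambda>p. \<psi> (fst p) (fst (snd p)) * g (snd (snd p))", OF _ \<psi>g(1)] by simp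

text \<open>By the symmetries of \<psi> and of the moment measures the fourteen lower-order
  integrals take few values. One detached point always gives \<open>I3g\<close>. Two 2-blocks give
  the square of \<open>I2\<close> if they are the pairs themselves and \<open>X\<close> if they run
  across. One 2-block with two single points gives the product of \<open>I2\<close> and
  \<open>I0\<close>, or \<open>Igg\<close>, by the same distinction, and four single points give the
  square of \<open>I0\<close>.\<close>

lemma cum4_f4: "cum4 f4 = (LINT p|m4. f4 p) - 4 * I3g - I2\<^sup>2 - 2 * X + 4 * I2 * I0 + 8 * Igg - 6 * I0\<^sup>2"
proof -
  have b: "\<bar>f4 p\<bar> \<le> C\<^sup>2" for p unfolding f4_def by (rule \<psi>\<psi>)
  have e23: "f4 (a, c, d, b) = \<psi> a c * \<psi> b d" for a b c d by (simp add: f4_def sym[of d])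
  have 31: "(LINT p|m31. f4 (fst (fst p), fst (snd (fst p)), snd (snd (fst p)), snd p)) = I3g"
    by (subst m31_iterated[where K = "C\<^sup>2"]) (auto intro: b \<psi>\<psi> simp: f4_def I3g_def g_def)
  have 32: "(LINT p|m31. f4 (fst (fst p), fst (snd (fst p)), snd p, snd (snd (fst p)))) = I3g"
    by (subst m31_iterated[where K = "C\<^sup>2"]) (auto intro: b \<psi>\<psi> simp: f4_def I3g_def g_swap)
  have 33: "(LINT p|m31. f4 (fst (fst p), snd p, fst (snd (fst p)), snd (snd (fst p)))) = I3g"
    by (subst m31_iterated[where K = "C\<^sup>2"]) (auto intro: b \<psi>\<psi> simp: f4_def I3g_rotate[symmetric] g_def mult.commute)
  have 34: "(LINT p|m31. f4 (snd p, fst (fst p), fst (snd (fst p)), snd (snd (fst p)))) = I3g"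
    by (subst m31_iterated[where K = "C\<^sup>2"]) (auto intro: b \<psi>\<psi> simp: f4_def I3g_rotate[symmetric] g_swap mult.commute)
  have 21: "(LINT p|m22. f4 (fst (fst p), snd (fst p), fst (snd p), snd (snd p))) = I2\<^sup>2"
    by (subst m22_iterated[where K = "C\<^sup>2"]) (auto intro: b \<psi>\<psi> simp: f4_def I2_def power2_eq_square[of "LINT p|m2. _ p"])
  have 22: "(LINT p|m22. f4 (fst (fst p), fst (snd p), snd (fst p), snd (snd p))) = X"
    by (subst m22_iterated[where K = "C\<^sup>2"]) (auto intro: b \<psi>\<psi> simp: f4_def X_def)
  have 23: "(LINT p|m22. f4 (fst (fst p), fst (snd p), snd (snd p), snd (fst p))) = X"
    by (subst m22_iterated[where K = "C\<^sup>2"]) (auto intro: b \<psi>\<psi> simp: X_def e23)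
  have 41: "(LINT p|m211. f4 (fst (fst p), snd (fst p), fst (snd p), snd (snd p))) = I2 * I0"
    by (subst m211_iterated[where K = "C\<^sup>2"]) (auto intro: b \<psi>\<psi> simp: f4_def I2_def I0_def g_def)
  have 42: "(LINT p|m211. f4 (fst (fst p), fst (snd p), snd (fst p), snd (snd p))) = Igg"
    by (subst m211_iterated[where K = "C\<^sup>2"]) (auto intro: b \<psi>\<psi> simp: f4_def Igg_def g_def)
  have 43: "(LINT p|m211. f4 (fst (fst p), fst (snd p), snd (snd p), snd (fst p))) = Igg"
    by (subst m211_iterated[where K = "C\<^sup>2"]) (auto intro: b \<psi>\<psi> simp: f4_def Igg_def g_swap, simp add: g_def)
  have 44: "(LINT p|m211. f4 (fst (snd p), fst (fst p), snd (fst p), snd (snd p))) = Igg"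
    by (subst m211_iterated[where K = "C\<^sup>2"]) (auto intro: b \<psi>\<psi> simp: f4_def Igg_def g_def[symmetric] g_swap)
  have 45: "(LINT p|m211. f4 (fst (snd p), fst (fst p), snd (snd p), snd (fst p))) = Igg"
    by (subst m211_iterated[where K = "C\<^sup>2"]) (auto intro: b \<psi>\<psi> simp: f4_def Igg_def g_swap)
  have 46: "(LINT p|m211. f4 (fst (snd p), snd (snd p), fst (fst p), snd (fst p))) = I2 * I0"
    by (subst m211_iterated[where K = "C\<^sup>2"]) (auto intro: b \<psi>\<psi> simp: f4_def I2_def I0_def g_def)
  have 1: "(LINT p|m1111. f4 p) = I0\<^sup>2"
    by (subst m1111_iterated[OF _ b]) (auto simp: f4_def I0_def g_def power2_eq_square)
  show ?thesis unfolding cum4_def 31 32 33 34 21 22 23 41 42 43 44 45 46 1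
    by (simp add: algebra_simps)
qed

text \<open>The moment measure is the cumulant plus the product measure. The first is bounded by the
  total variation, for the second the inner integral extends over a translate of D.\<close>

lemma I2_sq: "(LINT p|m2. (\<psi> (fst p) (snd p))\<^sup>2) \<le> C\<^sup>2 * measure lborel W * (4 * lam * var2 + lam\<^sup>2 * measure lborel D)"
proof -
  have b: "\<bar>(\<psi> (fst p) (snd p))\<^sup>2\<bar> \<le> C\<^sup>2" for p using \<psi>\<psi>[of "fst p" "snd p" "fst p" "snd p"] by (simp add: power2_eq_square)
  have "cum2 (\<lambda>p. (\<psi> (fst p) (snd p))\<^sup>2) \<le> 4 * C\<^sup>2 * (lam * (var2 * measure lborel W))"
    using cum2_bound[OF _ b, where D = UNIV] by (simp add: abs_le_iff)
  moreover have "(LINT p|m11. (\<psi> (fst p) (snd p))\<^sup>2) \<le> C\<^sup>2 * (lam * measure lborel D) * (lam * measure lborel W)"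
  proof -
    have "(LINT p|m11. (\<psi> (fst p) (snd p))\<^sup>2) = (LINT x|m1. (LINT y|m1. (\<psi> x y)\<^sup>2))"
      by (subst pair_integral_iterated(1)[OF fin(1) fin(1) sets_m(1) sets_m(1) _ b]) auto
    also have "\<dots> \<le> C\<^sup>2 * (lam * measure lborel D) * measure m1 (space m1)"
    proof (rule order_trans[OF abs_ge_self integral_abs_le[OF fin(1)]])
      fix x
      show "\<bar>LINT y|m1. (\<psi> x y)\<^sup>2\<bar> \<le> C\<^sup>2 * (lam * measure lborel D)"
        using supp b[of "(x, _)"] by (intro integral_supp_bound[where x = x]) auto
    qed
    finally show ?thesis using measure_m1[of UNIV] by simp
  qed
  ultimately show ?thesis by (simp add: cum2_def algebra_simps power2_eq_square)
qed

text \<open>The variance of \<open>U\<close> itself contains a term of order \<open>C\<^sup>2 |W| |D|\<^sup>2\<close>, which subtracting \<open>2 G\<close> removes.\<close>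

theorem degenerate_variance:
  defines "Y \<equiv> \<lambda>\<omega>. U \<omega> - 2 * G \<omega>"
  shows "integrable M Y" "integrable M (\<lambda>\<omega>. (Y \<omega>)\<^sup>2)"
    "(LINT \<omega>|M. (Y \<omega> - (LINT \<omega>|M. Y \<omega>))\<^sup>2) \<le> const * C\<^sup>2 * measure lborel W * (1 + measure lborel D)"
proof -
  have m: "(\<lambda>p. \<psi> (fst p) (fst (snd p)) * g (snd (snd p))) \<in> borel_measurable borel"
    "(\<lambda>p. \<psi> (fst p) (snd p) * g (snd p)) \<in> borel_measurable borel"
    "(\<lambda>p. g (fst p) * g (snd p)) \<in> borel_measurable borel"
    "(\<lambda>p. (\<psi> (fst p) (snd p))\<^sup>2) \<in> borel_measurable borel"
    "(\<lambda>x. (g x)\<^sup>2) \<in> borel_measurable borel" by measurable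
  have b: "\<bar>f4 p\<bar> \<le> C\<^sup>2" "\<bar>f3 r\<bar> \<le> C\<^sup>2" "\<bar>(\<psi> a d)\<^sup>2\<bar> \<le> C\<^sup>2" for p r a d
  proof -
    show "\<bar>f4 p\<bar> \<le> C\<^sup>2" "\<bar>f3 r\<bar> \<le> C\<^sup>2" unfolding f4_def f3_def by (rule \<psi>\<psi>)+
    show "\<bar>(\<psi> a d)\<^sup>2\<bar> \<le> C\<^sup>2" using \<psi>\<psi>[of a d a d] by (simp add: power2_eq_square)
  qed
  have bg: "\<bar>(g x)\<^sup>2\<bar> \<le> Cg * Cg" for x using \<psi>g(2)[of x x] by (simp add: power2_eq_square)
  note c4 = campbell_W(4)[OF measurable_f(1) b(1)] and c3 = campbell_W(3)[OF measurable_f(2) b(2)]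
    and c2 = campbell_W(2)[OF m(4) b(3)] and c3g = campbell_W(3)[OF m(1) \<psi>g(1)] and cpg = campbell_W(2)[OF m(2) \<psi>g(1)]
    and cgg = campbell_W(2)[OF m(3) \<psi>g(2)] and cg2 = campbell_W(1)[OF m(5) bg]
    and cU = campbell_W(2)[OF \<psi> C] and cG = campbell_W(1)[OF g_measurable g_le]
  have sq: "(Y \<omega>)\<^sup>2 = (\<Sum>p\<in>quads (N \<omega> \<inter> W). f4 p) + 4 * (\<Sum>p\<in>triples (N \<omega> \<inter> W). f3 p)
      + 2 * (\<Sum>p\<in>distinct_pairs (N \<omega> \<inter> W). (\<psi> (fst p) (snd p))\<^sup>2)
      - 4 * (\<Sum>p\<in>triples (N \<omega> \<inter> W). \<psi> (fst p) (fst (snd p)) * g (snd (snd p)))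
      - 8 * (\<Sum>p\<in>distinct_pairs (N \<omega> \<inter> W). \<psi> (fst p) (snd p) * g (snd p))
      + 4 * (\<Sum>p\<in>distinct_pairs (N \<omega> \<inter> W). g (fst p) * g (snd p))
      + 4 * (\<Sum>x\<in>N \<omega> \<inter> W. (g x)\<^sup>2)" if "\<omega> \<in> space M" for \<omega>
  proof -
    note S = finite_processD(1)[OF fp1 that]
    have "(Y \<omega>)\<^sup>2 = (U \<omega>)\<^sup>2 - 4 * (U \<omega> * G \<omega>) + 4 * (G \<omega>)\<^sup>2"
      by (simp add: Y_def power2_eq_square algebra_simps)
    also have "\<dots> = (\<Sum>p\<in>quads (N \<omega> \<inter> W). f4 p) + 4 * (\<Sum>p\<in>triples (N \<omega> \<inter> W). f3 p)
      + 2 * (\<Sum>p\<in>distinct_pairs (N \<omega> \<inter> W). (\<psi> (fst p) (snd p))\<^sup>2)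
      - 4 * ((\<Sum>p\<in>triples (N \<omega> \<inter> W). \<psi> (fst p) (fst (snd p)) * g (snd (snd p)))
        + 2 * (\<Sum>p\<in>distinct_pairs (N \<omega> \<inter> W). \<psi> (fst p) (snd p) * g (snd p)))
      + 4 * ((\<Sum>p\<in>distinct_pairs (N \<omega> \<inter> W). g (fst p) * g (snd p))
        + (\<Sum>x\<in>N \<omega> \<inter> W. (g x)\<^sup>2))"
      unfolding U_def G_def sum_pairs_sq[OF S sym] sum_pairs_times_sum[OF S sym] sum_sq_pairs[OF S] f4_def f3_def
      by (simp add: case_prod_beta')
    finally show ?thesis by simp
  qed
  have U: "U \<omega> = (\<Sum>p\<in>distinct_pairs (N \<omega> \<inter> W). \<psi> (fst p) (snd p))" for \<omega>
    by (simp add: U_def case_prod_beta')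
  have iY: "integrable M Y" and EY: "(LINT \<omega>|M. Y \<omega>) = I2 - 2 * I0"
    unfolding Y_def U G_def using cU cG by (auto simp: I2_def I0_def)
  then show "integrable M Y" by simp
  have iY2: "integrable M (\<lambda>\<omega>. (Y \<omega>)\<^sup>2)" and EY2: "(LINT \<omega>|M. (Y \<omega>)\<^sup>2) = (LINT p|m4. f4 p) + 4 * (LINT p|m3. f3 p)
      + 2 * (LINT p|m2. (\<psi> (fst p) (snd p))\<^sup>2) - 4 * I3g - 8 * Ipg + 4 * Igg + 4 * Ig2"
    using c4 c3 c2 c3g cpg cgg cg2
    by (subst Bochner_Integration.integrable_cong[OF refl sq] Bochner_Integration.integral_cong[OF refl sq];
        simp add: I3g_def Ipg_def Igg_def Ig2_def)+
  then show "integrable M (\<lambda>\<omega>. (Y \<omega>)\<^sup>2)" by simp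
  \<comment> \<open>The terms with g produced by -4 U G and 4 G^2 are exactly those needed to
    complete the five quantities on the right; what remains of \<open>I2\<close> and
    \<open>I0\<close> is the square of the mean I2 - 2 I0.\<close>
  have "(LINT \<omega>|M. (Y \<omega>)\<^sup>2) - (LINT \<omega>|M. Y \<omega>)\<^sup>2
      = cum4 f4 + 2 * cum2 h + 4 * cum3 f3 + 4 * cum2 q + 2 * (LINT p|m2. (\<psi> (fst p) (snd p))\<^sup>2)"
    unfolding EY2 EY cum4_f4 cum2_h cum3_f3 cum2_q by (simp add: power2_eq_square algebra_simps)
  \<comment> \<open>The kernels \<open>f4\<close> and \<open>f3\<close> contribute order |W|. The
    kernels \<open>h\<close> and \<open>q\<close> are themselves bounded by multiples of |D|, so
    their second cumulants contribute order |W| |D|.\<close>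
  also have "\<dots> \<le> 4 * C\<^sup>2 * (lam * (var4 * measure lborel W))
      + 2 * (4 * (4 * C\<^sup>2 * (lam * (var2 * measure lborel D))) * (lam * (var2 * measure lborel W)))
      + 4 * (4 * C\<^sup>2 * (lam * (var3 * measure lborel W)))
      + 4 * (4 * (C\<^sup>2 * (lam * measure lborel D)) * (lam * (var2 * measure lborel W)))
      + 2 * (C\<^sup>2 * measure lborel W * (4 * lam * var2 + lam\<^sup>2 * measure lborel D))"
    using cum4_bound[OF measurable_f(1) b(1), where D = UNIV] cum2_bound[OF h_measurable h_bound, where D = UNIV]
      cum3_bound[OF measurable_f(2) b(2), where D = UNIV] cum2_bound[OF q_measurable q_bound, where D = UNIV] I2_sq
    by (intro add_mono mult_left_mono) (simp_all add: abs_le_iff)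
  also have "\<dots> \<le> const * C\<^sup>2 * measure lborel W * (1 + measure lborel D)"
  proof -
    define w d where "w = C\<^sup>2 * measure lborel W" and "d = measure lborel D"
    have nn: "0 \<le> w" "0 \<le> d" "0 \<le> lam" "0 \<le> var2" "0 \<le> var3" "0 \<le> var4"
      using lam_pos by (auto simp: w_def d_def var2_def var3_def var4_def)
    have "const * w * (1 + d) - (4 * lam * var4 * w + 32 * lam\<^sup>2 * var2\<^sup>2 * w * d + 16 * lam * var3 * w
        + 16 * lam\<^sup>2 * var2 * w * d + 8 * lam * var2 * w + 2 * lam\<^sup>2 * w * d)
      = (4 * lam * var4 + 16 * lam * var3 + 8 * lam * var2) * w * d + (32 * lam\<^sup>2 * var2\<^sup>2 + 16 * lam\<^sup>2 * var2 + 2 * lam\<^sup>2) * w"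
      by (simp add: const_def algebra_simps)
    also have "\<dots> \<ge> 0" using nn by auto
    finally show ?thesis by (simp add: w_def d_def algebra_simps power2_eq_square)
  qed
  finally show "(LINT \<omega>|M. (Y \<omega> - (LINT \<omega>|M. Y \<omega>))\<^sup>2) \<le> const * C\<^sup>2 * measure lborel W * (1 + measure lborel D)"
    using variance_eq[OF iY iY2] by simp
qed

end

section \<open>Windows and edge correction\<close>

text \<open>The set covariance |W \<inter> (W - z)| of the window.\<close>

definition overlap :: "'a::euclidean_space set \<Rightarrow> 'a \<Rightarrow> real" where
  "overlap W z = measure lborel {u \<in> W. u + z \<in> W}"

text \<open>The image of W under the homothety with centre \<open>x0\<close> and ratio 1 -
  t.\<close>

definition shrink :: "real \<Rightarrow> 'a::euclidean_space \<Rightarrow> 'a set \<Rightarrow> 'a set" where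
  "shrink t x0 W = (\<lambda>y. t *\<^sub>R x0 + (1 - t) *\<^sub>R y) ` W"

lemma edge_volume_overlap:
  fixes W :: "'a::euclidean_space set"
  assumes [measurable]: "W \<in> sets borel"
  shows "edge_volume W x y = overlap W (y - x)"
proof -
  have eq: "((\<lambda>z. z - x) ` W) \<inter> ((\<lambda>z. z - y) ` W) = {z. z + x \<in> W \<and> z + y \<in> W}"
    by (force simp: image_iff algebra_simps)
  have [measurable]: "{z. z + x \<in> W \<and> z + y \<in> W} \<in> sets borel" "{u. u \<in> W \<and> u + (y - x) \<in> W} \<in> sets borel"
    by measurable
  have "emeasure lborel {u. u \<in> W \<and> u + (y - x) \<in> W} = (\<integral>\<^sup>+u. indicator {u. u \<in> W \<and> u + (y - x) \<in> W} u \<partial>lborel)"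
    by simp
  also have "\<dots> = (\<integral>\<^sup>+u. indicator {u. u \<in> W \<and> u + (y - x) \<in> W} (x + 1 *\<^sub>R u) \<partial>lborel)"
    by (subst lborel_affine_nn_integral[of 1 _ x]) auto
  also have "\<dots> = (\<integral>\<^sup>+z. indicator {z. z + x \<in> W \<and> z + y \<in> W} z \<partial>lborel)"
    by (intro nn_integral_cong) (auto simp: indicator_def algebra_simps)
  also have "\<dots> = emeasure lborel {z. z + x \<in> W \<and> z + y \<in> W}" by simp
  finally show ?thesis unfolding edge_volume_def overlap_def eq measure_def by simp
qed

lemma overlap_measurable [measurable]:
  fixes W :: "'a::euclidean_space set"
  assumes [measurable]: "W \<in> sets borel"
  shows "overlap W \<in> borel_measurable borel"
proof -
  have "overlap W z = enn2real (\<integral>\<^sup>+u. indicator W u * indicator W (u + z) \<partial>lborel)" for z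
  proof -
    have "{u \<in> W. u + z \<in> W} \<in> sets borel" by measurable
    then have "emeasure lborel {u \<in> W. u + z \<in> W} = (\<integral>\<^sup>+u. indicator {u \<in> W. u + z \<in> W} u \<partial>lborel)" by simp
    also have "\<dots> = (\<integral>\<^sup>+u. indicator W u * indicator W (u + z) \<partial>lborel)"
      by (intro nn_integral_cong) (auto simp: indicator_def)
    finally show ?thesis by (simp add: overlap_def measure_def)
  qed
  then have eq: "overlap W = (\<lambda>z. enn2real (\<integral>\<^sup>+u. indicator W u * indicator W (u + z) \<partial>lborel))" by auto
  show ?thesis unfolding eq by measurable
qed

lemma overlap_minus:
  fixes W :: "'a::euclidean_space set"
  assumes "W \<in> sets borel"
  shows "overlap W (- z) = overlap W z"
proof -
  have "edge_volume W 0 z = edge_volume W z 0" unfolding edge_volume_def by (simp add: Int_commute)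
  then show ?thesis using assms by (simp add: edge_volume_overlap)
qed

lemma overlap_le:
  fixes W :: "'a::euclidean_space set"
  assumes [measurable]: "W \<in> sets borel" and "bounded W"
  shows "overlap W z \<le> measure lborel W"
proof -
  have "{u \<in> W. u + z \<in> W} \<in> sets borel" by measurable
  then show ?thesis
    unfolding overlap_def using assms emeasure_bounded_finite[of W]
    by (intro measure_mono_fmeasurable fmeasurableI) auto
qed

text \<open>A homothetic copy takes the place of the erosion of a convex body, because its volume is
  explicit: convexity keeps its points at distance t \<rho> from the complement of W, and only the
  fraction 1 - (1 - t)^d of the volume is lost.\<close>

lemma shrink_facts:
  fixes W :: "'a::euclidean_space set"
  assumes W: "convex W" "compact W" and \<rho>: "cball x0 \<rho> \<subseteq> W" "0 \<le> \<rho>" and t: "0 \<le> t" "t < 1"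
  shows "compact (shrink t x0 W)" "measure lborel (shrink t x0 W) = (1 - t) ^ DIM('a) * measure lborel W"
    "\<And>z. z \<in> shrink t x0 W \<Longrightarrow> cball z (t * \<rho>) \<subseteq> W" "shrink t x0 W \<subseteq> W"
proof -
  show "compact (shrink t x0 W)"
    unfolding shrink_def by (intro compact_continuous_image continuous_intros W)
  then have [measurable]: "shrink t x0 W \<in> sets borel" by (simp add: borel_closed compact_imp_closed)
  have [measurable]: "W \<in> sets borel" using W by (simp add: borel_closed compact_imp_closed)
  have "emeasure lborel (shrink t x0 W) = (\<integral>\<^sup>+x. indicator (shrink t x0 W) x \<partial>lborel)" by simp
  also have "\<dots> = ennreal (\<bar>1 - t\<bar> ^ DIM('a)) * (\<integral>\<^sup>+x. indicator (shrink t x0 W) (t *\<^sub>R x0 + (1 - t) *\<^sub>R x) \<partial>lborel)"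
    using t by (intro lborel_affine_nn_integral) auto
  also have "(\<integral>\<^sup>+x. indicator (shrink t x0 W) (t *\<^sub>R x0 + (1 - t) *\<^sub>R x) \<partial>lborel) = (\<integral>\<^sup>+x. indicator W x \<partial>lborel)"
    using t by (intro nn_integral_cong) (auto simp: indicator_def shrink_def)
  finally have "emeasure lborel (shrink t x0 W) = ennreal ((1 - t) ^ DIM('a)) * emeasure lborel W" using t by simp
  then show "measure lborel (shrink t x0 W) = (1 - t) ^ DIM('a) * measure lborel W"
    using t by (simp add: measure_def enn2real_mult)
  show *: "cball z (t * \<rho>) \<subseteq> W" if z: "z \<in> shrink t x0 W" for z
  proof (cases "t = 0")
    case True
    then show ?thesis using z by (auto simp: shrink_def)
  next
    case False
    obtain y where y: "y \<in> W" "z = t *\<^sub>R x0 + (1 - t) *\<^sub>R y" using z by (auto simp: shrink_def)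
    show ?thesis
    proof
      fix v assume v: "v \<in> cball z (t * \<rho>)"
      \<comment> \<open>The displacement v - z, magnified by 1/t, stays in the inball; v is then the
        convex combination t u + (1 - t) y of two points of W.\<close>
      define u where "u = x0 + (1 / t) *\<^sub>R (v - z)"
      have "norm (v - z) \<le> t * \<rho>" using v by (simp add: dist_norm norm_minus_commute)
      then have "norm ((1 / t) *\<^sub>R (v - z)) \<le> \<rho>"
        unfolding norm_scaleR using False t by (simp add: field_simps)
      then have "u \<in> W" using \<rho>(1) by (auto simp: u_def dist_norm)
      moreover have "v = t *\<^sub>R u + (1 - t) *\<^sub>R y" using False by (simp add: u_def y(2) algebra_simps)
      ultimately show "v \<in> W" using convexD[OF W(1) \<open>u \<in> W\<close> y(1), of t "1 - t"] t by auto
    qed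
  qed
  show "shrink t x0 W \<subseteq> W"
  proof
    fix z assume "z \<in> shrink t x0 W"
    then show "z \<in> W" using *[of z] t \<rho>(2) by auto
  qed
qed

text \<open>The shrunk copy stays in W when shifted by z. This makes the edge correction comparable
  with |W|, uniformly over all shifts that are small against the inradius.\<close>

lemma overlap_ge:
  fixes W :: "'a::euclidean_space set"
  assumes W: "convex W" "compact W" and \<rho>: "cball x0 \<rho> \<subseteq> W" "0 \<le> \<rho>" and t: "0 \<le> t" "t < 1"
    and z: "norm z \<le> t * \<rho>"
  shows "(1 - t) ^ DIM('a) * measure lborel W \<le> overlap W z"
proof -
  note s = shrink_facts[OF W \<rho> t]
  have [measurable]: "W \<in> sets borel" using W by (simp add: borel_closed compact_imp_closed)
  have "shrink t x0 W \<subseteq> {u \<in> W. u + z \<in> W}"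
  proof
    fix u assume u: "u \<in> shrink t x0 W"
    then have "u + z \<in> cball u (t * \<rho>)" using z by (simp add: dist_norm)
    then show "u \<in> {u \<in> W. u + z \<in> W}" using s(3)[OF u] s(4) u by auto
  qed
  moreover have "{u \<in> W. u + z \<in> W} \<in> sets borel" by measurable
  moreover have "bounded {u \<in> W. u + z \<in> W}" using W by (auto intro: bounded_subset[OF compact_imp_bounded])
  ultimately have "measure lborel (shrink t x0 W) \<le> overlap W z"
    unfolding overlap_def using s(1) emeasure_bounded_finite
    by (intro measure_mono_fmeasurable fmeasurableI) (auto simp: borel_closed compact_imp_closed)
  then show ?thesis using s(2) by simp
qed

text \<open>\<open>Sup {}\<close> is an unspecified real number, so a positive
  \<open>inball_radius\<close> alone does not show that some ball fits into W; hence the second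
  assumption. Half the radius avoids the question whether the supremum is attained.\<close>

lemma inball_center:
  fixes W :: "'a::euclidean_space set"
  assumes "0 < inball_radius W" "Sup {} < inball_radius W"
  obtains x0 where "cball x0 (inball_radius W / 2) \<subseteq> W"
proof -
  define S where "S = {r. 0 < r \<and> (\<exists>x\<in>W. cball x r \<subseteq> W)}"
  have eq: "inball_radius W = Sup S" by (simp add: inball_radius_def S_def)
  have "S \<noteq> {}" using assms(2) eq by force
  moreover have "inball_radius W / 2 < Sup S" using assms(1) eq by simp
  ultimately obtain r where r: "r \<in> S" "inball_radius W / 2 < r" using less_cSupE by metis
  then obtain x where "cball x r \<subseteq> W" by (auto simp: S_def)
  then have "cball x (inball_radius W / 2) \<subseteq> W" using r(2) by (auto simp: subset_eq)
  then show ?thesis using that by blast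
qed

lemma window_scale_power:
  assumes "0 < measure lborel (W :: 'a::euclidean_space set)"
  shows "window_scale W ^ DIM('a) = measure lborel W" "0 < window_scale W"
proof -
  show "0 < window_scale W" using assms by (simp add: window_scale_def)
  then have "window_scale W ^ DIM('a) = window_scale W powr real DIM('a)" by (simp add: powr_realpow)
  also have "\<dots> = measure lborel W" using assms by (simp add: window_scale_def powr_powr)
  finally show "window_scale W ^ DIM('a) = measure lborel W" .
qed

lemma window_scale_powr_power:
  assumes "0 < measure lborel (W :: 'a::euclidean_space set)"
  shows "(window_scale W powr \<alpha>) ^ DIM('a) = measure lborel W powr \<alpha>"
proof -
  have "(window_scale W powr \<alpha>) ^ DIM('a) = (window_scale W powr \<alpha>) powr real DIM('a)"
    using window_scale_power(2)[OF assms] by (simp add: powr_realpow)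
  also have "\<dots> = measure lborel W powr \<alpha>"
    using assms by (simp add: window_scale_def powr_powr)
  finally show ?thesis .
qed

text \<open>Eventually the inradius exceeds both 0 and \<open>Sup {}\<close>, so a ball of half that
  radius exists, and its volume forces the volume of the windows to infinity.\<close>

lemma convex_averaging_limits:
  fixes W :: "nat \<Rightarrow> 'a::euclidean_space set"
  assumes W: "convex_averaging W"
  shows "filterlim (\<lambda>n. inball_radius (W n)) at_top sequentially"
    and "\<forall>\<^sub>F n in sequentially. \<exists>x0. cball x0 (inball_radius (W n) / 2) \<subseteq> W n"
    and "filterlim (\<lambda>n. measure lborel (W n)) at_top sequentially"
proof -
  show \<rho>: "filterlim (\<lambda>n. inball_radius (W n)) at_top sequentially"
    using W by (simp add: convex_averaging_def)
  then have "\<forall>\<^sub>F n in sequentially. max 0 (Sup {}) < inball_radius (W n)"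
    unfolding filterlim_at_top_dense by (rule spec)
  then show ev: "\<forall>\<^sub>F n in sequentially. \<exists>x0. cball x0 (inball_radius (W n) / 2) \<subseteq> W n"
    by eventually_elim (metis inball_center max_less_iff_conj)
  have cp: "compact (W n)" for n using W by (simp add: convex_averaging_def)
  have "\<forall>\<^sub>F n in sequentially. unit_ball_vol DIM('a) * (inball_radius (W n) / 2) ^ DIM('a) \<le> measure lborel (W n)"
    using ev eventually_compose_filterlim[OF eventually_gt_at_top[of 0] \<rho>]
  proof eventually_elim
    case (elim n)
    then obtain x0 where "cball x0 (inball_radius (W n) / 2) \<subseteq> W n" by blast
    moreover have "emeasure lborel (W n) < \<infinity>" using cp compact_imp_bounded emeasure_bounded_finite by blast
    ultimately have "measure lborel (cball x0 (inball_radius (W n) / 2)) \<le> measure lborel (W n)"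
      using cp[of n] by (intro measure_mono_fmeasurable fmeasurableI) (auto simp: borel_closed compact_imp_closed)
    then show ?case using elim by (simp add: content_cball)
  qed
  moreover have "filterlim (\<lambda>n. unit_ball_vol DIM('a) * (inball_radius (W n) / 2) ^ DIM('a)) at_top sequentially"
  proof (intro filterlim_tendsto_pos_mult_at_top[OF tendsto_const] filterlim_pow_at_top)
    have "filterlim (\<lambda>n. 1 / 2 * inball_radius (W n)) at_top sequentially"
      by (rule filterlim_tendsto_pos_mult_at_top[OF tendsto_const _ \<rho>]) simp
    then show "filterlim (\<lambda>n. inball_radius (W n) / 2) at_top sequentially" by simp
  qed auto
  ultimately show "filterlim (\<lambda>n. measure lborel (W n)) at_top sequentially"
    by (rule filterlim_at_top_mono[rotated])
qed

text \<open>The factor 0 occurs at r = 0; the image is then a null set, in accordance with 0^d =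
  0.\<close>

lemma scaled_set:
  fixes B :: "'a::euclidean_space set"
  assumes B: "compact B" and s: "0 \<le> s"
  shows "compact ((\<lambda>z. s *\<^sub>R z) ` B)" "measure lborel ((\<lambda>z. s *\<^sub>R z) ` B) = s ^ DIM('a) * measure lborel B"
proof -
  show cp: "compact ((\<lambda>z. s *\<^sub>R z) ` B)" by (rule compact_scaling[OF B])
  show "measure lborel ((\<lambda>z. s *\<^sub>R z) ` B) = s ^ DIM('a) * measure lborel B"
  proof (cases "s = 0")
    case True
    then have "(\<lambda>z. s *\<^sub>R z) ` B \<subseteq> {0}" by auto
    moreover have "emeasure lborel ((\<lambda>z. s *\<^sub>R z) ` B) \<le> emeasure lborel {0 :: 'a}"
      using calculation by (intro emeasure_mono) auto
    ultimately have "measure lborel ((\<lambda>z. s *\<^sub>R z) ` B) = 0" by (simp add: measure_def)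
    then show ?thesis using True by simp
  next
    case False
    have [measurable]: "(\<lambda>z. s *\<^sub>R z) ` B \<in> sets borel" "B \<in> sets borel"
      using cp B by (auto simp: borel_closed compact_imp_closed)
    have "emeasure lborel ((\<lambda>z. s *\<^sub>R z) ` B) = (\<integral>\<^sup>+x. indicator ((\<lambda>z. s *\<^sub>R z) ` B) x \<partial>lborel)" by simp
    also have "\<dots> = ennreal (\<bar>s\<bar> ^ DIM('a)) * (\<integral>\<^sup>+x. indicator ((\<lambda>z. s *\<^sub>R z) ` B) (0 + s *\<^sub>R x) \<partial>lborel)"
      using False by (intro lborel_affine_nn_integral) auto
    also have "(\<integral>\<^sup>+x. indicator ((\<lambda>z. s *\<^sub>R z) ` B) (0 + s *\<^sub>R x) \<partial>lborel) = (\<integral>\<^sup>+x. indicator B x \<partial>lborel)"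
      using False by (intro nn_integral_cong) (auto simp: indicator_def)
    finally have "emeasure lborel ((\<lambda>z. s *\<^sub>R z) ` B) = ennreal (s ^ DIM('a)) * emeasure lborel B" using s by simp
    then show ?thesis using s by (simp add: measure_def enn2real_mult)
  qed
qed

section \<open>Pair statistics with a translation invariant kernel\<close>

text \<open>Covariances of the three parts are never computed; the square of a sum of three is at
  most three times the sum of the squares, which is enough when each part is to be small.\<close>

lemma (in prob_space) variance_sum3:
  fixes X Y Z :: "'a \<Rightarrow> real"
  assumes X: "integrable M X" "integrable M (\<lambda>\<omega>. (X \<omega>)\<^sup>2)"
    and Y: "integrable M Y" "integrable M (\<lambda>\<omega>. (Y \<omega>)\<^sup>2)"
    and Z: "integrable M Z" "integrable M (\<lambda>\<omega>. (Z \<omega>)\<^sup>2)"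
  defines "S \<equiv> \<lambda>\<omega>. X \<omega> + Y \<omega> + Z \<omega>"
  shows "variance S \<le> 3 * (variance X + variance Y + variance Z)"
    and "integrable M S" and "integrable M (\<lambda>\<omega>. (S \<omega>)\<^sup>2)"
proof -
  have [measurable]: "X \<in> borel_measurable M" "Y \<in> borel_measurable M" "Z \<in> borel_measurable M"
    using X Y Z by auto
  have sq3: "(a + b + c)\<^sup>2 \<le> 3 * (a\<^sup>2 + b\<^sup>2 + c\<^sup>2)" for a b c :: real
    using sum_squares_ge_zero[of "a - b" "b - c"] zero_le_power2[of "a - c"]
    by (simp add: power2_eq_square algebra_simps)
  show iS: "integrable M S" unfolding S_def using X Y Z by simp
  have ES: "expectation S = expectation X + expectation Y + expectation Z"
    unfolding S_def using X Y Z by simp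
  have d: "integrable M (\<lambda>\<omega>. (T \<omega> - e)\<^sup>2)" if "integrable M T" "integrable M (\<lambda>\<omega>. (T \<omega>)\<^sup>2)" for T :: "'a \<Rightarrow> real" and e
    using that by (simp add: power2_diff)
  have iS2: "integrable M (\<lambda>\<omega>. (S \<omega>)\<^sup>2)"
  proof (rule Bochner_Integration.integrable_bound)
    show "integrable M (\<lambda>\<omega>. 3 * ((X \<omega>)\<^sup>2 + (Y \<omega>)\<^sup>2 + (Z \<omega>)\<^sup>2))" using X Y Z by simp
    show "AE \<omega> in M. norm ((S \<omega>)\<^sup>2) \<le> norm (3 * ((X \<omega>)\<^sup>2 + (Y \<omega>)\<^sup>2 + (Z \<omega>)\<^sup>2))"
      using sq3 by (intro AE_I2) (auto simp: S_def intro: order_trans[OF _ abs_ge_self])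
  qed (simp add: S_def)
  then show "integrable M (\<lambda>\<omega>. (S \<omega>)\<^sup>2)" .
  have "variance S \<le> (LINT \<omega>|M. 3 * ((X \<omega> - expectation X)\<^sup>2 + (Y \<omega> - expectation Y)\<^sup>2 + (Z \<omega> - expectation Z)\<^sup>2))"
  proof (rule integral_mono)
    show "(S \<omega> - expectation S)\<^sup>2 \<le> 3 * ((X \<omega> - expectation X)\<^sup>2 + (Y \<omega> - expectation Y)\<^sup>2 + (Z \<omega> - expectation Z)\<^sup>2)" for \<omega>
      using sq3[of "X \<omega> - expectation X" "Y \<omega> - expectation Y" "Z \<omega> - expectation Z"]
      unfolding ES by (simp add: S_def algebra_simps)
  qed (use d[OF iS iS2] d[OF X] d[OF Y] d[OF Z] in auto)
  also have "\<dots> = 3 * (variance X + variance Y + variance Z)"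
    using d[OF X] d[OF Y] d[OF Z] by simp
  finally show "variance S \<le> 3 * (variance X + variance Y + variance Z)" .
qed

text \<open>The kernel k depends on the difference of the points and lives on a set D that is small
  against the inradius \<rho>; t measures how small. Both estimators are of this type, with k the
  indicator of a scaled copy of B or a rescaled w.\<close>

locale kernel_window = window M N W for M :: "'w measure" and N :: "'w \<Rightarrow> 'a::euclidean_space set" and W +
  fixes x0 :: 'a and \<rho> t :: real and k :: "'a \<Rightarrow> real" and c :: real and D :: "'a set"
  assumes W': "convex W" "compact W" "cball x0 \<rho> \<subseteq> W" "0 < \<rho>" and t: "0 \<le> t" "t < 1"
    and k [measurable]: "k \<in> borel_measurable borel" and k_nonneg: "\<And>z. 0 \<le> k z" and k_le: "\<And>z. k z \<le> c"
    and k_sym: "\<And>z. k (- z) = k z"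
    and D' [measurable]: "D \<in> sets borel" and D_sub: "D \<subseteq> cball 0 (t * \<rho>)" and k_supp: "\<And>z. k z \<noteq> 0 \<Longrightarrow> z \<in> D"
begin

definition v where "v = measure lborel W"
text \<open>A lower bound, relative to |W|, for the overlap at shifts in D, and at the same time the
  relative volume of the inner region \<open>S\<close>.\<close>

definition \<eta> where "\<eta> = (1 - t) ^ DIM('a)"
text \<open>With the indicators, \<psi> vanishes off W x W as a function on the whole space, so that
  it can be compared pointwise with the indicator of a set of pairs in W, as in
  \<open>cum2_estimate\<close>. A vanishing overlap is harmless since k is 0 outside D.\<close>

definition \<psi> where "\<psi> x y = indicat_real W x * indicat_real W y * (k (y - x) / overlap W (y - x))"
definition \<kappa> where "\<kappa> = (LINT z|lborel. k z)"
definition S where "S = shrink t x0 W"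

lemma Wb [measurable]: "W \<in> sets borel" by (rule W(1))

lemma eta: "0 < \<eta>" "\<eta> \<le> 1" using t by (auto simp: \<eta>_def power_le_one)

lemma S_facts: "compact S" "measure lborel S = \<eta> * v" "\<And>z. z \<in> S \<Longrightarrow> cball z (t * \<rho>) \<subseteq> W" "S \<subseteq> W"
  using shrink_facts[OF W'(1-3) less_imp_le[OF W'(4)] t] unfolding S_def \<eta>_def v_def by auto

lemma S_borel [measurable]: "S \<in> sets borel" using S_facts(1) by (simp add: borel_closed compact_imp_closed)

lemma W_fin: "emeasure lborel W < \<infinity>" using W(2) by (rule emeasure_bounded_finite)

lemma v_pos: "0 < v"
proof -
  have "0 < unit_ball_vol (real DIM('a)) * \<rho> ^ DIM('a)" using W'(4) by simp
  also have "\<dots> = measure lborel (cball x0 \<rho>)" using W'(4) by (simp add: content_cball)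
  also have "\<dots> \<le> v" unfolding v_def using W'(3) W_fin by (intro measure_mono_fmeasurable fmeasurableI) auto
  finally show ?thesis .
qed

lemma overlap_bounds: "z \<in> D \<Longrightarrow> \<eta> * v \<le> overlap W z" "overlap W z \<le> v"
proof -
  show "overlap W z \<le> v" unfolding v_def by (rule overlap_le[OF W])
  show "\<eta> * v \<le> overlap W z" if "z \<in> D"
    unfolding \<eta>_def v_def
    using that D_sub by (intro overlap_ge[OF W'(1-3) less_imp_le[OF W'(4)] t]) auto
qed

lemma quotient_bound: "0 \<le> k z / overlap W z" "k z / overlap W z \<le> k z / (\<eta> * v)"
proof -
  have "0 < \<eta> * v" using eta v_pos by simp
  note p = this
  show "0 \<le> k z / overlap W z" using k_nonneg[of z] by (simp add: overlap_def)
  show "k z / overlap W z \<le> k z / (\<eta> * v)"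
  proof (cases "k z = 0")
    case False
    then have "\<eta> * v \<le> overlap W z" by (intro overlap_bounds(1) k_supp)
    then show ?thesis using p k_nonneg[of z] by (intro divide_left_mono) auto
  qed simp
qed

lemma psi_bound: "0 \<le> \<psi> x y" "\<psi> x y \<le> c / (\<eta> * v)"
proof -
  have p: "0 < \<eta> * v" using eta v_pos by simp
  show "0 \<le> \<psi> x y" unfolding \<psi>_def using quotient_bound(1) by (simp add: indicator_def)
  have "k (y - x) / overlap W (y - x) \<le> c / (\<eta> * v)"
    using quotient_bound(2)[of "y - x"] k_le[of "y - x"] p by (meson divide_right_mono less_imp_le order_trans)
  moreover have "0 \<le> c / (\<eta> * v)" using p k_nonneg[of 0] k_le[of 0] by simp
  ultimately show "\<psi> x y \<le> c / (\<eta> * v)" unfolding \<psi>_def by (auto simp: indicator_def)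
qed

sublocale P: pair_statistic M N W \<psi> "c / (\<eta> * v)" D
proof
  show "(\<lambda>p. \<psi> (fst p) (snd p)) \<in> borel_measurable borel" unfolding \<psi>_def by measurable
  show "\<psi> x y = \<psi> y x" for x y
    using k_sym[of "y - x"] overlap_minus[OF Wb, of "y - x"] by (simp add: \<psi>_def mult.commute)
  show "\<bar>\<psi> x y\<bar> \<le> c / (\<eta> * v)" for x y using psi_bound[of x y] by simp
  show "bounded D" using D_sub by (rule bounded_subset[OF bounded_cball])
  show "y - x \<in> D" if "\<psi> x y \<noteq> 0" for x y using that k_supp by (auto simp: \<psi>_def)
qed (rule D')

lemma U_eq: "P.U \<omega> = (\<Sum>(x, y)\<in>distinct_pairs (N \<omega> \<inter> W). k (y - x) / edge_volume W x y)"
  unfolding P.U_def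
  by (rule sum.cong) (auto simp: distinct_pairs_def \<psi>_def edge_volume_overlap)

lemma k_integrable: "integrable lborel k" "0 \<le> \<kappa>" "\<kappa> \<le> c * measure lborel D"
proof -
  have D_fin: "emeasure lborel D < \<infinity>" using D_sub by (intro emeasure_bounded_finite bounded_subset[OF bounded_cball])
  have i: "integrable lborel (\<lambda>z. c * indicat_real D z)" using D_fin by (intro integrable_mult_right integrable_real_indicator) auto
  have le: "k z \<le> c * indicat_real D z" for z using k_le[of z] k_supp[of z] by (cases "k z = 0") (auto simp: indicator_def intro: order_trans[OF k_nonneg k_le])
  show ik: "integrable lborel k"
    using le k_nonneg by (intro Bochner_Integration.integrable_bound[OF i]) (auto intro!: AE_I2 order_trans[OF _ abs_ge_self])
  show "0 \<le> \<kappa>" unfolding \<kappa>_def using k_nonneg by simp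
  have "\<kappa> \<le> (LINT z|lborel. c * indicat_real D z)" unfolding \<kappa>_def by (rule integral_mono[OF ik i le])
  then show "\<kappa> \<le> c * measure lborel D" by simp
qed

lemma k_shift: "integrable lborel (\<lambda>y. k (y - x))" "(LINT y|lborel. k (y - x)) = \<kappa>"
proof -
  have "(LINT y|lborel. k (y - x)) = (LINT y|lborel. k (x + 1 *\<^sub>R y - x))"
    by (subst lborel_affine_integral[of 1 _ x]) auto
  then show e: "(LINT y|lborel. k (y - x)) = \<kappa>" by (simp add: \<kappa>_def)
  have "(\<integral>\<^sup>+y. ennreal (k (y - x)) \<partial>lborel) = (\<integral>\<^sup>+y. ennreal (k (x + 1 *\<^sub>R y - x)) \<partial>lborel)"
    by (subst lborel_affine_nn_integral[of 1 _ x]) auto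
  also have "\<dots> = ennreal \<kappa>"
    unfolding \<kappa>_def using k_integrable(1) k_nonneg by (simp add: nn_integral_eq_integral)
  finally show "integrable lborel (\<lambda>y. k (y - x))"
    using k_nonneg by (intro integrableI_nonneg) auto
qed

lemma g_eq: "P.g x = lam * (LINT y|lborel. indicat_real W y * \<psi> x y)"
  unfolding P.g_def by (rule integral_m1) measurable

lemma g_integrand: "integrable lborel (\<lambda>y. indicat_real W y * \<psi> x y)"
  "indicat_real W y * \<psi> x y \<le> k (y - x) / (\<eta> * v)" "0 \<le> indicat_real W y * \<psi> x y"
proof -
  have le: "indicat_real W y * \<psi> x y \<le> k (y - x) / (\<eta> * v)" for y
    using quotient_bound[of "y - x"] by (auto simp: \<psi>_def indicator_def)
  then show "indicat_real W y * \<psi> x y \<le> k (y - x) / (\<eta> * v)" .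
  show nn: "0 \<le> indicat_real W y * \<psi> x y" for y using psi_bound(1) by (simp add: indicator_def)
  show "integrable lborel (\<lambda>y. indicat_real W y * \<psi> x y)"
    by (rule Bochner_Integration.integrable_bound[OF integrable_divide[OF k_shift(1)[of x], of "\<eta> * v"]])
       (use le nn in \<open>auto intro!: AE_I2 simp del: abs_divide intro: order_trans[OF _ abs_ge_self]\<close>)
qed

lemma g_upper: "0 \<le> P.g x" "P.g x \<le> lam * \<kappa> / (\<eta> * v)"
proof -
  show "0 \<le> P.g x" unfolding g_eq using lam_pos g_integrand(3) by simp
  have "(LINT y|lborel. indicat_real W y * \<psi> x y) \<le> (LINT y|lborel. k (y - x) / (\<eta> * v))"
    by (intro integral_mono g_integrand integrable_divide k_shift)
  then have "(LINT y|lborel. indicat_real W y * \<psi> x y) \<le> \<kappa> / (\<eta> * v)" using k_shift(2) by simp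
  from mult_left_mono[OF this, of lam] show "P.g x \<le> lam * \<kappa> / (\<eta> * v)"
    unfolding g_eq using lam_pos by simp
qed

text \<open>For x in the inner region the translate x + D lies in W, so no part of k is cut off, and
  the overlap is at most v. Together with \<open>g_upper\<close> this pins down g on S up to the
  factor 1/\<eta>; on W - S the lower bound used is 0.\<close>

lemma g_lower: "x \<in> S \<Longrightarrow> lam * \<kappa> / v \<le> P.g x"
proof -
  assume x: "x \<in> S"
  have "k (y - x) / v \<le> indicat_real W y * \<psi> x y" for y
  proof (cases "k (y - x) = 0")
    case True
    then show ?thesis using psi_bound(1)[of x y] by (simp add: indicator_def)
  next
    case False
    then have d: "y - x \<in> D" by (rule k_supp)
    then have "y \<in> cball x (t * \<rho>)" using D_sub by (auto simp: dist_norm norm_minus_commute)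
    then have y: "y \<in> W" "x \<in> W" using S_facts(3)[OF x] S_facts(4) x by auto
    have "0 < \<eta> * v" using eta v_pos by simp
    then have "0 < overlap W (y - x)" using overlap_bounds(1)[OF d] by linarith
    then show ?thesis using y overlap_bounds(2)[of "y - x"] k_nonneg v_pos
      by (auto simp: \<psi>_def intro!: divide_left_mono)
  qed
  then have "(LINT y|lborel. k (y - x) / v) \<le> (LINT y|lborel. indicat_real W y * \<psi> x y)"
    by (intro integral_mono g_integrand integrable_divide k_shift)
  then have "\<kappa> / v \<le> (LINT y|lborel. indicat_real W y * \<psi> x y)" using k_shift(2) by simp
  from mult_left_mono[OF this, of lam] show "lam * \<kappa> / v \<le> P.g x"
    unfolding g_eq using lam_pos by simp
qed

definition linc where "linc = 4 * lam * var2 + lam"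

text \<open>The projection 2G is put back and estimated crudely. Its contribution is of order
  \<kappa>^2/v, which vanishes for the bandwidth kernel; for the normalized K-function kernel it
  does not, and \<open>centered_bound\<close> is used instead.\<close>

lemma U_bound:
  "integrable M P.U" "integrable M (\<lambda>\<omega>. (P.U \<omega>)\<^sup>2)"
  "variance P.U \<le> 3 * (P.const * (c / (\<eta> * v))\<^sup>2 * v * (1 + measure lborel D) + linc * (2 * lam * \<kappa> / (\<eta> * v))\<^sup>2 * v)"
proof -
  have b: "\<bar>2 * P.g x\<bar> \<le> 2 * lam * \<kappa> / (\<eta> * v)" for x
    using g_upper[of x] by simp
  have m: "(\<lambda>x. 2 * P.g x) \<in> borel_measurable borel" by measurable
  note lin = linear_variance[OF m b, of UNIV]
  have e: "P.U = (\<lambda>\<omega>. (P.U \<omega> - 2 * P.G \<omega>) + (\<Sum>x\<in>N \<omega> \<inter> W. 2 * P.g x) + 0)"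
    by (auto simp: P.G_def sum_distrib_left)
  note s = variance_sum3[OF P.degenerate_variance(1,2) lin(2,1), of "\<lambda>_. 0"]
  show "integrable M P.U" by (subst e) (rule s(2); simp)
  show "integrable M (\<lambda>\<omega>. (P.U \<omega>)\<^sup>2)" by (subst e) (rule s(3); simp)
  have "variance P.U \<le> 3 * (variance (\<lambda>\<omega>. P.U \<omega> - 2 * P.G \<omega>) + variance (\<lambda>\<omega>. \<Sum>x\<in>N \<omega> \<inter> W. 2 * P.g x) + variance (\<lambda>_. 0))"
    by (subst (1 2) e) (rule s(1); simp)
  also have "\<dots> \<le> 3 * (P.const * (c / (\<eta> * v))\<^sup>2 * v * (1 + measure lborel D) + linc * (2 * lam * \<kappa> / (\<eta> * v))\<^sup>2 * v)"
    using P.degenerate_variance(3) lin(3) unfolding v_def linc_def by simp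
  finally show "variance P.U \<le> 3 * (P.const * (c / (\<eta> * v))\<^sup>2 * v * (1 + measure lborel D) + linc * (2 * lam * \<kappa> / (\<eta> * v))\<^sup>2 * v)" .
qed

text \<open>The projection 2G is replaced by a multiple of the number of points. The difference has
  relative size 1/\<eta> - 1 on the inner region S and is merely bounded on W - S, whose relative
  volume is 1 - \<eta>; these are the two terms of the last factor.\<close>

lemma centered_bound:
  defines "Z \<equiv> \<lambda>\<omega>. P.U \<omega> - 2 * lam * \<kappa> / v * real (card (N \<omega> \<inter> W))"
  shows "integrable M Z" "integrable M (\<lambda>\<omega>. (Z \<omega>)\<^sup>2)"
    "variance Z \<le> 3 * (P.const * (c / (\<eta> * v))\<^sup>2 * v * (1 + measure lborel D)
      + linc * (2 * lam * \<kappa> / v)\<^sup>2 * v * ((1 / \<eta> - 1)\<^sup>2 + (1 - \<eta>) / \<eta>\<^sup>2))"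
proof -
  define a where "a = 2 * lam * \<kappa> / v"
  have a0: "0 \<le> a" using lam_pos k_integrable(2) v_pos by (simp add: a_def)
  define l where "l x = 2 * P.g x - a" for x
  have [measurable]: "l \<in> borel_measurable borel" unfolding l_def by measurable
  have up: "l x \<le> a * (1 / \<eta> - 1)" for x
    using g_upper(2)[of x] eta v_pos by (simp add: l_def a_def field_simps)
  have l1: "\<bar>l x * indicat_real S x\<bar> \<le> a * (1 / \<eta> - 1)" for x
  proof (cases "x \<in> S")
    case True
    then have "0 \<le> l x" using g_lower[of x] v_pos by (simp add: l_def a_def field_simps)
    then show ?thesis using True up[of x] by simp
  next
    case False
    have "0 \<le> 1 / \<eta> - 1" using eta by simp
    then show ?thesis using False a0 by simp
  qed
  \<comment> \<open>Near the boundary the lower bound for g fails and l may fall to -a; since \<eta>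
    \<le> 1, the bound a/\<eta> covers both signs.\<close>
  have l2: "\<bar>l x * indicat_real (W - S) x\<bar> \<le> a / \<eta>" for x
  proof -
    have "- a \<le> l x" using g_upper(1)[of x] by (simp add: l_def)
    moreover have "a \<le> a / \<eta>" using a0 eta mult_left_le[of \<eta> a] by (simp add: le_divide_eq)
    moreover have "l x \<le> a / \<eta>" using up[of x] a0 by (simp add: algebra_simps)
    ultimately show ?thesis using a0 by (auto simp: indicator_def)
  qed
  have m: "(\<lambda>x. l x * indicat_real S x) \<in> borel_measurable borel" "(\<lambda>x. l x * indicat_real (W - S) x) \<in> borel_measurable borel"
    by measurable
  note lin1 = linear_variance[OF m(1) l1, of UNIV]
  note lin2 = linear_variance[OF m(2) l2, of "W - S"]
  have "Z \<omega> = (P.U \<omega> - 2 * P.G \<omega>) + (\<Sum>x\<in>N \<omega> \<inter> W. l x * indicat_real S x) + (\<Sum>x\<in>N \<omega> \<inter> W. l x * indicat_real (W - S) x)" for \<omega>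
  proof -
    have "(\<Sum>x\<in>N \<omega> \<inter> W. l x * indicat_real S x) + (\<Sum>x\<in>N \<omega> \<inter> W. l x * indicat_real (W - S) x) = (\<Sum>x\<in>N \<omega> \<inter> W. l x)"
      unfolding sum.distrib[symmetric] by (rule sum.cong) (auto simp: indicator_def)
    also have "\<dots> = 2 * P.G \<omega> - a * real (card (N \<omega> \<inter> W))"
      by (simp add: l_def P.G_def sum_subtractf sum_distrib_left)
    finally show ?thesis by (simp add: Z_def a_def)
  qed
  then have e: "Z = (\<lambda>\<omega>. (P.U \<omega> - 2 * P.G \<omega>) + (\<Sum>x\<in>N \<omega> \<inter> W. l x * indicat_real S x) + (\<Sum>x\<in>N \<omega> \<inter> W. l x * indicat_real (W - S) x))"
    by auto
  have lin1': "integrable M (\<lambda>\<omega>. \<Sum>x\<in>N \<omega> \<inter> W. l x * indicat_real S x)" "integrable M (\<lambda>\<omega>. (\<Sum>x\<in>N \<omega> \<inter> W. l x * indicat_real S x)\<^sup>2)"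
    "variance (\<lambda>\<omega>. \<Sum>x\<in>N \<omega> \<inter> W. l x * indicat_real S x) \<le> linc * (a * (1 / \<eta> - 1))\<^sup>2 * v"
    using lin1 by (simp_all add: linc_def v_def)
  have "measure lborel (W \<inter> (W - S)) = v - \<eta> * v"
  proof -
    have "measure lborel (W - S) = measure lborel W - measure lborel S"
      using W_fin S_facts(4) by (intro measure_Diff) (auto simp: less_top[symmetric])
    then show ?thesis using S_facts(2) by (simp add: v_def Int_absorb1)
  qed
  then have lin2': "integrable M (\<lambda>\<omega>. \<Sum>x\<in>N \<omega> \<inter> W. l x * indicat_real (W - S) x)" "integrable M (\<lambda>\<omega>. (\<Sum>x\<in>N \<omega> \<inter> W. l x * indicat_real (W - S) x)\<^sup>2)"
    "variance (\<lambda>\<omega>. \<Sum>x\<in>N \<omega> \<inter> W. l x * indicat_real (W - S) x) \<le> linc * (a / \<eta>)\<^sup>2 * (v - \<eta> * v)"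
    using lin2 by (simp_all add: linc_def indicator_def)
  note s = variance_sum3[OF P.degenerate_variance(1,2) lin1'(1,2) lin2'(1,2)]
  show "integrable M Z" "integrable M (\<lambda>\<omega>. (Z \<omega>)\<^sup>2)" unfolding e using s(2,3) by simp_all
  have "variance Z \<le> 3 * (variance (\<lambda>\<omega>. P.U \<omega> - 2 * P.G \<omega>) + variance (\<lambda>\<omega>. \<Sum>x\<in>N \<omega> \<inter> W. l x * indicat_real S x)
      + variance (\<lambda>\<omega>. \<Sum>x\<in>N \<omega> \<inter> W. l x * indicat_real (W - S) x))"
    unfolding e by (rule s(1))
  also have "\<dots> \<le> 3 * (P.const * (c / (\<eta> * v))\<^sup>2 * v * (1 + measure lborel D) + linc * (a * (1 / \<eta> - 1))\<^sup>2 * v + linc * (a / \<eta>)\<^sup>2 * (v - \<eta> * v))"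
    using P.degenerate_variance(3) lin1'(3) lin2'(3) by (intro mult_left_mono add_mono) (simp_all add: v_def)
  also have "\<dots> = 3 * (P.const * (c / (\<eta> * v))\<^sup>2 * v * (1 + measure lborel D) + linc * a\<^sup>2 * v * ((1 / \<eta> - 1)\<^sup>2 + (1 - \<eta>) / \<eta>\<^sup>2))"
    unfolding power_mult_distrib power_divide by (simp add: algebra_simps)
  finally show "variance Z \<le> 3 * (P.const * (c / (\<eta> * v))\<^sup>2 * v * (1 + measure lborel D)
      + linc * (2 * lam * \<kappa> / v)\<^sup>2 * v * ((1 / \<eta> - 1)\<^sup>2 + (1 - \<eta>) / \<eta>\<^sup>2))" unfolding a_def .
qed

text \<open>Substituting z = y - x and integrating over x first yields exactly the overlap at z,
  which cancels the denominator. So the product part of the mean is free of edge effects, not only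
  asymptotically.\<close>

lemma I0_eq: "(LINT p|m11. \<psi> (fst p) (snd p)) = lam\<^sup>2 * \<kappa>"
proof -
  have "P.I0 = lam * (LINT x|lborel. indicat_real W x * P.g x)"
    unfolding P.I0_def by (rule integral_m1) measurable
  have nn1: "ennreal (LINT y|lborel. indicat_real W y * \<psi> x y) = (\<integral>\<^sup>+y. ennreal (indicat_real W y * \<psi> x y) \<partial>lborel)" for x
    using g_integrand by (intro nn_integral_eq_integral[symmetric]) auto
  have "ennreal (LINT x|lborel. indicat_real W x * (LINT y|lborel. indicat_real W y * \<psi> x y))
      = (\<integral>\<^sup>+x. ennreal (indicat_real W x * (LINT y|lborel. indicat_real W y * \<psi> x y)) \<partial>lborel)"
  proof (intro nn_integral_eq_integral[symmetric] AE_I2)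
    have eq: "indicat_real W x * (LINT y|lborel. indicat_real W y * \<psi> x y) = (1 / lam) * (indicat_real W x * P.g x)" for x
      using lam_pos by (simp add: g_eq)
    have i: "integrable lborel (\<lambda>x. indicat_real W x * (lam * \<kappa> / (\<eta> * v)))"
      using W_fin by (intro integrable_mult_left integrable_real_indicator) auto
    show "integrable lborel (\<lambda>x. indicat_real W x * (LINT y|lborel. indicat_real W y * \<psi> x y))"
      unfolding eq
      by (intro integrable_mult_right Bochner_Integration.integrable_bound[OF i])
         (use g_upper in \<open>auto intro!: AE_I2 simp: indicator_def simp del: abs_divide intro: order_trans[OF _ abs_ge_self]\<close>)
    show "0 \<le> indicat_real W x * (LINT y|lborel. indicat_real W y * \<psi> x y)" for x
      using g_integrand(3) by (intro mult_nonneg_nonneg integral_nonneg) auto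
  qed
  also have "\<dots> = (\<integral>\<^sup>+x. (\<integral>\<^sup>+y. ennreal (indicat_real W x * indicat_real W y * (k (y - x) / overlap W (y - x))) \<partial>lborel) \<partial>lborel)"
  proof (rule nn_integral_cong)
    fix x
    have "ennreal (indicat_real W x * (LINT y|lborel. indicat_real W y * \<psi> x y))
        = ennreal (indicat_real W x) * (\<integral>\<^sup>+y. ennreal (indicat_real W y * \<psi> x y) \<partial>lborel)"
      using g_integrand(3) by (subst ennreal_mult) (auto simp: nn1)
    also have "\<dots> = (\<integral>\<^sup>+y. ennreal (indicat_real W x) * ennreal (indicat_real W y * \<psi> x y) \<partial>lborel)"
      by (subst nn_integral_cmult) (auto)
    also have "\<dots> = (\<integral>\<^sup>+y. ennreal (indicat_real W x * indicat_real W y * (k (y - x) / overlap W (y - x))) \<partial>lborel)"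
      by (intro nn_integral_cong) (auto simp: \<psi>_def indicator_def)
    finally show "ennreal (indicat_real W x * (LINT y|lborel. indicat_real W y * \<psi> x y))
        = (\<integral>\<^sup>+y. ennreal (indicat_real W x * indicat_real W y * (k (y - x) / overlap W (y - x))) \<partial>lborel)" .
  qed
  also have "\<dots> = (\<integral>\<^sup>+x. (\<integral>\<^sup>+z. ennreal (indicat_real W x * indicat_real W (x + z) * (k z / overlap W z)) \<partial>lborel) \<partial>lborel)"
  proof (rule nn_integral_cong)
    fix x
    show "(\<integral>\<^sup>+y. ennreal (indicat_real W x * indicat_real W y * (k (y - x) / overlap W (y - x))) \<partial>lborel)
        = (\<integral>\<^sup>+z. ennreal (indicat_real W x * indicat_real W (x + z) * (k z / overlap W z)) \<partial>lborel)"
      by (subst lborel_affine_nn_integral[of 1 _ x]) auto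
  qed
  also have "\<dots> = (\<integral>\<^sup>+z. (\<integral>\<^sup>+x. ennreal (indicat_real W x * indicat_real W (x + z) * (k z / overlap W z)) \<partial>lborel) \<partial>lborel)"
    by (rule lborel_pair.Fubini'[symmetric]) measurable
  also have "\<dots> = (\<integral>\<^sup>+z. ennreal (k z) \<partial>lborel)"
  proof (rule nn_integral_cong)
    fix z
    have m: "{u \<in> W. u + z \<in> W} \<in> sets borel" by measurable
    have fin: "emeasure lborel {u \<in> W. u + z \<in> W} < \<infinity>"
      using W(2) by (intro emeasure_bounded_finite) (auto intro: bounded_subset)
    have "(\<integral>\<^sup>+x. ennreal (indicat_real W x * indicat_real W (x + z) * (k z / overlap W z)) \<partial>lborel)
        = (\<integral>\<^sup>+x. ennreal (k z / overlap W z) * indicator {u \<in> W. u + z \<in> W} x \<partial>lborel)"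
      by (intro nn_integral_cong) (auto simp: indicator_def)
    also have "\<dots> = ennreal (k z / overlap W z) * ennreal (overlap W z)"
      using m fin by (subst nn_integral_cmult_indicator) (auto simp: overlap_def emeasure_eq_ennreal_measure)
    also have "\<dots> = ennreal (k z / overlap W z * overlap W z)"
      by (subst ennreal_mult[symmetric]) (auto simp: overlap_def quotient_bound(1)[unfolded overlap_def])
    also have "k z / overlap W z * overlap W z = k z"
    proof (cases "k z = 0")
      case False
      have "0 < \<eta> * v" using eta v_pos by simp
      then have "overlap W z \<noteq> 0" using overlap_bounds(1)[OF k_supp[OF False]] by auto
      then show ?thesis by simp
    qed simp
    finally show "(\<integral>\<^sup>+x. ennreal (indicat_real W x * indicat_real W (x + z) * (k z / overlap W z)) \<partial>lborel) = ennreal (k z)" .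
  qed
  also have "\<dots> = ennreal \<kappa>"
    unfolding \<kappa>_def using k_integrable(1) k_nonneg by (simp add: nn_integral_eq_integral)
  finally have "(LINT x|lborel. indicat_real W x * (LINT y|lborel. indicat_real W y * \<psi> x y)) = \<kappa>"
    using k_integrable(2) g_integrand(3) by (subst (asm) ennreal_inj) (auto intro!: integral_nonneg mult_nonneg_nonneg)
  moreover have "P.I0 = lam * (lam * (LINT x|lborel. indicat_real W x * (LINT y|lborel. indicat_real W y * \<psi> x y)))"
    unfolding P.I0_def by (subst integral_m1) (simp_all add: g_eq mult.left_commute)
  ultimately show ?thesis unfolding P.I11 by (simp add: power2_eq_square)
qed

lemma expectation_U: "expectation P.U = cum2 (\<lambda>p. \<psi> (fst p) (snd p)) + lam\<^sup>2 * \<kappa>"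
proof -
  have "P.U = (\<lambda>\<omega>. \<Sum>p\<in>distinct_pairs (N \<omega> \<inter> W). \<psi> (fst p) (snd p))"
    by (auto simp: P.U_def case_prod_beta')
  then have "expectation P.U = (LINT p|m2. \<psi> (fst p) (snd p))"
    using campbell_W(2)[OF P.\<psi> P.C] by simp
  then show ?thesis unfolding cum2_def I0_eq by simp
qed

text \<open>Close to the diagonal \<psi> is nearly the constant 1/v, because k is close to 1 there
  and the overlap close to v. So \<psi> is split into 1/v times the indicator of the set Q of close
  pairs, the deviation \<open>f1\<close> from it, and the remote part \<open>f2\<close>, which is
  controlled by the tail of the reduced cumulant.\<close>

lemma cum2_estimate:
  assumes m: "0 \<le> m" "m \<le> t * \<rho>"
    and \<delta>: "\<And>z. norm z \<le> m \<Longrightarrow> \<bar>k z - 1\<bar> \<le> \<delta>"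
    and \<epsilon>: "\<And>C. C \<in> bounded_borel {1..<2} \<Longrightarrow> C \<inter> Pi\<^sub>E {1..<2} (\<lambda>_. cball 0 m) = {} \<Longrightarrow> \<bar>red2 C\<bar> \<le> \<epsilon>"
  shows "\<bar>cum2 (\<lambda>p. \<psi> (fst p) (snd p)) - lam * red2 (Pi\<^sub>E {1..<2} (\<lambda>_. cball 0 m))\<bar>
    \<le> 4 * (\<delta> / \<eta> + 1 / \<eta> - 1) * (lam * var2) + 4 * c / \<eta> * lam * \<epsilon> + 2 * lam * var2 * (1 - \<eta>)"
proof -
  define Q where "Q = {p. fst p \<in> W \<and> snd p \<in> W \<and> norm (fst p - snd p) \<le> m}"
  define near where "near p = indicat_real {p. norm (fst p - snd p) \<le> m} p" for p :: "'a \<times> 'a"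
  have [measurable]: "{p. norm (fst p - snd p :: 'a) \<le> m} \<in> sets borel" by measurable
  have Q [measurable]: "Q \<in> sets borel" unfolding Q_def by measurable
  define f1 where "f1 p = (\<psi> (fst p) (snd p) - 1 / v * indicat_real Q p) * near p" for p
  define f2 where "f2 p = \<psi> (fst p) (snd p) * (1 - near p)" for p
  have fm [measurable]: "f1 \<in> borel_measurable borel" "f2 \<in> borel_measurable borel"
    unfolding f1_def f2_def near_def by measurable
  have pv: "0 < \<eta> * v" using eta v_pos by simp
  have \<delta>0: "0 \<le> \<delta>" using \<delta>[of 0] m by auto
  have \<epsilon>0: "0 \<le> \<epsilon>" using \<epsilon>[of "{}"] by (auto simp: bounded_borel_def)
  have b1: "\<bar>f1 p\<bar> \<le> (\<delta> / \<eta> + 1 / \<eta> - 1) / v" for p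
  proof (cases "p \<in> Q")
    case True
    define z where "z = snd p - fst p"
    have z: "norm z \<le> m" using True by (simp add: Q_def z_def norm_minus_commute)
    have ov: "\<eta> * v \<le> overlap W z" "overlap W z \<le> v"
      using overlap_ge[OF W'(1-3) less_imp_le[OF W'(4)] t, of z] z m(2) overlap_bounds(2) by (simp_all add: \<eta>_def v_def)
    then have ov0: "0 < overlap W z" using pv by linarith
    have "f1 p = (k z - 1) / overlap W z + (1 / overlap W z - 1 / v)"
      using True by (simp add: f1_def near_def Q_def \<psi>_def z_def diff_divide_distrib)
    also have "\<bar>\<dots>\<bar> \<le> \<delta> / (\<eta> * v) + (1 / (\<eta> * v) - 1 / v)"
    proof -
      have "\<bar>(k z - 1) / overlap W z\<bar> \<le> \<delta> / (\<eta> * v)"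
        unfolding abs_divide using \<delta>[OF z] ov ov0 pv by (intro frac_le) auto
      moreover have "1 / overlap W z \<le> 1 / (\<eta> * v)" using ov pv by (intro divide_left_mono) auto
      moreover have "1 / v \<le> 1 / overlap W z" using ov ov0 v_pos by (intro divide_left_mono) auto
      ultimately show ?thesis by linarith
    qed
    also have "\<dots> = (\<delta> / \<eta> + 1 / \<eta> - 1) / v" using eta v_pos by (simp add: field_simps)
    finally show ?thesis .
  next
    case False
    then have "f1 p = 0" by (auto simp: f1_def near_def Q_def \<psi>_def indicator_def)
    moreover have "0 \<le> \<delta> / \<eta>" "1 \<le> 1 / \<eta>" using eta \<delta>0 by auto
    ultimately show ?thesis using v_pos by simp
  qed
  have b2: "\<bar>f2 p\<bar> \<le> c / (\<eta> * v)" for p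
    using psi_bound[of "fst p" "snd p"] order_trans[OF psi_bound] by (auto simp: f2_def near_def indicator_def)
  have c1: "\<bar>cum2 f1\<bar> \<le> 4 * ((\<delta> / \<eta> + 1 / \<eta> - 1) / v) * (lam * (var2 * v))"
    using cum2_bound[OF fm(1) b1, where D = UNIV] by (simp add: v_def)
  have c2: "\<bar>cum2 f2\<bar> \<le> 4 * (c / (\<eta> * v)) * (lam * (\<epsilon> * measure lborel (W \<inter> UNIV)))"
  proof (rule c2.functional_bound[OF cum2_base fm(2) b2])
    fix Q' x assume Q': "Q' \<in> sets borel" "Q' \<subseteq> {y. f2 y \<noteq> 0}"
    have "c2.sect Q' x \<inter> Pi\<^sub>E {1..<2} (\<lambda>_. cball 0 m) = {}"
    proof (rule equals0I)
      fix u assume u: "u \<in> c2.sect Q' x \<inter> Pi\<^sub>E {1..<2} (\<lambda>_. cball 0 m)"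
      then have "f2 (u 1 + x, x) \<noteq> 0" using Q'(2) unfolding c2.sect_def by auto
      moreover have "norm (u 1) \<le> m" using u by (auto simp: PiE_def Pi_def)
      ultimately show False by (simp add: f2_def near_def)
    qed
    then show "\<bar>red2 (c2.sect Q' x)\<bar> \<le> \<epsilon> * indicat_real UNIV x"
      using \<epsilon>[OF c2.sect_bounded_borel[OF Q'(1)]] by simp
  qed (use \<epsilon>0 in auto)
  define \<tau> where "\<tau> = red2 (Pi\<^sub>E {1..<2} (\<lambda>_. cball 0 m))"
  have bb: "Pi\<^sub>E {1..<2} (\<lambda>_. cball 0 m) \<in> bounded_borel {1..<2}"
    unfolding bounded_borel_def by (auto intro!: sets_PiM_I_finite exI[of _ m])
  then have \<tau>: "\<bar>\<tau>\<bar> \<le> var2" unfolding \<tau>_def by (rule red2(2))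
  \<comment> \<open>For a base point in S the section of Q is the full ball of radius m, so the
    integrand equals \<tau> there; on W - S it is bounded by \<open>var2\<close>.\<close>
  have "\<bar>cum2 (indicat_real Q) - lam * (\<tau> * (\<eta> * v))\<bar> \<le> lam * (var2 * (v - \<eta> * v))"
  proof -
    note ext = c2.extension[OF cum2_base Q]
    have iS: "integrable lborel (\<lambda>x. \<tau> * indicat_real S x)"
      using S_facts(1) by (intro integrable_mult_right integrable_real_indicator emeasure_bounded_finite compact_imp_bounded) auto
    have sect_S: "red2 (c2.sect Q x) = \<tau>" if "x \<in> S" for x
    proof -
      have "c2.sect Q x = Pi\<^sub>E {1..<2} (\<lambda>_. cball 0 m)"
      proof -
        have "u 1 + x \<in> W" if "norm (u 1) \<le> m" for u :: "nat \<Rightarrow> 'a"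
        proof -
          have "u 1 + x \<in> cball x (t * \<rho>)" using that m by (simp add: dist_norm)
          then show ?thesis using S_facts(3)[OF \<open>x \<in> S\<close>] by blast
        qed
        moreover have "x \<in> W" using \<open>x \<in> S\<close> S_facts(4) by blast
        ultimately show ?thesis
          unfolding c2.sect_def Q_def space_PiM PiE_def Pi_def
          by (auto simp: numeral_eq_Suc less_Suc_eq)
      qed
      then show ?thesis by (simp add: \<tau>_def)
    qed
    have "\<bar>(LINT x|lborel. red2 (c2.sect Q x)) - \<tau> * (\<eta> * v)\<bar> = \<bar>LINT x|lborel. red2 (c2.sect Q x) - \<tau> * indicat_real S x\<bar>"
      using ext iS S_facts(2) by simp
    also have "\<dots> \<le> (LINT x|lborel. \<bar>red2 (c2.sect Q x) - \<tau> * indicat_real S x\<bar>)" by (rule integral_abs_bound)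
    also have "\<dots> \<le> (LINT x|lborel. var2 * indicat_real (W - S) x)"
    proof (rule integral_mono)
      show "integrable lborel (\<lambda>x. \<bar>red2 (c2.sect Q x) - \<tau> * indicat_real S x\<bar>)" using ext iS by auto
      show "integrable lborel (\<lambda>x. var2 * indicat_real (W - S) x)"
        using W(2) by (intro integrable_mult_right integrable_real_indicator emeasure_bounded_finite) (auto intro: bounded_subset)
      show "\<bar>red2 (c2.sect Q x) - \<tau> * indicat_real S x\<bar> \<le> var2 * indicat_real (W - S) x" for x
        using sect_S[of x] red2(2)[OF c2.sect_bounded_borel[OF Q], of x] c2.sect_notin[of x Q] signed_measure_on_empty[OF red2(1)]
        by (cases "x \<in> S"; cases "x \<in> W") auto
    qed
    also have "\<dots> = var2 * (v - \<eta> * v)"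
    proof -
      have "measure lborel (W - S) = measure lborel W - measure lborel S"
        using W_fin S_facts(4) by (intro measure_Diff) (auto simp: less_top[symmetric])
      then show ?thesis using S_facts(2) by (simp add: v_def)
    qed
    finally have "lam * \<bar>(LINT x|lborel. red2 (c2.sect Q x)) - \<tau> * (\<eta> * v)\<bar> \<le> lam * (var2 * (v - \<eta> * v))"
      using lam_pos by simp
    moreover have "cum2 (indicat_real Q) - lam * (\<tau> * (\<eta> * v)) = lam * ((LINT x|lborel. red2 (c2.sect Q x)) - \<tau> * (\<eta> * v))"
      using ext by (simp add: algebra_simps)
    ultimately show ?thesis using lam_pos by (simp add: abs_mult)
  qed
  then have c3: "\<bar>1 / v * cum2 (indicat_real Q) - lam * \<tau> * \<eta>\<bar> \<le> lam * var2 * (1 - \<eta>)"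
  proof -
    assume a: "\<bar>cum2 (indicat_real Q) - lam * (\<tau> * (\<eta> * v))\<bar> \<le> lam * (var2 * (v - \<eta> * v))"
    have "1 / v * cum2 (indicat_real Q) - lam * \<tau> * \<eta> = (cum2 (indicat_real Q) - lam * (\<tau> * (\<eta> * v))) / v"
      using v_pos by (simp add: field_simps)
    then have "\<bar>1 / v * cum2 (indicat_real Q) - lam * \<tau> * \<eta>\<bar> = \<bar>cum2 (indicat_real Q) - lam * (\<tau> * (\<eta> * v))\<bar> / v"
      using v_pos by simp
    also have "\<dots> \<le> lam * (var2 * (v - \<eta> * v)) / v" using a v_pos by (intro divide_right_mono) auto
    also have "\<dots> = lam * var2 * (1 - \<eta>)" using v_pos by (simp add: field_simps)
    finally show ?thesis .
  qed
  have split: "\<psi> (fst p) (snd p) = (f1 p + f2 p) + 1 / v * indicat_real Q p" for p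
    by (auto simp: f1_def f2_def near_def Q_def indicator_def)
  have "cum2 (\<lambda>p. \<psi> (fst p) (snd p)) = cum2 (\<lambda>p. f1 p + f2 p) + cum2 (\<lambda>p. 1 / v * indicat_real Q p)"
    unfolding split
  proof (rule signed_functionalD(1)[OF signed_functional_cum(1)])
    show "\<bar>f1 p + f2 p\<bar> \<le> (\<delta> / \<eta> + 1 / \<eta> - 1) / v + c / (\<eta> * v) + 1 / v" for p
      using b1[of p] b2[of p] v_pos abs_triangle_ineq[of "f1 p" "f2 p"] by (smt (verit) divide_pos_pos)
    have "0 \<le> (\<delta> / \<eta> + 1 / \<eta> - 1) / v" "0 \<le> c / (\<eta> * v)" using b1[of undefined] b2[of undefined] by auto
    then show "\<bar>1 / v * indicat_real Q p\<bar> \<le> (\<delta> / \<eta> + 1 / \<eta> - 1) / v + c / (\<eta> * v) + 1 / v" for p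
      using v_pos by (auto simp: indicator_def)
  qed measurable
  also have "cum2 (\<lambda>p. f1 p + f2 p) = cum2 f1 + cum2 f2"
  proof (rule signed_functionalD(1)[OF signed_functional_cum(1) fm])
    have "0 \<le> (\<delta> / \<eta> + 1 / \<eta> - 1) / v" "0 \<le> c / (\<eta> * v)" using b1[of undefined] b2[of undefined] by auto
    then show "\<bar>f1 p\<bar> \<le> (\<delta> / \<eta> + 1 / \<eta> - 1) / v + c / (\<eta> * v)" "\<bar>f2 p\<bar> \<le> (\<delta> / \<eta> + 1 / \<eta> - 1) / v + c / (\<eta> * v)" for p
      using b1[of p] b2[of p] by linarith+
  qed
  also have "cum2 (\<lambda>p. 1 / v * indicat_real Q p) = 1 / v * cum2 (indicat_real Q)"
    by (rule signed_functionalD(2)[OF signed_functional_cum(1), where C = 1]) (auto simp: indicator_def)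
  finally have e: "cum2 (\<lambda>p. \<psi> (fst p) (snd p)) = cum2 f1 + cum2 f2 + 1 / v * cum2 (indicat_real Q)" .
  \<comment> \<open>S has volume \<eta> v; replacing this by v costs another
    \<open>lam * var2 * (1 - \<eta>)\<close>, which explains the factor 2 in the last term of the
    estimate.\<close>
  have "\<bar>lam * \<tau> * \<eta> - lam * \<tau>\<bar> = lam * \<bar>\<tau>\<bar> * (1 - \<eta>)"
  proof -
    have "lam * \<tau> * \<eta> - lam * \<tau> = - (lam * \<tau> * (1 - \<eta>))" by (simp add: algebra_simps)
    then show ?thesis using lam_pos eta by (simp add: abs_mult)
  qed
  also have "\<dots> \<le> lam * var2 * (1 - \<eta>)" using \<tau> lam_pos eta by (intro mult_right_mono mult_left_mono) auto
  finally have c4: "\<bar>lam * \<tau> * \<eta> - lam * \<tau>\<bar> \<le> lam * var2 * (1 - \<eta>)" .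
  have c1': "\<bar>cum2 f1\<bar> \<le> 4 * (\<delta> / \<eta> + 1 / \<eta> - 1) * (lam * var2)" using c1 v_pos by simp
  have c2': "\<bar>cum2 f2\<bar> \<le> 4 * c / \<eta> * lam * \<epsilon>"
  proof -
    have "4 * (c / (\<eta> * v)) * (lam * (\<epsilon> * measure lborel (W \<inter> UNIV))) = 4 * c / \<eta> * lam * \<epsilon>"
      using v_pos by (simp add: v_def[symmetric])
    then show ?thesis using c2 by simp
  qed
  show ?thesis unfolding e \<tau>_def[symmetric] using c1' c2' c3 c4 by linarith
qed

end

section \<open>Convergence in probability\<close>

text \<open>Measurability is included for every n, so that sums, products and reciprocals of
  convergent sequences can be formed without separate measurability assumptions.\<close>

definition conv_prob :: "'w measure \<Rightarrow> (nat \<Rightarrow> 'w \<Rightarrow> real) \<Rightarrow> real \<Rightarrow> bool" where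
  "conv_prob M X c \<longleftrightarrow> (\<forall>n. X n \<in> borel_measurable M) \<and>
     (\<forall>\<epsilon>>0. (\<lambda>n. measure M {\<omega> \<in> space M. \<epsilon> \<le> \<bar>X n \<omega> - c\<bar>}) \<longlonglongrightarrow> 0)"

context prob_space
begin

lemma conv_probD:
  assumes "conv_prob M X c"
  shows "X n \<in> borel_measurable M" "\<epsilon> > 0 \<Longrightarrow> (\<lambda>n. prob {\<omega> \<in> space M. \<epsilon> \<le> \<bar>X n \<omega> - c\<bar>}) \<longlonglongrightarrow> 0"
  using assms by (auto simp: conv_prob_def)

lemma tendsto_0_squeeze:
  assumes "\<forall>\<^sub>F n in sequentially. f n \<le> g n" "g \<longlonglongrightarrow> 0" "\<And>n. 0 \<le> (f n :: real)"
  shows "f \<longlonglongrightarrow> 0"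
  using assms by (intro tendsto_sandwich[of "\<lambda>_. 0" f sequentially g 0]) auto

text \<open>Markov's inequality, with a nonnegative integral so that integrability is no issue. The
  bound is asked for only eventually because early windows may have volume 0 or contain no suitable
  ball.\<close>

lemma conv_prob_of_L1:
  assumes [measurable]: "\<And>n. X n \<in> borel_measurable M" and e: "e \<longlonglongrightarrow> 0"
    and X: "\<forall>\<^sub>F n in sequentially. (\<integral>\<^sup>+\<omega>. ennreal \<bar>X n \<omega> - c\<bar> \<partial>M) \<le> ennreal (e n)"
  shows "conv_prob M X c"
  unfolding conv_prob_def
proof (intro conjI allI impI)
  fix \<epsilon> :: real assume \<epsilon>: "0 < \<epsilon>"
  show "(\<lambda>n. prob {\<omega> \<in> space M. \<epsilon> \<le> \<bar>X n \<omega> - c\<bar>}) \<longlonglongrightarrow> 0"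
  proof (rule tendsto_0_squeeze)
    show "\<forall>\<^sub>F n in sequentially. prob {\<omega> \<in> space M. \<epsilon> \<le> \<bar>X n \<omega> - c\<bar>} \<le> max 0 (e n) / \<epsilon>"
      using X
    proof eventually_elim
      case (elim n)
      have "{\<omega> \<in> space M. \<epsilon> \<le> \<bar>X n \<omega> - c\<bar>} = {\<omega> \<in> space M. 1 \<le> ennreal (1 / \<epsilon>) * ennreal \<bar>X n \<omega> - c\<bar>}"
        using \<epsilon> by (auto simp: ennreal_mult[symmetric] field_simps)
      then have "emeasure M {\<omega> \<in> space M. \<epsilon> \<le> \<bar>X n \<omega> - c\<bar>} \<le> ennreal (1 / \<epsilon>) * (\<integral>\<^sup>+\<omega>. ennreal \<bar>X n \<omega> - c\<bar> \<partial>M)"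
        using nn_integral_Markov_inequality[of "\<lambda>\<omega>. ennreal \<bar>X n \<omega> - c\<bar>" "space M" M "ennreal (1 / \<epsilon>)"]
        by (simp add: nn_set_integral_space)
      also have "\<dots> \<le> ennreal (1 / \<epsilon>) * ennreal (max 0 (e n))"
        using elim by (intro mult_left_mono order_trans[OF elim]) (auto intro: ennreal_leI)
      also have "\<dots> = ennreal (max 0 (e n) / \<epsilon>)" using \<epsilon> by (subst ennreal_mult[symmetric]) auto
      finally show ?case using \<epsilon> by (simp add: emeasure_eq_measure)
    qed
    show "(\<lambda>n. max 0 (e n) / \<epsilon>) \<longlonglongrightarrow> 0"
      using \<epsilon> tendsto_max[OF tendsto_const[of 0] e] by (auto intro!: tendsto_divide_zero)
  qed simp
qed measurable

lemma conv_prob_of_L2: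
  assumes X [measurable]: "\<And>n. X n \<in> borel_measurable M" and e: "e \<longlonglongrightarrow> 0"
    and V: "\<forall>\<^sub>F n in sequentially. integrable M (\<lambda>\<omega>. (X n \<omega> - c)\<^sup>2) \<and> (LINT \<omega>|M. (X n \<omega> - c)\<^sup>2) \<le> e n"
  shows "conv_prob M X c"
proof -
  have "conv_prob M (\<lambda>n \<omega>. (X n \<omega> - c)\<^sup>2) 0"
  proof (rule conv_prob_of_L1[OF _ e])
    show "\<forall>\<^sub>F n in sequentially. (\<integral>\<^sup>+\<omega>. ennreal \<bar>(X n \<omega> - c)\<^sup>2 - 0\<bar> \<partial>M) \<le> ennreal (e n)"
      using V by eventually_elim (simp add: nn_integral_eq_integral ennreal_leI)
  qed measurable
  note sq = conv_probD(2)[OF this]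
  show ?thesis
    unfolding conv_prob_def
  proof (intro conjI allI impI)
    fix \<epsilon> :: real assume \<epsilon>: "0 < \<epsilon>"
    have "\<epsilon> \<le> \<bar>x\<bar> \<longleftrightarrow> \<epsilon>\<^sup>2 \<le> \<bar>x\<^sup>2 - 0\<bar>" for x
      using \<epsilon> abs_le_square_iff[of \<epsilon> x] by simp
    then show "(\<lambda>n. prob {\<omega> \<in> space M. \<epsilon> \<le> \<bar>X n \<omega> - c\<bar>}) \<longlonglongrightarrow> 0"
      using sq[of "\<epsilon>\<^sup>2"] \<epsilon> by simp
  qed measurable
qed

text \<open>Continuity is required at the limit point only, which admits division; measurability of
  the composition is therefore a separate assumption.\<close>

lemma conv_prob_continuous2:
  assumes X: "conv_prob M X x" and Y: "conv_prob M Y y"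
    and f: "isCont (\<lambda>p. f (fst p) (snd p)) (x, y)"
    and fm: "\<And>n. (\<lambda>\<omega>. f (X n \<omega>) (Y n \<omega>)) \<in> borel_measurable M"
  shows "conv_prob M (\<lambda>n \<omega>. f (X n \<omega>) (Y n \<omega>)) (f x y)"
  unfolding conv_prob_def
proof (intro conjI allI impI)
  note [measurable] = conv_probD(1)[OF X] conv_probD(1)[OF Y] fm
  fix \<epsilon> :: real assume \<epsilon>: "0 < \<epsilon>"
  obtain d where d: "0 < d" "\<And>p. dist p (x, y) < d \<Longrightarrow> dist (f (fst p) (snd p)) (f x y) < \<epsilon>"
    using f \<epsilon> unfolding continuous_at_eps_delta by (force simp: dist_commute)
  have sub: "{\<omega> \<in> space M. \<epsilon> \<le> \<bar>f (X n \<omega>) (Y n \<omega>) - f x y\<bar>}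
      \<subseteq> {\<omega> \<in> space M. d / 2 \<le> \<bar>X n \<omega> - x\<bar>} \<union> {\<omega> \<in> space M. d / 2 \<le> \<bar>Y n \<omega> - y\<bar>}" for n
  proof safe
    fix \<omega> assume \<omega>: "\<omega> \<in> space M" "\<epsilon> \<le> \<bar>f (X n \<omega>) (Y n \<omega>) - f x y\<bar>" "\<not> d / 2 \<le> \<bar>Y n \<omega> - y\<bar>"
    show "d / 2 \<le> \<bar>X n \<omega> - x\<bar>"
    proof (rule ccontr)
      assume a: "\<not> d / 2 \<le> \<bar>X n \<omega> - x\<bar>"
      have "dist (X n \<omega>, Y n \<omega>) (x, y) \<le> dist (X n \<omega>) x + dist (Y n \<omega>) y"
        unfolding dist_Pair_Pair by (rule sqrt_sum_squares_le_sum) auto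
      also have "\<dots> < d" using a \<omega>(3) by (simp add: dist_real_def)
      finally show False using d(2)[of "(X n \<omega>, Y n \<omega>)"] \<omega>(2) by (simp add: dist_real_def)
    qed
  qed
  show "(\<lambda>n. prob {\<omega> \<in> space M. \<epsilon> \<le> \<bar>f (X n \<omega>) (Y n \<omega>) - f x y\<bar>}) \<longlonglongrightarrow> 0"
  proof (rule tendsto_0_squeeze[OF always_eventually])
    show "\<forall>n. prob {\<omega> \<in> space M. \<epsilon> \<le> \<bar>f (X n \<omega>) (Y n \<omega>) - f x y\<bar>}
        \<le> prob {\<omega> \<in> space M. d / 2 \<le> \<bar>X n \<omega> - x\<bar>} + prob {\<omega> \<in> space M. d / 2 \<le> \<bar>Y n \<omega> - y\<bar>}"
      by (intro allI order_trans[OF finite_measure_mono[OF sub] measure_Un_le]) measurable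
    show "(\<lambda>n. prob {\<omega> \<in> space M. d / 2 \<le> \<bar>X n \<omega> - x\<bar>} + prob {\<omega> \<in> space M. d / 2 \<le> \<bar>Y n \<omega> - y\<bar>}) \<longlonglongrightarrow> 0"
      using tendsto_add[OF conv_probD(2)[OF X, of "d / 2"] conv_probD(2)[OF Y, of "d / 2"]] d(1) by simp
  qed simp
qed (rule fm)

lemma conv_prob_add:
  assumes "conv_prob M X x" "conv_prob M Y y"
  shows "conv_prob M (\<lambda>n \<omega>. X n \<omega> + Y n \<omega>) (x + y)"
  using assms conv_probD(1)[OF assms(1)] conv_probD(1)[OF assms(2)]
  by (intro conv_prob_continuous2[where f = "(+)"]) (auto intro!: continuous_intros)

lemma conv_prob_mult:
  assumes "conv_prob M X x" "conv_prob M Y y"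
  shows "conv_prob M (\<lambda>n \<omega>. X n \<omega> * Y n \<omega>) (x * y)"
  using assms conv_probD(1)[OF assms(1)] conv_probD(1)[OF assms(2)]
  by (intro conv_prob_continuous2[where f = "(*)"]) (auto intro!: continuous_intros)

lemma conv_prob_const:
  assumes "c \<longlonglongrightarrow> d"
  shows "conv_prob M (\<lambda>n \<omega>. c n) d"
proof (rule conv_prob_of_L1[where e = "\<lambda>n. \<bar>c n - d\<bar>"])
  show "(\<lambda>n. \<bar>c n - d\<bar>) \<longlonglongrightarrow> 0" using assms by (simp add: LIM_zero tendsto_rabs_zero)
qed (auto simp: emeasure_space_1)

lemma conv_prob_cmult:
  assumes "conv_prob M X x"
  shows "conv_prob M (\<lambda>n \<omega>. c * X n \<omega>) (c * x)"
  using conv_prob_mult[OF conv_prob_const[OF tendsto_const] assms] by simp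

lemma conv_prob_diff:
  assumes "conv_prob M X x" "conv_prob M Y y"
  shows "conv_prob M (\<lambda>n \<omega>. X n \<omega> - Y n \<omega>) (x - y)"
  using conv_prob_add[OF assms(1) conv_prob_cmult[OF assms(2), of "-1"]] by simp

lemma conv_prob_inverse:
  assumes "conv_prob M X x" "x \<noteq> 0"
  shows "conv_prob M (\<lambda>n \<omega>. 1 / X n \<omega>) (1 / x)"
  using conv_probD(1)[OF assms(1)] assms
  by (intro conv_prob_continuous2[OF assms(1) assms(1), where f = "\<lambda>x y. 1 / x"]) (auto intro!: continuous_intros)

text \<open>A sequence bounded in L^1 is tight: |Y| exceeds a large K with small probability, and
  elsewhere the product is at most K |X|.\<close>

lemma conv_prob_tight_mult:
  assumes X: "conv_prob M X 0" and [measurable]: "\<And>n. Y n \<in> borel_measurable M"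
    and Y: "\<forall>\<^sub>F n in sequentially. integrable M (\<lambda>\<omega>. \<bar>Y n \<omega>\<bar>) \<and> (LINT \<omega>|M. \<bar>Y n \<omega>\<bar>) \<le> C"
  shows "conv_prob M (\<lambda>n \<omega>. X n \<omega> * Y n \<omega>) 0"
  unfolding conv_prob_def
proof (intro conjI allI impI)
  note [measurable] = conv_probD(1)[OF X]
  show "(\<lambda>\<omega>. X n \<omega> * Y n \<omega>) \<in> borel_measurable M" for n by measurable
  fix \<epsilon> :: real assume \<epsilon>: "0 < \<epsilon>"
  define C' where "C' = max C 1"
  have C': "0 < C'" by (simp add: C'_def)
  show "(\<lambda>n. prob {\<omega> \<in> space M. \<epsilon> \<le> \<bar>X n \<omega> * Y n \<omega> - 0\<bar>}) \<longlonglongrightarrow> 0"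
  proof (rule LIMSEQ_I)
    fix r :: real assume r: "0 < r"
    define K where "K = 2 * C' / r"
    have K: "0 < K" using C' r by (simp add: K_def)
    have "\<forall>\<^sub>F n in sequentially. prob {\<omega> \<in> space M. \<epsilon> / K \<le> \<bar>X n \<omega> - 0\<bar>} < r / 2"
      using conv_probD(2)[OF X, of "\<epsilon> / K"] \<epsilon> K r by (intro order_tendstoD(2)) auto
    with Y have "\<forall>\<^sub>F n in sequentially. norm (prob {\<omega> \<in> space M. \<epsilon> \<le> \<bar>X n \<omega> * Y n \<omega> - 0\<bar>} - 0) < r"
    proof eventually_elim
      case (elim n)
      have "{\<omega> \<in> space M. \<epsilon> \<le> \<bar>X n \<omega> * Y n \<omega> - 0\<bar>} \<subseteq> {\<omega> \<in> space M. \<epsilon> / K \<le> \<bar>X n \<omega> - 0\<bar>} \<union> {\<omega> \<in> space M. K \<le> \<bar>Y n \<omega>\<bar>}"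
      proof safe
        fix \<omega> assume \<omega>: "\<omega> \<in> space M" "\<epsilon> \<le> \<bar>X n \<omega> * Y n \<omega> - 0\<bar>" "\<not> K \<le> \<bar>Y n \<omega>\<bar>"
        have "\<epsilon> \<le> \<bar>X n \<omega>\<bar> * K" using \<omega>(2,3) mult_left_mono[of "\<bar>Y n \<omega>\<bar>" K "\<bar>X n \<omega>\<bar>"] by (simp add: abs_mult)
        then show "\<epsilon> / K \<le> \<bar>X n \<omega> - 0\<bar>" using K by (simp add: field_simps)
      qed
      then have "prob {\<omega> \<in> space M. \<epsilon> \<le> \<bar>X n \<omega> * Y n \<omega> - 0\<bar>} \<le> prob {\<omega> \<in> space M. \<epsilon> / K \<le> \<bar>X n \<omega> - 0\<bar>} + prob {\<omega> \<in> space M. K \<le> \<bar>Y n \<omega>\<bar>}"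
        by (intro order_trans[OF finite_measure_mono measure_Un_le]) measurable
      also have "prob {\<omega> \<in> space M. K \<le> \<bar>Y n \<omega>\<bar>} \<le> (LINT \<omega>|M. \<bar>Y n \<omega>\<bar>) / K"
        using elim(1) K by (intro integral_Markov_inequality_measure[where A = "{}"]) auto
      also have "\<dots> \<le> C' / K" using elim(1) K by (intro divide_right_mono) (auto simp: C'_def)
      also have "\<dots> = r / 2" using C' by (simp add: K_def)
      finally show ?case using elim(2) by simp
    qed
    then show "\<exists>no. \<forall>n\<ge>no. norm (prob {\<omega> \<in> space M. \<epsilon> \<le> \<bar>X n \<omega> * Y n \<omega> - 0\<bar>} - 0) < r"
      by (simp add: eventually_sequentially)
  qed
qed

text \<open>Serves to identify the asymptotic variances of the two processes: consistent estimators
  with the same law cannot have different limits.\<close>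

lemma conv_prob_unique:
  assumes X: "conv_prob M X x" and Y: "conv_prob M X y"
  shows "x = y"
proof (rule ccontr)
  assume "x \<noteq> y"
  then have d: "0 < \<bar>x - y\<bar> / 2" by simp
  note [measurable] = conv_probD(1)[OF X]
  have "1 \<le> prob {\<omega> \<in> space M. \<bar>x - y\<bar> / 2 \<le> \<bar>X n \<omega> - x\<bar>} + prob {\<omega> \<in> space M. \<bar>x - y\<bar> / 2 \<le> \<bar>X n \<omega> - y\<bar>}" for n
  proof -
    have "space M \<subseteq> {\<omega> \<in> space M. \<bar>x - y\<bar> / 2 \<le> \<bar>X n \<omega> - x\<bar>} \<union> {\<omega> \<in> space M. \<bar>x - y\<bar> / 2 \<le> \<bar>X n \<omega> - y\<bar>}"
    proof
      fix \<omega> assume "\<omega> \<in> space M"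
      moreover have "\<bar>x - y\<bar> \<le> \<bar>X n \<omega> - x\<bar> + \<bar>X n \<omega> - y\<bar>" by linarith
      ultimately show "\<omega> \<in> {\<omega> \<in> space M. \<bar>x - y\<bar> / 2 \<le> \<bar>X n \<omega> - x\<bar>} \<union> {\<omega> \<in> space M. \<bar>x - y\<bar> / 2 \<le> \<bar>X n \<omega> - y\<bar>}"
        by (cases "\<bar>x - y\<bar> / 2 \<le> \<bar>X n \<omega> - x\<bar>") auto
    qed
    then have "prob (space M) \<le> prob {\<omega> \<in> space M. \<bar>x - y\<bar> / 2 \<le> \<bar>X n \<omega> - x\<bar>} + prob {\<omega> \<in> space M. \<bar>x - y\<bar> / 2 \<le> \<bar>X n \<omega> - y\<bar>}"
      by (intro order_trans[OF finite_measure_mono measure_Un_le]) measurable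
    then show ?thesis by (simp add: prob_space)
  qed
  moreover have "(\<lambda>n. prob {\<omega> \<in> space M. \<bar>x - y\<bar> / 2 \<le> \<bar>X n \<omega> - x\<bar>} + prob {\<omega> \<in> space M. \<bar>x - y\<bar> / 2 \<le> \<bar>X n \<omega> - y\<bar>}) \<longlonglongrightarrow> 0"
    using tendsto_add[OF conv_probD(2)[OF X d] conv_probD(2)[OF Y d]] by simp
  ultimately have "(1 :: real) \<le> 0" by (intro LIMSEQ_le_const) auto
  then show False by simp
qed

text \<open>Tested on the piecewise linear functions \<open>cts_step\<close>, which are Lipschitz
  with constant 1/(b - a): off an event of small probability the two integrands differ by at most
  r/2, on it by at most 1.\<close>

lemma slutsky:
  assumes X [measurable]: "\<And>n. X n \<in> borel_measurable M" and D: "conv_prob M (\<lambda>n \<omega>. Y n \<omega> - X n \<omega>) 0"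
    and Y [measurable]: "\<And>n. Y n \<in> borel_measurable M"
    and \<mu>: "real_distribution \<mu>" and W: "weak_conv_m (\<lambda>n. distr M borel (X n)) \<mu>"
  shows "weak_conv_m (\<lambda>n. distr M borel (Y n)) \<mu>"
proof -
  have rX: "real_distribution (distr M borel (X n))" and rY: "real_distribution (distr M borel (Y n))" for n
    by (auto intro!: real_distribution_distr)
  show ?thesis
  proof (rule integral_cts_step_conv_imp_weak_conv[OF rY \<mu>])
    fix a b :: real assume ab: "a < b"
    have uc: "isCont (cts_step a b) x" for x
      by (rule continuous_on_interior[OF uniformly_continuous_imp_continuous[OF cts_step_uniformly_continuous[OF ab]]]) simp
    have cm [measurable]: "cts_step a b \<in> borel_measurable borel"
      using uc by (intro borel_measurable_continuous_onI) (auto intro: continuous_at_imp_continuous_on)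
    have c01: "0 \<le> cts_step a b x" "cts_step a b x \<le> 1" for x using ab by (auto simp: cts_step_def divide_simps)
    have lip: "\<bar>cts_step a b x - cts_step a b y\<bar> \<le> \<bar>x - y\<bar> / (b - a)" for x y
      using ab by (auto simp: cts_step_def divide_simps split: if_splits)
    have lim: "(\<lambda>n. integral\<^sup>L (distr M borel (X n)) (cts_step a b)) \<longlonglongrightarrow> integral\<^sup>L \<mu> (cts_step a b)"
      using uc c01 by (intro weak_conv_imp_integral_bdd_continuous_conv[OF rX \<mu> W, where B = 1]) auto
    have i: "integrable M (\<lambda>\<omega>. cts_step a b (Z \<omega>))" if [measurable]: "Z \<in> borel_measurable M" for Z :: "'a \<Rightarrow> real"
      using c01 by (intro integrable_const_bound[of _ 1]) auto
    have "(\<lambda>n. integral\<^sup>L (distr M borel (Y n)) (cts_step a b) - integral\<^sup>L (distr M borel (X n)) (cts_step a b)) \<longlonglongrightarrow> 0"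
    proof (rule LIMSEQ_I)
      fix r :: real assume r: "0 < r"
      define \<epsilon> where "\<epsilon> = r / 2 * (b - a)"
      have \<epsilon>: "0 < \<epsilon>" using r ab by (simp add: \<epsilon>_def)
      have "\<forall>\<^sub>F n in sequentially. prob {\<omega> \<in> space M. \<epsilon> \<le> \<bar>Y n \<omega> - X n \<omega> - 0\<bar>} < r / 2"
        using conv_probD(2)[OF D \<epsilon>] r by (intro order_tendstoD(2)) auto
      then have "\<forall>\<^sub>F n in sequentially. norm (integral\<^sup>L (distr M borel (Y n)) (cts_step a b) - integral\<^sup>L (distr M borel (X n)) (cts_step a b) - 0) < r"
      proof eventually_elim
        case (elim n)
        define A where "A = {\<omega> \<in> space M. \<epsilon> \<le> \<bar>Y n \<omega> - X n \<omega> - 0\<bar>}"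
        have [measurable]: "A \<in> sets M" unfolding A_def by measurable
        have "\<bar>(LINT \<omega>|M. cts_step a b (Y n \<omega>)) - (LINT \<omega>|M. cts_step a b (X n \<omega>))\<bar>
            = \<bar>LINT \<omega>|M. cts_step a b (Y n \<omega>) - cts_step a b (X n \<omega>)\<bar>" using i[OF X] i[OF Y] by simp
        also have "\<dots> \<le> (LINT \<omega>|M. \<bar>cts_step a b (Y n \<omega>) - cts_step a b (X n \<omega>)\<bar>)" by (rule integral_abs_bound)
        also have "\<dots> \<le> (LINT \<omega>|M. r / 2 + indicat_real A \<omega>)"
        proof (rule integral_mono)
          show "integrable M (\<lambda>\<omega>. \<bar>cts_step a b (Y n \<omega>) - cts_step a b (X n \<omega>)\<bar>)" using i[OF X] i[OF Y] by simp
          show "integrable M (\<lambda>\<omega>. r / 2 + indicat_real A \<omega>)"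
            by (intro Bochner_Integration.integrable_add integrable_const integrable_real_indicator) (auto simp: emeasure_eq_measure)
          fix \<omega> assume \<omega>: "\<omega> \<in> space M"
          show "\<bar>cts_step a b (Y n \<omega>) - cts_step a b (X n \<omega>)\<bar> \<le> r / 2 + indicat_real A \<omega>"
          proof (cases "\<omega> \<in> A")
            case True
            then show ?thesis using c01[of "Y n \<omega>"] c01[of "X n \<omega>"] r by simp
          next
            case False
            then have "\<bar>Y n \<omega> - X n \<omega>\<bar> < \<epsilon>" using \<omega> by (auto simp: A_def)
            then have "\<bar>Y n \<omega> - X n \<omega>\<bar> / (b - a) \<le> r / 2" using ab by (simp add: \<epsilon>_def field_simps)
            then have "\<bar>cts_step a b (Y n \<omega>) - cts_step a b (X n \<omega>)\<bar> \<le> r / 2"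
              using lip[of "Y n \<omega>" "X n \<omega>"] by linarith
            then show ?thesis using False by simp
          qed
        qed
        also have "\<dots> = r / 2 + prob A"
          by (subst Bochner_Integration.integral_add) (auto simp: prob_space emeasure_eq_measure intro!: integrable_real_indicator)
        also have "\<dots> < r" using elim by (simp add: A_def)
        finally show ?case by (simp add: integral_distr)
      qed
      then show "\<exists>no. \<forall>n\<ge>no. norm (integral\<^sup>L (distr M borel (Y n)) (cts_step a b) - integral\<^sup>L (distr M borel (X n)) (cts_step a b) - 0) < r"
        by (simp add: eventually_sequentially)
    qed
    from tendsto_add[OF this lim] show "(\<lambda>n. integral\<^sup>L (distr M borel (Y n)) (cts_step a b)) \<longlonglongrightarrow> integral\<^sup>L \<mu> (cts_step a b)"
      by simp
  qed
qed

lemma weak_conv_continuous_image: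
  assumes X [measurable]: "\<And>n. X n \<in> borel_measurable M"
    and \<mu>: "real_distribution \<mu>" and W: "weak_conv_m (\<lambda>n. distr M borel (X n)) \<mu>"
    and g: "\<And>x. isCont g x"
  shows "weak_conv_m (\<lambda>n. distr M borel (\<lambda>\<omega>. g (X n \<omega>))) (distr \<mu> borel g)"
proof -
  interpret \<mu>: real_distribution \<mu> by fact
  have [measurable]: "g \<in> borel_measurable borel"
    using g by (intro borel_measurable_continuous_onI) (auto intro: continuous_at_imp_continuous_on)
  have rX: "real_distribution (distr M borel (X n))" and rg: "real_distribution (distr M borel (\<lambda>\<omega>. g (X n \<omega>)))" for n
    by (auto intro!: real_distribution_distr)
  have r\<mu>: "real_distribution (distr \<mu> borel g)" by (rule \<mu>.real_distribution_distr) simp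
  show ?thesis
  proof (rule integral_bdd_continuous_conv_imp_weak_conv[OF rg r\<mu>])
    fix f :: "real \<Rightarrow> real" and B assume f: "\<And>x. isCont f x" "\<And>x. \<bar>f x\<bar> \<le> B"
    have [measurable]: "f \<in> borel_measurable borel"
      using f by (intro borel_measurable_continuous_onI) (auto intro: continuous_at_imp_continuous_on)
    have "(\<lambda>n. integral\<^sup>L (distr M borel (X n)) (\<lambda>x. f (g x))) \<longlonglongrightarrow> integral\<^sup>L \<mu> (\<lambda>x. f (g x))"
      using f g by (intro weak_conv_imp_integral_bdd_continuous_conv[OF rX \<mu> W, where B = B]) (auto intro: isCont_o2)
    then show "(\<lambda>n. integral\<^sup>L (distr M borel (\<lambda>\<omega>. g (X n \<omega>))) f) \<longlonglongrightarrow> integral\<^sup>L (distr \<mu> borel g) f"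
      by (simp add: integral_distr)
  qed
qed

end

section \<open>Limits for one process\<close>

text \<open>A finite disjoint family that nearly exhausts the total variation lies in some ball; a
  set outside this ball can be added to the family, so it carries at most the missing \<epsilon>.
  Applied to differences of balls this makes the masses of balls a Cauchy sequence, so the limit in
  \<open>total_mass\<close> exists.\<close>

lemma (in mixing_process) red2_tail:
  assumes "0 < \<epsilon>"
  obtains m :: nat where "\<And>C. C \<in> bounded_borel {1..<2} \<Longrightarrow> C \<inter> Pi\<^sub>E {1..<2} (\<lambda>_. cball 0 (real m)) = {} \<Longrightarrow>
      \<bar>cumulant_red M N 2 C\<bar> \<le> \<epsilon>"
    "\<bar>total_mass {1..<2} (cumulant_red M N 2) - cumulant_red M N 2 (Pi\<^sub>E {1..<2} (\<lambda>_. cball 0 (real m)))\<bar> \<le> \<epsilon>"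
proof -
  define \<rho> where "\<rho> = cumulant_red M N 2"
  define K where "K m = Pi\<^sub>E {1..<2::nat} (\<lambda>_. cball (0::'a) (real m))" for m :: nat
  define V where "V = variation_norm {1..<2} \<rho>"
  have V: "V < \<infinity>" and s: "signed_measure_on {1..<2} \<rho>"
    using B4 unfolding B4_mixing_def is_reduced_def \<rho>_def V_def by auto
  have tail: "\<exists>m. \<forall>C\<in>bounded_borel {1..<2}. C \<inter> K m = {} \<longrightarrow> \<bar>\<rho> C\<bar> \<le> \<epsilon>" if \<epsilon>: "0 < \<epsilon>" for \<epsilon>
  proof -
    define \<F> :: "(nat \<Rightarrow> 'a) set set set" where "\<F> = {F. finite F \<and> F \<subseteq> bounded_borel {1..<2} \<and> disjoint F}"
    have SUP: "V = (SUP F\<in>\<F>. \<Sum>C\<in>F. ennreal \<bar>\<rho> C\<bar>)" by (simp add: V_def variation_norm_def \<F>_def)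
    have ne: "\<F> \<noteq> {}" by (auto simp: \<F>_def intro!: exI[of _ "{}"])
    have "\<exists>F\<in>\<F>. V < (\<Sum>C\<in>F. ennreal \<bar>\<rho> C\<bar>) + ennreal \<epsilon>"
      by (rule SUP_approx_ennreal[OF \<epsilon> ne SUP]) (use V in auto)
    then obtain F where F: "F \<in> \<F>" "V < (\<Sum>C\<in>F. ennreal \<bar>\<rho> C\<bar>) + ennreal \<epsilon>" by blast
    have Fb: "\<exists>m::nat. C \<subseteq> K m" if "C \<in> F" for C
    proof -
      have "C \<in> bounded_borel {1..<2}" using F(1) that unfolding \<F>_def by blast
      then obtain r where r: "C \<subseteq> Pi\<^sub>E {1..<2} (\<lambda>_. cball 0 r)" unfolding bounded_borel_def by blast
      obtain m :: nat where "r \<le> real m" using real_arch_simple by blast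
      then have "Pi\<^sub>E {1..<2::nat} (\<lambda>_. cball 0 r) \<subseteq> K m" unfolding K_def by (intro PiE_mono) auto
      then show ?thesis using r by blast
    qed
    then obtain f where f: "\<And>C. C \<in> F \<Longrightarrow> C \<subseteq> K (f C)" by metis
    \<comment> \<open>A sum in place of a maximum, which covers an empty family as well.\<close>
    define m where "m = (\<Sum>C\<in>F. f C)"
    have finF: "finite F" using F(1) by (simp add: \<F>_def)
    have sub: "C \<subseteq> K m" if "C \<in> F" for C
    proof -
      have "f C \<le> m" unfolding m_def using finF that by (intro member_le_sum) auto
      then have "K (f C) \<subseteq> K m" unfolding K_def by (intro PiE_mono) auto
      then show ?thesis using f[OF that] by blast
    qed
    have "\<bar>\<rho> C\<bar> \<le> \<epsilon>" if C: "C \<in> bounded_borel {1..<2}" "C \<inter> K m = {}" for C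
    \<comment> \<open>The empty set may already belong to F and is treated apart; any other C
      disjoint from \<open>K m\<close> is a new member of the family.\<close>
    proof (cases "C = {}")
      case True
      then show ?thesis using signed_measure_on_empty[OF s] \<epsilon> by simp
    next
      case False
      have nin: "C \<notin> F" using sub[of C] C(2) False by blast
      have "C \<inter> D = {}" if "D \<in> F" for D using sub[OF that] C(2) by blast
      then have "insert C F \<in> \<F>"
        using F(1) C(1) nin unfolding \<F>_def disjoint_def by (auto simp: Int_commute)
      then have "(\<Sum>C\<in>insert C F. ennreal \<bar>\<rho> C\<bar>) \<le> V" unfolding SUP by (rule SUP_upper)
      then have "ennreal \<bar>\<rho> C\<bar> + (\<Sum>C\<in>F. ennreal \<bar>\<rho> C\<bar>) \<le> V" using nin finF by simp
      also have "\<dots> \<le> ennreal \<epsilon> + (\<Sum>C\<in>F. ennreal \<bar>\<rho> C\<bar>)" using F(2) by (simp add: add.commute)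
      finally have "(\<Sum>C\<in>F. ennreal \<bar>\<rho> C\<bar>) + ennreal \<bar>\<rho> C\<bar> \<le> (\<Sum>C\<in>F. ennreal \<bar>\<rho> C\<bar>) + ennreal \<epsilon>"
        by (simp add: add.commute)
      then have "ennreal \<bar>\<rho> C\<bar> \<le> ennreal \<epsilon>"
        unfolding ennreal_add_left_cancel_le by simp
      then show ?thesis using \<epsilon> by (simp add: ennreal_le_iff)
    qed
    then show ?thesis by blast
  qed
  have Kb: "K m \<in> bounded_borel {1..<2}" for m
    unfolding K_def bounded_borel_def by (auto intro!: sets_PiM_I_finite exI[of _ "real m"])
  have diff: "\<bar>\<rho> (K j) - \<rho> (K m)\<bar> \<le> \<epsilon>"
    if m: "\<forall>C\<in>bounded_borel {1..<2}. C \<inter> K m = {} \<longrightarrow> \<bar>\<rho> C\<bar> \<le> \<epsilon>" and j: "m \<le> j" for m j \<epsilon>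
  proof -
    have sub: "K m \<subseteq> K j" unfolding K_def using j by (intro PiE_mono) auto
    have d: "K j - K m \<in> bounded_borel {1..<2}"
      using Kb[of j] Kb[of m] unfolding bounded_borel_def by auto
    have "\<rho> (K m \<union> (K j - K m)) = \<rho> (K m) + \<rho> (K j - K m)"
      by (rule signed_measure_on_add[OF s Kb d]) (use sub Kb[of j] in \<open>auto simp: Un_absorb1\<close>)
    then have "\<rho> (K j) - \<rho> (K m) = \<rho> (K j - K m)" using sub by (simp add: Un_absorb1)
    moreover have "\<bar>\<rho> (K j - K m)\<bar> \<le> \<epsilon>" using m d by blast
    ultimately show ?thesis by simp
  qed
  have "Cauchy (\<lambda>j. \<rho> (K j))"
  proof (rule metric_CauchyI)
    fix e :: real assume e: "0 < e"
    obtain m where m: "\<forall>C\<in>bounded_borel {1..<2}. C \<inter> K m = {} \<longrightarrow> \<bar>\<rho> C\<bar> \<le> e / 3" using tail[of "e / 3"] e by auto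
    have "dist (\<rho> (K i)) (\<rho> (K j)) < e" if "m \<le> i" "m \<le> j" for i j
      using diff[OF m that(1)] diff[OF m that(2)] e unfolding dist_real_def by linarith
    then show "\<exists>Mb. \<forall>m\<ge>Mb. \<forall>n\<ge>Mb. dist (\<rho> (K m)) (\<rho> (K n)) < e" by blast
  qed
  then have lim: "(\<lambda>j. \<rho> (K j)) \<longlonglongrightarrow> total_mass {1..<2} \<rho>"
    unfolding total_mass_def K_def by (simp add: Cauchy_convergent_iff convergent_LIMSEQ_iff)
  obtain m where m: "\<forall>C\<in>bounded_borel {1..<2}. C \<inter> K m = {} \<longrightarrow> \<bar>\<rho> C\<bar> \<le> \<epsilon>" using tail[OF assms] by blast
  have "(\<lambda>j. \<bar>\<rho> (K j) - \<rho> (K m)\<bar>) \<longlonglongrightarrow> \<bar>total_mass {1..<2} \<rho> - \<rho> (K m)\<bar>"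
    using lim by (intro tendsto_intros)
  then have "\<bar>total_mass {1..<2} \<rho> - \<rho> (K m)\<bar> \<le> \<epsilon>"
    by (rule LIMSEQ_le_const2) (use diff[OF m] in blast)
  then show ?thesis using m that[of m] unfolding \<rho>_def K_def by blast
qed

locale window_sequence = mixing_process M N for M :: "'w measure" and N :: "'w \<Rightarrow> 'a::euclidean_space set" +
  fixes W :: "nat \<Rightarrow> 'a set"
  assumes W: "convex_averaging W"
begin

abbreviation "v n \<equiv> measure lborel (W n)"
abbreviation "sc n \<equiv> window_scale (W n)"

lemma W_convex: "convex (W n)" "compact (W n)" "W n \<in> sets borel" "bounded (W n)"
  using W by (auto simp: convex_averaging_def borel_closed compact_imp_closed compact_imp_bounded)

lemmas W_limits = convex_averaging_limits[OF W]

lemma v_pos: "\<forall>\<^sub>F n in sequentially. 0 < v n"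
  using eventually_compose_filterlim[OF eventually_gt_at_top[of 0] W_limits(3)] .

lemma inv_v: "(\<lambda>n. 1 / v n) \<longlonglongrightarrow> 0"
  by (rule tendsto_divide_0[OF tendsto_const filterlim_at_top_imp_at_infinity[OF W_limits(3)]])

lemma window_n: "window M N (W n)"
  by unfold_locales (rule W_convex)+

text \<open>The constants of the variance bounds depend on the process but not on the window; here
  they are written without one, so that they are visibly the same for all n.\<close>

definition linc0 where "linc0 = 4 * lam * window.var2 M N + lam"
definition const0 where "const0 = 4 * lam * window.var4 M N + 32 * lam\<^sup>2 * (window.var2 M N)\<^sup>2 + 16 * lam * window.var3 M N + 16 * lam\<^sup>2 * window.var2 M N + 8 * lam * window.var2 M N + 2 * lam\<^sup>2"

lemma var_nonneg: "0 \<le> window.var2 M N" "0 \<le> window.var3 M N" "0 \<le> window.var4 M N"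
proof -
  interpret w: window M N "W 0" by (rule window_n)
  show "0 \<le> w.var2" "0 \<le> w.var3" "0 \<le> w.var4" by (simp_all add: w.var2_def w.var3_def w.var4_def)
qed

lemma const_nonneg: "0 \<le> linc0" "0 \<le> const0"
  using var_nonneg lam_pos by (simp_all add: linc0_def const0_def)

lemma count_variance:
  shows "integrable M (\<lambda>\<omega>. real (card (N \<omega> \<inter> W n)))" "integrable M (\<lambda>\<omega>. (real (card (N \<omega> \<inter> W n)))\<^sup>2)"
    "expectation (\<lambda>\<omega>. real (card (N \<omega> \<inter> W n))) = lam * v n"
    "variance (\<lambda>\<omega>. real (card (N \<omega> \<inter> W n))) \<le> linc0 * v n"
proof -
  interpret w: window M N "W n" by (rule window_n)
  note l = w.linear_variance[of "\<lambda>_. 1" 1 UNIV]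
  show "integrable M (\<lambda>\<omega>. real (card (N \<omega> \<inter> W n)))" "integrable M (\<lambda>\<omega>. (real (card (N \<omega> \<inter> W n)))\<^sup>2)"
    "variance (\<lambda>\<omega>. real (card (N \<omega> \<inter> W n))) \<le> linc0 * v n"
    using l by (simp_all add: linc0_def)
  have "expectation (\<lambda>\<omega>. real (card (N \<omega> \<inter> W n))) = measure w.m1 UNIV"
    using w.campbell_W(1)[of "\<lambda>_. 1" 1] by simp
  then show "expectation (\<lambda>\<omega>. real (card (N \<omega> \<inter> W n))) = lam * v n"
    using w.measure_m1[of UNIV] by simp
qed

lemma lambda_est_variance:
  assumes "0 < v n"
  shows "integrable M (\<lambda>\<omega>. (lambda_est (W n) (N \<omega>) - lam)\<^sup>2)" "(LINT \<omega>|M. (lambda_est (W n) (N \<omega>) - lam)\<^sup>2) \<le> linc0 / v n"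
proof -
  have e: "(lambda_est (W n) (N \<omega>) - lam)\<^sup>2 = (real (card (N \<omega> \<inter> W n)) - expectation (\<lambda>\<omega>. real (card (N \<omega> \<inter> W n))))\<^sup>2 / (v n)\<^sup>2" for \<omega>
    unfolding count_variance(3) lambda_est_def power_divide[symmetric] using assms by (simp add: diff_divide_distrib)
  have i: "integrable M (\<lambda>\<omega>. (real (card (N \<omega> \<inter> W n)) - expectation (\<lambda>\<omega>. real (card (N \<omega> \<inter> W n))))\<^sup>2)"
    using count_variance(1,2)[of n] by (simp add: power2_diff)
  show "integrable M (\<lambda>\<omega>. (lambda_est (W n) (N \<omega>) - lam)\<^sup>2)" unfolding e using i by simp
  have "(LINT \<omega>|M. (lambda_est (W n) (N \<omega>) - lam)\<^sup>2) \<le> linc0 * v n / (v n)\<^sup>2"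
    unfolding e using count_variance(4)[of n] assms by (simp add: divide_right_mono)
  also have "\<dots> = linc0 / v n" using assms by (simp add: power2_eq_square)
  finally show "(LINT \<omega>|M. (lambda_est (W n) (N \<omega>) - lam)\<^sup>2) \<le> linc0 / v n" .
qed

lemma count_measurable [measurable]: "(\<lambda>\<omega>. real (card (N \<omega> \<inter> W n))) \<in> borel_measurable M"
  using count_variance(1) by auto

lemma lambda_est_measurable [measurable]: "(\<lambda>\<omega>. lambda_est (W n) (N \<omega>)) \<in> borel_measurable M"
  unfolding lambda_est_def by measurable

lemma lambda2_est_measurable [measurable]: "(\<lambda>\<omega>. lambda2_est (W n) (N \<omega>)) \<in> borel_measurable M"
  unfolding lambda2_est_def by measurable

lemma lambda_est_conv: "conv_prob M (\<lambda>n \<omega>. lambda_est (W n) (N \<omega>)) lam"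
proof (rule conv_prob_of_L2)
  show "(\<lambda>n. linc0 / v n) \<longlonglongrightarrow> 0" using tendsto_mult_left[OF inv_v, of linc0] by simp
  show "\<forall>\<^sub>F n in sequentially. integrable M (\<lambda>\<omega>. (lambda_est (W n) (N \<omega>) - lam)\<^sup>2)
      \<and> (LINT \<omega>|M. (lambda_est (W n) (N \<omega>) - lam)\<^sup>2) \<le> linc0 / v n"
    using v_pos by eventually_elim (use lambda_est_variance in blast)
qed measurable

lemma lambda2_est_eq: "lambda2_est (W n) S = (lambda_est (W n) S)\<^sup>2 - 1 / v n * lambda_est (W n) S"
  by (cases "v n = 0") (simp_all add: lambda2_est_def lambda_est_def power2_eq_square field_simps)

lemma lambda2_est_conv: "conv_prob M (\<lambda>n \<omega>. lambda2_est (W n) (N \<omega>)) (lam\<^sup>2)"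
  unfolding lambda2_est_eq
  using conv_prob_diff[OF conv_prob_mult[OF lambda_est_conv lambda_est_conv] conv_prob_mult[OF conv_prob_const[OF inv_v] lambda_est_conv]]
  by (simp add: power2_eq_square)

lemma pair_sum_measurable:
  assumes F: "(\<lambda>p. F (fst p) (snd p)) \<in> borel_measurable borel"
  shows "(\<lambda>\<omega>. \<Sum>(x, y)\<in>distinct_pairs (N \<omega> \<inter> W n). F x y :: real) \<in> borel_measurable M"
  using finite_process_sum_measurable[OF finite_process_tuples(1)[OF finite_process_N[OF W_convex(3,4)]] F]
  by (simp add: case_prod_beta')

text \<open>The bias of \<open>lambda2K_est\<close> is not controlled; it cancels when two processes with the same
  law are compared.\<close>

lemma K_projection:
  fixes B :: "'a set" and R \<alpha> :: real
  assumes B: "compact B" "\<forall>x\<in>B. - x \<in> B" and R: "0 < R"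
    and \<alpha>: "0 < \<alpha>" "(\<lambda>n. sc n powr \<alpha> / inball_radius (W n)) \<longlonglongrightarrow> 0"
  defines "Z \<equiv> \<lambda>n r \<omega>. v n powr (1 / 2 - \<alpha>) * lambda2K_est B (W n) (N \<omega>) (sc n powr \<alpha> * r)
      - 2 * lam * measure lborel B * r ^ DIM('a) / sqrt (v n) * real (card (N \<omega> \<inter> W n))"
  obtains e where "e \<longlonglongrightarrow> 0" "\<And>n. 0 \<le> e n"
    "\<forall>\<^sub>F n in sequentially. \<forall>r\<in>{0..R}. integrable M (Z n r) \<and> integrable M (\<lambda>\<omega>. (Z n r \<omega>)\<^sup>2) \<and> variance (Z n r) \<le> e n"
proof -
  obtain b0 where b0: "0 < b0" "B \<subseteq> cball 0 b0"
    using compact_imp_bounded[OF B(1)] bounded_pos by (metis mem_cball_0 subsetI)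
  \<comment> \<open>Chosen such that the scaled copies of B for all r \<le> R lie in the ball of
    radius \<open>t n\<close> times half the inradius; \<open>b0\<close> is the radius of a ball
    containing B.\<close>
  define t where "t n = sc n powr \<alpha> * R * b0 / (inball_radius (W n) / 2)" for n
  define \<eta> where "\<eta> n = (1 - t n) ^ DIM('a)" for n
  define p where "p n = v n powr \<alpha>" for n
  \<comment> \<open>The bound of \<open>centered_bound\<close> after normalization, with r replaced
    by R to make it uniform in r. The first part tends to 0 like 1/\<open>p n\<close> =
    |W|^(-\<alpha>), the second because \<eta> tends to 1.\<close>
  define e where "e n = 3 * (const0 / (\<eta> n)\<^sup>2 * ((1 / p n)\<^sup>2 + R ^ DIM('a) * measure lborel B * (1 / p n))
      + linc0 * 4 * lam\<^sup>2 * (measure lborel B)\<^sup>2 * (R ^ DIM('a))\<^sup>2 * ((1 / \<eta> n - 1)\<^sup>2 + (1 - \<eta> n) / (\<eta> n)\<^sup>2))" for n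
  have "t = (\<lambda>n. (2 * R * b0) * (sc n powr \<alpha> / inball_radius (W n)))" by (auto simp: t_def)
  then have t: "t \<longlonglongrightarrow> 0" using tendsto_mult_left[OF \<alpha>(2), of "2 * R * b0"] by simp
  have eta: "\<eta> \<longlonglongrightarrow> 1"
    unfolding \<eta>_def using tendsto_power[OF tendsto_diff[OF tendsto_const[of 1] t], of "DIM('a)"] by simp
  have "(\<lambda>n. v n powr (- \<alpha>)) \<longlonglongrightarrow> 0"
    using \<alpha>(1) by (intro tendsto_neg_powr[OF _ W_limits(3)]) auto
  then have p: "(\<lambda>n. 1 / p n) \<longlonglongrightarrow> 0" by (simp add: p_def powr_minus_divide)
  have "e \<longlonglongrightarrow> 3 * (const0 / 1\<^sup>2 * (0\<^sup>2 + R ^ DIM('a) * measure lborel B * 0)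
      + linc0 * 4 * lam\<^sup>2 * (measure lborel B)\<^sup>2 * (R ^ DIM('a))\<^sup>2 * ((1 / 1 - 1)\<^sup>2 + (1 - 1) / 1\<^sup>2))"
    unfolding e_def by (intro tendsto_intros eta p) auto
  then have e0: "e \<longlonglongrightarrow> 0" by simp
  have main: "\<forall>\<^sub>F n in sequentially. \<forall>r\<in>{0..R}. integrable M (Z n r) \<and> integrable M (\<lambda>\<omega>. (Z n r \<omega>)\<^sup>2) \<and> variance (Z n r) \<le> e n"
    using W_limits(2) eventually_compose_filterlim[OF eventually_gt_at_top[of 0] W_limits(1)] v_pos order_tendstoD(2)[OF t, of 1, simplified]
  proof eventually_elim
    case (elim n)
    then obtain x0 where x0: "cball x0 (inball_radius (W n) / 2) \<subseteq> W n" by blast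
    show ?case
    proof
      fix r assume r: "r \<in> {0..R}"
      define s where "s = sc n powr \<alpha> * r"
      define D where "D = (\<lambda>z. s *\<^sub>R z) ` B"
      have s0: "0 \<le> s" using r by (simp add: s_def)
      note sB = scaled_set[OF B(1) s0, folded D_def]
      have Db: "D \<in> sets borel" using sB(1) by (simp add: borel_closed compact_imp_closed)
      have tn: "0 \<le> t n" using elim(2) R b0(1) by (simp add: t_def)
      have sub: "D \<subseteq> cball 0 (t n * (inball_radius (W n) / 2))"
      proof
        fix z assume "z \<in> D"
        then obtain b where b: "b \<in> B" "z = s *\<^sub>R b" by (auto simp: D_def)
        have "norm z \<le> s * b0" using b b0(2) s0 by (auto intro!: mult_left_mono)
        also have "\<dots> \<le> sc n powr \<alpha> * R * b0" unfolding s_def using r b0(1) by (intro mult_right_mono mult_left_mono) auto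
        also have "\<dots> = t n * (inball_radius (W n) / 2)" using elim(2) by (simp add: t_def)
        finally show "z \<in> cball 0 (t n * (inball_radius (W n) / 2))" by simp
      qed
      have Dsym: "- z \<in> D \<longleftrightarrow> z \<in> D" for z
      proof -
        have "- z \<in> D" if "z \<in> D" for z
        proof -
          obtain b where "b \<in> B" "z = s *\<^sub>R b" using \<open>z \<in> D\<close> by (auto simp: D_def)
          then show ?thesis using B(2) by (auto simp: D_def intro!: image_eqI[of _ _ "- b"])
        qed
        from this[of z] this[of "- z"] show ?thesis by auto
      qed
      interpret k: kernel_window M N "W n" x0 "inball_radius (W n) / 2" "t n" "indicat_real D" 1 D
        using W_convex[of n] x0 elim(2,4) tn Db sub
        by unfold_locales (auto simp: indicator_def Dsym)
      define a where "a = v n powr (1 / 2 - \<alpha>)"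
      have pn: "0 < p n" using elim(3) by (simp add: p_def)
      have a: "a = sqrt (v n) / p n"
        using elim(3) by (simp add: a_def p_def powr_diff powr_half_sqrt)
      have a2: "a\<^sup>2 = v n / (p n)\<^sup>2" using elim(3) by (simp add: a power_divide)
      have kap: "k.\<kappa> = p n * r ^ DIM('a) * measure lborel B"
        unfolding k.\<kappa>_def using Db sB(2) window_scale_powr_power[OF elim(3), of \<alpha>]
        by (simp add: s_def p_def power_mult_distrib)
      have U: "lambda2K_est B (W n) (N \<omega>) s = k.P.U \<omega>" for \<omega>
        unfolding k.U_eq lambda2K_est_def D_def[symmetric] ..
      have Z: "Z n r = (\<lambda>\<omega>. a * (k.P.U \<omega> - 2 * lam * k.\<kappa> / k.v * real (card (N \<omega> \<inter> W n))))"
      proof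
        fix \<omega>
        \<comment> \<open>The factor 1/\<open>p n\<close> in a cancels against \<kappa>, which is
          proportional to \<open>p n\<close>; this is why the coefficient of the count in Z does not
          involve \<alpha>.\<close>
        have "2 * lam * measure lborel B * r ^ DIM('a) / sqrt (v n) = a * (2 * lam * k.\<kappa> / k.v)"
        proof -
          have "a * (2 * lam * k.\<kappa> / k.v) = 2 * lam * measure lborel B * r ^ DIM('a) * (sqrt (v n) / v n)"
            unfolding a kap k.v_def using pn by (simp add: field_simps)
          also have "sqrt (v n) / v n = 1 / sqrt (v n)" using elim(3) by (simp add: real_div_sqrt field_simps)
          finally show ?thesis by simp
        qed
        then show "Z n r \<omega> = a * (k.P.U \<omega> - 2 * lam * k.\<kappa> / k.v * real (card (N \<omega> \<inter> W n)))"
          unfolding Z_def a_def[symmetric] s_def[symmetric] U by (simp add: algebra_simps)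
      qed
      note cb = k.centered_bound
      have i: "integrable M (Z n r)" "integrable M (\<lambda>\<omega>. (Z n r \<omega>)\<^sup>2)"
        unfolding Z power_mult_distrib using cb(1,2) by auto
      have const: "k.P.const = const0" "k.linc = linc0"
        by (simp_all add: k.P.const_def const0_def k.linc_def linc0_def)
      have eta_n: "k.\<eta> = \<eta> n" by (simp add: k.\<eta>_def \<eta>_def)
      have eta_pos: "0 < \<eta> n" "\<eta> n \<le> 1" using k.eta by (simp_all add: eta_n)
      define H where "H = (1 / \<eta> n - 1)\<^sup>2 + (1 - \<eta> n) / (\<eta> n)\<^sup>2"
      have H: "0 \<le> H" using eta_pos by (simp add: H_def)
      define \<beta> where "\<beta> = measure lborel B"
      define d where "d = r ^ DIM('a)"
      have d: "0 \<le> d" "d \<le> R ^ DIM('a)" using r by (auto simp: d_def intro: power_mono)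
      have \<beta>: "0 \<le> \<beta>" by (simp add: \<beta>_def)
      have mD: "measure lborel D = p n * d * \<beta>" using kap Db by (simp add: k.\<kappa>_def \<beta>_def d_def)
      have "variance (Z n r) = a\<^sup>2 * variance (\<lambda>\<omega>. k.P.U \<omega> - 2 * lam * k.\<kappa> / k.v * real (card (N \<omega> \<inter> W n)))"
        unfolding Z using cb(1) by (simp add: power_mult_distrib right_diff_distrib[symmetric])
      also have "\<dots> \<le> a\<^sup>2 * (3 * (const0 * (1 / (\<eta> n * v n))\<^sup>2 * v n * (1 + measure lborel D) + linc0 * (2 * lam * k.\<kappa> / v n)\<^sup>2 * v n * H))"
        using cb(3) unfolding const eta_n H_def k.v_def by (intro mult_left_mono) auto
      also have "\<dots> = 3 * (const0 / (\<eta> n)\<^sup>2 * ((1 / p n)\<^sup>2 + d * \<beta> * (1 / p n)) + linc0 * 4 * lam\<^sup>2 * \<beta>\<^sup>2 * d\<^sup>2 * H)"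
        unfolding a2 kap mD \<beta>_def[symmetric] d_def[symmetric] using pn elim(3) eta_pos
        by (simp add: power2_eq_square field_simps)
      also have "\<dots> \<le> 3 * (const0 / (\<eta> n)\<^sup>2 * ((1 / p n)\<^sup>2 + R ^ DIM('a) * \<beta> * (1 / p n)) + linc0 * 4 * lam\<^sup>2 * \<beta>\<^sup>2 * (R ^ DIM('a))\<^sup>2 * H)"
        using d \<beta> pn H const_nonneg eta_pos
        by (intro mult_left_mono add_mono mult_right_mono power_mono divide_nonneg_nonneg) auto
      also have "\<dots> = e n" by (simp add: e_def H_def \<beta>_def)
      finally show "integrable M (Z n r) \<and> integrable M (\<lambda>\<omega>. (Z n r \<omega>)\<^sup>2) \<and> variance (Z n r) \<le> e n" using i by simp
    qed
  qed
  show ?thesis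
  \<comment> \<open>Absolute values, because nothing is known about the sign of \<open>e n\<close>
    for small n.\<close>
  proof (rule that[of "\<lambda>n. \<bar>e n\<bar>"])
    show "(\<lambda>n. \<bar>e n\<bar>) \<longlonglongrightarrow> 0" using e0 by (simp add: tendsto_rabs_zero)
    show "\<forall>\<^sub>F n in sequentially. \<forall>r\<in>{0..R}. integrable M (Z n r) \<and> integrable M (\<lambda>\<omega>. (Z n r \<omega>)\<^sup>2) \<and> variance (Z n r) \<le> \<bar>e n\<bar>"
      using main by eventually_elim (use abs_ge_self order_trans in blast)
  qed simp
qed

end

section \<open>Consistency of the variance estimator\<close>

lemma (in prob_space) conv_prob_center:
  assumes X: "conv_prob M (\<lambda>n \<omega>. X n \<omega> - m n) 0" and m: "m \<longlonglongrightarrow> c"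
  shows "conv_prob M X c"
  using conv_prob_add[OF X conv_prob_const[OF m]] by simp

lemma (in prob_space) conv_prob_of_variance:
  assumes e: "e \<longlonglongrightarrow> 0" and X: "\<And>n. X n \<in> borel_measurable M"
    and V: "\<forall>\<^sub>F n in sequentially. integrable M (X n) \<and> integrable M (\<lambda>\<omega>. (X n \<omega>)\<^sup>2) \<and> variance (X n) \<le> e n"
  shows "conv_prob M (\<lambda>n \<omega>. X n \<omega> - expectation (X n)) 0"
proof (rule conv_prob_of_L2[OF _ e])
  show "(\<lambda>\<omega>. X n \<omega> - expectation (X n)) \<in> borel_measurable M" for n using X by simp
  show "\<forall>\<^sub>F n in sequentially. integrable M (\<lambda>\<omega>. (X n \<omega> - expectation (X n) - 0)\<^sup>2) \<and> (LINT \<omega>|M. (X n \<omega> - expectation (X n) - 0)\<^sup>2) \<le> e n"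
    using V
  proof eventually_elim
    case (elim n)
    then have "integrable M (\<lambda>\<omega>. (X n \<omega> - expectation (X n))\<^sup>2)" by (simp add: power2_diff)
    then show ?case using elim by simp
  qed
qed

context window_sequence
begin

text \<open>The double sum U has mean \<open>lam\<^sup>2\<close> h^d times the integral of w, plus a
  cumulant part that converges to \<open>lam\<close> times the total mass of the reduced cumulant,
  and its variance vanishes. Subtracting an estimate of the first part in place of its true value
  costs h^d times the error of the squared intensity, which is of order (h^(2d)/|W|)^(1/2).\<close>

lemma sigma2_est_conv:
  fixes w :: "'a \<Rightarrow> real" and b :: "nat \<Rightarrow> real"
  assumes w [measurable]: "w \<in> borel_measurable borel" and w_nonneg: "\<forall>x. 0 \<le> w x" and w_bounded: "bounded (range w)"
    and w_sym: "\<forall>x. w (- x) = w x" and w_supp: "bounded {x. w x \<noteq> 0}" and w_lim: "(w \<longlongrightarrow> 1) (at 0)" and w0: "w 0 = 1"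
    and b: "\<forall>n. 0 < b n" "b \<longlonglongrightarrow> 0" "filterlim (\<lambda>n. sc n * b n) at_top sequentially"
      "(\<lambda>n. sc n * (b n)\<^sup>2) \<longlonglongrightarrow> 0" "(\<lambda>n. sc n * b n / inball_radius (W n)) \<longlonglongrightarrow> 0"
  shows "conv_prob M (\<lambda>n \<omega>. sigma2_est w (b n * sc n) (W n) (N \<omega>)) (asymp_var M N)"
    and "\<And>n. (\<lambda>\<omega>. sigma2_est w (b n * sc n) (W n) (N \<omega>)) \<in> borel_measurable M"
proof -
  define h where "h n = b n * sc n" for n
  define U where "U n \<omega> = (\<Sum>(x, y)\<in>distinct_pairs (N \<omega> \<inter> W n). w ((y - x) /\<^sub>R h n) / edge_volume (W n) x y)" for n \<omega>
  define Iw where "Iw = (LINT x|lborel. w x)"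
  define tot where "tot = total_mass {1..<2} (cumulant_red M N 2)"
  obtain wm where wm: "0 < wm" "\<And>x. w x \<le> wm"
    using w_bounded unfolding bounded_pos by (force simp: abs_le_iff)
  obtain w0' where w0': "0 < w0'" "\<And>x. w x \<noteq> 0 \<Longrightarrow> norm x \<le> w0'"
    using w_supp unfolding bounded_pos by auto
  have [measurable]: "(\<lambda>p. overlap (W n) (snd p - fst p)) \<in> borel_measurable borel" for n
    using overlap_measurable[OF W_convex(3)[of n]] by measurable
  have Fm: "(\<lambda>p. w ((snd p - fst p) /\<^sub>R h n) / edge_volume (W n) (fst p) (snd p)) \<in> borel_measurable borel" for n
    unfolding edge_volume_overlap[OF W_convex(3)] by measurable
  have Um [measurable]: "U n \<in> borel_measurable M" for n
    unfolding U_def using pair_sum_measurable[of "\<lambda>x y. w ((y - x) /\<^sub>R h n) / edge_volume (W n) x y" n] Fm by simp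
  show "(\<lambda>\<omega>. sigma2_est w (b n * sc n) (W n) (N \<omega>)) \<in> borel_measurable M" for n
    unfolding sigma2_est_def h_def[symmetric] U_def[symmetric] by measurable
  note rho_pos = eventually_compose_filterlim[OF eventually_gt_at_top[of 0] W_limits(1)]
  have h_pos: "\<forall>\<^sub>F n in sequentially. 0 < h n"
    using v_pos
  proof eventually_elim
    case (elim n)
    then show ?case using b(1) window_scale_power(2)[OF elim] by (simp add: h_def)
  qed
  \<comment> \<open>The extra m makes room in the inball for the ball of radius m in
    \<open>cum2_estimate\<close>, besides the support of the rescaled w; being fixed, it does not
    affect the limit. The variance bound uses m = 0.\<close>
  define t where "t m n = (h n * w0' + m) / (inball_radius (W n) / 2)" for m n
  define \<eta> where "\<eta> m n = (1 - t m n) ^ DIM('a)" for m n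
  have t: "(\<lambda>n. t m n) \<longlonglongrightarrow> 0" for m
  proof -
    have "(\<lambda>n. m / inball_radius (W n)) \<longlonglongrightarrow> 0"
      by (rule tendsto_divide_0[OF tendsto_const filterlim_at_top_imp_at_infinity[OF W_limits(1)]])
    from tendsto_add[OF tendsto_mult_left[OF b(5), of "2 * w0'"] tendsto_mult_left[OF this, of 2]]
    have "(\<lambda>n. 2 * w0' * (sc n * b n / inball_radius (W n)) + 2 * (m / inball_radius (W n))) \<longlonglongrightarrow> 0" by simp
    moreover have "t m n = 2 * w0' * (sc n * b n / inball_radius (W n)) + 2 * (m / inball_radius (W n))" for n
      by (simp add: t_def h_def add_divide_distrib algebra_simps)
    ultimately show ?thesis by presburger
  qed
  have eta: "(\<lambda>n. \<eta> m n) \<longlonglongrightarrow> 1" for m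
    unfolding \<eta>_def using tendsto_power[OF tendsto_diff[OF tendsto_const[of 1] t[of m]], of "DIM('a)"] by simp
  define D where "D n = cball (0::'a) (h n * w0')" for n
  have kw: "kernel_window M N (W n) x0 (inball_radius (W n) / 2) (t m n) (\<lambda>z. w (z /\<^sub>R h n)) wm (D n)"
    if n: "cball x0 (inball_radius (W n) / 2) \<subseteq> W n" "0 < inball_radius (W n)" "t m n < 1" "0 < h n" "0 \<le> m" for n x0 m
  proof -
    interpret window M N "W n" by (rule window_n)
    show ?thesis
    proof
      show "0 \<le> t m n" using n w0'(1) by (simp add: t_def)
      have "h n * w0' \<le> t m n * (inball_radius (W n) / 2)" using n by (simp add: t_def)
      then show "D n \<subseteq> cball 0 (t m n * (inball_radius (W n) / 2))" unfolding D_def by auto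
      show "z \<in> D n" if "w (z /\<^sub>R h n) \<noteq> 0" for z
        using w0'(2)[OF that] n(4) by (simp add: D_def divide_simps mult.commute)
      show "w (- z /\<^sub>R h n) = w (z /\<^sub>R h n)" for z
        using w_sym[rule_format, of "z /\<^sub>R h n"] by (simp del: scaleR_minus_right add: scaleR_minus_right[symmetric])
    qed (use n W_convex w_nonneg wm(2) in \<open>auto simp: D_def\<close>)
  qed
  have kap: "(LINT z|lborel. w (z /\<^sub>R h n)) = h n ^ DIM('a) * Iw" if "0 < h n" for n
    unfolding Iw_def using that by (subst lborel_affine_integral[of "h n" _ 0]) auto
  define hv where "hv n = h n ^ DIM('a)" for n
  have hv_v: "(\<lambda>n. hv n / v n) \<longlonglongrightarrow> 0"
  proof -
    have "\<forall>\<^sub>F n in sequentially. b n ^ DIM('a) = hv n / v n"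
      using v_pos by eventually_elim (simp add: hv_def h_def power_mult_distrib window_scale_power)
    moreover have "(\<lambda>n. b n ^ DIM('a)) \<longlonglongrightarrow> 0" using b(2) by simp
    ultimately show ?thesis by (rule Lim_transform_eventually[rotated])
  qed
  \<comment> \<open>Here the condition that c_n b_n^2 tends to 0 enters: h^(2d)/|W| is the d-th
    power of this quantity.\<close>
  have hv2_v: "(\<lambda>n. (hv n)\<^sup>2 / v n) \<longlonglongrightarrow> 0"
  proof -
    have "\<forall>\<^sub>F n in sequentially. (sc n * (b n)\<^sup>2) ^ DIM('a) = (hv n)\<^sup>2 / v n"
      using v_pos
    proof eventually_elim
      case (elim n)
      have "(hv n)\<^sup>2 = (b n ^ DIM('a))\<^sup>2 * (v n)\<^sup>2"
        unfolding hv_def h_def power_mult_distrib window_scale_power(1)[OF elim] ..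
      then have "(hv n)\<^sup>2 / v n = (b n ^ DIM('a))\<^sup>2 * v n" using elim by (simp add: power2_eq_square)
      also have "\<dots> = (sc n * (b n)\<^sup>2) ^ DIM('a)"
        unfolding power_mult_distrib window_scale_power(1)[OF elim] by (simp add: power_mult[symmetric] mult.commute)
      finally show ?case by simp
    qed
    moreover have "(\<lambda>n. (sc n * (b n)\<^sup>2) ^ DIM('a)) \<longlonglongrightarrow> 0" using b(4) by simp
    ultimately show ?thesis by (rule Lim_transform_eventually[rotated])
  qed
  define ub where "ub = unit_ball_vol (real DIM('a)) * w0' ^ DIM('a)"
  define e where "e n = 3 * (const0 * wm\<^sup>2 / (\<eta> 0 n)\<^sup>2 * (1 / v n + ub * (hv n / v n)) + linc0 * 4 * lam\<^sup>2 * Iw\<^sup>2 / (\<eta> 0 n)\<^sup>2 * ((hv n)\<^sup>2 / v n))" for n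
  have "e \<longlonglongrightarrow> 3 * (const0 * wm\<^sup>2 / 1\<^sup>2 * (0 + ub * 0) + linc0 * 4 * lam\<^sup>2 * Iw\<^sup>2 / 1\<^sup>2 * 0)"
    unfolding e_def by (intro tendsto_intros eta inv_v hv_v hv2_v) auto
  then have e0: "e \<longlonglongrightarrow> 0" by simp
  have t1: "\<forall>\<^sub>F n in sequentially. t m n < 1" for m using order_tendstoD(2)[OF t[of m], of 1] by simp
  have var_U: "\<forall>\<^sub>F n in sequentially. integrable M (U n) \<and> integrable M (\<lambda>\<omega>. (U n \<omega>)\<^sup>2) \<and> variance (U n) \<le> e n"
    using W_limits(2) rho_pos v_pos h_pos t1[of 0]
  proof eventually_elim
    case (elim n)
    then obtain x0 where x0: "cball x0 (inball_radius (W n) / 2) \<subseteq> W n" by blast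
    interpret k: kernel_window M N "W n" x0 "inball_radius (W n) / 2" "t 0 n" "\<lambda>z. w (z /\<^sub>R h n)" wm "D n"
      by (rule kw[OF x0 elim(2,5,4)]) simp
    have UU: "U n = k.P.U" by (auto simp: U_def k.U_eq)
    have const: "k.P.const = const0" "k.linc = linc0"
      by (simp_all add: k.P.const_def const0_def k.linc_def linc0_def)
    have eta_n: "k.\<eta> = \<eta> 0 n" by (simp add: k.\<eta>_def \<eta>_def)
    have kp: "k.\<kappa> = hv n * Iw" unfolding k.\<kappa>_def hv_def by (rule kap[OF elim(4)])
    have mD: "measure lborel (D n) = ub * hv n"
      using elim(4) w0'(1) by (simp add: D_def content_cball ub_def hv_def power_mult_distrib)
    have "variance (U n) \<le> 3 * (const0 * (wm / (\<eta> 0 n * v n))\<^sup>2 * v n * (1 + ub * hv n) + linc0 * (2 * lam * (hv n * Iw) / (\<eta> 0 n * v n))\<^sup>2 * v n)"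
      using k.U_bound(3) unfolding UU const eta_n mD kp k.v_def .
    also have "\<dots> = e n"
      unfolding e_def using elim(3) k.eta unfolding eta_n by (simp add: power2_eq_square field_simps)
    finally show ?case using k.U_bound(1,2) unfolding UU by simp
  qed
  have U1: "conv_prob M (\<lambda>n \<omega>. U n \<omega> - expectation (U n)) 0"
    by (rule conv_prob_of_variance[OF e0 Um var_U])
  \<comment> \<open>For a given accuracy m is chosen first, such that the reduced cumulant has
    little mass beyond m; then n so large that w(z/h) is close to 1 for |z| \<le> m, which is
    possible since h tends to infinity, and that \<eta> is close to 1.\<close>
  have mean: "(\<lambda>n. expectation (U n) - lam\<^sup>2 * (hv n * Iw)) \<longlonglongrightarrow> lam * tot"
  proof (rule LIMSEQ_I)
    fix r :: real assume r: "0 < r"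
    define var2 where "var2 = window.var2 M N"
    have var2: "0 \<le> var2" using var_nonneg by (simp add: var2_def)
    \<comment> \<open>The error coefficients below added up: 12 is 4 times the 3 from
      \<epsilon>/\<eta> + 1/\<eta> - 1 \<le> 3\<epsilon>, 8 is 4 times the bound 2 for 1/\<eta>;
      then come the boundary term and the tail of the total mass.\<close>
    define K where "K = 12 * (lam * var2) + 8 * wm * lam + 2 * lam * var2 + lam"
    have K: "0 < K" unfolding K_def using lam_pos var2 wm(1) by (intro add_nonneg_pos) auto
    define \<epsilon> where "\<epsilon> = min (r / (2 * K)) (1/2)"
    have \<epsilon>: "0 < \<epsilon>" "\<epsilon> \<le> 1/2" "K * \<epsilon> < r"
    proof -
      show "0 < \<epsilon>" "\<epsilon> \<le> 1/2" using r K by (auto simp: \<epsilon>_def)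
      have "K * \<epsilon> \<le> K * (r / (2 * K))" using K by (intro mult_left_mono) (auto simp: \<epsilon>_def)
      also have "\<dots> < r" using K r by simp
      finally show "K * \<epsilon> < r" .
    qed
    obtain m :: nat where m: "\<And>C. C \<in> bounded_borel {1..<2} \<Longrightarrow> C \<inter> Pi\<^sub>E {1..<2} (\<lambda>_. cball 0 (real m)) = {} \<Longrightarrow> \<bar>cumulant_red M N 2 C\<bar> \<le> \<epsilon>"
      "\<bar>tot - cumulant_red M N 2 (Pi\<^sub>E {1..<2} (\<lambda>_. cball 0 (real m)))\<bar> \<le> \<epsilon>"
      using red2_tail[OF \<epsilon>(1)] unfolding tot_def by metis
    obtain d where d: "0 < d" "\<And>z. norm z < d \<Longrightarrow> \<bar>w z - 1\<bar> \<le> \<epsilon>"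
    proof -
      obtain d where "0 < d" "\<And>z. z \<noteq> 0 \<Longrightarrow> dist z 0 < d \<Longrightarrow> dist (w z) 1 < \<epsilon>"
        using w_lim \<epsilon>(1) unfolding LIM_def by blast
      then show ?thesis using that[of d] w0 \<epsilon>(1) by (metis abs_zero diff_self dist_0_norm dist_commute dist_real_def less_imp_le)
    qed
    have h_large: "\<forall>\<^sub>F n in sequentially. real m / d < h n"
      using b(3) unfolding filterlim_at_top_dense h_def by (simp add: mult.commute)
    \<comment> \<open>The threshold 1/(1 + \<epsilon>) gives both 1/\<eta> \<le> 1 + \<epsilon> and
      1 - \<eta> \<le> \<epsilon>.\<close>
    have eta_big: "\<forall>\<^sub>F n in sequentially. 1 / (1 + \<epsilon>) < \<eta> (real m) n"
      using order_tendstoD(1)[OF eta, of "1 / (1 + \<epsilon>)" "real m"] \<epsilon> by simp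
    have "\<forall>\<^sub>F n in sequentially. norm (expectation (U n) - lam\<^sup>2 * (hv n * Iw) - lam * tot) < r"
      using W_limits(2) rho_pos h_pos t1[of "real m"] h_large eta_big
    proof eventually_elim
      case (elim n)
      then obtain x0 where x0: "cball x0 (inball_radius (W n) / 2) \<subseteq> W n" by blast
      interpret k: kernel_window M N "W n" x0 "inball_radius (W n) / 2" "t (real m) n" "\<lambda>z. w (z /\<^sub>R h n)" wm "D n"
        by (rule kw[OF x0 elim(2,4,3)]) simp
      have UU: "U n = k.P.U" by (auto simp: U_def k.U_eq)
      have eta_n: "k.\<eta> = \<eta> (real m) n" by (simp add: k.\<eta>_def \<eta>_def)
      have kp: "k.\<kappa> = hv n * Iw" unfolding k.\<kappa>_def hv_def by (rule kap[OF elim(3)])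
      define \<tau> where "\<tau> = cumulant_red M N 2 (Pi\<^sub>E {1..<2} (\<lambda>_. cball 0 (real m)))"
      have E: "expectation (U n) - lam\<^sup>2 * (hv n * Iw) = k.cum2 (\<lambda>p. k.\<psi> (fst p) (snd p))"
        unfolding UU k.expectation_U kp by simp
      have est: "\<bar>k.cum2 (\<lambda>p. k.\<psi> (fst p) (snd p)) - lam * \<tau>\<bar>
          \<le> 4 * (\<epsilon> / k.\<eta> + 1 / k.\<eta> - 1) * (lam * var2) + 4 * wm / k.\<eta> * lam * \<epsilon> + 2 * lam * var2 * (1 - k.\<eta>)"
        unfolding \<tau>_def var2_def
      proof (rule k.cum2_estimate)
        show "0 \<le> real m" by simp
        show "real m \<le> t (real m) n * (inball_radius (W n) / 2)"
          using elim(2,3) w0'(1) by (simp add: t_def)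
        show "\<bar>w (z /\<^sub>R h n) - 1\<bar> \<le> \<epsilon>" if "norm z \<le> real m" for z
        proof (rule d(2))
          have "norm z < d * h n" using that elim(5) d(1) by (simp add: field_simps)
          then show "norm (z /\<^sub>R h n) < d" using elim(3) by (simp add: divide_simps mult.commute)
        qed
      qed (rule m(1))
      define i where "i = 1 / k.\<eta>"
      have eta1: "0 < k.\<eta>" "k.\<eta> \<le> 1" using k.eta by auto
      have i: "1 \<le> i" "i \<le> 1 + \<epsilon>"
        using eta1 elim(6) \<epsilon>(1) unfolding eta_n[symmetric] i_def by (auto simp: field_simps)
      have eta2: "1 - k.\<eta> \<le> \<epsilon>"
      proof -
        have "1 - \<epsilon> \<le> 1 / (1 + \<epsilon>)" using \<epsilon>(1) by (simp add: field_simps)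
        then show ?thesis using elim(6) unfolding eta_n by linarith
      qed
      have 1: "\<epsilon> / k.\<eta> + 1 / k.\<eta> - 1 \<le> 3 * \<epsilon>"
      proof -
        have "\<epsilon> * i \<le> \<epsilon> * 2" using i \<epsilon> by (intro mult_left_mono) auto
        then show ?thesis using i by (simp add: i_def)
      qed
      have 2: "4 * wm / k.\<eta> * lam * \<epsilon> \<le> 8 * wm * lam * \<epsilon>"
      proof -
        have "4 * wm / k.\<eta> * lam * \<epsilon> = (4 * wm * lam * \<epsilon>) * i" by (simp add: i_def)
        also have "\<dots> \<le> (4 * wm * lam * \<epsilon>) * 2" using i \<epsilon> wm(1) lam_pos by (intro mult_left_mono) auto
        finally show ?thesis by simp
      qed
      have 3: "2 * lam * var2 * (1 - k.\<eta>) \<le> 2 * lam * var2 * \<epsilon>"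
        using eta2 lam_pos var2 by (intro mult_left_mono) auto
      have 4: "4 * (\<epsilon> / k.\<eta> + 1 / k.\<eta> - 1) * (lam * var2) \<le> 4 * (3 * \<epsilon>) * (lam * var2)"
        using 1 lam_pos var2 by (intro mult_right_mono mult_left_mono) auto
      have 5: "\<bar>lam * \<tau> - lam * tot\<bar> \<le> lam * \<epsilon>"
        using m(2) lam_pos unfolding right_diff_distrib[symmetric] abs_mult \<tau>_def[symmetric] by (simp add: abs_minus_commute)
      have "\<bar>expectation (U n) - lam\<^sup>2 * (hv n * Iw) - lam * tot\<bar> \<le> 4 * (3 * \<epsilon>) * (lam * var2) + 8 * wm * lam * \<epsilon> + 2 * lam * var2 * \<epsilon> + lam * \<epsilon>"
        unfolding E using est 2 3 4 5 by linarith
      also have "\<dots> = K * \<epsilon>" by (simp add: K_def algebra_simps)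
      finally show ?case using \<epsilon>(3) by simp
    qed
    then show "\<exists>no. \<forall>n\<ge>no. norm (expectation (U n) - lam\<^sup>2 * (hv n * Iw) - lam * tot) < r"
      by (simp add: eventually_sequentially)
  qed
  have U2: "conv_prob M (\<lambda>n \<omega>. U n \<omega> - lam\<^sup>2 * (hv n * Iw)) (lam * tot)"
    by (rule conv_prob_center[OF _ mean]) (use U1 in \<open>simp add: algebra_simps\<close>)
  \<comment> \<open>Since h^d tends to infinity, consistency of the intensity estimator does not
    suffice; its variance of order 1/|W| is used against h^(2d).\<close>
  have L1: "conv_prob M (\<lambda>n \<omega>. hv n * (lambda_est (W n) (N \<omega>) - lam)) 0"
  proof (rule conv_prob_of_L2)
    show "(\<lambda>n. linc0 * ((hv n)\<^sup>2 / v n)) \<longlonglongrightarrow> 0" using tendsto_mult_left[OF hv2_v, of linc0] by simp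
    show "\<forall>\<^sub>F n in sequentially. integrable M (\<lambda>\<omega>. (hv n * (lambda_est (W n) (N \<omega>) - lam) - 0)\<^sup>2)
        \<and> (LINT \<omega>|M. (hv n * (lambda_est (W n) (N \<omega>) - lam) - 0)\<^sup>2) \<le> linc0 * ((hv n)\<^sup>2 / v n)"
      using v_pos
    proof eventually_elim
      case (elim n)
      note l = lambda_est_variance[OF elim]
      have "(hv n)\<^sup>2 * (LINT \<omega>|M. (lambda_est (W n) (N \<omega>) - lam)\<^sup>2) \<le> (hv n)\<^sup>2 * (linc0 / v n)"
        using l(2) by (intro mult_left_mono) auto
      then show ?case using l(1) by (simp add: power_mult_distrib mult.commute)
    qed
  qed measurable
  have L2: "conv_prob M (\<lambda>n \<omega>. hv n * (lambda_est (W n) (N \<omega>) - lam) * (lambda_est (W n) (N \<omega>) + lam) - hv n / v n * lambda_est (W n) (N \<omega>)) (0 * (lam + lam) - 0 * lam)"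
    by (intro conv_prob_diff conv_prob_mult L1 conv_prob_add lambda_est_conv conv_prob_const tendsto_const hv_v)
  \<comment> \<open>The true first order mean of U is subtracted and added back, and the remaining
    difference of squared intensities is factored into a difference and a sum, to which
    \<open>L1\<close> and consistency apply.\<close>
  have eq: "sigma2_est w (b n * sc n) (W n) (N \<omega>) = lambda_est (W n) (N \<omega>) + (U n \<omega> - lam\<^sup>2 * (hv n * Iw))
      - Iw * (hv n * (lambda_est (W n) (N \<omega>) - lam) * (lambda_est (W n) (N \<omega>) + lam) - hv n / v n * lambda_est (W n) (N \<omega>))" for n \<omega>
    unfolding sigma2_est_def h_def[symmetric] U_def[symmetric] Iw_def[symmetric] lambda2_est_eq hv_def[symmetric]
    by (simp add: power2_eq_square algebra_simps)
  have "conv_prob M (\<lambda>n \<omega>. sigma2_est w (b n * sc n) (W n) (N \<omega>)) (lam + lam * tot - Iw * (0 * (lam + lam) - 0 * lam))"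
    unfolding eq by (intro conv_prob_diff conv_prob_add conv_prob_cmult lambda_est_conv U2 L2)
  then show "conv_prob M (\<lambda>n \<omega>. sigma2_est w (b n * sc n) (W n) (N \<omega>)) (asymp_var M N)"
    by (simp add: asymp_var_def tot_def algebra_simps)
qed

end

section \<open>Two processes with the same law\<close>

lemma (in prob_space) conv_prob_cong:
  assumes X: "conv_prob M X c" and Y: "\<And>n. Y n \<in> borel_measurable M"
    and eq: "\<forall>\<^sub>F n in sequentially. \<forall>\<omega>\<in>space M. Y n \<omega> = X n \<omega>"
  shows "conv_prob M Y c"
  unfolding conv_prob_def
proof (intro conjI allI impI Y)
  fix \<epsilon> :: real assume \<epsilon>: "0 < \<epsilon>"
  have "\<forall>\<^sub>F n in sequentially. prob {\<omega> \<in> space M. \<epsilon> \<le> \<bar>X n \<omega> - c\<bar>} = prob {\<omega> \<in> space M. \<epsilon> \<le> \<bar>Y n \<omega> - c\<bar>}"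
    using eq
  proof eventually_elim
    case (elim n)
    then have "{\<omega> \<in> space M. \<epsilon> \<le> \<bar>X n \<omega> - c\<bar>} = {\<omega> \<in> space M. \<epsilon> \<le> \<bar>Y n \<omega> - c\<bar>}" by auto
    then show ?case by simp
  qed
  with conv_probD(2)[OF X \<epsilon>] show "(\<lambda>n. prob {\<omega> \<in> space M. \<epsilon> \<le> \<bar>Y n \<omega> - c\<bar>}) \<longlonglongrightarrow> 0"
    by (rule Lim_transform_eventually)
qed

text \<open>The transfer goes through the laws on the space of configurations, which is why
  \<open>F n\<close> has to be measurable there and not just along one process.\<close>

lemma conv_prob_law:
  assumes F: "\<And>n. F n \<in> borel_measurable L" and N: "Na \<in> M \<rightarrow>\<^sub>M L" "Nb \<in> M \<rightarrow>\<^sub>M L"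
    and law: "distr M L Na = distr M L Nb" and c: "conv_prob M (\<lambda>n \<omega>. F n (Na \<omega>)) c"
  shows "conv_prob M (\<lambda>n \<omega>. F n (Nb \<omega>)) c"
proof -
  have p: "measure M {\<omega> \<in> space M. \<epsilon> \<le> \<bar>F n (K \<omega>) - c\<bar>} = measure (distr M L K) {S \<in> space L. \<epsilon> \<le> \<bar>F n S - c\<bar>}"
    if K: "K \<in> M \<rightarrow>\<^sub>M L" for K \<epsilon> n
  proof -
    note [measurable] = F
    have "{S \<in> space L. \<epsilon> \<le> \<bar>F n S - c\<bar>} \<in> sets L" by measurable
    then show ?thesis using K measurable_space[OF K]
      by (subst measure_distr) (auto intro!: arg_cong[where f = "measure M"])
  qed
  show ?thesis
    using c F N unfolding conv_prob_def p[OF N(1)] p[OF N(2)] law by (auto intro: measurable_compose)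
qed

lemma expectation_law:
  fixes F :: "'s \<Rightarrow> real"
  assumes "F \<in> borel_measurable L" "Na \<in> M \<rightarrow>\<^sub>M L" "Nb \<in> M \<rightarrow>\<^sub>M L" "distr M L Na = distr M L Nb"
  shows "(LINT \<omega>|M. F (Na \<omega>)) = (LINT \<omega>|M. F (Nb \<omega>))"
  using integral_distr[OF assms(2,1)] integral_distr[OF assms(3,1)] assms(4) by simp

text \<open>Extended by its end values, V is nondecreasing and right-continuous on the whole line:
  locally constant to the right of points below 0 or from R on, and equal to V in between. The mass
  of [0,R] is then at most that of the half-open interval from -1 to R.\<close>

lemma finite_measure_stieltjes:
  assumes R: "0 < R" and V: "mono_on {0..R} V" "\<forall>r\<in>{0..<R}. continuous (at_right r) V"
  shows "finite_measure (restrict_space (stieltjes R V) {0..R})"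
proof (rule finite_measureI)
  define F where "F r = V (max 0 (min R r))" for r
  have mono: "F x \<le> F y" if "x \<le> y" for x y
    unfolding F_def using that R by (intro mono_onD[OF V(1)]) auto
  have right: "continuous (at_right x) F" for x
  proof -
    consider "x < 0" | "0 \<le> x" "x < R" | "R \<le> x" by linarith
    then show ?thesis
    proof cases
      case 1
      then have "\<forall>\<^sub>F r in at_right x. F x = F r"
        by (intro eventually_at_rightI[of x 0]) (auto simp: F_def)
      then show ?thesis unfolding continuous_within using tendsto_const by (rule Lim_transform_eventually[rotated])
    next
      case 2
      then have "\<forall>\<^sub>F r in at_right x. V r = F r"
        by (intro eventually_at_rightI[of x R]) (auto simp: F_def)
      moreover have "(V \<longlongrightarrow> F x) (at_right x)" using V(2) 2 unfolding continuous_within by (auto simp: F_def)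
      ultimately show ?thesis unfolding continuous_within by (rule Lim_transform_eventually[rotated])
    next
      case 3
      then have "\<forall>\<^sub>F r in at_right x. F x = F r"
        by (intro eventually_at_rightI[of x "x + 1"]) (use R in \<open>auto simp: F_def\<close>)
      then show ?thesis unfolding continuous_within using tendsto_const by (rule Lim_transform_eventually[rotated])
    qed
  qed
  have S: "stieltjes R V = interval_measure F" by (simp add: stieltjes_def F_def[abs_def])
  have "emeasure (interval_measure F) {0..R} \<le> emeasure (interval_measure F) {- 1<..R}"
    by (intro emeasure_mono) auto
  also have "\<dots> = ennreal (F R - F (- 1))" using mono right R by (intro emeasure_interval_measure_Ioc) auto
  also have "\<dots> < \<infinity>" by simp
  finally show "emeasure (restrict_space (stieltjes R V) {0..R}) (space (restrict_space (stieltjes R V) {0..R})) \<noteq> \<infinity>"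
    by (simp add: S emeasure_restrict_space space_restrict_space)
qed

section \<open>Limit law of the difference of two independent normalized counts\<close>

lemma normal_distr_std:
  assumes "0 < \<sigma>"
  shows "density lborel (normal_density 0 \<sigma>) = distr std_normal_distribution borel (\<lambda>x. \<sigma> * x)"
proof -
  interpret s: prob_space std_normal_distribution by (rule prob_space_normal_density) simp
  have "distributed std_normal_distribution lborel (\<lambda>x. x) std_normal_density"
    unfolding distributed_def by (auto simp: distr_id2)
  from s.normal_density_affine[OF this, of \<sigma> 0] assms
  have "distributed std_normal_distribution lborel (\<lambda>x. \<sigma> * x) (normal_density 0 \<sigma>)" by simp
  then have "distr std_normal_distribution lborel (\<lambda>x. \<sigma> * x) = density lborel (normal_density 0 \<sigma>)"
    by (simp add: distributed_def)
  moreover have "distr std_normal_distribution lborel (\<lambda>x. \<sigma> * x) = distr std_normal_distribution borel (\<lambda>x. \<sigma> * x)"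
    by (rule distr_cong) auto
  ultimately show ?thesis by simp
qed

lemma real_distribution_scaled_normal: "real_distribution (distr std_normal_distribution borel (\<lambda>x. \<sigma> * x))"
proof -
  interpret real_distribution std_normal_distribution by (rule real_dist_normal_dist)
  show ?thesis by (rule real_distribution_distr) simp
qed

lemma char_scaled_normal:
  "char (distr std_normal_distribution borel (\<lambda>x. \<sigma> * x)) t = complex_of_real (exp (- ((\<sigma> * t)\<^sup>2) / 2))"
proof -
  have "char (distr std_normal_distribution borel (\<lambda>x. \<sigma> * x)) t = char std_normal_distribution (\<sigma> * t)"
    unfolding char_def by (subst integral_distr) (simp_all add: mult_ac)
  then show ?thesis by (simp add: char_std_normal_distribution)
qed

text \<open>By independence the characteristic functions multiply, the limits are even and their
  exponents add up, which doubles the variance; Levy's continuity theorem turns this back into weak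
  convergence.\<close>

lemma (in prob_space) weak_conv_difference:
  assumes ind: "\<And>n. indep_var borel (X n) borel (Y n)"
    and X: "weak_conv_m (\<lambda>n. distr M borel (X n)) (density lborel (normal_density 0 \<sigma>))"
    and Y: "weak_conv_m (\<lambda>n. distr M borel (Y n)) (density lborel (normal_density 0 \<sigma>))" and \<sigma>: "0 < \<sigma>"
  shows "weak_conv_m (\<lambda>n. distr M borel (\<lambda>\<omega>. X n \<omega> - Y n \<omega>)) (distr std_normal_distribution borel (\<lambda>x. (sqrt 2 * \<sigma>) * x))"
proof (rule levy_continuity)
  have [measurable]: "X n \<in> borel_measurable M" "Y n \<in> borel_measurable M" for n
    using ind[of n] by (auto dest: indep_var_rv1 indep_var_rv2)
  show "real_distribution (distr M borel (\<lambda>\<omega>. X n \<omega> - Y n \<omega>))" for n by (rule real_distribution_distr) simp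
  show "real_distribution (distr std_normal_distribution borel (\<lambda>x. (sqrt 2 * \<sigma>) * x))" by (rule real_distribution_scaled_normal)
  fix t
  have lim: "(\<lambda>n. char (distr M borel (Z n)) s) \<longlonglongrightarrow> complex_of_real (exp (- ((\<sigma> * s)\<^sup>2) / 2))"
    if "\<And>n. Z n \<in> borel_measurable M" "weak_conv_m (\<lambda>n. distr M borel (Z n)) (density lborel (normal_density 0 \<sigma>))" for Z s
    unfolding char_scaled_normal[symmetric]
    using that(1) by (intro levy_continuity1 real_distribution_distr real_distribution_scaled_normal that(2)[unfolded normal_distr_std[OF \<sigma>]])
  have neg: "char (distr M borel (\<lambda>\<omega>. - Y n \<omega>)) t = char (distr M borel (Y n)) (- t)" for n
    unfolding char_def by (simp add: integral_distr)
  have "char (distr M borel (\<lambda>\<omega>. X n \<omega> - Y n \<omega>)) t = char (distr M borel (X n)) t * char (distr M borel (Y n)) (- t)" for n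
  proof -
    have "indep_var borel (X n) borel (\<lambda>\<omega>. - Y n \<omega>)"
      using indep_var_compose[OF ind[of n], of "\<lambda>x. x" borel uminus borel] by (simp add: comp_def)
    from char_distr_add[OF this, of t] show ?thesis by (simp add: neg)
  qed
  moreover have "(\<lambda>n. char (distr M borel (X n)) t * char (distr M borel (Y n)) (- t))
      \<longlonglongrightarrow> complex_of_real (exp (- ((\<sigma> * t)\<^sup>2) / 2)) * complex_of_real (exp (- ((\<sigma> * (- t))\<^sup>2) / 2))"
    by (intro tendsto_mult lim X Y) measurable
  moreover have "complex_of_real (exp (- ((\<sigma> * t)\<^sup>2) / 2)) * complex_of_real (exp (- ((\<sigma> * (- t))\<^sup>2) / 2))
      = complex_of_real (exp (- ((sqrt 2 * \<sigma> * t)\<^sup>2) / 2))"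
    unfolding of_real_mult[symmetric] exp_add[symmetric] by (simp add: power_mult_distrib)
  ultimately show "(\<lambda>n. char (distr M borel (\<lambda>\<omega>. X n \<omega> - Y n \<omega>)) t) \<longlonglongrightarrow> char (distr std_normal_distribution borel (\<lambda>x. (sqrt 2 * \<sigma>) * x)) t"
    by (simp add: char_scaled_normal)
qed

text \<open>Nonnegativity of the variance of |X|, in place of the Cauchy-Schwarz inequality.\<close>

lemma (in prob_space) L1_le_L2:
  assumes "integrable M X" "integrable M (\<lambda>\<omega>. (X \<omega>)\<^sup>2)" "expectation (\<lambda>\<omega>. (X \<omega>)\<^sup>2) \<le> c"
  shows "expectation (\<lambda>\<omega>. \<bar>X \<omega>\<bar>) \<le> sqrt c"
proof -
  have "0 \<le> variance (\<lambda>\<omega>. \<bar>X \<omega>\<bar>)" by (rule variance_positive)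
  also have "\<dots> = expectation (\<lambda>\<omega>. (X \<omega>)\<^sup>2) - (expectation (\<lambda>\<omega>. \<bar>X \<omega>\<bar>))\<^sup>2"
    using assms by (subst variance_eq) auto
  finally have "(expectation (\<lambda>\<omega>. \<bar>X \<omega>\<bar>))\<^sup>2 \<le> c" using assms(3) by linarith
  then show ?thesis by (rule real_le_rsqrt)
qed

section \<open>Measurability of the estimators in the configuration and the radius\<close>

lemma indicator_scaled_image:
  fixes B :: "'a::euclidean_space set"
  assumes "0 \<in> B"
  shows "indicat_real ((\<lambda>z. s *\<^sub>R z) ` B) z = (if s = 0 then indicat_real {0} z else indicat_real B (z /\<^sub>R s))"
proof (cases "s = 0")
  case True
  then have "(\<lambda>z. s *\<^sub>R z) ` B = {0}" using assms by auto
  then show ?thesis using True by simp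
next
  case False
  then have "z \<in> (\<lambda>z. s *\<^sub>R z) ` B \<longleftrightarrow> z /\<^sub>R s \<in> B"
    by (auto intro: image_eqI[of _ _ "z /\<^sub>R s"])
  then show ?thesis using False by (simp add: indicator_def)
qed

text \<open>Writing membership of z in s B as membership of z/s in B makes the summand a Borel
  function of r and the pair; scale 0 is separated, since there z/s is 0 by convention. Joint
  measurability in S and r is what exchanging the integrals over \<omega> and r requires.\<close>

lemma lambda2K_est_measurable_config:
  fixes B W :: "'a::euclidean_space set"
  assumes B: "compact B" "0 \<in> B" and W: "W \<in> sets borel" "bounded W"
  shows "(\<lambda>(S, r). lambda2K_est B W S (c * r)) \<in> borel_measurable (config_algebra \<Otimes>\<^sub>M borel)"
proof -
  have [measurable]: "B \<in> sets borel" using B by (simp add: borel_closed compact_imp_closed)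
  note [measurable] = overlap_measurable[OF W(1)]
  define F where "F r p = (if c * r = 0 then indicat_real {0} (snd p - fst p) else indicat_real B ((snd p - fst p) /\<^sub>R (c * r)))
      / overlap W (snd p - fst p)" for r :: real and p :: "'a \<times> 'a"
  have "(\<lambda>(r, p). F r p) \<in> borel_measurable borel"
    unfolding F_def case_prod_beta' by measurable
  from finite_process_sum_measurable2[OF finite_process_tuples(1)[OF finite_process_config[OF W]] this]
  show ?thesis
    unfolding lambda2K_est_def indicator_scaled_image[OF B(2)] edge_volume_overlap[OF W(1)] F_def by (simp add: case_prod_beta')
qed

lemma card_measurable_config:
  assumes "W \<in> sets borel" "bounded (W :: 'a::euclidean_space set)"
  shows "(\<lambda>S. real (card (S \<inter> W))) \<in> borel_measurable config_algebra"
  using finite_processD(2)[OF finite_process_config[OF assms] space_in_borel] by simp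

lemma sigma2_est_measurable_config:
  fixes W :: "'a::euclidean_space set"
  assumes W: "W \<in> sets borel" "bounded W" and [measurable]: "w \<in> borel_measurable borel"
  shows "(\<lambda>S. sigma2_est w h W S) \<in> borel_measurable config_algebra"
proof -
  note [measurable] = overlap_measurable[OF W(1)] card_measurable_config[OF W]
  have "(\<lambda>p. w ((snd p - fst p) /\<^sub>R h) / overlap W (snd p - fst p)) \<in> borel_measurable borel" by measurable
  from finite_process_sum_measurable[OF finite_process_tuples(1)[OF finite_process_config[OF W]] this]
  have [measurable]: "(\<lambda>S. \<Sum>(x, y)\<in>distinct_pairs (S \<inter> W). w ((y - x) /\<^sub>R h) / edge_volume W x y) \<in> borel_measurable config_algebra"
    by (simp add: edge_volume_overlap[OF W(1)] case_prod_beta')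
  show ?thesis unfolding sigma2_est_def lambda_est_def lambda2_est_def by measurable
qed

text \<open>The estimators of the two processes are compared through the common law on
  configurations, not by identifying the constants of the two processes; the variance constants
  \<open>a.linc0\<close> and \<open>b.linc0\<close> are simply kept apart.\<close>

locale equal_laws = a: window_sequence M Na W + b: window_sequence M Nb W
  for M :: "'w measure" and Na Nb :: "'w \<Rightarrow> 'a::euclidean_space set" and W +
  assumes law: "distr M config_algebra Na = distr M config_algebra Nb"
begin

lemma N_measurable [measurable]: "Na \<in> M \<rightarrow>\<^sub>M config_algebra" "Nb \<in> M \<rightarrow>\<^sub>M config_algebra"
  using a.pp b.pp by (simp_all add: point_process_def)

abbreviation "lm \<equiv> intensity M Na"

lemma intensity_eq: "intensity M Nb = lm"
  unfolding intensity_def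
  by (rule expectation_law[symmetric, OF _ N_measurable law]) (intro card_measurable_config unit_cube_facts)

text \<open>The one random quantity to which both parts of the test statistic reduce.\<close>

definition dif :: "nat \<Rightarrow> 'w \<Rightarrow> real" where
  "dif n \<omega> = sqrt (a.v n) * (lambda_est (W n) (Na \<omega>) - lambda_est (W n) (Nb \<omega>))"

lemma dif_measurable [measurable]: "dif n \<in> borel_measurable M"
  unfolding dif_def by measurable

lemma dif_second_moment:
  assumes "0 < a.v n"
  shows "integrable M (\<lambda>\<omega>. (dif n \<omega>)\<^sup>2)" "a.expectation (\<lambda>\<omega>. (dif n \<omega>)\<^sup>2) \<le> 2 * (a.linc0 + b.linc0)"
proof -
  note A = a.lambda_est_variance[OF assms] and B = b.lambda_est_variance[OF assms, unfolded intensity_eq]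
  define x y where "x \<omega> = lambda_est (W n) (Na \<omega>) - lm" and "y \<omega> = lambda_est (W n) (Nb \<omega>) - lm" for \<omega>
  have le: "(dif n \<omega>)\<^sup>2 \<le> 2 * a.v n * ((x \<omega>)\<^sup>2 + (y \<omega>)\<^sup>2)" for \<omega>
  proof -
    have "(dif n \<omega>)\<^sup>2 = a.v n * (x \<omega> - y \<omega>)\<^sup>2"
      using assms by (simp add: dif_def x_def y_def power_mult_distrib)
    also have "(x \<omega> - y \<omega>)\<^sup>2 \<le> 2 * ((x \<omega>)\<^sup>2 + (y \<omega>)\<^sup>2)"
      using zero_le_power2[of "x \<omega> + y \<omega>"] by (simp add: power2_eq_square algebra_simps)
    finally show ?thesis using assms by (simp add: algebra_simps)
  qed
  have i: "integrable M (\<lambda>\<omega>. 2 * a.v n * ((x \<omega>)\<^sup>2 + (y \<omega>)\<^sup>2))"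
    using A(1) B(1) by (simp add: x_def y_def)
  show i2: "integrable M (\<lambda>\<omega>. (dif n \<omega>)\<^sup>2)"
    by (rule Bochner_Integration.integrable_bound[OF i]) (use le in \<open>auto intro!: AE_I2 intro: order_trans[OF _ abs_ge_self]\<close>)
  have "a.expectation (\<lambda>\<omega>. (dif n \<omega>)\<^sup>2) \<le> a.expectation (\<lambda>\<omega>. 2 * a.v n * ((x \<omega>)\<^sup>2 + (y \<omega>)\<^sup>2))"
    by (rule integral_mono[OF i2 i le])
  also have "\<dots> = 2 * a.v n * (a.expectation (\<lambda>\<omega>. (x \<omega>)\<^sup>2) + a.expectation (\<lambda>\<omega>. (y \<omega>)\<^sup>2))"
    using A(1) B(1) by (simp add: x_def y_def)
  also have "\<dots> \<le> 2 * a.v n * (a.linc0 / a.v n + b.linc0 / a.v n)"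
    using A(2) B(2) assms by (intro mult_left_mono add_mono) (simp_all add: x_def y_def)
  also have "\<dots> = 2 * (a.linc0 + b.linc0)" using assms by (simp add: field_simps)
  finally show "a.expectation (\<lambda>\<omega>. (dif n \<omega>)\<^sup>2) \<le> 2 * (a.linc0 + b.linc0)" .
qed

text \<open>\<open>dif\<close> has bounded second moments, so its square is tight; for
  \<open>dif\<close> itself the inequality |x| \<le> 1 + x^2 gives a bound in L^1.\<close>

lemma conv_prob_0_times_dif:
  assumes X: "conv_prob M X 0"
  shows "conv_prob M (\<lambda>n \<omega>. X n \<omega> * dif n \<omega>) 0" "conv_prob M (\<lambda>n \<omega>. X n \<omega> * (dif n \<omega>)\<^sup>2) 0"
proof -
  show "conv_prob M (\<lambda>n \<omega>. X n \<omega> * (dif n \<omega>)\<^sup>2) 0"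
  proof (rule a.conv_prob_tight_mult[OF X, where C = "2 * (a.linc0 + b.linc0)"])
    show "\<forall>\<^sub>F n in sequentially. integrable M (\<lambda>\<omega>. \<bar>(dif n \<omega>)\<^sup>2\<bar>) \<and> a.expectation (\<lambda>\<omega>. \<bar>(dif n \<omega>)\<^sup>2\<bar>) \<le> 2 * (a.linc0 + b.linc0)"
      using a.v_pos
    proof eventually_elim
      case (elim n)
      then show ?case using dif_second_moment[OF elim] by simp
    qed
  qed measurable
  show "conv_prob M (\<lambda>n \<omega>. X n \<omega> * dif n \<omega>) 0"
  proof (rule a.conv_prob_tight_mult[OF X, where C = "1 + 2 * (a.linc0 + b.linc0)"])
    show "\<forall>\<^sub>F n in sequentially. integrable M (\<lambda>\<omega>. \<bar>dif n \<omega>\<bar>) \<and> a.expectation (\<lambda>\<omega>. \<bar>dif n \<omega>\<bar>) \<le> 1 + 2 * (a.linc0 + b.linc0)"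
      using a.v_pos
    proof eventually_elim
      case (elim n)
      note D = dif_second_moment[OF elim]
      have le: "\<bar>x\<bar> \<le> 1 + x\<^sup>2" for x :: real
        using zero_le_power2[of "\<bar>x\<bar> - 1"] zero_le_power2[of x] by (simp add: power2_eq_square algebra_simps)
      have i: "integrable M (\<lambda>\<omega>. 1 + (dif n \<omega>)\<^sup>2)" using D(1) by simp
      have i2: "integrable M (\<lambda>\<omega>. \<bar>dif n \<omega>\<bar>)"
        by (rule Bochner_Integration.integrable_bound[OF i]) (use le in \<open>auto intro!: AE_I2 intro: order_trans[OF _ abs_ge_self]\<close>)
      have "a.expectation (\<lambda>\<omega>. \<bar>dif n \<omega>\<bar>) \<le> a.expectation (\<lambda>\<omega>. 1 + (dif n \<omega>)\<^sup>2)"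
        by (rule integral_mono[OF i2 i le])
      also have "\<dots> \<le> 1 + 2 * (a.linc0 + b.linc0)" using D by (simp add: a.prob_space)
      finally show ?case using i2 by simp
    qed
  qed measurable
qed

section \<open>The difference of the two K-function estimators\<close>

context
  fixes B :: "'a set" and R \<alpha> :: real and V :: "real \<Rightarrow> real"
  assumes B: "compact B" "\<forall>x\<in>B. - x \<in> B" "0 \<in> B" and R: "0 < R"
    and \<alpha>: "0 < \<alpha>" "(\<lambda>n. a.sc n powr \<alpha> / inball_radius (W n)) \<longlonglongrightarrow> 0"
    and V: "mono_on {0..R} V" "\<forall>r\<in>{0..<R}. continuous (at_right r) V"
begin

definition Kd :: "nat \<Rightarrow> real \<Rightarrow> 'w \<Rightarrow> real" where
  "Kd n r \<omega> = lambda2K_est B (W n) (Na \<omega>) (a.sc n powr \<alpha> * r) - lambda2K_est B (W n) (Nb \<omega>) (a.sc n powr \<alpha> * r)"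

text \<open>The derivative with respect to the intensity of \<open>lam\<^sup>2\<close> |B| r^d: an
  error of the intensity estimator enters with this factor.\<close>

definition slope :: "real \<Rightarrow> real" where
  "slope r = 2 * lm * measure lborel B * r ^ DIM('a)"

definition Err :: "nat \<Rightarrow> real \<Rightarrow> 'w \<Rightarrow> real" where
  "Err n r \<omega> = a.v n powr (1 / 2 - \<alpha>) * Kd n r \<omega> - slope r * dif n \<omega>"

definition \<nu> :: "real measure" where "\<nu> = restrict_space (stieltjes R V) {0..R}"

lemma finite_measure_\<nu>: "finite_measure \<nu>"
  unfolding \<nu>_def by (rule finite_measure_stieltjes[OF R V])

interpretation \<nu>: finite_measure \<nu> by (rule finite_measure_\<nu>)

lemma space_\<nu>: "space \<nu> = {0..R}"
  by (simp add: \<nu>_def space_restrict_space stieltjes_def)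

lemma id_\<nu> [measurable]: "(\<lambda>r. r) \<in> \<nu> \<rightarrow>\<^sub>M borel"
  unfolding \<nu>_def stieltjes_def
  by (rule measurable_restrict_space1) (simp add: measurable_ident_sets)

lemma set_integral_\<nu>: "(LINT r:{0..R}|stieltjes R V. f r) = (LINT r|\<nu>. f r)" for f :: "real \<Rightarrow> real"
  unfolding \<nu>_def set_lebesgue_integral_def by (subst integral_restrict_space) (auto simp: stieltjes_def)

lemma Kd_joint: "(\<lambda>p. Kd n (snd p) (fst p)) \<in> borel_measurable (M \<Otimes>\<^sub>M borel)"
proof -
  note K = lambda2K_est_measurable_config[OF B(1,3) a.W_convex(3,4)[of n], of "a.sc n powr \<alpha>"]
  have "(\<lambda>p. (Na (fst p), snd p)) \<in> M \<Otimes>\<^sub>M borel \<rightarrow>\<^sub>M config_algebra \<Otimes>\<^sub>M borel" by measurable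
  from measurable_compose[OF this K]
  have [measurable]: "(\<lambda>p. lambda2K_est B (W n) (Na (fst p)) (a.sc n powr \<alpha> * snd p)) \<in> borel_measurable (M \<Otimes>\<^sub>M borel)" by simp
  have "(\<lambda>p. (Nb (fst p), snd p)) \<in> M \<Otimes>\<^sub>M borel \<rightarrow>\<^sub>M config_algebra \<Otimes>\<^sub>M borel" by measurable
  from measurable_compose[OF this K]
  have [measurable]: "(\<lambda>p. lambda2K_est B (W n) (Nb (fst p)) (a.sc n powr \<alpha> * snd p)) \<in> borel_measurable (M \<Otimes>\<^sub>M borel)" by simp
  show ?thesis unfolding Kd_def by measurable
qed

lemma Kd_joint_\<nu> [measurable]: "(\<lambda>p. Kd n (snd p) (fst p)) \<in> borel_measurable (M \<Otimes>\<^sub>M \<nu>)"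
proof -
  have "(\<lambda>p. (fst p, snd p)) \<in> M \<Otimes>\<^sub>M \<nu> \<rightarrow>\<^sub>M M \<Otimes>\<^sub>M borel" by measurable
  from measurable_compose[OF this Kd_joint] show ?thesis by simp
qed

lemma slope_joint [measurable]: "(\<lambda>p. slope (snd p)) \<in> borel_measurable (M \<Otimes>\<^sub>M \<nu>)" "slope \<in> borel_measurable \<nu>"
  unfolding slope_def by measurable

lemma Err_joint [measurable]: "(\<lambda>p. Err n (snd p) (fst p)) \<in> borel_measurable (M \<Otimes>\<^sub>M \<nu>)"
  unfolding Err_def by measurable

lemma Kd_section [measurable]: "\<omega> \<in> space M \<Longrightarrow> (\<lambda>r. Kd n r \<omega>) \<in> borel_measurable \<nu>"
  "\<omega> \<in> space M \<Longrightarrow> (\<lambda>r. Err n r \<omega>) \<in> borel_measurable \<nu>"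
  "r \<in> {0..R} \<Longrightarrow> Kd n r \<in> borel_measurable M" "r \<in> {0..R} \<Longrightarrow> Err n r \<in> borel_measurable M"
  using measurable_Pair2[OF Kd_joint_\<nu>[of n], of \<omega>] measurable_Pair2[OF Err_joint[of n], of \<omega>]
    measurable_Pair1[OF Kd_joint_\<nu>[of n], of r] measurable_Pair1[OF Err_joint[of n], of r]
  by (auto simp: space_\<nu>)

definition slope_max :: real where "slope_max = 2 * lm * measure lborel B * R ^ DIM('a)"

lemma slope_bound: "r \<in> {0..R} \<Longrightarrow> \<bar>slope r\<bar> \<le> slope_max" "0 \<le> slope_max"
  using a.lam_pos R unfolding slope_def slope_max_def
  by (auto simp: abs_mult power_abs intro!: mult_left_mono power_mono)

text \<open>For a fixed configuration all values of the K-function estimator are at most the sum of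
  the edge weights, whatever the radius. So the integrals over r in \<open>I_conv\<close> exist for
  every single \<omega> and the square may be expanded under the integral.\<close>

lemma Err_bounded:
  obtains K where "\<And>r. r \<in> {0..R} \<Longrightarrow> \<bar>Err n r \<omega>\<bar> \<le> K" "\<And>r. r \<in> {0..R} \<Longrightarrow> \<bar>Kd n r \<omega>\<bar> \<le> K"
proof -
  define s where "s S = (\<Sum>(x, y)\<in>distinct_pairs (S \<inter> W n). 1 / edge_volume (W n) x y)" for S
  have K: "\<bar>lambda2K_est B (W n) S r\<bar> \<le> s S" for S r
  proof -
    have "\<bar>lambda2K_est B (W n) S r\<bar> \<le> (\<Sum>p\<in>distinct_pairs (S \<inter> W n). \<bar>case p of (x, y) \<Rightarrow> indicat_real ((\<lambda>z. r *\<^sub>R z) ` B) (y - x) / edge_volume (W n) x y\<bar>)"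
      unfolding lambda2K_est_def by (rule sum_abs)
    also have "\<dots> \<le> s S"
      unfolding s_def by (intro sum_mono) (auto simp: indicator_def edge_volume_def)
    finally show ?thesis .
  qed
  define k where "k = s (Na \<omega>) + s (Nb \<omega>)"
  have Kd: "\<bar>Kd n r \<omega>\<bar> \<le> k" for r
    unfolding Kd_def k_def using K[of "Na \<omega>" "a.sc n powr \<alpha> * r"] K[of "Nb \<omega>" "a.sc n powr \<alpha> * r"] by linarith
  have k0: "0 \<le> k" using Kd[of 0] by simp
  define p where "p = a.v n powr (1 / 2 - \<alpha>)"
  have p0: "0 \<le> p" by (simp add: p_def)
  have E: "\<bar>Err n r \<omega>\<bar> \<le> p * k + slope_max * \<bar>dif n \<omega>\<bar>" if "r \<in> {0..R}" for r
  proof -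
    have "\<bar>Err n r \<omega>\<bar> \<le> \<bar>p * Kd n r \<omega>\<bar> + \<bar>slope r * dif n \<omega>\<bar>"
      unfolding Err_def p_def by (rule abs_triangle_ineq4)
    also have "\<dots> \<le> p * k + slope_max * \<bar>dif n \<omega>\<bar>"
    proof (rule add_mono)
      show "\<bar>p * Kd n r \<omega>\<bar> \<le> p * k"
        using Kd[of r] p0 by (simp add: abs_mult mult_left_mono)
      show "\<bar>slope r * dif n \<omega>\<bar> \<le> slope_max * \<bar>dif n \<omega>\<bar>"
        unfolding abs_mult by (rule mult_right_mono[OF slope_bound(1)[OF that]]) simp
    qed
    finally show ?thesis .
  qed
  show ?thesis
  proof (rule that)
    have "0 \<le> p * k" "0 \<le> slope_max * \<bar>dif n \<omega>\<bar>" using p0 k0 slope_bound(2) by auto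
    then show "\<bar>Err n r \<omega>\<bar> \<le> p * k + slope_max * \<bar>dif n \<omega>\<bar> + k" "\<bar>Kd n r \<omega>\<bar> \<le> p * k + slope_max * \<bar>dif n \<omega>\<bar> + k"
      if "r \<in> {0..R}" for r
      using E[OF that] Kd[of r] k0 by linarith+
  qed
qed

text \<open>\<open>Err\<close> is the difference of one functional Z of configurations at the two
  processes, so its mean vanishes under equal laws whatever the mean of Z; its second moment is then
  a variance, bounded by those of the two summands.\<close>

lemma Err_moments:
  obtains e where "e \<longlonglongrightarrow> 0" "\<And>n. 0 \<le> e n"
    "\<forall>\<^sub>F n in sequentially. \<forall>r\<in>{0..R}. integrable M (Err n r) \<and> integrable M (\<lambda>\<omega>. (Err n r \<omega>)\<^sup>2) \<and>
       a.expectation (\<lambda>\<omega>. (Err n r \<omega>)\<^sup>2) \<le> e n"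
proof -
  define Z where "Z n r S = a.v n powr (1 / 2 - \<alpha>) * lambda2K_est B (W n) S (a.sc n powr \<alpha> * r)
      - 2 * lm * measure lborel B * r ^ DIM('a) / sqrt (a.v n) * real (card (S \<inter> W n))" for n r S
  have "\<exists>e. e \<longlonglongrightarrow> 0 \<and> (\<forall>n. 0 \<le> e n) \<and> (\<forall>\<^sub>F n in sequentially. \<forall>r\<in>{0..R}. integrable M (\<lambda>\<omega>. Z n r (Na \<omega>)) \<and>
      integrable M (\<lambda>\<omega>. (Z n r (Na \<omega>))\<^sup>2) \<and> a.variance (\<lambda>\<omega>. Z n r (Na \<omega>)) \<le> e n)"
    unfolding Z_def by (rule a.K_projection[OF B(1,2) R \<alpha>]) (intro exI conjI, assumption, blast, assumption)
  then obtain ea where ea: "ea \<longlonglongrightarrow> 0" "\<And>n. 0 \<le> ea n"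
    "\<forall>\<^sub>F n in sequentially. \<forall>r\<in>{0..R}. integrable M (\<lambda>\<omega>. Z n r (Na \<omega>)) \<and> integrable M (\<lambda>\<omega>. (Z n r (Na \<omega>))\<^sup>2) \<and> a.variance (\<lambda>\<omega>. Z n r (Na \<omega>)) \<le> ea n"
    by (elim exE conjE) (rule that, assumption, erule spec, assumption)
  have "\<exists>e. e \<longlonglongrightarrow> 0 \<and> (\<forall>n. 0 \<le> e n) \<and> (\<forall>\<^sub>F n in sequentially. \<forall>r\<in>{0..R}. integrable M (\<lambda>\<omega>. Z n r (Nb \<omega>)) \<and>
      integrable M (\<lambda>\<omega>. (Z n r (Nb \<omega>))\<^sup>2) \<and> a.variance (\<lambda>\<omega>. Z n r (Nb \<omega>)) \<le> e n)"
    unfolding Z_def by (rule b.K_projection[OF B(1,2) R \<alpha>, unfolded intensity_eq]) (intro exI conjI, assumption, blast, assumption)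
  then obtain eb where eb: "eb \<longlonglongrightarrow> 0" "\<And>n. 0 \<le> eb n"
    "\<forall>\<^sub>F n in sequentially. \<forall>r\<in>{0..R}. integrable M (\<lambda>\<omega>. Z n r (Nb \<omega>)) \<and> integrable M (\<lambda>\<omega>. (Z n r (Nb \<omega>))\<^sup>2) \<and> a.variance (\<lambda>\<omega>. Z n r (Nb \<omega>)) \<le> eb n"
    by (elim exE conjE) (rule that, assumption, erule spec, assumption)
  have ev: "\<forall>\<^sub>F n in sequentially. \<forall>r\<in>{0..R}. integrable M (Err n r) \<and> integrable M (\<lambda>\<omega>. (Err n r \<omega>)\<^sup>2) \<and>
       a.expectation (\<lambda>\<omega>. (Err n r \<omega>)\<^sup>2) \<le> 3 * (ea n + eb n)"
    using ea(3) eb(3) a.v_pos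
  proof eventually_elim
    case (elim n)
    show ?case
    proof
      fix r assume r: "r \<in> {0..R}"
      define X Y where "X = (\<lambda>\<omega>. Z n r (Na \<omega>))" and "Y = (\<lambda>\<omega>. - Z n r (Nb \<omega>))"
      have X: "integrable M X" "integrable M (\<lambda>\<omega>. (X \<omega>)\<^sup>2)" "a.variance X \<le> ea n"
        using elim(1) r unfolding X_def by auto
      have Y: "integrable M Y" "integrable M (\<lambda>\<omega>. (Y \<omega>)\<^sup>2)" "a.variance Y \<le> eb n"
        using elim(2) r unfolding Y_def by (auto simp: power2_commute)
      have "(\<lambda>S. Z n r S) \<in> borel_measurable config_algebra"
      proof -
        have "(\<lambda>S. (S, r)) \<in> config_algebra \<rightarrow>\<^sub>M config_algebra \<Otimes>\<^sub>M borel" by measurable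
        from measurable_compose[OF this lambda2K_est_measurable_config[OF B(1,3) a.W_convex(3,4)[of n], of "a.sc n powr \<alpha>"]]
        have [measurable]: "(\<lambda>S. lambda2K_est B (W n) S (a.sc n powr \<alpha> * r)) \<in> borel_measurable config_algebra" by simp
        note [measurable] = card_measurable_config[OF a.W_convex(3,4)[of n]]
        show ?thesis unfolding Z_def by measurable
      qed
      from expectation_law[OF this N_measurable law]
      have EXY: "a.expectation X + a.expectation Y = 0" by (simp add: X_def Y_def)
      have eq: "Err n r = (\<lambda>\<omega>. X \<omega> + Y \<omega> + 0)"
      proof
        fix \<omega>
        have "slope r * dif n \<omega> = 2 * lm * measure lborel B * r ^ DIM('a) / sqrt (a.v n) * real (card (Na \<omega> \<inter> W n))
            - 2 * lm * measure lborel B * r ^ DIM('a) / sqrt (a.v n) * real (card (Nb \<omega> \<inter> W n))"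
        proof -
          have "sqrt (a.v n) / a.v n = 1 / sqrt (a.v n)" using elim(3) by (simp add: real_div_sqrt field_simps)
          then have e: "dif n \<omega> = 1 / sqrt (a.v n) * (real (card (Na \<omega> \<inter> W n)) - real (card (Nb \<omega> \<inter> W n)))"
            unfolding dif_def lambda_est_def by (metis (no_types, opaque_lifting) diff_divide_distrib times_divide_eq_left times_divide_eq_right)
          show ?thesis unfolding e slope_def by (simp add: algebra_simps)
        qed
        then show "Err n r \<omega> = X \<omega> + Y \<omega> + 0" unfolding Err_def Kd_def X_def Y_def Z_def by (simp add: algebra_simps)
      qed
      note s = a.variance_sum3[OF X(1,2) Y(1,2), of "\<lambda>_. 0"]
      have i: "integrable M (Err n r)" "integrable M (\<lambda>\<omega>. (Err n r \<omega>)\<^sup>2)" unfolding eq using s(2,3) by simp_all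
      have "a.expectation (Err n r) = 0" unfolding eq using X(1) Y(1) EXY by simp
      then have "a.expectation (\<lambda>\<omega>. (Err n r \<omega>)\<^sup>2) = a.variance (Err n r)" by simp
      also have "\<dots> \<le> 3 * (a.variance X + a.variance Y + a.variance (\<lambda>_. 0))" unfolding eq by (rule s(1)) auto
      also have "\<dots> \<le> 3 * (ea n + eb n)" using X(3) Y(3) by simp
      finally show "integrable M (Err n r) \<and> integrable M (\<lambda>\<omega>. (Err n r \<omega>)\<^sup>2) \<and>
         a.expectation (\<lambda>\<omega>. (Err n r \<omega>)\<^sup>2) \<le> 3 * (ea n + eb n)" using i by simp
    qed
  qed
  show ?thesis
  proof (rule that[OF _ _ ev])
    show "(\<lambda>n. 3 * (ea n + eb n)) \<longlonglongrightarrow> 0"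
      using tendsto_mult_left[OF tendsto_add[OF ea(1) eb(1)], of 3] by simp
    show "0 \<le> 3 * (ea n + eb n)" for n using ea(2)[of n] eb(2)[of n] by simp
  qed
qed

text \<open>Tonelli: the L^1 norm of an integral over r is at most the mass of \<nu> times a bound
  for the L^1 norms that is uniform in r. Such bounds come from \<open>Err_moments\<close>, directly
  for the square and by \<open>L1_le_L2\<close> for the cross term.\<close>

lemma Err_integrals_conv:
  "conv_prob M (\<lambda>n \<omega>. LINT r|\<nu>. slope r * Err n r \<omega>) 0" "conv_prob M (\<lambda>n \<omega>. LINT r|\<nu>. (Err n r \<omega>)\<^sup>2) 0"
proof -
  obtain e where e: "e \<longlonglongrightarrow> 0" "\<And>n. 0 \<le> e n"
    "\<forall>\<^sub>F n in sequentially. \<forall>r\<in>{0..R}. integrable M (Err n r) \<and> integrable M (\<lambda>\<omega>. (Err n r \<omega>)\<^sup>2) \<and>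
       a.expectation (\<lambda>\<omega>. (Err n r \<omega>)\<^sup>2) \<le> e n" by (rule Err_moments) (rule that, assumption, simp, assumption)
  interpret P: pair_sigma_finite M \<nu> ..
  define \<mu> where "\<mu> = measure \<nu> (space \<nu>)"
  have gen: "conv_prob M (\<lambda>n \<omega>. LINT r|\<nu>. f n r \<omega>) 0"
    if [measurable]: "\<And>n. (\<lambda>p. f n (snd p) (fst p)) \<in> borel_measurable (M \<Otimes>\<^sub>M \<nu>)"
      and g: "g \<longlonglongrightarrow> 0" "\<And>n. 0 \<le> g n"
      and b: "\<forall>\<^sub>F n in sequentially. \<forall>r\<in>{0..R}. (\<integral>\<^sup>+\<omega>. ennreal \<bar>f n r \<omega>\<bar> \<partial>M) \<le> ennreal (g n)" for f :: "nat \<Rightarrow> real \<Rightarrow> 'w \<Rightarrow> real" and g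
  proof (rule a.conv_prob_of_L1)
    show "(\<lambda>\<omega>. LINT r|\<nu>. f n r \<omega>) \<in> borel_measurable M" for n
      by (rule \<nu>.borel_measurable_lebesgue_integral) (use that(1)[of n] in \<open>simp add: case_prod_beta'\<close>)
    show "(\<lambda>n. g n * \<mu>) \<longlonglongrightarrow> 0" using tendsto_mult_right[OF g(1), of \<mu>] by simp
    show "\<forall>\<^sub>F n in sequentially. (\<integral>\<^sup>+\<omega>. ennreal \<bar>(LINT r|\<nu>. f n r \<omega>) - 0\<bar> \<partial>M) \<le> ennreal (g n * \<mu>)"
      using b
    proof eventually_elim
      case (elim n)
      have "(\<integral>\<^sup>+\<omega>. ennreal \<bar>(LINT r|\<nu>. f n r \<omega>) - 0\<bar> \<partial>M) \<le> (\<integral>\<^sup>+\<omega>. (\<integral>\<^sup>+r. ennreal \<bar>f n r \<omega>\<bar> \<partial>\<nu>) \<partial>M)"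
      proof (rule nn_integral_mono)
        fix \<omega>
        show "ennreal \<bar>(LINT r|\<nu>. f n r \<omega>) - 0\<bar> \<le> (\<integral>\<^sup>+r. ennreal \<bar>f n r \<omega>\<bar> \<partial>\<nu>)"
        proof (cases "integrable \<nu> (\<lambda>r. f n r \<omega>)")
          case True
          then show ?thesis using integral_norm_bound_ennreal[OF True] by simp
        next
          case False
          then show ?thesis by (simp add: not_integrable_integral_eq)
        qed
      qed
      also have "\<dots> = (\<integral>\<^sup>+r. (\<integral>\<^sup>+\<omega>. ennreal \<bar>f n r \<omega>\<bar> \<partial>M) \<partial>\<nu>)"
        by (rule P.Fubini'[symmetric]) (simp add: case_prod_beta')
      also have "\<dots> \<le> (\<integral>\<^sup>+r. ennreal (g n) \<partial>\<nu>)"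
        using elim by (intro nn_integral_mono) (auto simp: space_\<nu>)
      also have "\<dots> = ennreal (g n * \<mu>)"
        using g(2) by (simp add: \<mu>_def \<nu>.emeasure_eq_measure ennreal_mult)
      finally show ?case .
    qed
  qed
  show "conv_prob M (\<lambda>n \<omega>. LINT r|\<nu>. (Err n r \<omega>)\<^sup>2) 0"
  proof (rule gen[OF _ e(1,2)])
    show "\<forall>\<^sub>F n in sequentially. \<forall>r\<in>{0..R}. (\<integral>\<^sup>+\<omega>. ennreal \<bar>(Err n r \<omega>)\<^sup>2\<bar> \<partial>M) \<le> ennreal (e n)"
      using e(3) by eventually_elim (auto simp: nn_integral_eq_integral intro!: ennreal_leI)
  qed measurable
  show "conv_prob M (\<lambda>n \<omega>. LINT r|\<nu>. slope r * Err n r \<omega>) 0"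
  proof (rule gen)
    show "(\<lambda>n. slope_max * sqrt (e n)) \<longlonglongrightarrow> 0"
      using tendsto_mult_left[OF tendsto_real_sqrt[OF e(1)], of slope_max] by simp
    show "0 \<le> slope_max * sqrt (e n)" for n using slope_bound(2) e(2) by simp
    show "\<forall>\<^sub>F n in sequentially. \<forall>r\<in>{0..R}. (\<integral>\<^sup>+\<omega>. ennreal \<bar>slope r * Err n r \<omega>\<bar> \<partial>M) \<le> ennreal (slope_max * sqrt (e n))"
      using e(3)
    proof eventually_elim
      case (elim n)
      show ?case
      proof
        fix r assume r: "r \<in> {0..R}"
        have i: "integrable M (Err n r)" "integrable M (\<lambda>\<omega>. (Err n r \<omega>)\<^sup>2)" "a.expectation (\<lambda>\<omega>. (Err n r \<omega>)\<^sup>2) \<le> e n"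
          using elim r by auto
        have "(\<integral>\<^sup>+\<omega>. ennreal \<bar>slope r * Err n r \<omega>\<bar> \<partial>M) = ennreal (a.expectation (\<lambda>\<omega>. \<bar>slope r * Err n r \<omega>\<bar>))"
          using i(1) by (intro nn_integral_eq_integral) auto
        also have "a.expectation (\<lambda>\<omega>. \<bar>slope r * Err n r \<omega>\<bar>) = \<bar>slope r\<bar> * a.expectation (\<lambda>\<omega>. \<bar>Err n r \<omega>\<bar>)"
          by (simp add: abs_mult)
        also have "\<dots> \<le> slope_max * sqrt (e n)"
          using slope_bound r a.L1_le_L2[OF i] by (intro mult_mono) (auto intro!: integral_nonneg)
        finally show "(\<integral>\<^sup>+\<omega>. ennreal \<bar>slope r * Err n r \<omega>\<bar> \<partial>M) \<le> ennreal (slope_max * sqrt (e n))"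
          by (simp add: ennreal_leI)
      qed
    qed
  qed measurable
qed

definition I :: "nat \<Rightarrow> 'w \<Rightarrow> real" where
  "I n \<omega> = (LINT r|\<nu>. (a.v n powr (1 / 2 - \<alpha>) * Kd n r \<omega>)\<^sup>2)"

lemma I_measurable [measurable]: "I n \<in> borel_measurable M"
  unfolding I_def by (rule \<nu>.borel_measurable_lebesgue_integral) (simp add: case_prod_beta')

definition J where "J = (LINT r|\<nu>. r ^ (2 * DIM('a)))"

text \<open>The normalized difference at r is slope(r) \<open>dif\<close> + \<open>Err\<close>. Its
  square integrates to the square of \<open>dif\<close> times the integral of the squared slope,
  plus a cross term in which \<open>dif\<close> factors out of the integral over r, plus the
  integral of the squared error; the last two vanish in probability.\<close>

lemma I_conv: "conv_prob M (\<lambda>n \<omega>. I n \<omega> - 4 * lm\<^sup>2 * (measure lborel B)\<^sup>2 * J * (dif n \<omega>)\<^sup>2) 0"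
proof -
  have "conv_prob M (\<lambda>n \<omega>. 2 * ((LINT r|\<nu>. slope r * Err n r \<omega>) * dif n \<omega>) + (LINT r|\<nu>. (Err n r \<omega>)\<^sup>2)) (2 * 0 + 0)"
    by (intro a.conv_prob_add a.conv_prob_cmult conv_prob_0_times_dif Err_integrals_conv)
  moreover have "I n \<omega> - 4 * lm\<^sup>2 * (measure lborel B)\<^sup>2 * J * (dif n \<omega>)\<^sup>2
      = 2 * ((LINT r|\<nu>. slope r * Err n r \<omega>) * dif n \<omega>) + (LINT r|\<nu>. (Err n r \<omega>)\<^sup>2)" if \<omega>: "\<omega> \<in> space M" for n \<omega>
  proof -
    obtain K where K: "\<And>r. r \<in> {0..R} \<Longrightarrow> \<bar>Err n r \<omega>\<bar> \<le> K" by (rule Err_bounded[of n \<omega>]) (rule that, simp)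
    note [measurable] = Kd_section(2)[OF \<omega>, of n]
    have K0: "0 \<le> K" using K[of 0] R by auto
    have i1: "integrable \<nu> (\<lambda>r. slope r * Err n r \<omega>)"
      using K slope_bound by (intro \<nu>.integrable_const_bound[of _ "slope_max * K"]) (auto simp: space_\<nu> abs_mult intro!: AE_I2 mult_mono)
    have i2: "integrable \<nu> (\<lambda>r. (Err n r \<omega>)\<^sup>2)"
      using power_mono[OF K, of _ 2] by (intro \<nu>.integrable_const_bound[of _ "K\<^sup>2"]) (auto simp: space_\<nu> intro!: AE_I2)
    have i3: "integrable \<nu> (\<lambda>r. r ^ (2 * DIM('a)))"
      by (intro \<nu>.integrable_const_bound[of _ "R ^ (2 * DIM('a))"]) (auto simp: space_\<nu> intro!: AE_I2 power_mono)
    have "(a.v n powr (1 / 2 - \<alpha>) * Kd n r \<omega>)\<^sup>2 = (2 * dif n \<omega>) * (slope r * Err n r \<omega>) + (Err n r \<omega>)\<^sup>2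
        + (4 * lm\<^sup>2 * (measure lborel B)\<^sup>2 * (dif n \<omega>)\<^sup>2) * r ^ (2 * DIM('a))" for r
    proof -
      have "a.v n powr (1 / 2 - \<alpha>) * Kd n r \<omega> = Err n r \<omega> + slope r * dif n \<omega>" by (simp add: Err_def)
      moreover have "(slope r)\<^sup>2 = 4 * lm\<^sup>2 * (measure lborel B)\<^sup>2 * r ^ (2 * DIM('a))"
        by (simp add: slope_def power_mult_distrib power_mult mult.commute[of 2])
      ultimately show ?thesis by (simp add: power2_sum power_mult_distrib mult_ac)
    qed
    then have "I n \<omega> = (2 * dif n \<omega>) * (LINT r|\<nu>. slope r * Err n r \<omega>) + (LINT r|\<nu>. (Err n r \<omega>)\<^sup>2)
        + (4 * lm\<^sup>2 * (measure lborel B)\<^sup>2 * (dif n \<omega>)\<^sup>2) * J"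
      unfolding I_def J_def using i1 i2 i3 by simp
    then show ?thesis by (simp add: mult_ac)
  qed
  ultimately show ?thesis
    by (intro a.conv_prob_cong[where Y = "\<lambda>n \<omega>. I n \<omega> - 4 * lm\<^sup>2 * (measure lborel B)\<^sup>2 * J * (dif n \<omega>)\<^sup>2"]) (auto intro!: always_eventually)
qed

text \<open>The denominators are replaced by twice their common limits. The squared intensity in the
  first of them cancels against the one in the squared slope, which leaves a constant free of the
  intensity.\<close>

lemma test_statistic_conv:
  fixes sa sb :: "nat \<Rightarrow> 'w \<Rightarrow> real" and s2 :: real
  assumes sa: "conv_prob M sa s2" and sb: "conv_prob M sb s2" and s2: "0 < s2"
  defines "T \<equiv> \<lambda>n \<omega>. a.v n * (LINT r:{0..R}|stieltjes R V. (lambda2K_est B (W n) (Na \<omega>) (a.sc n powr \<alpha> * r) - lambda2K_est B (W n) (Nb \<omega>) (a.sc n powr \<alpha> * r))\<^sup>2)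
      / (a.v n powr (2 * \<alpha>) * (lambda2_est (W n) (Na \<omega>) * sa n \<omega> + lambda2_est (W n) (Nb \<omega>) * sb n \<omega>))
      + a.v n * (lambda_est (W n) (Na \<omega>) - lambda_est (W n) (Nb \<omega>))\<^sup>2 / (sa n \<omega> + sb n \<omega>)"
  shows "conv_prob M (\<lambda>n \<omega>. T n \<omega> - (4 * (measure lborel B)\<^sup>2 * (LINT r:{0..R}|stieltjes R V. r ^ (2 * DIM('a))) + 1) / (2 * s2) * (dif n \<omega>)\<^sup>2) 0"
    and "\<And>n. T n \<in> borel_measurable M"
proof -
  note [measurable] = a.conv_probD(1)[OF sa] a.conv_probD(1)[OF sb]
  have [measurable]: "(\<lambda>\<omega>. LINT r|\<nu>. (Kd n r \<omega>)\<^sup>2) \<in> borel_measurable M" for n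
    by (rule \<nu>.borel_measurable_lebesgue_integral) (simp add: case_prod_beta')
  show Tm [measurable]: "T n \<in> borel_measurable M" for n
    unfolding T_def Kd_def[symmetric] set_integral_\<nu> by measurable
  define Q1 where "Q1 n \<omega> = 1 / (lambda2_est (W n) (Na \<omega>) * sa n \<omega> + lambda2_est (W n) (Nb \<omega>) * sb n \<omega>)" for n \<omega>
  define Q2 where "Q2 n \<omega> = 1 / (sa n \<omega> + sb n \<omega>)" for n \<omega>
  have lm: "lm \<noteq> 0" using a.lam_pos by simp
  have "conv_prob M Q1 (1 / (lm\<^sup>2 * s2 + lm\<^sup>2 * s2))"
    unfolding Q1_def
    by (intro a.conv_prob_inverse a.conv_prob_add a.conv_prob_mult a.lambda2_est_conv b.lambda2_est_conv[unfolded intensity_eq] sa sb)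
      (use s2 lm in auto)
  then have Q1: "conv_prob M Q1 (1 / (2 * lm\<^sup>2 * s2))" by (simp add: mult_ac)
  have "conv_prob M Q2 (1 / (s2 + s2))"
    unfolding Q2_def by (intro a.conv_prob_inverse a.conv_prob_add sa sb) (use s2 in auto)
  then have Q2: "conv_prob M Q2 (1 / (2 * s2))" by simp
  have Q0: "conv_prob M (\<lambda>n \<omega>. Q1 n \<omega> - 1 / (2 * lm\<^sup>2 * s2)) 0" "conv_prob M (\<lambda>n \<omega>. Q2 n \<omega> - 1 / (2 * s2)) 0"
    using a.conv_prob_diff[OF Q1 a.conv_prob_const[OF tendsto_const, of "1 / (2 * lm\<^sup>2 * s2)"]]
      a.conv_prob_diff[OF Q2 a.conv_prob_const[OF tendsto_const, of "1 / (2 * s2)"]] by (simp_all only: diff_self)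
  define A where "A = 4 * lm\<^sup>2 * (measure lborel B)\<^sup>2 * J"
  \<comment> \<open>The three sources of error: the numerator of the first term, its denominator,
    and the denominator of the second term. The last two are multiplied by the square of
    \<open>dif\<close>, which is bounded in L^1.\<close>
  have "conv_prob M (\<lambda>n \<omega>. (I n \<omega> - A * (dif n \<omega>)\<^sup>2) * Q1 n \<omega> + A * ((Q1 n \<omega> - 1 / (2 * lm\<^sup>2 * s2)) * (dif n \<omega>)\<^sup>2)
      + (Q2 n \<omega> - 1 / (2 * s2)) * (dif n \<omega>)\<^sup>2) (0 * (1 / (2 * lm\<^sup>2 * s2)) + A * 0 + 0)"
    unfolding A_def by (intro a.conv_prob_add a.conv_prob_mult I_conv Q1 a.conv_prob_cmult conv_prob_0_times_dif Q0)
  then have main: "conv_prob M (\<lambda>n \<omega>. (I n \<omega> - A * (dif n \<omega>)\<^sup>2) * Q1 n \<omega> + A * ((Q1 n \<omega> - 1 / (2 * lm\<^sup>2 * s2)) * (dif n \<omega>)\<^sup>2)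
      + (Q2 n \<omega> - 1 / (2 * s2)) * (dif n \<omega>)\<^sup>2) 0" by simp
  show "conv_prob M (\<lambda>n \<omega>. T n \<omega> - (4 * (measure lborel B)\<^sup>2 * (LINT r:{0..R}|stieltjes R V. r ^ (2 * DIM('a))) + 1) / (2 * s2) * (dif n \<omega>)\<^sup>2) 0"
  proof (rule a.conv_prob_cong[OF main])
    show "\<forall>\<^sub>F n in sequentially. \<forall>\<omega>\<in>space M. T n \<omega> - (4 * (measure lborel B)\<^sup>2 * (LINT r:{0..R}|stieltjes R V. r ^ (2 * DIM('a))) + 1) / (2 * s2) * (dif n \<omega>)\<^sup>2
      = (I n \<omega> - A * (dif n \<omega>)\<^sup>2) * Q1 n \<omega> + A * ((Q1 n \<omega> - 1 / (2 * lm\<^sup>2 * s2)) * (dif n \<omega>)\<^sup>2)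
      + (Q2 n \<omega> - 1 / (2 * s2)) * (dif n \<omega>)\<^sup>2"
      using a.v_pos
    proof eventually_elim
      case (elim n)
      \<comment> \<open>The factor |W|/|W|^(2\<alpha>) in the statistic is the square of the
        normalization used for \<open>Err\<close>.\<close>
      have pw: "(a.v n powr (1 / 2 - \<alpha>))\<^sup>2 = a.v n / a.v n powr (2 * \<alpha>)"
      proof -
        have "(a.v n powr (1 / 2 - \<alpha>))\<^sup>2 = a.v n powr (1 - 2 * \<alpha>)"
          unfolding power2_eq_square by (simp add: powr_add[symmetric])
        then show ?thesis using elim by (simp add: powr_diff)
      qed
      show ?case
      proof
        fix \<omega>
        have "I n \<omega> = a.v n / a.v n powr (2 * \<alpha>) * (LINT r|\<nu>. (Kd n r \<omega>)\<^sup>2)"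
          unfolding I_def power_mult_distrib pw by simp
        then have 1: "a.v n * (LINT r|\<nu>. (Kd n r \<omega>)\<^sup>2)
            / (a.v n powr (2 * \<alpha>) * (lambda2_est (W n) (Na \<omega>) * sa n \<omega> + lambda2_est (W n) (Nb \<omega>) * sb n \<omega>)) = I n \<omega> * Q1 n \<omega>"
          by (simp add: Q1_def)
        have 2: "a.v n * (lambda_est (W n) (Na \<omega>) - lambda_est (W n) (Nb \<omega>))\<^sup>2 / (sa n \<omega> + sb n \<omega>) = (dif n \<omega>)\<^sup>2 * Q2 n \<omega>"
          using elim by (simp add: dif_def Q2_def power_mult_distrib)
        have T: "T n \<omega> = I n \<omega> * Q1 n \<omega> + (dif n \<omega>)\<^sup>2 * Q2 n \<omega>"
          unfolding T_def Kd_def[symmetric] set_integral_\<nu> 1 2 ..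
        have A: "A * (1 / (2 * lm\<^sup>2 * s2)) = 4 * (measure lborel B)\<^sup>2 * J / (2 * s2)"
          using lm s2 by (simp add: A_def)
        have "(4 * (measure lborel B)\<^sup>2 * J + 1) / (2 * s2) * (dif n \<omega>)\<^sup>2 = A * (1 / (2 * lm\<^sup>2 * s2)) * (dif n \<omega>)\<^sup>2 + 1 / (2 * s2) * (dif n \<omega>)\<^sup>2"
          unfolding A by (simp add: add_divide_distrib algebra_simps)
        then show "T n \<omega> - (4 * (measure lborel B)\<^sup>2 * (LINT r:{0..R}|stieltjes R V. r ^ (2 * DIM('a))) + 1) / (2 * s2) * (dif n \<omega>)\<^sup>2
          = (I n \<omega> - A * (dif n \<omega>)\<^sup>2) * Q1 n \<omega> + A * ((Q1 n \<omega> - 1 / (2 * lm\<^sup>2 * s2)) * (dif n \<omega>)\<^sup>2)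
          + (Q2 n \<omega> - 1 / (2 * s2)) * (dif n \<omega>)\<^sup>2"
          unfolding T set_integral_\<nu> J_def[symmetric] by (simp add: algebra_simps)
      qed
    qed
  qed measurable
qed

end

end

theorem theorem4:
  fixes M :: "'w measure"
    and N_a N_b :: "'w \<Rightarrow> 'a::euclidean_space set"
    and W :: "nat \<Rightarrow> 'a set"
    and B :: "'a set"
    and w :: "'a \<Rightarrow> real"
    and b :: "nat \<Rightarrow> real"
    and R \<alpha> :: real
    and V :: "real \<Rightarrow> real"
  assumes processes: "point_process M N_a" "point_process M N_b"
    and mixing: "B4_mixing M N_a" "B4_mixing M N_b"
    and indep: "prob_space.indep_var M config_algebra N_a config_algebra N_b"
    and windows: "convex_averaging W"
    and B: "compact B" "convex B" "\<forall>x\<in>B. - x \<in> B" "0 \<in> interior B"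
    and w: "w \<in> borel_measurable borel" "\<forall>x. 0 \<le> w x" "bounded (range w)" "\<forall>x. w (- x) = w x"
      "bounded {x. w x \<noteq> 0}" "(w \<longlongrightarrow> 1) (at 0)" "w 0 = 1"
    and R: "0 < R"
    and \<alpha>: "0 < \<alpha>" "\<alpha> \<le> 1 / 2"
      "(\<lambda>n. window_scale (W n) powr \<alpha> / inball_radius (W n)) \<longlonglongrightarrow> 0"
    and clt: "\<forall>N\<in>{N_a, N_b}. 0 < asymp_var M N \<and>
      weak_conv_m
        (\<lambda>n. distr M borel (\<lambda>\<omega>. (real (card (N \<omega> \<inter> W n)) - intensity M N * measure lborel (W n))
                                 / sqrt (measure lborel (W n))))
        (density lborel (normal_density 0 (sqrt (asymp_var M N))))"
    and bounded_moment: "\<forall>N\<in>{N_a, N_b}. \<exists>a0>0. \<forall>A\<in>sets borel. bounded A \<longrightarrow>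
      moment_red M N 2 (Pi\<^sub>E {1..<2} (\<lambda>_. A)) \<le> a0 * measure lborel A"
    and densities: "\<forall>N\<in>{N_a, N_b}. \<alpha> > 1 / 4 \<or>
      (\<exists>(\<kappa>3 :: 'a \<Rightarrow> 'a \<Rightarrow> real) (\<kappa>4 :: 'a \<Rightarrow> 'a \<Rightarrow> 'a \<Rightarrow> real) (a01 :: real) (a02 :: real).
         has_lebesgue_density {1..<3} (cumulant_red M N 3) (\<lambda>x. \<kappa>3 (x 1) (x 2)) \<and>
         has_lebesgue_density {1..<4} (cumulant_red M N 4) (\<lambda>x. \<kappa>4 (x 1) (x 2) (x 3)) \<and>
         (\<forall>x y. \<bar>\<kappa>3 x y\<bar> \<le> a01) \<and>
         (\<integral>\<^sup>+x. (\<integral>\<^sup>+y. (\<integral>\<^sup>+z. ennreal \<bar>\<kappa>4 x (y + z) z\<bar> \<partial>lborel)\<^sup>2 \<partial>lborel) \<partial>lborel) \<le> ennreal a02)"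
    and bandwidths: "\<forall>n. 0 < b n" "b \<longlonglongrightarrow> 0"
      "filterlim (\<lambda>n. window_scale (W n) * b n) at_top sequentially"
      "(\<lambda>n. window_scale (W n) * (b n)\<^sup>2) \<longlonglongrightarrow> 0"
      "(\<lambda>n. window_scale (W n) * b n / inball_radius (W n)) \<longlonglongrightarrow> 0"
    and V: "\<forall>r\<in>{0..R}. 0 \<le> V r" "mono_on {0..R} V" "\<forall>r\<in>{0..<R}. continuous (at_right r) V"
    and null_hypothesis: "distr M config_algebra N_a = distr M config_algebra N_b"
  shows "weak_conv_m
    (\<lambda>n. distr M borel (\<lambda>\<omega>.
       (let v = measure lborel (W n); h = b n * window_scale (W n);
            Ka = lambda2K_est B (W n) (N_a \<omega>); Kb = lambda2K_est B (W n) (N_b \<omega>);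
            la = lambda_est (W n) (N_a \<omega>); lb = lambda_est (W n) (N_b \<omega>);
            l2a = lambda2_est (W n) (N_a \<omega>); l2b = lambda2_est (W n) (N_b \<omega>);
            s2a = sigma2_est w h (W n) (N_a \<omega>); s2b = sigma2_est w h (W n) (N_b \<omega>)
        in v * (LINT r:{0..R}|stieltjes R V.
                  (Ka (window_scale (W n) powr \<alpha> * r) - Kb (window_scale (W n) powr \<alpha> * r))\<^sup>2)
             / (v powr (2 * \<alpha>) * (l2a * s2a + l2b * s2b))
           + v * (la - lb)\<^sup>2 / (s2a + s2b))))
    (distr (density lborel std_normal_density) borel
       (\<lambda>z. (4 * (measure lborel B)\<^sup>2 * (LINT r:{0..R}|stieltjes R V. r ^ (2 * DIM('a))) + 1) * z\<^sup>2))"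
proof -
  interpret equal_laws M N_a N_b W
    using processes mixing windows null_hypothesis by unfold_locales
  have B0: "0 \<in> B" using B(4) interior_subset by blast
  have V': "mono_on {0..R} V" "\<forall>r\<in>{0..<R}. continuous (at_right r) V" using V by auto
  note s2a = a.sigma2_est_conv[OF w(1-7) bandwidths] and s2b = b.sigma2_est_conv[OF w(1-7) bandwidths]
  have Wm: "\<And>n. W n \<in> sets borel" "\<And>n. bounded (W n)" by (rule a.W_convex)+
  define s2 where "s2 = asymp_var M N_a"
  \<comment> \<open>Both variance estimators have the same law, so their limits agree; the reduced
    measures themselves, which are given by a choice, are not compared.\<close>
  have "asymp_var M N_a = asymp_var M N_b"
    by (rule a.conv_prob_unique[OF conv_prob_law[OF _ N_measurable law s2a(1)] s2b(1)])
       (intro sigma2_est_measurable_config Wm w(1))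
  then have sb: "asymp_var M N_b = s2" by (simp add: s2_def)
  have s2: "0 < s2" using clt by (simp add: s2_def)
  define \<sigma> where "\<sigma> = sqrt s2"
  have \<sigma>: "0 < \<sigma>" using s2 by (simp add: \<sigma>_def)
  define \<kappa> where "\<kappa> = 4 * (measure lborel B)\<^sup>2 * (LINT r:{0..R}|stieltjes R V. r ^ (2 * DIM('a))) + 1"
  \<comment> \<open>Both counts are centred with the same intensity, so that the centring cancels in
    the difference and exactly \<open>dif\<close> remains.\<close>
  define X where "X N n \<omega> = (real (card (N \<omega> \<inter> W n)) - lm * measure lborel (W n)) / sqrt (measure lborel (W n))"
    for N :: "'w \<Rightarrow> 'a set" and n \<omega>
  have clt': "weak_conv_m (\<lambda>n. distr M borel (X N_a n)) (density lborel (normal_density 0 \<sigma>))"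
    "weak_conv_m (\<lambda>n. distr M borel (X N_b n)) (density lborel (normal_density 0 \<sigma>))"
    using clt unfolding X_def \<sigma>_def by (simp_all add: sb s2_def[symmetric] intensity_eq)
  have "a.indep_var borel (X N_a n) borel (X N_b n)" for n
  proof -
    note [measurable] = card_measurable_config[OF Wm]
    let ?f = "\<lambda>S. (real (card (S \<inter> W n)) - lm * measure lborel (W n)) / sqrt (measure lborel (W n))"
    have "?f \<in> borel_measurable config_algebra" by measurable
    from a.indep_var_compose[OF indep this this] show ?thesis by (simp add: comp_def X_def[abs_def])
  qed
  from a.weak_conv_difference[OF this clt' \<sigma>]
  have "weak_conv_m (\<lambda>n. distr M borel (\<lambda>\<omega>. X N_a n \<omega> - X N_b n \<omega>)) (distr std_normal_distribution borel (\<lambda>x. sqrt 2 * \<sigma> * x))" .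
  moreover have "X N_a n \<omega> - X N_b n \<omega> = dif n \<omega>" for n \<omega>
  \<comment> \<open>Early windows may be null sets; then both sides are 0, because division by 0
    gives 0.\<close>
  proof (cases "measure lborel (W n) = 0")
    case False
    then have p: "0 < measure lborel (W n)" by (simp add: less_le)
    have "X N_a n \<omega> - X N_b n \<omega> = (real (card (N_a \<omega> \<inter> W n)) - real (card (N_b \<omega> \<inter> W n))) / sqrt (measure lborel (W n))"
      by (simp add: X_def diff_divide_distrib)
    also have "\<dots> = (real (card (N_a \<omega> \<inter> W n)) - real (card (N_b \<omega> \<inter> W n))) * (sqrt (measure lborel (W n)) / measure lborel (W n))"
    proof -
      have "sqrt (measure lborel (W n)) / measure lborel (W n) = 1 / sqrt (measure lborel (W n))"
        using p by (simp add: real_div_sqrt field_simps)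
      then show ?thesis by simp
    qed
    also have "\<dots> = dif n \<omega>" by (simp add: dif_def lambda_est_def diff_divide_distrib algebra_simps)
    finally show ?thesis .
  qed (simp add: X_def dif_def)
  ultimately have dif: "weak_conv_m (\<lambda>n. distr M borel (dif n)) (distr std_normal_distribution borel (\<lambda>x. sqrt 2 * \<sigma> * x))"
    by simp
  \<comment> \<open>\<open>dif\<close> is asymptotically normal with variance 2 \<open>s2\<close>,
    so g turns the limit into \<kappa> times the square of a standard normal variable.\<close>
  define g where "g x = \<kappa> / (2 * s2) * x\<^sup>2" for x :: real
  have g: "isCont g x" for x unfolding g_def by (intro continuous_intros)
  have gm [measurable]: "g \<in> borel_measurable borel" unfolding g_def by measurable
  have "distr (distr std_normal_distribution borel (\<lambda>x. sqrt 2 * \<sigma> * x)) borel g = distr std_normal_distribution borel (\<lambda>z. \<kappa> * z\<^sup>2)"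
  proof -
    have "g (sqrt 2 * \<sigma> * z) = \<kappa> * z\<^sup>2" for z
      using s2 by (simp add: g_def \<sigma>_def power_mult_distrib)
    then show ?thesis by (subst distr_distr) (auto simp: comp_def)
  qed
  with a.weak_conv_continuous_image[OF dif_measurable real_distribution_scaled_normal dif g]
  have lim: "weak_conv_m (\<lambda>n. distr M borel (\<lambda>\<omega>. g (dif n \<omega>))) (distr std_normal_distribution borel (\<lambda>z. \<kappa> * z\<^sup>2))"
    by simp
  have rd: "real_distribution (distr std_normal_distribution borel (\<lambda>z. \<kappa> * z\<^sup>2))"
  proof -
    interpret real_distribution std_normal_distribution by (rule real_dist_normal_dist)
    show ?thesis by (rule real_distribution_distr) simp
  qed
  note T = test_statistic_conv[OF B(1,3) B0 R \<alpha>(1,3) V' s2a(1)[folded s2_def] s2b(1)[unfolded sb] s2, folded \<kappa>_def]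
  have "conv_prob M (\<lambda>n \<omega>. T n \<omega> - g (dif n \<omega>)) 0 \<Longrightarrow> (\<And>n. T n \<in> borel_measurable M) \<Longrightarrow>
      weak_conv_m (\<lambda>n. distr M borel (T n)) (distr std_normal_distribution borel (\<lambda>z. \<kappa> * z\<^sup>2))" for T
    by (rule a.slutsky[OF _ _ _ rd lim]) auto
  from this[OF T[folded g_def]] show ?thesis
    unfolding Let_def \<kappa>_def by simp
qed

end
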